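(* Let $q\in\mathbb{C}\setminus\{0\}$ be not a root of unity, let $\mathcal{A}=\mathbb{C}_q[SL(2)]$, let $N\in\mathbb{Z}$ and let $\sigma=\sigma_{q^{-N},1}\in\mathrm{Aut}(\mathcal{A})$, i.e. the automorphism determined by $\sigma(a)=q^{-N}a$, $\sigma(b)=b$ (so $\sigma(c)=c$, $\sigma(d)=q^{N}d$). Then the $\sigma$-twisted periodic cyclic homology of $\mathcal{A}$ is given by $$HP^\sigma_{\mathrm{even}}(\mathcal{A})=HC^\sigma_4(\mathcal{A})=\begin{cases}\mathbb{C}\,[b^rc^r(\mathsf{d}\mathcal{A}\frown[\partial^-_H])] & \text{if } N=2r+2 \text{ with } r\ge 0,\\ \mathbb{C}\,[1] & \text{otherwise,}\end{cases}$$ $$HP^\sigma_{\mathrm{odd}}(\mathcal{A})=HC^\sigma_3(\mathcal{A})=\begin{cases}\mathbb{C}\,[b^rc^r\,\mathsf{d}\mathcal{A}] & \text{if } N=2r+2\text{ with } r\ge 0,\\ \mathbb{C}\,[b\otimes c] & \text{otherwise.}\end{cases}$$ Here $\mathbb{C}[x]$ denotes the one-dimensional vector space spanned by the (nonzero) class represented by $x$, and classes in $HC^\sigma_n(\mathcal{A})$ are represented by classes in $H_{n-2p}(\mathcal{A},{}_\sigma\mathcal{A})$, $p\ge0$, via Connes' spectral sequence $E^1_{pq}=H_{q-p}(\mathcal{A},{}_\sigma\mathcal{A})\Rightarrow HC^\sigma_{p+q}(\mathcal{A})$.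
   Context: $\mathcal{A}=\mathbb{C}_q[SL(2)]$ is the unital associative $\mathbb{C}$-algebra with generators $a,b,c,d$ and relations $ab=qba$, $ac=qca$, $bc=cb$, $bd=qdb$, $cd=qdc$, $ad-qbc=1$, $da-q^{-1}bc=1$. For $\lambda,\mu\in\mathbb{C}\setminus\{0\}$, $\sigma_{\lambda,\mu}$ is the automorphism with $a\mapsto\lambda a$, $b\mapsto\mu b$, $c\mapsto\mu^{-1}c$, $d\mapsto\lambda^{-1}d$. Unadorned $\otimes$ is over $\mathbb{C}$. Hochschild homology: for $\sigma\in\mathrm{Aut}(\mathcal{A})$, ${}_\sigma\mathcal{A}$ is $\mathcal{A}$ with bimodule structure $x\triangleright y\triangleleft z=\sigma(x)yz$. $H_\bullet(\mathcal{A},{}_\sigma\mathcal{A})$ is the homology of $C_n(\mathcal{A},{}_\sigma\mathcal{A})=\mathcal{A}^{\otimes n+1}$ with $\mathsf{b}(a_0\otimes\cdots\otimes a_n)=\sum_{i=0}^{n-1}(-1)^i a_0\otimes\cdots\otimes a_ia_{i+1}\otimes\cdots\otimes a_n+(-1)^n\sigma(a_n)a_0\otimes a_1\otimes\cdots\otimes a_{n-1}$. Cyclic homology: on $C_n=C_n(\mathcal{A},{}_\sigma\mathcal{A})$ put $\mathsf{t}(a_0\otimes\cdots\otimes a_n)=(-1)^n\sigma(a_n)\otimes a_0\otimes\cdots\otimes a_{n-1}$, $\mathsf{T}=\mathsf{t}^{n+1}=\sigma^{\otimes n+1}$, $\mathsf{N}=\sum_{i=0}^n\mathsf{t}^i$,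 $\mathsf{s}(x)=1\otimes x$, $\mathsf{B}=(\mathrm{id}-\mathsf{t})\mathsf{s}\mathsf{N}$, and $C^\sigma_\bullet(\mathcal{A})=C_\bullet/\mathrm{im}(\mathrm{id}-\mathsf{T})$. On $C^\sigma_\bullet(\mathcal{A})$ one has $\mathsf{b}^2=\mathsf{B}^2=\mathsf{b}\mathsf{B}+\mathsf{B}\mathsf{b}=0$. $HC^\sigma_\bullet(\mathcal{A})$ is the total homology of the bicomplex $E^0_{pq}=C^\sigma_{q-p}(\mathcal{A})$, $p,q\ge0$ (zero for $q<p$), with differentials $\mathsf{b}:E^0_{pq}\to E^0_{p,q-1}$ and $\mathsf{B}:E^0_{pq}\to E^0_{p-1,q}$. Connes' spectral sequence is the one obtained by filtering by columns; since $\sigma$ is diagonalisable, the quotient map $C_\bullet\to C^\sigma_\bullet(\mathcal{A})$ is a quasi-isomorphism for $\mathsf{b}$, so $E^1_{pq}=H_{q-p}(\mathcal{A},{}_\sigma\mathcal{A})$. $HP^\sigma_{\mathrm{even}}$ and $HP^\sigma_{\mathrm{odd}}$ (periodic cyclic homology) are the even and odd total homology of the direct product total complex of the same bicomplex with $p,q$ ranging over $\mathbb{Z}$; they are identified with $HC^\sigma_4$, $HC^\sigma_3$ along the canonical maps to cyclic homology. The fundamental class: $\mathsf{d}\mathcal{A}\in H_3(\mathcal{A},{}_{\sigma_{q^{-2},1}}\mathcal{A})$ is the class of the cycle $d\otimes(-qb\otimes a\otimes c+a\otimes b\otimes c+q^2b\otimes c\otimes a-a\otimes c\otimes b-q^2c\otimes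 b\otimes a+qc\otimes a\otimes b)+c\otimes(b\otimes a\otimes d-q^{-1}a\otimes b\otimes d-b\otimes d\otimes a-(q-q^{-1})b\otimes c\otimes b+a\otimes d\otimes b+qd\otimes b\otimes a-d\otimes a\otimes b)$. $\partial^-_H:\mathcal{A}\to\mathcal{A}$ is the derivation with $a\mapsto-a$, $b\mapsto-b$, $c\mapsto c$, $d\mapsto d$. The cap product with it is $(a_0\otimes\cdots\otimes a_n)\frown\partial^-_H=a_0\partial^-_H(a_1)\otimes a_2\otimes\cdots\otimes a_n$. Multiplication by $b^rc^r$ means multiplying the zeroth tensor component from the left by $b^rc^r$; it maps cycles with coefficients in ${}_{\sigma_{q^{-2},1}}\mathcal{A}$ to cycles with coefficients in ${}_{\sigma_{q^{-2-r'},1}}\mathcal{A}$ with $r'=2r$. *)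

theory Defs
  imports Complex_Main
    "HOL-Library.Poly_Mapping"
    "HOL-Library.Set_Algebras"
    "HOL-Library.Function_Algebras"
begin

section \<open>Free complex vector spaces\<close>

text \<open>The free complex vector space on the type \<open>'x\<close> is \<open>'x \<Rightarrow>\<^sub>0 complex\<close>.\<close>

definition cmul :: "complex \<Rightarrow> ('x \<Rightarrow>\<^sub>0 complex) \<Rightarrow> ('x \<Rightarrow>\<^sub>0 complex)" where
  "cmul k = Poly_Mapping.map ((*) k)"

lemma lookup_cmul: "Poly_Mapping.lookup (cmul k f) x = k * Poly_Mapping.lookup f x"
  by (simp add: cmul_def Poly_Mapping.map.rep_eq when_def)

global_interpretation free: vector_space "cmul :: complex \<Rightarrow> ('x \<Rightarrow>\<^sub>0 complex) \<Rightarrow> _"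
  by unfold_locales
    (auto intro!: poly_mapping_eqI simp: lookup_cmul lookup_add algebra_simps)

definition lin_ext :: "('x \<Rightarrow> ('y \<Rightarrow>\<^sub>0 complex)) \<Rightarrow> ('x \<Rightarrow>\<^sub>0 complex) \<Rightarrow> ('y \<Rightarrow>\<^sub>0 complex)" where
  "lin_ext g f = (\<Sum>x\<in>Poly_Mapping.keys f. cmul (Poly_Mapping.lookup f x) (g x))"


section \<open>The algebra of functions on quantum SL(2)\<close>

locale complex_algebra = vector_space scale
  for scale :: "complex \<Rightarrow> 'a::ring_1 \<Rightarrow> 'a" +
  assumes scale_mult_left: "scale k x * y = scale k (x * y)"
    and scale_mult_right: "x * scale k y = scale k (x * y)"

datatype gen = GA | GB | GC | GD

text \<open>With words as an additive monoid under concatenation, \<open>word \<Rightarrow>\<^sub>0 complex\<close> with its library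
  multiplication (convolution) is the free unital algebra on the four generators.\<close>

datatype word = Word (letters: "gen list")

instantiation word :: monoid_add
begin

definition zero_word :: word where "zero_word = Word []"
definition plus_word :: "word \<Rightarrow> word \<Rightarrow> word" where
  "plus_word u v = Word (letters u @ letters v)"

instance
  by standard (auto simp: zero_word_def plus_word_def)

end

type_synonym free_alg = "word \<Rightarrow>\<^sub>0 complex"

definition var :: "gen \<Rightarrow> free_alg" where
  "var g = Poly_Mapping.single (Word [g]) 1"

definition const :: "complex \<Rightarrow> free_alg" where
  "const k = Poly_Mapping.single 0 k"

inductive_set two_sided_ideal :: "'r::ring_1 set \<Rightarrow> 'r set" for R :: "'r set" where
  zero: "0 \<in> two_sided_ideal R"
| base: "r \<in> R \<Longrightarrow> r \<in> two_sided_ideal R"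
| add: "x \<in> two_sided_ideal R \<Longrightarrow> y \<in> two_sided_ideal R \<Longrightarrow> x + y \<in> two_sided_ideal R"
| mult_left: "x \<in> two_sided_ideal R \<Longrightarrow> y * x \<in> two_sided_ideal R"
| mult_right: "x \<in> two_sided_ideal R \<Longrightarrow> x * y \<in> two_sided_ideal R"

definition SL2_relations :: "complex \<Rightarrow> free_alg set" where
  "SL2_relations q =
    (let a = var GA; b = var GB; c = var GC; d = var GD in
     { a * b - const q * b * a,
       a * c - const q * c * a,
       b * c - c * b,
       b * d - const q * d * b,
       c * d - const q * d * c,
       a * d - const q * b * c - 1,
       d * a - const (inverse q) * b * c - 1 })"

fun gen_value :: "'a \<Rightarrow> 'a \<Rightarrow> 'a \<Rightarrow> 'a \<Rightarrow> gen \<Rightarrow> 'a" where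
  "gen_value a b c d GA = a"
| "gen_value a b c d GB = b"
| "gen_value a b c d GC = c"
| "gen_value a b c d GD = d"

definition eval_alg ::
    "(complex \<Rightarrow> 'a::ring_1 \<Rightarrow> 'a) \<Rightarrow> (gen \<Rightarrow> 'a) \<Rightarrow> free_alg \<Rightarrow> 'a" where
  "eval_alg scale v f =
    (\<Sum>w\<in>Poly_Mapping.keys f.
       scale (Poly_Mapping.lookup f w) (prod_list (map v (letters w))))"

text \<open>An algebra is presented by the given generators and relations iff evaluation from the free
  algebra is onto with kernel the two-sided ideal generated by the relations. The locale thus
  describes the algebra up to isomorphism, on a type of its own.\<close>

locale quantum_SL2 = complex_algebra scale
  for scale :: "complex \<Rightarrow> 'a::ring_1 \<Rightarrow> 'a" +
  fixes q :: complex and a b c d :: 'a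
  assumes generated: "range (eval_alg scale (gen_value a b c d)) = UNIV"
    and related: "{f. eval_alg scale (gen_value a b c d) f = 0} = two_sided_ideal (SL2_relations q)"

definition algebra_automorphism :: "(complex \<Rightarrow> 'a::ring_1 \<Rightarrow> 'a) \<Rightarrow> ('a \<Rightarrow> 'a) \<Rightarrow> bool" where
  "algebra_automorphism scale \<sigma> \<longleftrightarrow>
    Vector_Spaces.linear scale scale \<sigma> \<and> \<sigma> 1 = 1 \<and> (\<forall>x y. \<sigma> (x * y) = \<sigma> x * \<sigma> y) \<and> bij \<sigma>"

definition derivation :: "(complex \<Rightarrow> 'a::ring_1 \<Rightarrow> 'a) \<Rightarrow> ('a \<Rightarrow> 'a) \<Rightarrow> bool" where
  "derivation scale \<delta> \<longleftrightarrow>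
    Vector_Spaces.linear scale scale \<delta> \<and> (\<forall>x y. \<delta> (x * y) = \<delta> x * y + x * \<delta> y)"


section \<open>Chains\<close>

text \<open>An elementary tensor \<open>a\<^sub>0 \<otimes> \<dots> \<otimes> a\<^sub>n\<close> is the basis vector of the list \<open>[a\<^sub>0, \<dots>, a\<^sub>n]\<close>, and the
  tensor power with \<open>n + 1\<close> factors is the quotient \<open>chains n / tensor_rels scale n\<close>
  by multilinearity. Quotient complexes are handled throughout by representatives: a complex is a
  graded space together with a graded subspace of relations, which the operators preserve.
  Degrees are integers; chains of negative degree vanish.\<close>

type_synonym 'a chain = "'a list \<Rightarrow>\<^sub>0 complex"

definition tensor :: "'a list \<Rightarrow> 'a chain" where
  "tensor xs = Poly_Mapping.single xs 1"

definition chains :: "int \<Rightarrow> 'a chain set" where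
  "chains n = {f. \<forall>xs\<in>Poly_Mapping.keys f. xs \<noteq> [] \<and> int (length xs) = n + 1}"

definition tensor_rels :: "(complex \<Rightarrow> 'a::ring_1 \<Rightarrow> 'a) \<Rightarrow> int \<Rightarrow> 'a chain set" where
  "tensor_rels scale n = free.span
    ({tensor (us @ (x + y) # vs) - tensor (us @ x # vs) - tensor (us @ y # vs) | us vs x y.
        int (length us + length vs) = n} \<union>
     {tensor (us @ scale k x # vs) - cmul k (tensor (us @ x # vs)) | us vs k x.
        int (length us + length vs) = n})"

definition hoch_b :: "('a::ring_1 \<Rightarrow> 'a) \<Rightarrow> 'a chain \<Rightarrow> 'a chain" where
  "hoch_b \<sigma> = lin_ext (\<lambda>xs. let n = length xs - 1 in
     if n = 0 then 0
     else (\<Sum>i<n. cmul ((-1) ^ i) (tensor (take i xs @ (xs ! i * xs ! Suc i) # drop (i + 2) xs)))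
          + cmul ((-1) ^ n) (tensor ((\<sigma> (last xs) * hd xs) # butlast (tl xs))))"

definition cyc_t :: "('a::ring_1 \<Rightarrow> 'a) \<Rightarrow> 'a chain \<Rightarrow> 'a chain" where
  "cyc_t \<sigma> = lin_ext (\<lambda>xs. cmul ((-1) ^ (length xs - 1)) (tensor (\<sigma> (last xs) # butlast xs)))"

text \<open>In degree \<open>n\<close> the lists have length \<open>n + 1\<close>, so the following are \<open>t^(n+1)\<close> and
  \<open>\<Sum>i=0..n. t^i\<close>.\<close>

definition cyc_T :: "('a::ring_1 \<Rightarrow> 'a) \<Rightarrow> 'a chain \<Rightarrow> 'a chain" where
  "cyc_T \<sigma> = lin_ext (\<lambda>xs. (cyc_t \<sigma> ^^ length xs) (tensor xs))"

definition cyc_N :: "('a::ring_1 \<Rightarrow> 'a) \<Rightarrow> 'a chain \<Rightarrow> 'a chain" where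
  "cyc_N \<sigma> = lin_ext (\<lambda>xs. \<Sum>i<length xs. (cyc_t \<sigma> ^^ i) (tensor xs))"

definition cyc_s :: "'a::ring_1 chain \<Rightarrow> 'a chain" where
  "cyc_s = lin_ext (\<lambda>xs. tensor (1 # xs))"

definition connes_B :: "('a::ring_1 \<Rightarrow> 'a) \<Rightarrow> 'a chain \<Rightarrow> 'a chain" where
  "connes_B \<sigma> f = cyc_s (cyc_N \<sigma> f) - cyc_t \<sigma> (cyc_s (cyc_N \<sigma> f))"

text \<open>The quotient \<open>chains n / cyc_rels scale \<sigma> n\<close> is \<open>C\<^sup>\<sigma>\<^sub>n = C\<^sub>n / im (id - T)\<close>.\<close>

definition cyc_rels ::
    "(complex \<Rightarrow> 'a::ring_1 \<Rightarrow> 'a) \<Rightarrow> ('a \<Rightarrow> 'a) \<Rightarrow> int \<Rightarrow> 'a chain set" where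
  "cyc_rels scale \<sigma> n = tensor_rels scale n + (\<lambda>f. f - cyc_T \<sigma> f) ` chains n"


section \<open>Homology\<close>

text \<open>Homology of the complex \<open>V / R\<close> with differential \<open>D\<close> of degree \<open>-1\<close>; a homology class is a
  coset of \<open>boundaries\<close> in \<open>cycles\<close>.\<close>

definition cycles :: "(int \<Rightarrow> 'v set) \<Rightarrow> (int \<Rightarrow> 'v set) \<Rightarrow> ('v \<Rightarrow> 'v) \<Rightarrow> int \<Rightarrow> 'v::ab_group_add set" where
  "cycles V R D n = {z \<in> V n. D z \<in> R (n - 1)}"

definition boundaries :: "(int \<Rightarrow> 'v set) \<Rightarrow> (int \<Rightarrow> 'v set) \<Rightarrow> ('v \<Rightarrow> 'v) \<Rightarrow> int \<Rightarrow> 'v::ab_group_add set" where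
  "boundaries V R D n = R n + D ` V (n + 1)"

definition homology :: "(int \<Rightarrow> 'v set) \<Rightarrow> (int \<Rightarrow> 'v set) \<Rightarrow> ('v \<Rightarrow> 'v) \<Rightarrow> int \<Rightarrow> 'v::ab_group_add set set" where
  "homology V R D n = (\<lambda>z. z +o boundaries V R D n) ` cycles V R D n"

text \<open>Cycles of \<open>C\<^sub>\<bullet>(A, \<^sub>\<sigma>A)\<close>, and boundaries of \<open>(C\<^sup>\<sigma>\<^sub>\<bullet>(A), b)\<close>.\<close>

definition hoch_cycles ::
    "(complex \<Rightarrow> 'a::ring_1 \<Rightarrow> 'a) \<Rightarrow> ('a \<Rightarrow> 'a) \<Rightarrow> int \<Rightarrow> 'a chain set" where
  "hoch_cycles scale \<sigma> = cycles chains (tensor_rels scale) (hoch_b \<sigma>)"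

definition E1_boundaries ::
    "(complex \<Rightarrow> 'a::ring_1 \<Rightarrow> 'a) \<Rightarrow> ('a \<Rightarrow> 'a) \<Rightarrow> int \<Rightarrow> 'a chain set" where
  "E1_boundaries scale \<sigma> = boundaries chains (cyc_rels scale \<sigma>) (hoch_b \<sigma>)"


subsection \<open>The bicomplex and its total complexes\<close>

text \<open>\<open>E0 p q\<close> is \<open>C\<^sup>\<sigma>\<^sub>q\<^sub>-\<^sub>p\<close>, which vanishes for \<open>q < p\<close>. A total chain of degree \<open>n\<close> is the family
  of its components \<open>z p\<close> in \<open>E0 p (n - p)\<close>, with columns \<open>p\<close> running through \<open>P\<close>. For \<open>P = {0..}\<close>
  only finitely many columns are nonzero, so this is the usual direct-sum total complex of the first
  quadrant bicomplex; for \<open>P = UNIV\<close> it is the direct-product one.\<close>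

definition tot_chains :: "int set \<Rightarrow> int \<Rightarrow> (int \<Rightarrow> 'a chain) set" where
  "tot_chains P n = {z. \<forall>p. z p \<in> (if p \<in> P then chains ((n - p) - p) else {0})}"

definition tot_rels :: "(complex \<Rightarrow> 'a::ring_1 \<Rightarrow> 'a) \<Rightarrow> ('a \<Rightarrow> 'a) \<Rightarrow> int set \<Rightarrow> int \<Rightarrow>
    (int \<Rightarrow> 'a chain) set" where
  "tot_rels scale \<sigma> P n =
    {z. \<forall>p. z p \<in> (if p \<in> P then cyc_rels scale \<sigma> ((n - p) - p) else {0})}"

definition tot_d :: "('a::ring_1 \<Rightarrow> 'a) \<Rightarrow> int set \<Rightarrow> (int \<Rightarrow> 'a chain) \<Rightarrow> (int \<Rightarrow> 'a chain)" where
  "tot_d \<sigma> P z = (\<lambda>p. if p \<in> P then hoch_b \<sigma> (z p) + connes_B \<sigma> (z (p + 1)) else 0)"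

definition tot_mul :: "complex \<Rightarrow> (int \<Rightarrow> 'a chain) \<Rightarrow> (int \<Rightarrow> 'a chain)" where
  "tot_mul k z = (\<lambda>p. cmul k (z p))"

definition HC_cycles :: "(complex \<Rightarrow> 'a::ring_1 \<Rightarrow> 'a) \<Rightarrow> ('a \<Rightarrow> 'a) \<Rightarrow> int \<Rightarrow> (int \<Rightarrow> 'a chain) set" where
  "HC_cycles scale \<sigma> = cycles (tot_chains {0..}) (tot_rels scale \<sigma> {0..}) (tot_d \<sigma> {0..})"

definition HC_boundaries :: "(complex \<Rightarrow> 'a::ring_1 \<Rightarrow> 'a) \<Rightarrow> ('a \<Rightarrow> 'a) \<Rightarrow> int \<Rightarrow> (int \<Rightarrow> 'a chain) set" where
  "HC_boundaries scale \<sigma> = boundaries (tot_chains {0..}) (tot_rels scale \<sigma> {0..}) (tot_d \<sigma> {0..})"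

definition HC_class ::
    "(complex \<Rightarrow> 'a::ring_1 \<Rightarrow> 'a) \<Rightarrow> ('a \<Rightarrow> 'a) \<Rightarrow> int \<Rightarrow> (int \<Rightarrow> 'a chain) \<Rightarrow> (int \<Rightarrow> 'a chain) set" where
  "HC_class scale \<sigma> n z = z +o HC_boundaries scale \<sigma> n"

definition HC ::
    "(complex \<Rightarrow> 'a::ring_1 \<Rightarrow> 'a) \<Rightarrow> ('a \<Rightarrow> 'a) \<Rightarrow> int \<Rightarrow> (int \<Rightarrow> 'a chain) set set" where
  "HC scale \<sigma> = homology (tot_chains {0..}) (tot_rels scale \<sigma> {0..}) (tot_d \<sigma> {0..})"

definition HP ::
    "(complex \<Rightarrow> 'a::ring_1 \<Rightarrow> 'a) \<Rightarrow> ('a \<Rightarrow> 'a) \<Rightarrow> int \<Rightarrow> (int \<Rightarrow> 'a chain) set set" where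
  "HP scale \<sigma> = homology (tot_chains UNIV) (tot_rels scale \<sigma> UNIV) (tot_d \<sigma> UNIV)"

text \<open>The canonical map \<open>HP n \<rightarrow> HC m\<close> for \<open>n\<close> and \<open>m\<close> of equal parity: identify the total degrees
  \<open>n\<close> and \<open>m\<close> of the periodic complex by the column shift \<open>(p, q) \<mapsto> (p + 1, q + 1)\<close>, then discard
  the columns \<open>p < 0\<close>. On a coset, the image plus the boundaries is the coset of the image of any
  representative.\<close>

definition periodic_to_cyclic :: "int \<Rightarrow> int \<Rightarrow> (int \<Rightarrow> 'a chain) \<Rightarrow> (int \<Rightarrow> 'a chain)" where
  "periodic_to_cyclic n m z = (\<lambda>p. if p \<in> {0..} then z (p + (n - m) div 2) else 0)"

definition HP_to_HC :: "(complex \<Rightarrow> 'a::ring_1 \<Rightarrow> 'a) \<Rightarrow> ('a \<Rightarrow> 'a) \<Rightarrow> int \<Rightarrow> int \<Rightarrow>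
    (int \<Rightarrow> 'a chain) set \<Rightarrow> (int \<Rightarrow> 'a chain) set" where
  "HP_to_HC scale \<sigma> n m \<xi> = periodic_to_cyclic n m ` \<xi> + HC_boundaries scale \<sigma> m"


subsection \<open>Connes' spectral sequence\<close>

text \<open>Filtration by columns: \<open>HC_filt p n\<close> is \<open>F\<^sub>p HC\<^sub>n\<close>.\<close>

definition HC_filt ::
    "(complex \<Rightarrow> 'a::ring_1 \<Rightarrow> 'a) \<Rightarrow> ('a \<Rightarrow> 'a) \<Rightarrow> int \<Rightarrow> int \<Rightarrow> (int \<Rightarrow> 'a chain) set set" where
  "HC_filt scale \<sigma> p n = HC_class scale \<sigma> n ` {z \<in> HC_cycles scale \<sigma> n. \<forall>p'>p. z p' = 0}"

text \<open>The Hochschild cycle \<open>x\<close> of degree \<open>n - 2p\<close>, an element of \<open>E\<^sup>1\<close> in position \<open>(p, n - p)\<close>,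
  represents the class of the total cycle \<open>z\<close>: the latter lies in \<open>F\<^sub>p HC\<^sub>n\<close> and its image in
  \<open>E\<^sup>\<infinity> = F\<^sub>p HC\<^sub>n / F\<^sub>p\<^sub>-\<^sub>1 HC\<^sub>n\<close> is that of \<open>x\<close>. (Any ambiguity of \<open>z p\<close> by images of later
  differentials is absorbed into the choice of \<open>z\<close> within its class.)\<close>

definition represents :: "(complex \<Rightarrow> 'a::ring_1 \<Rightarrow> 'a) \<Rightarrow> ('a \<Rightarrow> 'a) \<Rightarrow> int \<Rightarrow> int \<Rightarrow>
    'a chain \<Rightarrow> (int \<Rightarrow> 'a chain) \<Rightarrow> bool" where
  "represents scale \<sigma> n p x z \<longleftrightarrow>
     x \<in> hoch_cycles scale \<sigma> (n - 2 * p) \<and>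
     z \<in> HC_cycles scale \<sigma> n \<and> (\<forall>p'>p. z p' = 0) \<and>
     z p - x \<in> E1_boundaries scale \<sigma> (n - 2 * p)"

text \<open>\<open>HC\<^sub>n\<close> is one-dimensional, spanned by a class that \<open>x\<close> represents and that is nonzero in
  \<open>E\<^sup>\<infinity>\<close>, hence nonzero in \<open>HC\<^sub>n\<close>.\<close>

definition HC_line_spanned_by :: "(complex \<Rightarrow> 'a::ring_1 \<Rightarrow> 'a) \<Rightarrow> ('a \<Rightarrow> 'a) \<Rightarrow> int \<Rightarrow> int \<Rightarrow>
    'a chain \<Rightarrow> bool" where
  "HC_line_spanned_by scale \<sigma> n p x \<longleftrightarrow>
     (\<exists>z. represents scale \<sigma> n p x z \<and>
          HC_class scale \<sigma> n z \<notin> HC_filt scale \<sigma> (p - 1) n \<and>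
          HC scale \<sigma> n = range (\<lambda>k. HC_class scale \<sigma> n (tot_mul k z)))"


section \<open>The fundamental class and operations on chains\<close>

definition fundamental_cycle :: "complex \<Rightarrow> 'a \<Rightarrow> 'a \<Rightarrow> 'a \<Rightarrow> 'a \<Rightarrow> 'a chain" where
  "fundamental_cycle q a b c d =
     cmul (- q) (tensor [d, b, a, c]) + tensor [d, a, b, c]
   + cmul (q\<^sup>2) (tensor [d, b, c, a]) - tensor [d, a, c, b]
   - cmul (q\<^sup>2) (tensor [d, c, b, a]) + cmul q (tensor [d, c, a, b])
   + tensor [c, b, a, d] - cmul (inverse q) (tensor [c, a, b, d])
   - tensor [c, b, d, a] - cmul (q - inverse q) (tensor [c, b, c, b])
   + tensor [c, a, d, b] + cmul q (tensor [c, d, b, a])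
   - tensor [c, d, a, b]"

definition cap_derivation :: "('a::ring_1 \<Rightarrow> 'a) \<Rightarrow> 'a chain \<Rightarrow> 'a chain" where
  "cap_derivation \<delta> = lin_ext (\<lambda>xs. tensor ((xs ! 0 * \<delta> (xs ! 1)) # drop 2 xs))"

definition left_mult :: "'a::ring_1 \<Rightarrow> 'a chain \<Rightarrow> 'a chain" where
  "left_mult y = lin_ext (\<lambda>xs. tensor ((y * hd xs) # tl xs))"

end

theory Submission
  imports Defs "HOL-Library.Product_Plus"
begin

text \<open>Write \<open>H\<close> for the Hochschild homology of the algebra with coefficients twisted by \<open>\<sigma>\<close>, and \<open>x = bc\<close>. The
  differential of the first page of Connes' spectral sequence is Connes' operator \<open>B\<close> on \<open>H\<close>. The theorem follows
  from a computation of the second page \<open>H(H, B)\<close>: it is at most one-dimensional in every degree, it is zero in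
  degrees above three, and it is spanned by \<open>1\<close> and \<open>b \<otimes> c\<close> in degrees \<open>0\<close> and \<open>1\<close> (the regular case), or by the capped
  fundamental class and the fundamental class in degrees \<open>2\<close> and \<open>3\<close> (the singular case \<open>N = 2r + 2\<close>). General facts on
  mixed complexes (\<open>line_spans\<close>, \<open>line_nonzero\<close>) turn this into lines in cyclic homology. Because \<open>H\<close> vanishes above
  degree three, cycles and boundaries extend to the periodic complex (\<open>extend_cycle\<close>, \<open>extend_boundary\<close>), so the
  canonical maps from periodic cyclic homology are bijective (\<open>periodic_bij\<close>).

  The algebra is given by a presentation only. It acts through any operators that satisfy its seven relations, and
  such a representation on a free space yields the Poincare-Birkhoff-Witt basis \<open>b\<^sup>j c\<^sup>k a\<^sup>i\<close> (\<open>bas_co\<close>, \<open>co_bas\<close>).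
  Tensor powers then have lists of indices as a basis. Formal chains modulo the relations of the tensor product and
  modulo the image of \<open>1 - T\<close> become the \<open>T\<close>-invariant tensors, as \<open>T\<close> is diagonal in this basis
  (\<open>tensor_rels_kernel\<close>, \<open>cyc_rels_kernel\<close>).

  Hochschild homology is computed by a Koszul complex. The right adjoint action \<open>m \<mapsto> \<sigma>(S\<^sup>-\<^sup>1(g\<^sub>1)) m g\<^sub>2\<close> makes the
  coefficients a module over the algebra, and \<open>H\<close> is its Tor with the trivial module \<open>a, d \<mapsto> 1\<close>, \<open>b, c \<mapsto> 0\<close>. The
  elements \<open>b, c, a - 1\<close> form a regular sequence and generate the augmentation ideal. The Koszul complex on the chains of
  the bar complex is thus a double complex: its columns are contractible, and its rows of positive bar degree are exact,
  because there the adjoint action becomes right multiplication after untwisting by the coproduct (\<open>coact_\<rho>\<close>). A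
  staircase \<open>\<psi>\<close> through it identifies Koszul and Hochschild homology (\<open>\<psi>_onto\<close>, \<open>\<psi>_boundary\<close>, \<open>\<psi>_inj\<close>); in particular
  \<open>H\<close> vanishes above degree three (\<open>no_homology_above_3\<close>).

  The algebra is graded by the weights of a two-dimensional torus, and so is everything else. By Cartan's formula
  (\<open>cartan\<close>) the weight, being the eigenvalue of a Lie derivative, acts by zero on the second page. Only weight zero
  contributes (\<open>weight0_d1_image\<close>). There the Koszul complex consists of finitely supported sequences, and its
  differentials are governed by \<open>\<nu>\<^sub>k = q\<^bsup>N-2k\<^esup> - 1\<close>, which vanishes for at most one \<open>k\<close>. In the regular case the homology has
  dimensions 1, 1, 0, 0, with generators \<open>1\<close> and \<open>b \<otimes> c\<close>, on which \<open>B\<close> vanishes. In the singular case the dimensions are at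
  most 1, 2, 2, 1, and it remains to identify the generators. They are \<open>x\<^sup>r\<^sup>+\<^sup>1\<close>; \<open>B x\<^sup>r\<^sup>+\<^sup>1\<close> and \<open>x\<^sup>r b \<otimes> c\<close>; \<open>B(x\<^sup>r b \<otimes> c)\<close> and the
  capped fundamental class; the fundamental class. Their independence is reduced to degree one by contracting with
  the derivations of the torus. By Cartan's formula in weight zero, a contraction of \<open>B(x\<^sup>r b \<otimes> c)\<close> is \<open>B x\<^sup>r\<^sup>+\<^sup>1\<close>, which
  is \<open>r + 1\<close> times the class of \<open>x\<^sup>r b \<otimes> c + x\<^sup>r c \<otimes> b\<close>; and a contraction of the capped fundamental class is this class up
  to a term that does not matter (\<open>zcap\<close>). The class is nonzero because its Koszul representative has a coefficient, that
  of \<open>b\<^sup>r\<^sup>+\<^sup>1 c\<^sup>r d\<close>, which vanishes on all boundaries precisely because \<open>\<nu>\<close> vanishes at \<open>r + 1\<close> (\<open>tW_boundary\<close>).\<close>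

abbreviation (input) "lookup \<equiv> Poly_Mapping.lookup"
abbreviation (input) "single \<equiv> Poly_Mapping.single"
abbreviation (input) "keys \<equiv> Poly_Mapping.keys"

section \<open>Linear maps on free vector spaces\<close>

text \<open>Linearity is an equation between functions and assumes nothing about the two scalar multiplications, so
  one set of rules serves free spaces, the algebra, and functions of algebra elements.\<close>

definition lin :: "(complex => 'u::ab_group_add => 'u) => (complex => 'v::ab_group_add => 'v) => ('u => 'v) => bool" where
  "lin s t f \<longleftrightarrow> (\<forall>x y. f (x + y) = f x + f y) \<and> (\<forall>k x. f (s k x) = t k (f x))"

abbreviation vlin :: "(('x \<Rightarrow>\<^sub>0 complex) => ('y \<Rightarrow>\<^sub>0 complex)) => bool" where
  "vlin \<equiv> lin cmul cmul"

lemma linI: "(\<And>x y. f (x + y) = f x + f y) ==> (\<And>k x. f (s k x) = t k (f x)) ==> lin s t f"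
  by (simp add: lin_def)

lemma lin_add: "lin s t f ==> f (x + y) = f x + f y"
  and lin_scale: "lin s t f ==> f (s k x) = t k (f x)"
  by (simp_all add: lin_def)

lemma lin_0: "lin s t f ==> f 0 = 0"
  using lin_add[of s t f 0 0] by simp

lemma lin_uminus: "lin s t f ==> f (- x) = - f x"
  using lin_add[of s t f x "- x"] lin_0[of s t f] by (simp add: eq_neg_iff_add_eq_0 add.commute)

lemma lin_diff: "lin s t f ==> f (x - y) = f x - f y"
  using lin_add[of s t f x "- y"] lin_uminus[of s t f y] by simp

lemma lin_sum: "lin s t f ==> f (\<Sum>i\<in>S. g i) = (\<Sum>i\<in>S. f (g i))"
  by (induction S rule: infinite_finite_induct) (auto simp: lin_0 lin_add)

lemmas lin_as = lin_add lin_scale and lin_ad = lin_add lin_diff and lin_ds = lin_diff lin_scale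
lemmas lin_ads = lin_ad lin_scale
lemmas lin_all = lin_ad lin_uminus lin_scale lin_0

lemma lin_comp: "lin s t f ==> lin t u g ==> lin s u (\<lambda>x. g (f x))"
  by (simp add: lin_def)

lemma lin_id: "lin s s (\<lambda>x. x)"
  by (simp add: lin_def)

lemma lin_plus: "vector_space t ==> lin s t f ==> lin s t g ==> lin s t (\<lambda>x. f x + g x)"
  by (auto simp: lin_def module.scale_right_distrib vector_space_def module_iff_vector_space[symmetric] algebra_simps)

lemma lin_cmul: "vector_space t ==> lin s t f ==> lin s t (\<lambda>x. t k (f x))"
  unfolding lin_def
  by (simp add: vector_space.vector_space_assms(1) vector_space.vector_space_assms(3) mult.commute)

lemma lin_zero: "vector_space t ==> lin s t (\<lambda>x. 0)"
  unfolding lin_def by (metis add.left_neutral module.scale_zero_right module_iff_vector_space)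

lemma lin_neg: "vector_space t ==> lin s t f ==> lin s t (\<lambda>x. - f x)"
  unfolding lin_def by (metis minus_add_distrib add.commute module.scale_minus_right module_iff_vector_space)

lemma lin_minus: "vector_space t ==> lin s t f ==> lin s t g ==> lin s t (\<lambda>x. f x - g x)"
  using lin_plus[OF _ _ lin_neg, of t s f g] by simp

lemma lin_setsum: "vector_space t ==> (\<And>i. i \<in> S ==> lin s t (f i)) ==> lin s t (\<lambda>x. \<Sum>i\<in>S. f i x)"
  by (induction S rule: infinite_finite_induct) (auto simp: lin_zero lin_plus)

lemmas vs_cmul = free.vector_space_axioms
lemmas cmul_add = free.scale_right_distrib and cmul_diff = free.scale_right_diff_distrib
  and cmul_minus = free.scale_minus_left and cmul_cmul = free.scale_scale
lemmas coords = lookup_add lookup_minus lookup_cmul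
lemmas vlin_plus = lin_plus[OF vs_cmul]
lemmas vlin_cmul = lin_cmul[OF vs_cmul]
lemmas vlin_zero = lin_zero[OF vs_cmul]
lemmas vlin_neg = lin_neg[OF vs_cmul]
lemmas vlin_minus = lin_minus[OF vs_cmul]
lemmas vlin_setsum = lin_setsum[OF vs_cmul]

lemma cmul_single: "cmul k (single x m) = single x (k * m)"
  by (rule poly_mapping_eqI) (simp add: lookup_cmul lookup_single when_def)

text \<open>The extension \<open>lin_ext\<close> with values in an arbitrary vector space, such as the algebra.\<close>

definition lext :: "(complex => 'v::ab_group_add => 'v) => ('x => 'v) => ('x \<Rightarrow>\<^sub>0 complex) => 'v" where
  "lext t g f = (\<Sum>x\<in>keys f. t (lookup f x) (g x))"

lemma lin_ext_lext: "lin_ext = lext cmul"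
  by (simp add: fun_eq_iff lin_ext_def lext_def)

lemma lext_superset:
  assumes "vector_space t" "finite S" "keys f \<subseteq> S"
  shows "lext t g f = (\<Sum>x\<in>S. t (lookup f x) (g x))"
  unfolding lext_def
  by (rule sum.mono_neutral_left)
     (use assms in \<open>auto simp: in_keys_iff module.scale_zero_left module_iff_vector_space[symmetric]\<close>)

lemma lin_lext:
  fixes g :: "'x => 'v::ab_group_add"
  assumes t: "vector_space t" shows "lin cmul t (lext t g)"
proof (rule linI)
  fix f h :: "'x \<Rightarrow>\<^sub>0 complex"
  let ?S = "keys f \<union> keys h"
  have "lext t g (f + h) = (\<Sum>x\<in>?S. t (lookup (f + h) x) (g x))"
    by (rule lext_superset[OF t]) (auto dest: subsetD[OF keys_add])
  also have "\<dots> = lext t g f + lext t g h"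
    by (simp add: lext_superset[OF t, of ?S f] lext_superset[OF t, of ?S h] lookup_add
        vector_space.vector_space_assms(2)[OF t] sum.distrib)
  finally show "lext t g (f + h) = lext t g f + lext t g h" .
next
  fix k and f :: "'x \<Rightarrow>\<^sub>0 complex"
  have "lext t g (cmul k f) = (\<Sum>x\<in>keys f. t (lookup (cmul k f) x) (g x))"
    by (rule lext_superset[OF t]) (auto simp: in_keys_iff lookup_cmul)
  also have "\<dots> = t k (lext t g f)"
    unfolding lext_def
    by (simp add: lookup_cmul module.scale_sum_right[OF t[unfolded module_iff_vector_space[symmetric]]]
        vector_space.vector_space_assms(3)[OF t])
  finally show "lext t g (cmul k f) = t k (lext t g f)" .
qed

lemmas vlin_lext = lin_lext[OF vs_cmul]

lemma lext_single: "vector_space t ==> lext t g (single x k) = t k (g x)"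
  by (cases "k = 0")
     (auto simp: lext_def module.scale_zero_left module_iff_vector_space[symmetric])

lemma lext_single1 [simp]: "vector_space t ==> lext t g (single x 1) = g x"
  by (simp add: lext_single vector_space.vector_space_assms(4))

lemma vlext_single1 [simp]: "lext cmul g (single x 1) = g x"
  by (simp add: vs_cmul)

lemma poly_mapping_sum_singles:
  "f = (\<Sum>x\<in>keys f. cmul (lookup f x) (single x 1))"
  by (rule poly_mapping_eqI)
     (auto simp: lookup_sum lookup_cmul lookup_single when_def in_keys_iff if_distrib[of "(*) _"] sum.delta cong: if_cong)

lemma lin_eq_lext:
  assumes "lin cmul t F" shows "F f = lext t (\<lambda>x. F (single x 1)) f"
  unfolding lext_def
  by (subst poly_mapping_sum_singles) (simp add: lin_sum[OF assms] lin_scale[OF assms])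

lemma lin_eqI:
  assumes "lin cmul t F" "lin cmul t G"
    and "\<And>x. x \<in> keys f ==> F (single x 1) = G (single x 1)"
  shows "F f = G f"
  by (subst lin_eq_lext[OF assms(1)], subst lin_eq_lext[OF assms(2)]) (simp add: lext_def assms(3))

lemma lext_cong: "(\<And>x. x \<in> keys f ==> g x = h x) ==> lext t g f = lext t h f"
  by (simp add: lext_def)

lemma lin_of_lext: "vector_space t ==> lin t u F ==> F (lext t g f) = lext u (\<lambda>x. F (g x)) f"
  by (simp add: lext_def lin_sum lin_scale)

lemma lin_lext_arg:
  "vector_space t ==> (\<And>x. x \<in> keys f ==> lin s t (\<lambda>y. g y x)) ==> lin s t (\<lambda>y. lext t (g y) f)"
  unfolding lext_def by (intro lin_setsum lin_cmul) auto

lemma keys_cmul: "keys (cmul k f) \<subseteq> keys f"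
  by (auto simp: in_keys_iff lookup_cmul)

lemma lext_keys: "keys (lext cmul g f) \<subseteq> (\<Union>x\<in>keys f. keys (g x))"
proof
  fix y assume "y \<in> keys (lext cmul g f)"
  then have "(\<Sum>x\<in>keys f. lookup (cmul (lookup f x) (g x)) y) \<noteq> 0"
    by (simp add: lext_def in_keys_iff lookup_sum)
  then obtain x where "x \<in> keys f" "lookup (cmul (lookup f x) (g x)) y \<noteq> 0"
    by (meson sum.neutral)
  then show "y \<in> (\<Union>x\<in>keys f. keys (g x))"
    by (auto simp: lookup_cmul in_keys_iff)
qed

section \<open>Representations of a presented algebra\<close>

lemma cmul_mult_left: "cmul k f * g = cmul k (f * g)" for f g :: "'w::monoid_add \<Rightarrow>\<^sub>0 complex"
  by (simp add: cmul_def mult_map_scale_conv_mult mult.assoc)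

lemma cmul_mult_right: "f * cmul k g = cmul k (f * g)" for f g :: "'w::monoid_add \<Rightarrow>\<^sub>0 complex"
proof -
  have l: "lin cmul cmul (\<lambda>f. f * cmul k g)" "lin cmul cmul (\<lambda>f. cmul k (f * g))"
    by (auto intro!: linI simp: algebra_simps cmul_mult_left cmul_add cmul_cmul)
  show ?thesis
  proof (rule lin_eqI[OF l])
    fix x
    show "single x 1 * cmul k g = cmul k (single x 1 * g)"
      by (simp add: cmul_def mult_map_scale_conv_mult mult_single flip: mult.assoc)
  qed
qed

text \<open>The product of the free algebra is determined by bilinearity and by concatenation of words.\<close>

lemma mult_eqI:
  fixes F :: "('w::monoid_add \<Rightarrow>\<^sub>0 complex) => 'v::ab_group_add" and G
  assumes F: "lin cmul t F"
    and "\<And>f. lin cmul t (G f)" "\<And>g. lin cmul t (\<lambda>f. G f g)"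
    and "\<And>u w. F (single (u + w) 1) = G (single u 1) (single w 1)"
  shows "F (f * g) = G f g"
proof (rule lin_eqI[where F = "\<lambda>f. F (f * g)" and G = "\<lambda>f. G f g"])
  show "lin cmul t (\<lambda>f. F (f * g))"
    by (rule linI) (simp_all add: algebra_simps cmul_mult_left lin_add[OF F] lin_scale[OF F])
  fix u
  show "F (single u 1 * g) = G (single u 1) g"
  proof (rule lin_eqI[where F = "\<lambda>g. F (single u 1 * g)"])
    show "lin cmul t (\<lambda>g. F (single u 1 * g))"
      by (rule linI) (simp_all add: algebra_simps cmul_mult_right lin_add[OF F] lin_scale[OF F])
  qed (use assms in \<open>simp_all add: mult_single\<close>)
qed (rule assms)

definition act :: "(gen => ('y \<Rightarrow>\<^sub>0 complex) => ('y \<Rightarrow>\<^sub>0 complex)) => free_alg => ('y \<Rightarrow>\<^sub>0 complex) => ('y \<Rightarrow>\<^sub>0 complex)" where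
  "act E f v = lext cmul (\<lambda>w. fold E (letters w) v) f"

lemma act_lin: "lin cmul cmul (\<lambda>f. act E f v)"
  unfolding act_def by (rule vlin_lext)

lemma fold_vlin: "(\<And>g. vlin (E g)) ==> vlin (fold E gs)"
proof (induction gs)
  case (Cons g gs)
  then show ?case using lin_comp[of cmul cmul "E g" cmul "fold E gs"] by (simp add: comp_def)
qed (simp add: lin_def)

lemma act_vlin: "(\<And>g. vlin (E g)) ==> vlin (act E f)"
  unfolding act_def by (rule lin_lext_arg[OF vs_cmul], rule fold_vlin)

lemma act_single: "act E (single w 1) v = fold E (letters w) v"
  by (simp add: act_def)

lemma act_mult:
  assumes "\<And>g. vlin (E g)" shows "act E (f * h) v = act E h (act E f v)"
proof (rule mult_eqI[where F = "\<lambda>f. act E f v" and G = "\<lambda>f h. act E h (act E f v)"])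
  show "lin cmul cmul (\<lambda>f. act E h (act E f v))" for h
    by (rule lin_comp[OF act_lin act_vlin]) (rule assms)
qed (simp_all add: act_lin act_single plus_word_def)

definition subspc :: "(complex => 'v::ab_group_add => 'v) => 'v set => bool" where
  "subspc s V \<longleftrightarrow> 0 \<in> V \<and> (\<forall>x\<in>V. \<forall>y\<in>V. x + y \<in> V) \<and> (\<forall>k. \<forall>x\<in>V. s k x \<in> V)"

lemma subspc_sum: "subspc s V ==> (\<And>i. i \<in> S ==> f i \<in> V) ==> sum f S \<in> V"
  by (induction S rule: infinite_finite_induct) (auto simp: subspc_def)

lemma subspc_UNIV: "subspc s UNIV" by (simp add: subspc_def)

lemma poly_mapping_lin_induct:
  assumes "\<And>x y. P x ==> P y ==> P (x + y)" "\<And>k x. P x ==> P (cmul k x)" "\<And>x. P (single x 1)"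
  shows "P (p :: 'x \<Rightarrow>\<^sub>0 complex)"
proof -
  have "subspc cmul {p. P p}"
    using assms(2)[OF assms(3), of 0] assms(1,2) by (simp add: subspc_def)
  from subspc_sum[OF this, of "keys p" "\<lambda>x. cmul (lookup p x) (single x 1)"]
  show ?thesis using assms(2,3) poly_mapping_sum_singles[of p] by auto
qed

lemma fold_closed: "(\<And>g v. v \<in> V ==> E g v \<in> V) ==> v \<in> V ==> fold E gs v \<in> V"
  by (induction gs arbitrary: v) auto

lemma act_closed: "subspc cmul V ==> (\<And>g v. v \<in> V ==> E g v \<in> V) ==> v \<in> V ==> act E f v \<in> V"
  unfolding act_def lext_def
  by (rule subspc_sum, assumption) (auto simp: subspc_def fold_closed)

text \<open>The operators of a right representation: a word acts by its letters from left to right, so the relation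
  \<open>ab = qba\<close> reads "first \<open>a\<close>, then \<open>b\<close>" on its left-hand side.\<close>

definition SL2_rels :: "complex => (gen => ('y \<Rightarrow>\<^sub>0 complex) => ('y \<Rightarrow>\<^sub>0 complex)) => ('y \<Rightarrow>\<^sub>0 complex) => bool" where
  "SL2_rels q E v \<longleftrightarrow>
     E GB (E GA v) = cmul q (E GA (E GB v)) \<and>
     E GC (E GA v) = cmul q (E GA (E GC v)) \<and>
     E GC (E GB v) = E GB (E GC v) \<and>
     E GD (E GB v) = cmul q (E GB (E GD v)) \<and>
     E GD (E GC v) = cmul q (E GC (E GD v)) \<and>
     E GD (E GA v) = v + cmul q (E GC (E GB v)) \<and>
     E GA (E GD v) = v + cmul (inverse q) (E GC (E GB v))"

text \<open>The relations are required only on an invariant subspace \<open>V\<close>: operators on tensors are given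
  by one formula in all degrees, but satisfy the relations in each degree separately.\<close>

definition SL2_rep :: "complex => ('y \<Rightarrow>\<^sub>0 complex) set => (gen => ('y \<Rightarrow>\<^sub>0 complex) => ('y \<Rightarrow>\<^sub>0 complex)) => bool" where
  "SL2_rep q V E \<longleftrightarrow> subspc cmul V \<and> (\<forall>g. vlin (E g)) \<and> (\<forall>g. \<forall>v\<in>V. E g v \<in> V) \<and> (\<forall>v\<in>V. SL2_rels q E v)"

text \<open>The annihilator of a module is a two-sided ideal, so it contains the ideal of the relators as soon as it
  contains the relators.\<close>

lemma act_ideal:
  assumes E: "SL2_rep q V E" and f: "f \<in> two_sided_ideal (SL2_relations q)"
  shows "v \<in> V ==> act E f v = 0"
proof -
  have l: "\<And>g. vlin (E g)" and cl: "\<And>g v. v \<in> V ==> E g v \<in> V" and V: "subspc cmul V"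
    using E by (auto simp: SL2_rep_def)
  have vr: "act E (var g) v = E g v" for g v by (simp add: var_def act_single)
  have cn: "act E (const k) v = cmul k v" for k v
    by (simp add: const_def act_def lext_single[OF vs_cmul] zero_word_def)
  have on: "act E 1 v = v" for v
    using cn[of 1 v] by (simp add: const_def)
  show "v \<in> V ==> act E f v = 0"
    using f
  proof (induction arbitrary: v)
    case (base r)
    from E base.prems have "SL2_rels q E v" by (auto simp: SL2_rep_def)
    note e = this[unfolded SL2_rels_def]
    have red: "act E (f - h) v = act E f v - act E h v" for f h
      by (rule lin_diff[OF act_lin])
    show ?case using base.hyps
      unfolding SL2_relations_def Let_def
      by (elim insertE emptyE)
         (simp_all add: red act_mult[OF l] vr cn on e lin_scale[OF l])
  next
    case (mult_left x y) then show ?case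
      by (simp add: act_mult[OF l] act_closed[OF V cl])
  next
    case (mult_right x y) then show ?case
      by (simp add: act_mult[OF l] lin_0[OF act_vlin[OF l]])
  qed (simp_all add: lin_add[OF act_lin] lin_0[OF act_lin])
qed

context quantum_SL2
begin

abbreviation "gv \<equiv> gen_value a b c d"
abbreviation "ev \<equiv> eval_alg scale gv"

lemma vs_scale: "vector_space scale" by (rule vector_space_axioms)

lemma ev_lext: "ev f = lext scale (\<lambda>w. prod_list (map gv (letters w))) f"
  by (simp add: eval_alg_def lext_def)

lemma ev_lin: "lin cmul scale ev"
  using lin_lext[OF vs_scale] by (simp add: ev_lext[abs_def])

lemma ev_single: "ev (single w k) = scale k (prod_list (map gv (letters w)))"
  by (simp add: ev_lext lext_single[OF vs_scale])

lemma ev_mult: "ev (f * g) = ev f * ev g"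
proof (rule mult_eqI[where t = scale and F = ev and G = "\<lambda>f g. ev f * ev g"])
  show "lin cmul scale (\<lambda>g. ev f * ev g)" for f
    by (rule linI) (simp_all add: lin_as[OF ev_lin] algebra_simps scale_mult_right)
  show "lin cmul scale (\<lambda>f. ev f * ev g)" for g
    by (rule linI) (simp_all add: lin_as[OF ev_lin] algebra_simps scale_mult_left)
qed (simp_all add: ev_lin ev_single plus_word_def)

lemma ev_var: "ev (var g) = gv g" by (simp add: var_def ev_single)
lemma ev_const: "ev (const k) = scale k 1" by (simp add: const_def ev_single zero_word_def)
lemma ev_one: "ev 1 = 1" using ev_const[of 1] by (simp add: const_def)

lemma ev_onto: obtains f where "ev f = y" using generated by (metis surj_def)

lemma ev_relator: assumes "r \<in> SL2_relations q" shows "ev r = 0"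
  using related two_sided_ideal.base[OF assms] by blast

lemma rel_ab: "a * b = scale q (b * a)"
  and rel_ac: "a * c = scale q (c * a)"
  and rel_bc: "b * c = c * b"
  and rel_bd: "b * d = scale q (d * b)"
  and rel_cd: "c * d = scale q (d * c)"
  and rel_ad: "a * d = 1 + scale q (b * c)"
  and rel_da: "d * a = 1 + scale (inverse q) (b * c)"
  using ballI[of "SL2_relations q" "\<lambda>r. ev r = 0", OF ev_relator] unfolding SL2_relations_def Let_def
  by (simp_all add: lin_ad[OF ev_lin] ev_mult ev_var ev_const ev_one scale_mult_left mult.assoc
    diff_diff_eq diff_eq_eq)

text \<open>Words span the algebra, and they are built by appending generators on the right.\<close>

lemma gen_induct [case_names one mult add scale]:
  assumes "P 1" "\<And>y g. P y ==> P (y * gv g)"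
    "\<And>y z. P y ==> P z ==> P (y + z)" "\<And>k y. P y ==> P (scale k y)"
  shows "P y"
proof -
  have w: "P (prod_list (map gv (letters w)))" for w
  proof -
    have "P (prod_list (map gv gs))" for gs
      by (induction gs rule: rev_induct) (simp_all add: assms)
    then show ?thesis .
  qed
  obtain f where f: "ev f = y" by (rule ev_onto)
  have z: "P 0" using assms(4)[of 1 0] assms(1) by simp
  have "P (\<Sum>x\<in>S. scale (lookup f x) (prod_list (map gv (letters x))))" for S
    by (induction S rule: infinite_finite_induct) (simp_all add: z assms w)
  then show ?thesis using f by (auto simp: eval_alg_def)
qed

text \<open>By \<open>act_ideal\<close> all polynomials representing \<open>y\<close> act in the same way, so any of
  them will do. Every right representation thus becomes a right module, which is the only way in which the
  completeness of the relations is used.\<close>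

definition ract :: "(gen => ('y \<Rightarrow>\<^sub>0 complex) => ('y \<Rightarrow>\<^sub>0 complex)) => 'a => ('y \<Rightarrow>\<^sub>0 complex) => ('y \<Rightarrow>\<^sub>0 complex)" where
  "ract E y v = act E (SOME f. ev f = y) v"

lemma ract_eq:
  assumes E: "SL2_rep q V E" "v \<in> V" and f: "ev f = y"
  shows "ract E y v = act E f v"
proof -
  let ?g = "SOME f. ev f = y"
  have "ev ?g = y" using f by (rule someI)
  then have "ev (?g - f) = 0" using f by (simp add: lin_diff[OF ev_lin])
  then have "act E (?g - f) v = 0" using related act_ideal[OF E(1) _ E(2)] by blast
  then show ?thesis by (simp add: ract_def lin_diff[OF act_lin])
qed

lemma ract_add: assumes E: "SL2_rep q V E" "v \<in> V" shows "ract E (y + z) v = ract E y v + ract E z v"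
proof -
  obtain f g where fg: "ev f = y" "ev g = z" by (metis ev_onto)
  then have "ev (f + g) = y + z" by (simp add: lin_add[OF ev_lin])
  then show ?thesis using fg by (simp add: ract_eq[OF E] lin_add[OF act_lin])
qed

lemma ract_scale: assumes E: "SL2_rep q V E" "v \<in> V" shows "ract E (scale k y) v = cmul k (ract E y v)"
proof -
  obtain f where f: "ev f = y" by (metis ev_onto)
  then have "ev (cmul k f) = scale k y" by (simp add: lin_scale[OF ev_lin])
  then show ?thesis using f by (simp add: ract_eq[OF E] lin_scale[OF act_lin])
qed

lemma ract_lin: assumes "SL2_rep q V E" "v \<in> V" shows "lin scale cmul (\<lambda>y. ract E y v)"
  by (rule linI) (simp_all add: ract_add[OF assms] ract_scale[OF assms])

lemma ract_one: assumes E: "SL2_rep q V E" "v \<in> V" shows "ract E 1 v = v"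
  by (subst ract_eq[OF E ev_one]) (simp add: act_single[of _ 0, simplified] zero_word_def)

lemma ract_mult: assumes E: "SL2_rep q V E" "v \<in> V"
  shows "ract E (y * gv g) v = E g (ract E y v)"
proof -
  obtain f where f: "ev f = y" by (metis ev_onto)
  have l: "\<And>g. vlin (E g)" using E by (auto simp: SL2_rep_def)
  have "ev (f * var g) = y * gv g" using f by (simp add: ev_mult ev_var)
  then show ?thesis using f
    by (simp add: ract_eq[OF E] act_mult[OF l]) (simp add: var_def act_single)
qed

lemma ract_closed: assumes E: "SL2_rep q V E" "v \<in> V" shows "ract E y v \<in> V"
  unfolding ract_def by (rule act_closed) (use E in \<open>auto simp: SL2_rep_def\<close>)

end

section \<open>The Poincare-Birkhoff-Witt basis\<close>

type_synonym idx = "int \<times> nat \<times> nat"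

text \<open>The would-be right multiplication by a generator on the monomials \<open>b\<^sup>j c\<^sup>k
  a\<^sup>i\<close>, where \<open>a\<^sup>i\<close> stands for \<open>d\<^sup>-\<^sup>i\<close> when
  \<open>i < 0\<close>. The second summands come from \<open>da = 1 + q\<^sup>-\<^sup>1 bc\<close> and
  \<open>ad = 1 + q bc\<close>.\<close>

definition pbw_step :: "complex => gen => idx => (idx \<Rightarrow>\<^sub>0 complex)" where
  "pbw_step q g = (\<lambda>(i, j, k). case g of
     GA => single (i + 1, j, k) 1
          + single (i + 1, Suc j, Suc k) (if i < 0 then q powi (2 * i + 1) else 0)
   | GB => single (i, Suc j, k) (q powi i)
   | GC => single (i, j, Suc k) (q powi i)
   | GD => single (i - 1, j, k) 1
          + single (i - 1, Suc j, Suc k) (if i > 0 then q powi (2 * i - 1) else 0))"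

definition pbw_op :: "complex => gen => (idx \<Rightarrow>\<^sub>0 complex) => (idx \<Rightarrow>\<^sub>0 complex)" where
  "pbw_op q g = lext cmul (pbw_step q g)"

lemma pbw_op_lin: "vlin (pbw_op q g)"
  unfolding pbw_op_def by (rule vlin_lext)

lemma pbw_op_single:
  "pbw_op q GA (single (i, j, k) m) = single (i + 1, j, k) m
     + single (i + 1, Suc j, Suc k) (if i < 0 then m * q powi (2 * i + 1) else 0)"
  "pbw_op q GB (single (i, j, k) m) = single (i, Suc j, k) (m * q powi i)"
  "pbw_op q GC (single (i, j, k) m) = single (i, j, Suc k) (m * q powi i)"
  "pbw_op q GD (single (i, j, k) m) = single (i - 1, j, k) m
     + single (i - 1, Suc j, Suc k) (if i > 0 then m * q powi (2 * i - 1) else 0)"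
  by (simp_all add: pbw_op_def lext_single[OF vs_cmul] pbw_step_def cmul_single cmul_add)

text \<open>That the table satisfies the relations is the only computation behind the linear independence of the
  monomials: the algebra then acts on the free space, and this action separates them.\<close>

lemma pbw_rep: assumes q: "q \<noteq> 0" shows "SL2_rep q UNIV (pbw_op q)"
proof -
  note l = lin_as[OF pbw_op_lin]
  have qq: "q * (inverse q * w) = w" "inverse q * (q * w) = w" for w
    using q by (simp_all flip: mult.assoc)
  have "q powi (i + i) = q powi i * q powi i" for i
    by (rule power_int_add) (simp add: q)
  then have p2: "q powi (2 * i) = q powi i * q powi i" "q powi (i * 2) = q powi i * q powi i" for i
    by (metis mult_2, metis mult_2_right)
  have p: "q powi (1 + i) = q * q powi i" "q powi (i + 1) = q * q powi i" "q powi (i - 1) = inverse q * q powi i" for i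
    using q by (simp_all add: power_int_add power_int_diff divide_inverse mult.commute)
  have "SL2_rels q (pbw_op q) v" for v
  proof (induction v rule: poly_mapping_lin_induct)
    case (3 x)
    obtain i j k where "x = (i, j, k)" by (metis prod_cases3)
    then show ?case
      by (auto simp: SL2_rels_def pbw_op_single l cmul_single cmul_add add.assoc p p2 mult_ac q qq)
  qed (simp_all add: SL2_rels_def l cmul_add add_ac mult.commute)
  then show ?thesis
    by (simp add: SL2_rep_def subspc_UNIV pbw_op_lin)
qed

locale qsl2 = quantum_SL2 scale q a b c d
  for scale :: "complex => 'a::ring_1 => 'a" and q a b c d +
  assumes q0: "q \<noteq> 0" and q_nroot: "\<forall>n::nat. n > 0 --> q ^ n \<noteq> 1"
begin

lemma q_powi_eq_1: "q powi n = 1 \<longleftrightarrow> n = 0"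
proof
  assume "q powi n = 1"
  then have "q ^ nat \<bar>n\<bar> = 1"
    by (cases "n \<ge> 0") (auto simp: power_int_def power_inverse split: if_splits)
  then show "n = 0" using q_nroot by (metis nat_0_iff abs_le_zero_iff not_gr_zero)
qed simp

lemma db: "d * b = scale (inverse q) (b * d)"
  using rel_bd q0 by simp
lemma dc: "d * c = scale (inverse q) (c * d)"
  using rel_cd q0 by simp

definition zpow :: "int => 'a" where
  "zpow i = (if i \<ge> 0 then a ^ nat i else d ^ nat (- i))"

definition bas :: "idx => 'a" where
  "bas = (\<lambda>(i, j, k). b ^ j * c ^ k * zpow i)"

lemma cb_power: "c ^ k * b = b * c ^ k"
  by (induction k) (simp_all add: mult.assoc flip: rel_bc, metis mult.assoc rel_bc)

lemma a_pow_b: "a ^ n * b = scale (q ^ n) (b * a ^ n)"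
  by (induction n; simp add: mult.assoc scale_mult_right)
     (simp_all add: rel_ab scale_mult_left mult.commute flip: mult.assoc)

lemma a_pow_c: "a ^ n * c = scale (q ^ n) (c * a ^ n)"
  by (induction n; simp add: mult.assoc scale_mult_right)
     (simp_all add: rel_ac scale_mult_left mult.commute flip: mult.assoc)

lemma d_pow_b: "d ^ n * b = scale (inverse q ^ n) (b * d ^ n)"
  by (induction n; simp add: mult.assoc scale_mult_right)
     (simp_all add: db scale_mult_left mult.commute flip: mult.assoc)

lemma d_pow_c: "d ^ n * c = scale (inverse q ^ n) (c * d ^ n)"
  by (induction n; simp add: mult.assoc scale_mult_right)
     (simp_all add: dc scale_mult_left mult.commute flip: mult.assoc)

lemma zpow_b: "zpow i * b = scale (q powi i) (b * zpow i)"
  and zpow_c: "zpow i * c = scale (q powi i) (c * zpow i)"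
  using q0 by (auto simp: zpow_def power_int_def a_pow_b a_pow_c d_pow_b d_pow_c)

lemma zpow_a: "zpow i * a = zpow (i + 1) + (if i < 0 then scale (q powi (2 * i + 1)) (b * c * zpow (i + 1)) else 0)"
proof (cases "i < 0")
  case True
  then obtain m where i: "i = - int (Suc m)" by (metis zero_less_imp_eq_int neg_0_less_iff_less minus_equation_iff gr0_implies_Suc)
  have z: "zpow i = d ^ m * d" "zpow (i + 1) = d ^ m" by (auto simp: zpow_def i nat_add_distrib power_commutes)
  have "zpow i * a = d ^ m * (1 + scale (inverse q) (b * c))"
    by (simp add: z mult.assoc rel_da)
  also have "\<dots> = d ^ m + scale (inverse q) ((d ^ m * b) * c)"
    by (simp add: distrib_left scale_mult_right mult.assoc)
  also have "(d ^ m * b) * c = scale (inverse q ^ m * inverse q ^ m) (b * c * d ^ m)"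
    by (simp add: d_pow_b d_pow_c scale_mult_left scale_mult_right mult.assoc)
  also have "inverse q * (inverse q ^ m * inverse q ^ m) = q powi (2 * i + 1)"
  proof -
    have "2 * i + 1 = - int (Suc (m + m))" by (simp add: i)
    then show ?thesis by (simp only: power_int_minus power_int_of_nat) (simp add: power_add power_inverse)
  qed
  then have "scale (inverse q) (scale (inverse q ^ m * inverse q ^ m) (b * c * d ^ m)) = scale (q powi (2 * i + 1)) (b * c * d ^ m)"
    by simp
  finally show ?thesis using True z by simp
qed (simp add: zpow_def nat_add_distrib power_commutes)

lemma zpow_d: "zpow i * d = zpow (i - 1) + (if i > 0 then scale (q powi (2 * i - 1)) (b * c * zpow (i - 1)) else 0)"
proof (cases "i > 0")
  case True
  then obtain m where i: "i = int (Suc m)" by (metis zero_less_imp_eq_int gr0_implies_Suc)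
  have z: "zpow i = a ^ m * a" "zpow (i - 1) = a ^ m" by (auto simp: zpow_def i nat_add_distrib power_commutes)
  have "zpow i * d = a ^ m * (1 + scale q (b * c))"
    by (simp add: z mult.assoc rel_ad)
  also have "\<dots> = a ^ m + scale q ((a ^ m * b) * c)"
    by (simp add: distrib_left scale_mult_right mult.assoc)
  also have "(a ^ m * b) * c = scale (q ^ m * q ^ m) (b * c * a ^ m)"
    by (simp add: a_pow_b a_pow_c scale_mult_left scale_mult_right mult.assoc)
  also have "q * (q ^ m * q ^ m) = q powi (2 * i - 1)"
  proof -
    have "2 * i - 1 = int (Suc (m + m))" by (simp add: i)
    then show ?thesis by (simp only: power_int_of_nat) (simp add: power_add)
  qed
  then have "scale q (scale (q ^ m * q ^ m) (b * c * a ^ m)) = scale (q powi (2 * i - 1)) (b * c * a ^ m)"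
    by simp
  finally show ?thesis using True z by simp
next
  case False
  then have "nat (1 - i) = Suc (nat (- i))" by simp
  then show ?thesis using False by (auto simp: zpow_def power_commutes)
qed

lemma bas_mult_gen: "bas e * gv g = lext scale bas (pbw_op q g (single e 1))"
proof -
  obtain i j k where e: "e = (i, j, k)" by (metis prod_cases3)
  note s = lin_add[OF lin_lext[OF vs_scale]] lext_single[OF vs_scale]
  have bb: "b ^ j * c ^ k * (b * y) = b ^ Suc j * c ^ k * y" for y
    by (metis cb_power mult.assoc power_Suc2)
  have cc: "b ^ j * c ^ k * (c * y) = b ^ j * c ^ Suc k * y" for y
    by (metis mult.assoc power_Suc2)
  have bc: "b ^ j * c ^ k * (b * c * y) = b ^ Suc j * c ^ Suc k * y" for y
    by (metis cb_power mult.assoc power_Suc2)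
  show ?thesis
  proof (cases g)
    case GA
    then show ?thesis
      by (auto simp: e bas_def pbw_op_single s mult.assoc[of _ "zpow i"] zpow_a distrib_left scale_mult_right bc simp del: power_Suc)
  next
    case GB
    then show ?thesis
      by (auto simp: e bas_def pbw_op_single s mult.assoc[of _ "zpow i"] zpow_b scale_mult_right bb simp del: power_Suc)
  next
    case GC
    then show ?thesis
      by (auto simp: e bas_def pbw_op_single s mult.assoc[of _ "zpow i"] zpow_c scale_mult_right cc simp del: power_Suc)
  next
    case GD
    then show ?thesis
      by (auto simp: e bas_def pbw_op_single s mult.assoc[of _ "zpow i"] zpow_d distrib_left scale_mult_right bc simp del: power_Suc)
  qed
qed

text \<open>The coordinates of \<open>y\<close> are the image of the vector of the empty monomial under the action of
  \<open>y\<close>.\<close>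

definition co :: "'a => (idx \<Rightarrow>\<^sub>0 complex)" where
  "co y = ract (pbw_op q) y (single (0, 0, 0) 1)"

lemma co_lin: "lin scale cmul co"
  unfolding co_def[abs_def] by (rule ract_lin[OF pbw_rep[OF q0] UNIV_I])

lemma co_one: "co 1 = single (0, 0, 0) 1"
  unfolding co_def by (rule ract_one[OF pbw_rep[OF q0] UNIV_I])

lemma co_mult: "co (y * gv g) = pbw_op q g (co y)"
  unfolding co_def by (rule ract_mult[OF pbw_rep[OF q0] UNIV_I])

lemmas co_mults = co_mult[of _ GA, simplified] co_mult[of _ GB, simplified]
  co_mult[of _ GC, simplified] co_mult[of _ GD, simplified]

lemma bas_lin_mult: "lext scale bas f * gv g = lext scale bas (pbw_op q g f)"
  by (rule lin_eqI[where F = "\<lambda>f. lext scale bas f * gv g" and t = scale])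
     (auto intro!: linI simp: lin_as[OF lin_lext[OF vs_scale]] distrib_right
       scale_mult_left lin_as[OF pbw_op_lin] vs_scale bas_mult_gen)

lemma bas_0: "bas (0, 0, 0) = 1" by (simp add: bas_def zpow_def)

text \<open>The monomials span, by induction along words, because their span is closed under right multiplication.\<close>

lemma bas_co: "lext scale bas (co y) = y"
proof (induction y rule: gen_induct)
  case one then show ?case by (simp add: co_one vs_scale bas_0)
next
  case (mult y g) then show ?case by (simp add: co_mult flip: bas_lin_mult)
qed (simp_all add: lin_as[OF co_lin] lin_as[OF lin_lext[OF vs_scale]])

text \<open>The monomials are independent: acting on the empty monomial, each one produces its own basis vector.\<close>

lemma co_bas: "co (bas e) = single e 1"
proof -
  obtain i j k where e: "e = (i, j, k)" by (metis prod_cases3)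
  have 1: "co (b ^ j) = single (0, j, 0) 1"
    by (induction j) (simp_all add: co_one power_Suc2 co_mults pbw_op_single del: power_Suc)
  have 2: "co (b ^ j * c ^ k) = single (0, j, k) 1"
    by (induction k) (simp_all add: 1 power_Suc2 co_mults pbw_op_single flip: mult.assoc del: power_Suc)
  have 3: "co (b ^ j * c ^ k * a ^ n) = single (int n, j, k) 1" for n
    by (induction n) (simp_all add: 2 power_Suc2 co_mults pbw_op_single add.commute flip: mult.assoc del: power_Suc)
  have diff_conv: "- int n - 1 = - 1 - int n" for n by simp
  have 4: "co (b ^ j * c ^ k * d ^ n) = single (- int n, j, k) 1" for n
    by (induction n) (simp_all add: 2 power_Suc2 co_mults pbw_op_single diff_conv flip: mult.assoc del: power_Suc)
  show ?thesis using 3[of "nat i"] 4[of "nat (- i)"] by (auto simp: e bas_def zpow_def)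
qed

lemma co_lext: "co (lext scale bas f) = f"
  by (rule lin_eqI[where F = "\<lambda>f. co (lext scale bas f)" and t = cmul])
     (auto intro: lin_comp[OF lin_lext[OF vs_scale] co_lin] lin_id simp: vs_scale co_bas)

lemma lin_basis_eqI:
  assumes "lin scale t F" "lin scale t G" "\<And>e. e \<in> keys (co y) ==> F (bas e) = G (bas e)"
  shows "F y = G y"
  by (subst (1 2) bas_co[of y, symmetric], unfold lext_def)
     (simp add: lin_sum[OF assms(1)] lin_sum[OF assms(2)] lin_scale[OF assms(1)] lin_scale[OF assms(2)] assms(3))

definition blin :: "(complex => 'v::ab_group_add => 'v) => (idx => 'v) => 'a => 'v" where
  "blin t g y = lext t g (co y)"

lemma blin_lin: "vector_space t ==> lin scale t (blin t g)"
  unfolding blin_def[abs_def] by (rule lin_comp[OF co_lin lin_lext])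

lemma blin_bas: "vector_space t ==> blin t g (bas e) = g e"
  by (simp add: blin_def co_bas)

lemma lin_blin: "lin scale t F ==> F y = lext t (\<lambda>e. F (bas e)) (co y)"
  by (subst bas_co[of y, symmetric], unfold lext_def) (simp add: lin_sum lin_scale)

end

section \<open>Tensor powers in coordinates\<close>

type_synonym tens = "idx list \<Rightarrow>\<^sub>0 complex"

context qsl2
begin

text \<open>The tensor powers have the lists of monomial indices as a basis; prepending a factor expands it in that
  basis.\<close>

definition cns :: "'a => tens => tens" where
  "cns x v = lext cmul (\<lambda>e. lext cmul (\<lambda>l. single (e # l) 1) v) (co x)"

fun ten :: "'a list => tens" where
  "ten [] = single [] 1"
| "ten (x # xs) = cns x (ten xs)"

lemma cns_lin1: "lin scale cmul (\<lambda>x. cns x v)"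
  unfolding cns_def by (rule lin_comp[OF co_lin vlin_lext])

lemma cns_lin2: "vlin (cns x)"
  unfolding cns_def[abs_def] by (rule lin_lext_arg[OF vs_cmul], rule vlin_lext)

lemma cns_bas: "cns (bas e) (single l 1) = single (e # l) 1"
  by (simp add: cns_def co_bas)

lemma ten_bas: "ten (map bas l) = single l 1"
  by (induction l) (simp_all add: cns_bas)

lemma ten_lin: "lin scale cmul (\<lambda>x. ten (us @ x # vs))"
  by (induction us) (simp_all add: cns_lin1 lin_comp[OF _ cns_lin2])

lemma ten_lin_comp: "lin scale scale M ==> lin scale cmul (\<lambda>x. ten (us @ M x # vs))"
  by (rule lin_comp[OF _ ten_lin])

lemma mult_lin_l: "lin scale scale (\<lambda>x. x * y)" and mult_lin_r: "lin scale scale (\<lambda>x. y * x)"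
  by (auto intro!: linI simp: algebra_simps scale_mult_left scale_mult_right)

text \<open>Multilinearity on lists of length \<open>n\<close>, by recursion on the first slot.\<close>

primrec ml :: "nat => ('a list => ('y \<Rightarrow>\<^sub>0 complex)) => bool" where
  "ml 0 g = True"
| "ml (Suc n) g = ((\<forall>xs. length xs = n --> lin scale cmul (\<lambda>x. g (x # xs))) \<and> (\<forall>x. ml n (\<lambda>xs. g (x # xs))))"

lemma mlI: "(\<And>us vs. length us + length vs + 1 = n ==> lin scale cmul (\<lambda>x. g (us @ x # vs))) ==> ml n g"
proof (induction n arbitrary: g)
  case (Suc n)
  show ?case
  proof (simp, intro conjI allI impI)
    fix xs :: "'a list" assume "length xs = n"
    then show "lin scale cmul (\<lambda>x. g (x # xs))" using Suc.prems[of "[]" xs] by simp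
  next
    fix x
    show "ml n (\<lambda>xs. g (x # xs))"
    proof (rule Suc.IH)
      fix us vs :: "'a list" assume "length us + length vs + 1 = n"
      then show "lin scale cmul (\<lambda>y. g (x # us @ y # vs))" using Suc.prems[of "x # us" vs] by simp
    qed
  qed
qed simp

text \<open>The linear map on the tensor power induced by a multilinear function of lists. It is defined on the basis,
  and \<open>mop_ten\<close> gives its value on every elementary tensor.\<close>

definition mop :: "('a list => ('y \<Rightarrow>\<^sub>0 complex)) => tens => ('y \<Rightarrow>\<^sub>0 complex)" where
  "mop g v = lext cmul (\<lambda>l. g (map bas l)) v"

lemma mop_lin: "vlin (mop g)"
  unfolding mop_def[abs_def] by (rule vlin_lext)

lemma mop_single: "mop g (single l 1) = g (map bas l)"
  by (simp add: mop_def)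

lemma mop_cns: "mop g (cns x v) = lext cmul (\<lambda>e. mop (\<lambda>ys. g (bas e # ys)) v) (co x)"
proof -
  have "mop g (cns x v) = lext cmul (\<lambda>e. mop g (lext cmul (\<lambda>l. single (e # l) 1) v)) (co x)"
    unfolding cns_def by (rule lin_of_lext[OF vs_cmul mop_lin])
  also have "\<dots> = lext cmul (\<lambda>e. mop (\<lambda>ys. g (bas e # ys)) v) (co x)"
    by (subst lin_of_lext[OF vs_cmul mop_lin]) (simp add: mop_single, simp add: mop_def)
  finally show ?thesis .
qed

lemma mop_ten: "ml (length xs) g ==> mop g (ten xs) = g xs"
proof (induction xs arbitrary: g)
  case Nil then show ?case by (simp add: mop_def)
next
  case (Cons x xs)
  have "mop g (ten (x # xs)) = lext cmul (\<lambda>e. g (bas e # xs)) (co x)"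
    using Cons by (simp add: mop_cns cong: lext_cong)
  also have "\<dots> = g (x # xs)"
    using Cons.prems by (subst lin_blin[where F = "\<lambda>x. g (x # xs)" and t = cmul]) auto
  finally show ?case .
qed

lemma ml_cmul: "ml n f ==> ml n (\<lambda>xs. cmul k (f xs))"
  by (induction n arbitrary: f) (auto intro: vlin_cmul)
lemma ml_cong: "ml n f ==> (\<And>xs. length xs = n ==> f xs = g xs) ==> ml n g"
proof (induction n arbitrary: f g)
  case (Suc n)
  have "lin scale cmul (\<lambda>x. g (x # xs))" if "length xs = n" for xs
  proof -
    have "(\<lambda>x. g (x # xs)) = (\<lambda>x. f (x # xs))" using that Suc.prems by auto
    then show ?thesis using that Suc.prems by auto
  qed
  moreover have "ml n (\<lambda>xs. g (x # xs))" for x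
    by (rule Suc.IH[of "\<lambda>xs. f (x # xs)"]) (use Suc.prems in auto)
  ultimately show ?case by simp
qed simp

definition Cn :: "nat => tens set" where
  "Cn n = {v. \<forall>l\<in>keys v. length l = Suc n}"

lemma Cn_subspc: "subspc cmul (Cn n)"
  unfolding subspc_def Cn_def using keys_add keys_cmul by (fastforce simp: subset_iff)

lemma Cn_0: "0 \<in> Cn n" and Cn_add: "x \<in> Cn n ==> y \<in> Cn n ==> x + y \<in> Cn n"
  and Cn_cmul: "x \<in> Cn n ==> cmul k x \<in> Cn n"
  using Cn_subspc[of n] by (auto simp: subspc_def)

lemma uminus_cmul: "- x = cmul (-1) x" for x :: "'x \<Rightarrow>\<^sub>0 complex"
  by (simp add: cmul_minus)

lemma Cn_uminus: "x \<in> Cn n ==> - x \<in> Cn n"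
  by (simp only: uminus_cmul Cn_cmul)

lemma Cn_diff: "x \<in> Cn n ==> y \<in> Cn n ==> x - y \<in> Cn n"
  using Cn_add[of x n "- y"] Cn_uminus[of y n] by simp

lemma Cn_sum: "(\<And>i. i \<in> S ==> f i \<in> Cn n) ==> (\<Sum>i\<in>S. f i) \<in> Cn n"
  by (rule subspc_sum[OF Cn_subspc])

lemma Cn_lext: "(\<And>x. x \<in> keys f ==> g x \<in> Cn n) ==> lext cmul g f \<in> Cn n"
  unfolding lext_def by (intro Cn_sum Cn_cmul)

lemma single_Cn: "length l = Suc n ==> single l k \<in> Cn n"
  by (auto simp: Cn_def)

lemma ten_keys: "\<forall>l\<in>keys (ten xs). length l = length xs"
proof (induction xs)
  case (Cons x xs)
  show ?case
  proof
    fix l assume "l \<in> keys (ten (x # xs))"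
    then obtain e where "l \<in> keys (lext cmul (\<lambda>l. single (e # l) 1) (ten xs))"
      using lext_keys[of "\<lambda>e. lext cmul (\<lambda>l. single (e # l) 1) (ten xs)" "co x"]
      by (auto simp: cns_def)
    then obtain l' where "l' \<in> keys (ten xs)" "l = e # l'"
      using lext_keys[of "\<lambda>l. single (e # l) (1::complex)" "ten xs"] by auto
    then show "length l = length (x # xs)" using Cons by simp
  qed
qed simp

lemma ten_Cn: "length xs = Suc n ==> ten xs \<in> Cn n"
  using ten_keys[of xs] by (auto simp: Cn_def)

lemma Cn_eqI:
  assumes "v \<in> Cn n" "lin cmul t F" "lin cmul t G" "\<And>xs. length xs = Suc n ==> F (ten xs) = G (ten xs)"
  shows "F v = G v"
proof (rule lin_eqI[OF assms(2,3)])
  fix l assume "l \<in> keys v"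
  then have "length (map bas l) = Suc n" using assms(1) by (auto simp: Cn_def)
  from assms(4)[OF this] show "F (single l 1) = G (single l 1)"
    by (simp add: ten_bas)
qed

lemma vCn_eqI:
  assumes "v \<in> Cn n" "vlin F" "vlin G" "\<And>xs. length xs = Suc n ==> F (ten xs) = G (ten xs)"
  shows "F v = G v"
  by (rule Cn_eqI[OF assms])

lemma Cn_induct:
  assumes "v \<in> Cn n" "subspc cmul V" "\<And>xs. length xs = Suc n ==> ten xs \<in> V"
  shows "v \<in> V"
proof -
  have "v = (\<Sum>x\<in>keys v. cmul (lookup v x) (ten (map bas x)))"
    by (subst poly_mapping_sum_singles) (simp add: ten_bas)
  also have "\<dots> \<in> V"
    using assms by (intro subspc_sum[OF assms(2)]) (auto simp: subspc_def Cn_def)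
  finally show ?thesis .
qed

lemma mop_Cn: "v \<in> Cn n ==> (\<And>xs. length xs = Suc n ==> g xs \<in> Cn m) ==> mop g v \<in> Cn m"
  unfolding mop_def by (rule Cn_lext) (auto simp: Cn_def[of n])

text \<open>The elementary tensors of degree zero form a subspace, as there is only one slot.\<close>

lemma Cn0_ten: assumes "v \<in> Cn 0" obtains y where "v = ten [y]"
proof -
  have "v \<in> range (\<lambda>y. ten [y])"
  proof (rule Cn_induct[OF assms])
    note l = ten_lin[of "[]" "[]"]
    show "subspc cmul (range (\<lambda>y. ten [y]))"
      unfolding subspc_def
      using lin_0[OF l] lin_add[OF l] lin_scale[OF l] by (auto simp: image_iff) metis+
  qed (auto simp: length_Suc_conv)
  then show ?thesis using that by blast
qed

declare ten.simps [simp del]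

end

section \<open>The twisted cyclic operators\<close>

locale twisted = qsl2 scale q a b c d
  for scale :: "complex => 'a::ring_1 => 'a" and q a b c d +
  fixes \<sigma> :: "'a => 'a" and N :: int
  assumes \<sigma>_aut: "algebra_automorphism scale \<sigma>"
    and \<sigma>_gen: "\<sigma> a = scale (q powi (- N)) a" "\<sigma> b = b" "\<sigma> c = c" "\<sigma> d = scale (q powi N) d"
begin

lemma \<sigma>_lin: "lin scale scale \<sigma>"
  using \<sigma>_aut unfolding algebra_automorphism_def
  by (auto simp: lin_def Vector_Spaces.linear_def module_hom_def module_hom_axioms_def)

lemma \<sigma>_mult: "\<sigma> (x * y) = \<sigma> x * \<sigma> y" and \<sigma>_one [simp]: "\<sigma> 1 = 1"
  using \<sigma>_aut by (auto simp: algebra_automorphism_def)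

text \<open>The faces of the twisted cyclic module on lists: the last one multiplies cyclically and twists by
  \<open>\<sigma>\<close>. The cyclic operator is \<open>rot\<close> up to sign.\<close>

definition fc :: "nat => 'a list => 'a list" where
  "fc i xs = (if Suc i < length xs then take i xs @ (xs ! i * xs ! Suc i) # drop (i + 2) xs
              else (\<sigma> (last xs) * hd xs) # butlast (tl xs))"

definition rot :: "'a list => 'a list" where
  "rot xs = \<sigma> (last xs) # butlast xs"

lemma length_fc: "length xs \<ge> 2 ==> i < length xs ==> length (fc i xs) = length xs - 1"
  by (auto simp: fc_def)

lemma nth_fc: "Suc i < length xs ==> k < length xs - 1 ==>
    fc i xs ! k = (if k < i then xs ! k else if k = i then xs ! i * xs ! Suc i else xs ! Suc k)"
  by (auto simp: fc_def nth_append nth_Cons' min_def)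

lemma nth_fc_last: "Suc i = length xs ==> k < length xs - 1 ==>
    fc i xs ! k = (if k = 0 then \<sigma> (xs ! i) * xs ! 0 else xs ! k)"
  by (cases xs) (auto simp: fc_def last_conv_nth nth_Cons' nth_butlast)

lemma length_rot: "xs \<noteq> [] ==> length (rot xs) = length xs"
  by (cases xs) (auto simp: rot_def)

lemma length_rot_Suc [simp]: "length xs = Suc n ==> length (rot xs) = Suc n"
  by (cases xs) (auto simp: rot_def)

lemma nth_rot: "k < length xs ==> rot xs ! k = (if k = 0 then \<sigma> (xs ! (length xs - 1)) else xs ! (k - 1))"
  by (cases xs) (auto simp: rot_def last_conv_nth nth_Cons' nth_butlast)

text \<open>Both sides are compared entry by entry. For inner faces this is associativity, and for the last face it
  uses that \<open>\<sigma>\<close> is multiplicative.\<close>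

lemma fc_fc: assumes "i < j" "j < length xs" "length xs \<ge> 3"
  shows "fc i (fc j xs) = fc (j - 1) (fc i xs)"
proof (rule nth_equalityI)
  have l: "length (fc j xs) = length xs - 1" "length (fc i xs) = length xs - 1"
    using assms by (simp_all add: length_fc)
  show "length (fc i (fc j xs)) = length (fc (j - 1) (fc i xs))"
    using assms l by (subst (1 2) length_fc) auto
  fix k assume k: "k < length (fc i (fc j xs))"
  then have k: "k < length xs - 2" using assms l by (subst (asm) length_fc) auto
  show "fc i (fc j xs) ! k = fc (j - 1) (fc i xs) ! k"
  proof (cases "Suc j = length xs")
    case True
    show ?thesis
    proof (cases "Suc i = j")
      case T: True
      have "fc i (fc j xs) ! k = (if k = 0 then \<sigma> (fc j xs ! i) * fc j xs ! 0 else fc j xs ! k)"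
        using k l T True by (intro nth_fc_last) auto
      moreover have "fc (j - 1) (fc i xs) ! k = (if k = 0 then \<sigma> (fc i xs ! (j - 1)) * fc i xs ! 0 else fc i xs ! k)"
        using k l T True by (intro nth_fc_last) auto
      ultimately show ?thesis
        using k T True assms by (auto simp: nth_fc nth_fc_last \<sigma>_mult mult.assoc)
    next
      case F: False
      have "fc i (fc j xs) ! k = (if k < i then fc j xs ! k else if k = i then fc j xs ! i * fc j xs ! Suc i else fc j xs ! Suc k)"
        using k l F True assms by (intro nth_fc) auto
      moreover have "fc (j - 1) (fc i xs) ! k = (if k = 0 then \<sigma> (fc i xs ! (j - 1)) * fc i xs ! 0 else fc i xs ! k)"
        using k l F True assms by (intro nth_fc_last) auto
      ultimately show ?thesis
        using k F True assms by (auto simp: nth_fc nth_fc_last \<sigma>_mult mult.assoc)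
    qed
  next
    case False
    have "fc i (fc j xs) ! k = (if k < i then fc j xs ! k else if k = i then fc j xs ! i * fc j xs ! Suc i else fc j xs ! Suc k)"
      using k l False assms by (intro nth_fc) auto
    moreover have "fc (j - 1) (fc i xs) ! k = (if k < j - 1 then fc i xs ! k else if k = j - 1 then fc i xs ! (j - 1) * fc i xs ! Suc (j - 1) else fc i xs ! Suc k)"
      using k l False assms by (intro nth_fc) auto
    ultimately have e: "(fc i (fc j xs) ! k = fc (j - 1) (fc i xs) ! k) \<longleftrightarrow>
        ((if k < i then fc j xs ! k else if k = i then fc j xs ! i * fc j xs ! Suc i else fc j xs ! Suc k)
        = (if k < j - 1 then fc i xs ! k else if k = j - 1 then fc i xs ! (j - 1) * fc i xs ! Suc (j - 1) else fc i xs ! Suc k))"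
      by (simp only:)
    have sj: "Suc j < length xs" "Suc i < length xs" using False assms by auto
    obtain m where m: "j = Suc (i + m)" using assms(1) less_imp_Suc_add by blast
    have C: "k < i \<or> k = i \<or> (i < k \<and> k < j - 1) \<or> (i < k \<and> k = j - 1) \<or> (i < k \<and> k > j - 1)" by linarith
    show ?thesis unfolding e
      by (cases m; use C k sj in \<open>elim disjE conjE\<close>) (simp_all add: m nth_fc mult.assoc)
  qed
qed

lemma fc_rot: assumes "0 < i" "i < length xs" "length xs \<ge> 2" shows "fc i (rot xs) = rot (fc (i - 1) xs)"
proof (rule nth_equalityI)
  have xs: "xs \<noteq> []" using assms by auto
  have l: "length (fc (i - 1) xs) = length xs - 1" "length (rot xs) = length xs"
    using assms xs by (simp_all add: length_fc length_rot)
  have ne: "fc (i - 1) xs \<noteq> []" using l assms by auto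
  show "length (fc i (rot xs)) = length (rot (fc (i - 1) xs))"
    using assms l ne by (simp add: length_rot length_fc)
  fix k assume "k < length (fc i (rot xs))"
  then have k: "k < length xs - 1" using assms l by (simp add: length_fc)
  have r: "rot (fc (i - 1) xs) ! k = (if k = 0 then \<sigma> (fc (i - 1) xs ! (length xs - 1 - 1)) else fc (i - 1) xs ! (k - 1))"
    using nth_rot[of k "fc (i - 1) xs"] l k by auto
  have r0: "rot xs ! 0 = \<sigma> (xs ! (length xs - 1))" using nth_rot[of 0 xs] xs by simp
  show "fc i (rot xs) ! k = rot (fc (i - 1) xs) ! k"
  proof (cases "Suc i = length xs")
    case True
    have "fc i (rot xs) ! k = (if k = 0 then \<sigma> (rot xs ! i) * rot xs ! 0 else rot xs ! k)"
      using k l True by (intro nth_fc_last) auto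
    moreover obtain i' where "i = Suc i'" using assms by (cases i) auto
    moreover have "length xs = Suc (Suc i')" using calculation True by simp
    ultimately show ?thesis unfolding r using k True assms
      by (auto simp: r0 nth_fc nth_rot \<sigma>_mult)
  next
    case False
    have e: "fc i (rot xs) ! k = (if k < i then rot xs ! k else if k = i then rot xs ! i * rot xs ! Suc i else rot xs ! Suc k)"
      using k l False assms by (intro nth_fc) auto
    have si: "Suc (i - 1) < length xs" "Suc i < length xs" using False assms by auto
    note f = nth_fc[OF si(1)]
    show ?thesis
    proof (cases k)
      case 0
      have "fc (i - 1) xs ! (length xs - 1 - 1) = xs ! (length xs - 1)"
        using si assms by (subst f) (auto intro!: arg_cong[where f = "(!) xs"])
      then show ?thesis unfolding e r using assms r0 0 by simp
    next
      case (Suc k')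
      have g: "rot xs ! k = xs ! k'" "rot xs ! Suc k = xs ! k" using k Suc by (simp_all add: nth_rot)
      have h: "rot xs ! i = xs ! (i - 1)" "rot xs ! Suc i = xs ! i"
        using si assms by (simp_all add: nth_rot)
      have "fc (i - 1) xs ! k' = (if k' < i - 1 then xs ! k' else if k' = i - 1 then xs ! (i - 1) * xs ! Suc (i - 1) else xs ! Suc k')"
        using k Suc by (intro f) auto
      then show ?thesis unfolding e r using assms Suc g h by auto
    qed
  qed
qed

lemma fc0_rot: assumes "length xs \<ge> 2" shows "fc 0 (rot xs) = fc (length xs - 1) xs"
  using assms by (cases xs rule: rev_cases; cases "butlast xs") (auto simp: fc_def rot_def)

text \<open>A list operation is multilinear if, seen from each single slot, it moves the entry somewhere and applies a
  linear map to it.\<close>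

lemma ml_ten_map:
  assumes "\<And>us vs. length us + length vs + 1 = n ==>
     \<exists>ps qs M. lin scale scale M \<and> (\<forall>x. F (us @ x # vs) = ps @ M x # qs)"
  shows "ml n (\<lambda>xs. ten (F xs))"
proof (rule mlI)
  fix us vs :: "'a list" assume "length us + length vs + 1 = n"
  from assms[OF this] obtain ps qs M where "lin scale scale M" "\<forall>x. F (us @ x # vs) = ps @ M x # qs" by blast
  then show "lin scale cmul (\<lambda>x. ten (F (us @ x # vs)))" by (simp add: ten_lin_comp)
qed

lemma ml_fc: assumes "i < n" "n \<ge> 2" shows "ml n (\<lambda>xs. ten (fc i xs))"
proof (rule ml_ten_map)
  fix us vs :: "'a list" assume n: "length us + length vs + 1 = n"
  show "\<exists>ps qs M. lin scale scale M \<and> (\<forall>x. fc i (us @ x # vs) = ps @ M x # qs)"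
  proof (cases "Suc i < n")
    case True
    consider "Suc i < length us" | "Suc i = length us" | "i = length us" | "i > length us" by linarith
    then show ?thesis
    proof cases
      case 1
      then have "fc i (us @ x # vs) = (take i us @ (us ! i * us ! Suc i) # drop (i + 2) us) @ x # vs" for x
        using n by (simp add: fc_def nth_append)
      then show ?thesis using lin_id by blast
    next
      case 2
      then have "fc i (us @ x # vs) = take i us @ (us ! i * x) # vs" for x
        using n by (simp add: fc_def nth_append)
      then show ?thesis using mult_lin_r by blast
    next
      case 3
      then have "fc i (us @ x # vs) = us @ (x * vs ! 0) # drop 1 vs" for x
        using n True by (simp add: fc_def nth_append)
      then show ?thesis using mult_lin_l by blast
    next
      case 4
      then obtain j where j: "i = length us + Suc j" by (metis less_imp_Suc_add add_Suc_right)
      then have "fc i (us @ x # vs) = us @ x # (take j vs @ (vs ! j * vs ! Suc j) # drop (j + 2) vs)" for x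
        using n True by (simp add: fc_def nth_append numeral_3_eq_3)
      then show ?thesis using lin_id by blast
    qed
  next
    case False
    show ?thesis
    proof (cases us)
      case Nil
      then have "fc i (us @ x # vs) = [] @ (\<sigma> (last vs) * x) # butlast vs" for x
        using n False assms by (auto simp: fc_def)
      then show ?thesis using mult_lin_r by blast
    next
      case (Cons u us')
      show ?thesis
      proof (cases "vs = []")
        case True
        then have "fc i (us @ x # vs) = [] @ (\<sigma> x * u) # us'" for x
          using n False assms Cons by (auto simp: fc_def)
        then show ?thesis using lin_comp[OF \<sigma>_lin mult_lin_l] by blast
      next
        case F: False
        then have "fc i (us @ x # vs) = ((\<sigma> (last vs) * u) # us') @ x # butlast vs" for x
          using n False assms Cons by (auto simp: fc_def butlast_append)
        then show ?thesis using lin_id by blast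
      qed
    qed
  qed
qed

lemma ml_rot: "n \<ge> 1 ==> ml n (\<lambda>xs. ten (rot xs))"
proof (rule ml_ten_map)
  fix us vs :: "'a list"
  show "\<exists>ps qs M. lin scale scale M \<and> (\<forall>x. rot (us @ x # vs) = ps @ M x # qs)"
  proof (cases vs rule: rev_cases)
    case Nil
    then have "rot (us @ x # vs) = [] @ \<sigma> x # us" for x by (simp add: rot_def)
    then show ?thesis using \<sigma>_lin by blast
  next
    case (snoc ws z)
    then have "rot (us @ x # vs) = (\<sigma> z # us) @ x # ws" for x by (simp add: rot_def butlast_append)
    then show ?thesis using lin_id by blast
  qed
qed

end

context qsl2
begin

lemma ml_ap: assumes "lin scale scale f" shows "ml n (\<lambda>xs. ten (xs[i := f (xs ! i)]))"
proof (rule mlI)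
  fix us vs :: "'a list"
  consider "i < length us" | "i = length us" | "i > length us" by linarith
  then show "lin scale cmul (\<lambda>x. ten ((us @ x # vs)[i := f ((us @ x # vs) ! i)]))"
  proof cases
    case 1 then show ?thesis by (simp add: nth_append list_update_append ten_lin)
  next
    case 2 then show ?thesis by (simp add: list_update_append ten_lin_comp assms)
  next
    case 3
    then obtain j where "i = length us + Suc j" by (metis less_imp_Suc_add add_Suc_right)
    then show ?thesis by (simp add: list_update_append nth_append ten_lin)
  qed
qed

lemma ml_cons: "ml n (\<lambda>xs. ten (y # xs))"
  by (rule mlI) (use ten_lin[of "y # us" for us] in simp)

lemma ml_snoc: "ml n (\<lambda>xs. ten (xs @ [y]))"
  by (rule mlI) (use ten_lin in simp)

lemma ml_ins: "n \<ge> 1 ==> ml n (\<lambda>xs. ten (hd xs # y # tl xs))"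
proof (rule mlI)
  fix us vs :: "'a list"
  show "lin scale cmul (\<lambda>x. ten (hd (us @ x # vs) # y # tl (us @ x # vs)))"
    using ten_lin[of "[]" "y # vs"] ten_lin[of "hd us # y # tl us" vs] by (cases us) simp_all
qed

definition sq :: "tens => tens" where "sq = mop (\<lambda>xs. ten (1 # xs))"
definition s0 :: "tens => tens" where "s0 = mop (\<lambda>xs. ten (hd xs # 1 # tl xs))"

lemma sq_lin: "vlin sq" and s0_lin: "vlin s0"
  by (simp_all add: sq_def s0_def mop_lin)

lemma sq_ten: "sq (ten xs) = ten (1 # xs)"
  unfolding sq_def by (subst mop_ten) (auto intro: ml_cons)

lemma s0_ten: "s0 (ten (x # xs)) = ten (x # 1 # xs)"
proof -
  have "s0 (ten (x # xs)) = ten (hd (x # xs) # 1 # tl (x # xs))"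
    unfolding s0_def by (rule mop_ten, rule ml_ins) simp
  then show ?thesis by simp
qed

lemma sq_Cn: "v \<in> Cn n ==> sq v \<in> Cn (Suc n)"
  unfolding sq_def by (erule mop_Cn) (simp add: ten_Cn)

lemma s0_Cn: "v \<in> Cn n ==> s0 v \<in> Cn (Suc n)"
  unfolding s0_def by (erule mop_Cn) (auto simp: length_Suc_conv intro!: ten_Cn)

end

context twisted
begin

definition dq :: "nat => tens => tens" where "dq i = mop (\<lambda>xs. ten (fc i xs))"
definition tq :: "tens => tens" where "tq = mop (\<lambda>xs. cmul ((-1) ^ (length xs - 1)) (ten (rot xs)))"
definition Tq :: "tens => tens" where "Tq = mop (\<lambda>xs. ten (map \<sigma> xs))"

lemma dq_lin: "vlin (dq i)" and tq_lin: "vlin tq" and Tq_lin: "vlin Tq"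
  by (simp_all add: dq_def tq_def Tq_def mop_lin)

lemma dq_ten: "i < length xs ==> 2 \<le> length xs ==> dq i (ten xs) = ten (fc i xs)"
  unfolding dq_def by (rule mop_ten) (auto intro: ml_fc)

lemma tq_ten: "xs \<noteq> [] ==> tq (ten xs) = cmul ((-1) ^ (length xs - 1)) (ten (rot xs))"
  unfolding tq_def
  by (rule mop_ten, rule ml_cong[OF ml_cmul[OF ml_rot]]) (auto simp: Suc_le_eq)

lemma ml_map\<sigma>: "ml n (\<lambda>xs. ten (map \<sigma> xs))"
  by (rule ml_ten_map) (use \<sigma>_lin in auto)

lemma Tq_ten: "Tq (ten xs) = ten (map \<sigma> xs)"
  unfolding Tq_def by (rule mop_ten[OF ml_map\<sigma>])

lemma dq_Cn: "v \<in> Cn n ==> i \<le> n ==> 0 < n ==> dq i v \<in> Cn (n - 1)"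
  unfolding dq_def by (erule mop_Cn) (auto simp: length_fc intro!: ten_Cn)

lemma tq_Cn: "v \<in> Cn n ==> tq v \<in> Cn n"
  unfolding tq_def by (erule mop_Cn) (auto simp: length_rot intro!: ten_Cn Cn_cmul)

lemma tqm_Cn: "v \<in> Cn n ==> (tq ^^ m) v \<in> Cn n"
  by (induction m) (simp_all add: tq_Cn)

lemma tqm_lin: "vlin (tq ^^ m)"
proof (induction m)
  case (Suc m) then show ?case using lin_comp[OF Suc tq_lin] by (simp add: comp_def)
qed (simp add: lin_id[unfolded id_def[symmetric]] id_def lin_def)

lemmas op_lin = dq_lin tq_lin Tq_lin sq_lin s0_lin tqm_lin
lemmas vl = op_lin[THEN lin_comp[rotated]] vlin_plus vlin_minus vlin_neg vlin_cmul lin_id vlin_setsum vlin_zero op_lin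
lemmas ls [simp] = op_lin[THEN lin_0]
lemmas la = op_lin[THEN lin_add] op_lin[THEN lin_diff] and lc = op_lin[THEN lin_scale]
  and lsum = op_lin[THEN lin_sum] and lneg = op_lin[THEN lin_uminus]

lemma dq_tq:
  assumes v: "v \<in> Cn n" and i: "0 < i" "i \<le> n"
  shows "dq i (tq v) = - tq (dq (i - 1) v)"
proof (rule vCn_eqI[OF v], goal_cases)
  case l: (3 xs)
  then have xs: "xs \<noteq> []" by auto
  have 1: "fc (i - 1) xs \<noteq> []" using length_fc[of xs "i - 1"] l i by fastforce
  obtain m where m: "n = Suc m" using i by (cases n) auto
  show ?case
    using l i xs 1 m
    by (simp add: tq_ten dq_ten lc length_rot fc_rot length_fc cmul_cmul lneg)
qed (intro vl)+

lemma dq0_tq: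
  assumes v: "v \<in> Cn n" and n: "0 < n"
  shows "dq 0 (tq v) = cmul ((-1) ^ n) (dq n v)"
proof (rule vCn_eqI[OF v], goal_cases)
  case l: (3 xs)
  then have xs: "xs \<noteq> []" by auto
  show ?case
    using l n xs by (simp add: tq_ten dq_ten lc length_rot fc0_rot)
qed (intro vl)+

lemma dq_dq:
  assumes v: "v \<in> Cn n" and i: "i < j" "j \<le> n" "2 \<le> n"
  shows "dq i (dq j v) = dq (j - 1) (dq i v)"
proof (rule vCn_eqI[OF v], goal_cases)
  case l: (3 xs)
  show ?case
    using l i by (simp add: dq_ten length_fc fc_fc)
qed (intro vl)+

lemma dq0_sq: assumes v: "v \<in> Cn n" shows "dq 0 (sq v) = v"
proof (rule vCn_eqI[OF v], goal_cases)
  case l: (3 xs)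
  then show ?case
    by (cases xs) (auto simp: sq_ten dq_ten fc_def)
qed (intro vl)+

lemma dq_Suc_sq: assumes v: "v \<in> Cn n" and i: "i < n" shows "dq (Suc i) (sq v) = sq (dq i v)"
proof (rule vCn_eqI[OF v], goal_cases)
  case l: (3 xs)
  have "fc (Suc i) (1 # xs) = 1 # fc i xs" using l i by (simp add: fc_def)
  then show ?case
    using l i by (simp add: sq_ten dq_ten)
qed (intro vl)+

lemma dq_last_sq: assumes v: "v \<in> Cn n" shows "dq (Suc n) (sq v) = cmul ((-1) ^ n) (tq v)"
proof (rule vCn_eqI[OF v], goal_cases)
  case l: (3 xs)
  then have xs: "xs \<noteq> []" by auto
  have "fc (Suc n) (1 # xs) = rot xs" using l xs by (simp add: fc_def rot_def)
  then show ?case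
    using l xs by (simp add: sq_ten dq_ten tq_ten cmul_cmul power_mult_distrib[symmetric])
qed (intro vl)+

lemma rot_pow: "m \<le> length xs ==> (rot ^^ m) xs = map \<sigma> (drop (length xs - m) xs) @ take (length xs - m) xs"
proof (induction m)
  case (Suc m)
  let ?k = "length xs - Suc m"
  have k: "length xs - m = Suc ?k" using Suc.prems by simp
  have t: "take (Suc ?k) xs = take ?k xs @ [xs ! ?k]" "drop ?k xs = xs ! ?k # drop (Suc ?k) xs"
    using Suc.prems by (simp_all add: take_Suc_conv_app_nth Cons_nth_drop_Suc)
  have "(rot ^^ Suc m) xs = rot (map \<sigma> (drop (Suc ?k) xs) @ take ?k xs @ [xs ! ?k])"
    using Suc k t by simp
  also have "\<dots> = map \<sigma> (drop ?k xs) @ take ?k xs"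
    unfolding t(2) by (simp add: rot_def butlast_append)
  finally show ?case .
qed simp

lemma rot_full: "(rot ^^ length xs) xs = map \<sigma> xs"
  using rot_pow[of "length xs" xs] by simp

lemma length_rot_pow: "xs \<noteq> [] ==> length ((rot ^^ m) xs) = length xs"
  by (induction m) (auto simp: length_rot, metis length_rot list.size(3) length_0_conv)

lemma tqm_ten: "length xs = Suc n ==> (tq ^^ m) (ten xs) = cmul ((-1) ^ (n * m)) (ten ((rot ^^ m) xs))"
proof (induction m)
  case (Suc m)
  have "xs \<noteq> []" using Suc.prems by auto
  then have l: "length ((rot ^^ m) xs) = Suc n" using Suc.prems length_rot_pow[of xs m] by simp
  then have "(rot ^^ m) xs \<noteq> []" by auto
  then show ?case using Suc l by (simp add: lc tq_ten cmul_cmul flip: power_add) (simp add: add.commute)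
qed simp

text \<open>A full rotation applies \<open>\<sigma>\<close> to every factor, and its sign is
  \<open>(-1)\<^bsup>n(n+1)\<^esup> = 1\<close>.\<close>

lemma tq_full: assumes v: "v \<in> Cn n" shows "(tq ^^ Suc n) v = Tq v"
proof (rule vCn_eqI[OF v], goal_cases)
  case l: (3 xs)
  have "even (n * Suc n)" by simp
  then have e: "((-1) ^ (n * Suc n) :: complex) = 1" by (simp only: power_minus_even power_one)
  show ?case
    unfolding tqm_ten[OF l] e using rot_full[of xs] l by (simp add: Tq_ten)
qed (intro vl)+

text \<open>A face that the rotation does not carry across the end of the list slides through it. A face that is
  carried across turns once into the last face, which \<open>dq_tqm_less\<close> describes.\<close>

lemma dq_tqm_ge: "v \<in> Cn n ==> m \<le> i ==> i \<le> n ==> 0 < n ==>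
   dq i ((tq ^^ m) v) = cmul ((-1) ^ m) ((tq ^^ m) (dq (i - m) v))"
proof (induction m arbitrary: i)
  case (Suc m)
  have "dq i (tq ((tq ^^ m) v)) = - tq (dq (i - 1) ((tq ^^ m) v))"
    by (rule dq_tq[OF tqm_Cn[OF Suc.prems(1)]]) (use Suc.prems in auto)
  also have "dq (i - 1) ((tq ^^ m) v) = cmul ((-1) ^ m) ((tq ^^ m) (dq (i - 1 - m) v))"
    by (rule Suc.IH) (use Suc.prems in auto)
  finally show ?case by (simp add: lc lneg cmul_cmul)
qed simp

lemma sgn_eq: "even (i + j) ==> ((-1) ^ i :: complex) = (-1) ^ j"
  by (cases "even i") auto

lemma dq_tqm_less: assumes v: "v \<in> Cn n" and i: "i < m" "m \<le> n"
  shows "cmul ((-1) ^ i) (dq i ((tq ^^ m) v)) = cmul ((-1) ^ (n + 1 - m + i)) ((tq ^^ (m - 1)) (dq (n + 1 - m + i) v))"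
proof -
  have n: "0 < n" using i by auto
  let ?w = "(tq ^^ (m - i)) v"
  obtain k where k: "m - i = Suc k" using i by (metis Suc_diff_Suc)
  have w: "?w \<in> Cn n" by (rule tqm_Cn[OF v])
  have "(tq ^^ m) v = (tq ^^ i) ?w" using i by (metis comp_apply funpow_add le_add_diff_inverse less_imp_le)
  then have "dq i ((tq ^^ m) v) = cmul ((-1) ^ i) ((tq ^^ i) (dq 0 ?w))"
    using dq_tqm_ge[OF w, of i i] i n by simp
  also have "dq 0 ?w = cmul ((-1) ^ n) (dq n ((tq ^^ k) v))"
    using dq0_tq[OF tqm_Cn[OF v] n, of k] k by simp
  also have "dq n ((tq ^^ k) v) = cmul ((-1) ^ k) ((tq ^^ k) (dq (n - k) v))"
    by (rule dq_tqm_ge[OF v]) (use i k n in auto)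
  finally have "cmul ((-1) ^ i) (dq i ((tq ^^ m) v)) = cmul ((-1) ^ (i + i + n + k)) ((tq ^^ i) ((tq ^^ k) (dq (n - k) v)))"
    by (simp add: lc cmul_cmul power_add mult.assoc)
  also have "(tq ^^ i) ((tq ^^ k) (dq (n - k) v)) = (tq ^^ (m - 1)) (dq (n + 1 - m + i) v)"
  proof -
    have "i + k = m - 1" "n - k = n + 1 - m + i" using k i by auto
    then show ?thesis by (metis comp_apply funpow_add)
  qed
  also have "((-1) ^ (i + i + n + k) :: complex) = (-1) ^ (n + 1 - m + i)"
  proof (rule sgn_eq)
    have "n + 1 - m + i = n - k" "k \<le> n" using k i by auto
    then show "even (i + i + n + k + (n + 1 - m + i))" by simp
  qed
  finally show ?thesis .
qed

text \<open>Alternating sums of faces: \<open>bp\<close> is the bar differential, without the twisted face, and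
  \<open>bn\<close> the Hochschild differential. The partial sums are needed because \<open>bn\<close> does
  not commute with single powers of \<open>t\<close>.\<close>

definition Sp :: "nat => tens => tens" where
  "Sp j v = (\<Sum>i<j. cmul ((-1) ^ i) (dq i v))"

definition bp :: "nat => tens => tens" where "bp n = Sp n"
definition bn :: "nat => tens => tens" where "bn n v = (if n = 0 then 0 else Sp (Suc n) v)"
definition Nq :: "nat => tens => tens" where "Nq n v = (\<Sum>m\<le>n. (tq ^^ m) v)"
definition Bq :: "nat => tens => tens" where "Bq n v = sq (Nq n v) - tq (sq (Nq n v))"

lemma Sp_lin: "vlin (Sp j)" unfolding Sp_def[abs_def] by (intro vl)
lemma bp_lin: "vlin (bp n)" by (simp add: bp_def Sp_lin)
lemma bn_lin: "vlin (bn n)" unfolding bn_def[abs_def] by (cases "n = 0") (simp_all add: vlin_zero Sp_lin)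
lemma Nq_lin: "vlin (Nq n)" unfolding Nq_def[abs_def] by (intro vl)
lemma Bq_lin: "vlin (Bq n)" unfolding Bq_def[abs_def] by (intro vl lin_comp[OF Nq_lin sq_lin])

lemmas sum_lin = Sp_lin bp_lin bn_lin Nq_lin Bq_lin
lemmas vl' = vl sum_lin[THEN lin_comp[rotated]] sum_lin
lemmas ls' [simp] = sum_lin[THEN lin_0]

lemma Sp_Cn: "v \<in> Cn n ==> j \<le> Suc n ==> 0 < n ==> Sp j v \<in> Cn (n - 1)"
  unfolding Sp_def by (intro Cn_sum Cn_cmul dq_Cn) auto
lemma bp_Cn: "v \<in> Cn n ==> bp n v \<in> Cn (n - 1)"
  using Sp_Cn[of v n n] by (cases "n = 0") (auto simp: bp_def Sp_def Cn_0)
lemma bn_Cn: "v \<in> Cn n ==> bn n v \<in> Cn (n - 1)"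
  using Sp_Cn[of v n "Suc n"] by (auto simp: bn_def Cn_0)
lemma bn_Cn_Suc: "v \<in> Cn (Suc n) ==> bn (Suc n) v \<in> Cn n"
  using bn_Cn[of v "Suc n"] by simp
lemma Nq_Cn: "v \<in> Cn n ==> Nq n v \<in> Cn n"
  unfolding Nq_def by (intro Cn_sum tqm_Cn)
lemma Bq_Cn: "v \<in> Cn n ==> Bq n v \<in> Cn (Suc n)"
  unfolding Bq_def by (intro Cn_diff tq_Cn sq_Cn Nq_Cn)

lemma bn_bp: "0 < n ==> bn n v = bp n v + cmul ((-1) ^ n) (dq n v)"
  by (simp add: bn_def bp_def Sp_def)

lemma bp_sq: assumes v: "v \<in> Cn n" shows "bp (Suc n) (sq v) = v - sq (bp n v)"
proof -
  have "bp (Suc n) (sq v) = dq 0 (sq v) + (\<Sum>i<n. cmul ((-1) ^ Suc i) (dq (Suc i) (sq v)))"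
    unfolding bp_def Sp_def by (subst sum.lessThan_Suc_shift) simp
  also have "(\<Sum>i<n. cmul ((-1) ^ Suc i) (dq (Suc i) (sq v))) = (\<Sum>i<n. - cmul ((-1) ^ i) (sq (dq i v)))"
    by (rule sum.cong) (simp_all add: dq_Suc_sq[OF v] cmul_minus)
  also have "\<dots> = - sq (bp n v)"
    by (simp add: bp_def Sp_def lsum lc sum_negf)
  finally show ?thesis by (simp add: dq0_sq[OF v])
qed

lemma bn_sq: assumes v: "v \<in> Cn n" shows "bn (Suc n) (sq v) = v - tq v - sq (bp n v)"
proof -
  have "((-1) ^ Suc n * (-1) ^ n :: complex) = - 1" by (simp flip: power_add)
  then show ?thesis
    using bn_bp[of "Suc n" "sq v"] by (simp add: bp_sq[OF v] dq_last_sq[OF v] cmul_cmul cmul_minus)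
qed

lemma bn_tq: assumes v: "v \<in> Cn n" shows "bn n (tq v) = bn n v - bp n v + tq (bp n v)"
proof (cases "n = 0")
  case False
  have "bn n (tq v) = dq 0 (tq v) + (\<Sum>i<n. cmul ((-1) ^ Suc i) (dq (Suc i) (tq v)))"
    unfolding bn_def Sp_def using False by (subst sum.lessThan_Suc_shift) simp
  also have "(\<Sum>i<n. cmul ((-1) ^ Suc i) (dq (Suc i) (tq v))) = (\<Sum>i<n. cmul ((-1) ^ i) (tq (dq i v)))"
    by (rule sum.cong) (use dq_tq[OF v, of "Suc i" for i] in \<open>simp_all add: cmul_minus free.scale_minus_right\<close>)
  also have "\<dots> = tq (bp n v)"
    by (simp add: bp_def Sp_def lsum lc)
  finally show ?thesis using False by (simp add: dq0_tq[OF v] bn_bp)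
qed (simp add: bn_def bp_def Sp_def)

lemma Sp_tqm_ge: assumes v: "v \<in> Cn n" "m \<le> n"
  shows "(\<Sum>i\<in>{m..<n}. cmul ((-1) ^ i) (dq i ((tq ^^ m) v))) = (tq ^^ m) (Sp (n - m) v)"
proof -
  have "(\<Sum>i\<in>{m..<n}. cmul ((-1) ^ i) (dq i ((tq ^^ m) v))) = (\<Sum>i<n - m. cmul ((-1) ^ (i + m)) (dq (i + m) ((tq ^^ m) v)))"
    by (rule sum.reindex_bij_witness[of _ "\<lambda>i. i + m" "\<lambda>i. i - m"]) (use v in auto)
  also have "\<dots> = (\<Sum>i<n - m. cmul ((-1) ^ i) ((tq ^^ m) (dq i v)))"
  proof (rule sum.cong[OF refl])
    fix i assume "i \<in> {..<n - m}"
    then have "dq (i + m) ((tq ^^ m) v) = cmul ((-1) ^ m) ((tq ^^ m) (dq (i + m - m) v))"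
      by (intro dq_tqm_ge[OF v(1)]) auto
    moreover have "((-1) ^ (i + m) * (-1) ^ m :: complex) = (-1) ^ i" by (simp add: power_add flip: power_mult_distrib)
    ultimately show "cmul ((-1) ^ (i + m)) (dq (i + m) ((tq ^^ m) v)) = cmul ((-1) ^ i) ((tq ^^ m) (dq i v))"
      by (simp add: cmul_cmul)
  qed
  finally show ?thesis by (simp add: Sp_def lsum lc)
qed

lemma Sp_tqm_less: assumes v: "v \<in> Cn n" "0 < m" "m \<le> n"
  shows "(\<Sum>i<m. cmul ((-1) ^ i) (dq i ((tq ^^ m) v))) = (tq ^^ (m - 1)) (bn n v - Sp (n + 1 - m) v)"
proof -
  have "(\<Sum>i<m. cmul ((-1) ^ i) (dq i ((tq ^^ m) v))) = (\<Sum>i<m. cmul ((-1) ^ (n + 1 - m + i)) ((tq ^^ (m - 1)) (dq (n + 1 - m + i) v)))"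
    by (rule sum.cong[OF refl], rule dq_tqm_less[OF v(1)]) (use v in auto)
  also have "\<dots> = (\<Sum>l\<in>{n + 1 - m..<Suc n}. cmul ((-1) ^ l) ((tq ^^ (m - 1)) (dq l v)))"
    by (rule sum.reindex_bij_witness[of _ "\<lambda>l. l - (n + 1 - m)" "\<lambda>i. n + 1 - m + i"]) (use v in auto)
  also have "\<dots> = (tq ^^ (m - 1)) (\<Sum>l\<in>{n + 1 - m..<Suc n}. cmul ((-1) ^ l) (dq l v))"
    by (simp add: lsum lc del: sum.op_ivl_Suc)
  also have "(\<Sum>l\<in>{n + 1 - m..<Suc n}. cmul ((-1) ^ l) (dq l v)) = bn n v - Sp (n + 1 - m) v"
  proof -
    have "Sp (Suc n) v = Sp (n + 1 - m) v + (\<Sum>l\<in>{n + 1 - m..<Suc n}. cmul ((-1) ^ l) (dq l v))"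
      unfolding Sp_def lessThan_atLeast0 using v by (subst sum.atLeastLessThan_concat) auto
    then show ?thesis using v by (simp add: bn_def)
  qed
  finally show ?thesis .
qed

lemma bp_split: "m \<le> n ==> bp n w = (\<Sum>i<m. cmul ((-1) ^ i) (dq i w)) + (\<Sum>i\<in>{m..<n}. cmul ((-1) ^ i) (dq i w))"
  unfolding bp_def Sp_def lessThan_atLeast0 by (subst sum.atLeastLessThan_concat) auto

lemma telescope:
  fixes g :: "nat => 'v::ab_group_add"
  shows "(\<Sum>m\<le>n. (if m = 0 then 0 else h (m - 1) - g (m - 1)) + g m) = (\<Sum>m<n. h m) + g n"
  by (induction n) (simp_all add: algebra_simps)

text \<open>The relation \<open>b'N = Nb\<close>. For each power of \<open>t\<close>, the faces on the two sides of
  the cut leave partial sums, which telescope over the powers.\<close>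

lemma bp_Nq: assumes v: "v \<in> Cn n" "0 < n" shows "bp n (Nq n v) = Nq (n - 1) (bn n v)"
proof -
  have "bp n (Nq n v) = (\<Sum>m\<le>n. bp n ((tq ^^ m) v))"
    by (simp add: Nq_def lin_sum[OF bp_lin])
  also have "\<dots> = (\<Sum>m\<le>n. (if m = 0 then 0 else (tq ^^ (m - 1)) (bn n v) - (tq ^^ (m - 1)) (Sp (n - (m - 1)) v))
       + (tq ^^ m) (Sp (n - m) v))"
  proof (rule sum.cong[OF refl])
    fix m assume m: "m \<in> {..n}"
    then have "m > 0 ==> n + 1 - m = n - (m - 1)" by auto
    then show "bp n ((tq ^^ m) v) = (if m = 0 then 0 else (tq ^^ (m - 1)) (bn n v) - (tq ^^ (m - 1)) (Sp (n - (m - 1)) v))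
       + (tq ^^ m) (Sp (n - m) v)"
      using m Sp_tqm_ge[OF v(1), of m] Sp_tqm_less[OF v(1), of m] by (subst bp_split[of m]) (auto simp: la)
  qed
  also have "\<dots> = (\<Sum>m<n. (tq ^^ m) (bn n v)) + (tq ^^ n) (Sp (n - n) v)"
    by (rule telescope)
  also have "\<dots> = Nq (n - 1) (bn n v)"
    using v(2) by (simp add: Nq_def Sp_def flip: lessThan_Suc_atMost)
  finally show ?thesis .
qed

lemma Nq_tq: assumes v: "v \<in> Cn n" shows "Nq n v - Nq n (tq v) = v - Tq v" and "Nq n v - tq (Nq n v) = v - Tq v"
proof -
  have 1: "Nq n (tq v) = (\<Sum>m\<le>n. (tq ^^ Suc m) v)" by (simp add: Nq_def funpow_swap1)
  have 2: "tq (Nq n v) = (\<Sum>m\<le>n. (tq ^^ Suc m) v)" by (simp add: Nq_def lsum)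
  have "Nq n v = v + (\<Sum>m<n. (tq ^^ Suc m) v)"
    unfolding Nq_def by (subst sum.atMost_shift) simp
  moreover have "(\<Sum>m\<le>n. (tq ^^ Suc m) v) = (\<Sum>m<n. (tq ^^ Suc m) v) + Tq v"
    using tq_full[OF v] by (simp flip: lessThan_Suc_atMost)
  ultimately show "Nq n v - Nq n (tq v) = v - Tq v" "Nq n v - tq (Nq n v) = v - Tq v"
    unfolding 1 2 by simp_all
qed

lemma bp_Nq': assumes v: "v \<in> Cn n" shows "sq (bp n (Nq n v)) = sq (Nq (n - 1) (bn n v))"
  using bp_Nq[OF v] by (cases "n = 0") (auto simp: bp_def Sp_def bn_def)

text \<open>From \<open>b(1 - t) = (1 - t)b'\<close>, \<open>b's + sb' = 1\<close>, \<open>b'N = Nb\<close> and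
  \<open>(1 - t)N = 1 - T\<close>.\<close>

lemma bn_Bq: assumes v: "v \<in> Cn n" shows "bn (Suc n) (Bq n v) = v - Tq v - Bq (n - 1) (bn n v)"
proof -
  let ?w = "sq (Nq n v)"
  note N = Nq_Cn[OF v]
  have "bn (Suc n) (Bq n v) = bn (Suc n) ?w - bn (Suc n) (tq ?w)"
    by (simp add: Bq_def lin_diff[OF bn_lin])
  also have "\<dots> = bp (Suc n) ?w - tq (bp (Suc n) ?w)"
    by (simp add: bn_tq[OF sq_Cn[OF N]])
  also have "\<dots> = Nq n v - tq (Nq n v) - (sq (bp n (Nq n v)) - tq (sq (bp n (Nq n v))))"
    by (simp add: bp_sq[OF N] la)
  finally show ?thesis by (simp add: bp_Nq'[OF v] Nq_tq(2)[OF v] Bq_def)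
qed

text \<open>The simplicial cancellation: the pairs \<open>i < j\<close> and \<open>j \<le> i\<close> are matched by
  \<open>(i, j) \<mapsto> (j - 1, i)\<close> with opposite signs.\<close>

lemma alternating_cancel:
  fixes G :: "nat => nat => ('x \<Rightarrow>\<^sub>0 complex)"
  assumes G: "\<And>i j. i < j ==> j \<le> n ==> G i j = G (j - 1) i"
  shows "(\<Sum>j\<le>n. cmul ((-1) ^ j) (\<Sum>i<n. cmul ((-1) ^ i) (G i j))) = 0"
proof -
  let ?f = "\<lambda>(i, j). cmul ((-1) ^ (i + j)) (G i j)"
  let ?A = "{(i, j). i < j \<and> j \<le> n}" and ?B = "{(i, j). i < n \<and> j \<le> i}"
  have fin: "finite ?A" "finite ?B"
    by (rule finite_subset[of _ "{..n} \<times> {..n}"]; auto)+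
  have "(\<Sum>j\<le>n. cmul ((-1) ^ j) (\<Sum>i<n. cmul ((-1) ^ i) (G i j))) = sum ?f ({..<n} \<times> {..n})"
    by (simp add: free.scale_sum_right cmul_cmul power_add mult.commute sum.cartesian_product[symmetric])
       (subst sum.swap, simp only: mult.commute)
  also have "{..<n} \<times> {..n} = ?A \<union> ?B" by auto
  also have "sum ?f (?A \<union> ?B) = sum ?f ?A + sum ?f ?B"
    by (rule sum.union_disjoint[OF fin]) auto
  also have "sum ?f ?A = sum (\<lambda>(i, j). - cmul ((-1) ^ (i + j)) (G i j)) ?B"
  proof (rule sum.reindex_bij_witness[of _ "\<lambda>(i, j). (j, Suc i)" "\<lambda>(i, j). (j - 1, i)"])
    fix p assume p: "p \<in> ?A"
    obtain i j where [simp]: "p = (i, j)" by (cases p)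
    obtain m where [simp]: "j = Suc m" using p by (cases j) auto
    show "(case (case p of (i, j) => (j - 1, i)) of (i, j) => - cmul ((-1) ^ (i + j)) (G i j)) = ?f p"
      using p G[of i j] by (simp add: cmul_minus add.commute)
  qed auto
  also have "\<dots> = - sum ?f ?B" by (simp add: sum_negf split_def)
  finally show ?thesis by simp
qed

lemma bn_bn: assumes v: "v \<in> Cn (Suc n)" shows "bn n (bn (Suc n) v) = 0"
proof (cases "n = 0")
  case False
  have "bn n (bn (Suc n) v) = (\<Sum>j\<le>Suc n. cmul ((-1) ^ j) (\<Sum>i<Suc n. cmul ((-1) ^ i) (dq i (dq j v))))"
    using False by (simp add: bn_def Sp_def lsum lc free.scale_sum_right cmul_cmul mult.commute
        flip: lessThan_Suc_atMost del: sum.lessThan_Suc) (subst sum.swap, simp only: mult.commute)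
  also have "\<dots> = 0"
    by (rule alternating_cancel, rule dq_dq[OF v]) (use False in auto)
  finally show ?thesis .
qed (simp add: bn_def)

lemma bp_bp: assumes v: "v \<in> Cn (Suc n)" shows "bp n (bp (Suc n) v) = 0"
proof (cases "n = 0")
  case False
  then obtain m where m: "n = Suc m" by (cases n) auto
  have "bp n (bp (Suc n) v) = (\<Sum>j\<le>n. cmul ((-1) ^ j) (\<Sum>i<n. cmul ((-1) ^ i) (dq i (dq j v))))"
    by (simp add: bp_def Sp_def lsum lc free.scale_sum_right cmul_cmul mult.commute
        flip: lessThan_Suc_atMost del: sum.lessThan_Suc) (subst sum.swap, simp only: mult.commute)
  also have "\<dots> = 0"
    by (rule alternating_cancel, rule dq_dq[OF v]) (use False in auto)
  finally show ?thesis .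
qed (simp add: bp_def Sp_def)

text \<open>The simplicial identities turn the last, twisted face into a chain map from the bar complex to the
  Hochschild complex. It plays the role of the augmentation in the comparison with the Koszul complex.\<close>

lemma dq_last_bp: assumes v: "v \<in> Cn (Suc (Suc n))"
  shows "dq (Suc n) (bp (Suc (Suc n)) v) = bn (Suc n) (dq (Suc (Suc n)) v)"
proof -
  have "dq (Suc n) (bp (Suc (Suc n)) v) = (\<Sum>i<Suc (Suc n). cmul ((-1) ^ i) (dq (Suc n) (dq i v)))"
    by (simp add: bp_def Sp_def lsum lc la)
  also have "\<dots> = (\<Sum>i<Suc (Suc n). cmul ((-1) ^ i) (dq i (dq (Suc (Suc n)) v)))"
    by (rule sum.cong) (use dq_dq[OF v, of _ "Suc (Suc n)"] in auto)
  finally show ?thesis by (simp add: bn_def Sp_def)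
qed

lemma Tq_dq: assumes v: "v \<in> Cn n" and i: "i \<le> n" "0 < n" shows "Tq (dq i v) = dq i (Tq v)"
proof (rule vCn_eqI[OF v], goal_cases)
  case l: (3 xs)
  then have "xs \<noteq> []" "tl xs \<noteq> []" using i by (auto simp flip: length_0_conv)
  then have "map \<sigma> (fc i xs) = fc i (map \<sigma> xs)" using l i
    by (auto simp: fc_def \<sigma>_mult take_map drop_map last_map hd_map map_butlast map_tl)
  then show ?case using l i by (simp add: dq_ten Tq_ten)
qed (intro vl)+

lemma Tq_tq: assumes v: "v \<in> Cn n" shows "Tq (tq v) = tq (Tq v)"
  using tq_full[OF v] tq_full[OF tq_Cn[OF v]] by (simp add: funpow_swap1)

lemma Tq_tqm: "v \<in> Cn n ==> Tq ((tq ^^ m) v) = (tq ^^ m) (Tq v)"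
  by (induction m) (simp_all add: Tq_tq[OF tqm_Cn])

lemma Tq_sq: assumes v: "v \<in> Cn n" shows "Tq (sq v) = sq (Tq v)"
  by (rule vCn_eqI[OF v]) (auto simp: Tq_ten sq_ten intro: vl)

lemma Tq_bn: "v \<in> Cn n ==> Tq (bn n v) = bn n (Tq v)"
  by (auto simp: bn_def Sp_def lsum lc Tq_dq intro!: sum.cong simp del: sum.lessThan_Suc)

lemma Tq_Nq: "v \<in> Cn n ==> Tq (Nq n v) = Nq n (Tq v)"
  by (simp add: Nq_def lsum Tq_tqm)

lemma Tq_Bq: "v \<in> Cn n ==> Tq (Bq n v) = Bq n (Tq v)"
  by (simp add: Bq_def la Tq_tq[OF sq_Cn[OF Nq_Cn]] Tq_sq[OF Nq_Cn] Tq_Nq)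

text \<open>Since \<open>N(1 - t) = 1 - T\<close> and \<open>T\<close> commutes with everything,
  \<open>B\<^sup>2\<close> vanishes only modulo the image of \<open>1 - T\<close>.\<close>

lemma Bq_Bq: assumes v: "v \<in> Cn n" shows "\<exists>g\<in>Cn (Suc (Suc n)). Bq (Suc n) (Bq n v) = g - Tq g"
proof
  let ?w = "sq (Nq n v)"
  let ?g = "sq ?w - tq (sq ?w)"
  have w: "?w \<in> Cn (Suc n)" by (intro sq_Cn Nq_Cn v)
  show "?g \<in> Cn (Suc (Suc n))" by (intro Cn_diff tq_Cn sq_Cn Nq_Cn v)
  have "Nq (Suc n) (Bq n v) = ?w - Tq ?w"
    using Nq_tq(1)[OF w] by (simp add: Bq_def lin_diff[OF Nq_lin])
  then show "Bq (Suc n) (Bq n v) = ?g - Tq ?g"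
    by (simp add: Bq_def[of "Suc n"] la Tq_tq[OF sq_Cn[OF w]] Tq_sq[OF w])
qed

section \<open>The Cartan homotopy formula\<close>

text \<open>Commuting with \<open>\<sigma>\<close> lets a derivation act on twisted chains.\<close>

definition is_der :: "('a => 'a) => bool" where
  "is_der D \<longleftrightarrow> lin scale scale D \<and> (\<forall>x y. D (x * y) = D x * y + x * D y) \<and> (\<forall>x. D (\<sigma> x) = \<sigma> (D x))"

text \<open>Operators of a derivation \<open>D\<close>: on a single slot (\<open>Dq\<close>), the contraction \<open>m
  \<otimes> x \<otimes> \<dots> \<mapsto> m D(x) \<otimes> \<dots>\<close> (\<open>eq\<close>), the Lie
  derivative on the first \<open>m + 1\<close> slots (\<open>Lq\<close>), and the homotopy
  \<open>Yq\<close>. The latter weights the powers of \<open>t\<close> in \<open>N\<close> by partial Lie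
  derivatives, which makes \<open>b'Y - Yb\<close> and \<open>(1 - t)Y\<close> computable by the telescoping
  that proves \<open>b'N = Nb\<close>.\<close>

definition Dq :: "('a => 'a) => nat => tens => tens" where
  "Dq D j = mop (\<lambda>xs. ten (xs[j := D (xs ! j)]))"

definition eq :: "('a => 'a) => tens => tens" where
  "eq D v = dq 0 (Dq D 1 v)"

definition Lq :: "('a => 'a) => nat => tens => tens" where
  "Lq D m v = (\<Sum>j\<le>m. Dq D j v)"

definition Yq :: "('a => 'a) => nat => tens => tens" where
  "Yq D n v = (\<Sum>m\<le>n. Lq D m ((tq ^^ m) v))"

context
  fixes D assumes D: "is_der D"
begin

lemma D_lin: "lin scale scale D" and D_mult: "D (x * y) = D x * y + x * D y" and D_\<sigma>: "D (\<sigma> x) = \<sigma> (D x)"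
  using D by (auto simp: is_der_def)

lemma D_one: "D 1 = 0" using D_mult[of 1 1] by simp

lemma Dq_lin: "vlin (Dq D j)" by (simp add: Dq_def mop_lin)
lemma eq_lin: "vlin (eq D)" unfolding eq_def[abs_def] by (intro vl Dq_lin)
lemma Lq_lin: "vlin (Lq D m)" unfolding Lq_def[abs_def] by (intro vl Dq_lin)

lemmas vlD = vl' lin_comp[OF _ Dq_lin] lin_comp[OF _ eq_lin] lin_comp[OF _ Lq_lin] Dq_lin eq_lin Lq_lin

lemma Yq_lin: "vlin (Yq D n)" unfolding Yq_def[abs_def] by (intro vlD)

lemma Dq_ten: "Dq D j (ten xs) = ten (xs[j := D (xs ! j)])"
  unfolding Dq_def by (rule mop_ten[OF ml_ap[OF D_lin]])

lemma Dq_Cn: "v \<in> Cn n ==> Dq D j v \<in> Cn n"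
  unfolding Dq_def by (erule mop_Cn) (auto intro!: ten_Cn)
lemma Lq_Cn: "v \<in> Cn n ==> Lq D m v \<in> Cn n"
  unfolding Lq_def by (intro Cn_sum Dq_Cn)
lemma Yq_Cn: "v \<in> Cn n ==> Yq D n v \<in> Cn n"
  unfolding Yq_def by (intro Cn_sum Lq_Cn tqm_Cn)
lemma eq_Cn: "v \<in> Cn n ==> 0 < n ==> eq D v \<in> Cn (n - 1)"
  unfolding eq_def by (intro dq_Cn Dq_Cn) auto

lemma Dq_tq: assumes v: "v \<in> Cn n" and j: "j < n" shows "Dq D (Suc j) (tq v) = tq (Dq D j v)"
proof (rule vCn_eqI[OF v], goal_cases)
  case l: (3 xs)
  then have ne: "xs \<noteq> []" by auto
  have "(rot xs)[Suc j := D (rot xs ! Suc j)] = rot (xs[j := D (xs ! j)])"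
    using l j ne by (intro nth_equalityI) (auto simp: nth_rot nth_list_update)
  then show ?case
    using l ne by (simp add: tq_ten Dq_ten lin_scale[OF Dq_lin])
qed (intro vlD)+

lemma Dq0_tq: assumes v: "v \<in> Cn n" shows "Dq D 0 (tq v) = tq (Dq D n v)"
proof (rule vCn_eqI[OF v], goal_cases)
  case l: (3 xs)
  then have ne: "xs \<noteq> []" by auto
  have "(rot xs)[0 := D (rot xs ! 0)] = rot (xs[n := D (xs ! n)])"
    using l ne by (intro nth_equalityI) (auto simp: nth_rot nth_list_update D_\<sigma>)
  then show ?case
    using l ne by (simp add: tq_ten Dq_ten lin_scale[OF Dq_lin])
qed (intro vlD)+

lemma dq_Dq_less: assumes v: "v \<in> Cn n" and i: "i < n" "j < i" shows "dq i (Dq D j v) = Dq D j (dq i v)"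
proof (rule vCn_eqI[OF v], goal_cases)
  case l: (3 xs)
  have "fc i (xs[j := D (xs ! j)]) = (fc i xs)[j := D (fc i xs ! j)]"
    using l i by (intro nth_equalityI) (auto simp: nth_fc length_fc nth_list_update)
  then show ?case
    using l i by (simp add: dq_ten Dq_ten)
qed (intro vlD)+

lemma dq_Dq_last: assumes v: "v \<in> Cn n" and j: "0 < j" "j < n" shows "dq n (Dq D j v) = Dq D j (dq n v)"
proof (rule vCn_eqI[OF v], goal_cases)
  case l: (3 xs)
  have "fc n (xs[j := D (xs ! j)]) = (fc n xs)[j := D (fc n xs ! j)]"
    using l j by (intro nth_equalityI) (auto simp: nth_fc_last length_fc nth_list_update)
  then show ?case
    using l j by (simp add: dq_ten Dq_ten)
qed (intro vlD)+

lemma dq_Dq_greater: assumes v: "v \<in> Cn n" and i: "Suc i < j" "j \<le> n" shows "dq i (Dq D j v) = Dq D (j - 1) (dq i v)"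
proof (rule vCn_eqI[OF v], goal_cases)
  case l: (3 xs)
  have "fc i (xs[j := D (xs ! j)]) = (fc i xs)[j - 1 := D (fc i xs ! (j - 1))]"
    using l i by (intro nth_equalityI) (auto simp: nth_fc length_fc nth_list_update)
  then show ?case
    using l i by (simp add: dq_ten Dq_ten)
qed (intro vlD)+

lemma dq_Dq_leibniz: assumes v: "v \<in> Cn n" and i: "i < n"
  shows "dq i (Dq D i v) + dq i (Dq D (Suc i) v) = Dq D i (dq i v)"
proof (rule vCn_eqI[OF v, where F = "\<lambda>v. dq i (Dq D i v) + dq i (Dq D (Suc i) v)"], goal_cases)
  case l: (3 xs)
  have fi: "fc i xs ! i = xs ! i * xs ! Suc i" using l i by (subst nth_fc) auto
  have e: "fc i (xs[i := D (xs ! i)]) = take i (fc i xs) @ (D (xs ! i) * xs ! Suc i) # drop (Suc i) (fc i xs)"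
          "fc i (xs[Suc i := D (xs ! Suc i)]) = take i (fc i xs) @ (xs ! i * D (xs ! Suc i)) # drop (Suc i) (fc i xs)"
          "(fc i xs)[i := D (fc i xs ! i)] = take i (fc i xs) @ (D (xs ! i) * xs ! Suc i + xs ! i * D (xs ! Suc i)) # drop (Suc i) (fc i xs)"
    unfolding fi using l i by (auto simp: fc_def min_def upd_conv_take_nth_drop D_mult nth_append)
  show ?case
    using l i by (simp add: dq_ten Dq_ten e lin_add[OF ten_lin])
qed (intro vlD)+

lemma Dq0_sq: assumes v: "v \<in> Cn n" shows "eq D (sq v) = Dq D 0 v" and "eq D (tq (sq v)) = 0"
proof goal_cases
  case 1 show ?case
  proof (rule vCn_eqI[OF v], goal_cases)
    case l: (3 xs)
    then obtain x ys where "xs = x # ys" by (cases xs) auto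
    then show ?case
      by (simp add: eq_def sq_ten Dq_ten dq_ten fc_def)
  qed (intro vlD)+
  case 2 show ?case
  proof (rule vCn_eqI[OF v, where F = "\<lambda>v. eq D (tq (sq v))" and G = "\<lambda>v. 0"], goal_cases)
    case l: (3 xs)
    then obtain z ys where z: "xs = ys @ [z]" by (cases xs rule: rev_cases) auto
    have "ten (0 # ys) = 0" using lin_0[OF ten_lin[of "[]" ys]] by simp
    then show ?case
      by (simp add: eq_def sq_ten tq_ten Dq_ten dq_ten fc_def z rot_def lc lneg lin_uminus[OF Dq_lin] lin_scale[OF Dq_lin] D_one)
  qed (intro vlD)+
qed

lemma Tq_Dq: assumes v: "v \<in> Cn n" and j: "j \<le> n" shows "Tq (Dq D j v) = Dq D j (Tq v)"
proof (rule vCn_eqI[OF v], goal_cases)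
  case l: (3 xs)
  show ?case
    using l j by (simp add: Tq_ten Dq_ten D_\<sigma> map_update)
qed (intro vlD)+

lemma Tq_eq: assumes v: "v \<in> Cn n" "0 < n" shows "Tq (eq D v) = eq D (Tq v)"
  using v by (simp add: eq_def Tq_dq[OF Dq_Cn[OF v(1)]] Tq_Dq[OF v(1)])

text \<open>The faces \<open>2, 3, \<dots>\<close> slide past the contraction with an index shift, hence the sign. By
  the Leibniz rule the face \<open>1\<close> produces two terms: one cancels the face \<open>0\<close>, the
  other is the face \<open>0\<close> of the contraction.\<close>

lemma bn_eq: assumes v: "v \<in> Cn n" "2 \<le> n" shows "bn (n - 1) (eq D v) = - eq D (bn n v)"
proof -
  have "n = Suc (Suc (n - 2))" using v(2) by simp
  then obtain m where m: "n = Suc (Suc m)" ..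
  let ?d = "\<lambda>i. dq i v" and ?f = "\<lambda>i. cmul ((-1) ^ i) (dq 0 (Dq D 1 (dq i v)))"
  have c: "?f (Suc (Suc i)) = - cmul ((-1) ^ Suc i) (dq (Suc i) (eq D v))" if i: "i < Suc m" for i
  proof -
    have "Dq D 1 (dq (Suc (Suc i)) v) = dq (Suc (Suc i)) (Dq D 1 v)"
      using i m dq_Dq_less[OF v(1), of "Suc (Suc i)" 1] dq_Dq_last[OF v(1), of 1] by (cases "Suc (Suc i) = n") auto
    moreover have "dq 0 (dq (Suc (Suc i)) (Dq D 1 v)) = dq (Suc i) (dq 0 (Dq D 1 v))"
      using dq_dq[OF Dq_Cn[OF v(1)], of 0 "Suc (Suc i)"] i m by simp
    ultimately show ?thesis by (simp add: eq_def cmul_minus)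
  qed
  have d01: "dq 0 (dq 1 w) = dq 0 (dq 0 w)" if "w \<in> Cn n" for w
    using dq_dq[OF that, of 0 1] m by simp
  have a: "?f 0 = dq 0 (dq 0 (Dq D 2 v))"
    using dq_Dq_greater[OF v(1), of 0 2] m by (simp add: numeral_2_eq_2)
  have b: "?f (Suc 0) = - (dq 0 (dq 0 (Dq D 1 v)) + dq 0 (dq 0 (Dq D 2 v)))"
    using dq_Dq_leibniz[OF v(1), of 1, symmetric] m
    by (simp add: la d01[OF Dq_Cn[OF v(1)], simplified] numeral_2_eq_2 cmul_minus)
  have "eq D (bn n v) = (\<Sum>i<Suc n. ?f i)"
    by (simp add: m bn_def Sp_def eq_def lsum lc la lin_sum[OF Dq_lin] lin_add[OF Dq_lin] lin_diff[OF Dq_lin] lin_uminus[OF Dq_lin] lneg lin_scale[OF Dq_lin])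
  also have "\<dots> = ?f 0 + (?f (Suc 0) + (\<Sum>i<Suc m. ?f (Suc (Suc i))))"
    unfolding m by (subst sum.lessThan_Suc_shift, subst sum.lessThan_Suc_shift) simp
  also have "(\<Sum>i<Suc m. ?f (Suc (Suc i))) = (\<Sum>i<Suc m. - cmul ((-1) ^ Suc i) (dq (Suc i) (eq D v)))"
    by (rule sum.cong) (use c in auto)
  also have "?f 0 + (?f (Suc 0) + \<dots>) = - (dq 0 (eq D v) + (\<Sum>i<Suc m. cmul ((-1) ^ Suc i) (dq (Suc i) (eq D v))))"
    unfolding a b sum_negf by (simp add: eq_def)
  also have "\<dots> = - bn (n - 1) (eq D v)"
    unfolding m by (simp add: bn_def Sp_def sum.lessThan_Suc_shift[of _ "Suc m"] del: sum.lessThan_Suc)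
  finally show ?thesis by simp
qed

text \<open>A face multiplying two slots inside the range of the partial Lie derivative merges their two terms into
  one, by the Leibniz rule.\<close>

lemma dq_Lq_less: assumes v: "v \<in> Cn n" and i: "i < m" "m \<le> n" shows "dq i (Lq D m v) = Lq D (m - 1) (dq i v)"
proof -
  obtain k where k: "m = Suc k" using i by (cases m) auto
  have 1: "dq i (Dq D j v) = Dq D (j - 1) (dq i v)" if "j > Suc i" "j \<le> m" for j
    using dq_Dq_greater[OF v, of i j] that i by auto
  have S: "(\<Sum>j\<le>m. f j) = (\<Sum>j<i. f j) + ((f i + f (Suc i)) + (\<Sum>j\<in>{Suc (Suc i)..<Suc m}. f j))" for f :: "nat => tens"
  proof -
    have "(\<Sum>j\<le>m. f j) = (\<Sum>j\<in>{0..<i}. f j) + (\<Sum>j\<in>{i..<Suc m}. f j)"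
      using i by (subst sum.atLeastLessThan_concat) (auto simp: atLeast0LessThan lessThan_Suc_atMost)
    also have "(\<Sum>j\<in>{i..<Suc m}. f j) = f i + (f (Suc i) + (\<Sum>j\<in>{Suc (Suc i)..<Suc m}. f j))"
      using i by (subst sum.atLeast_Suc_lessThan, simp, subst sum.atLeast_Suc_lessThan) auto
    finally show ?thesis by (simp add: atLeast0LessThan add.assoc)
  qed
  have "dq i (Lq D m v) = (\<Sum>j<i. dq i (Dq D j v)) + ((dq i (Dq D i v) + dq i (Dq D (Suc i) v)) + (\<Sum>j\<in>{Suc (Suc i)..<Suc m}. dq i (Dq D j v)))"
    unfolding Lq_def lsum by (rule S)
  also have "\<dots> = (\<Sum>j<i. Dq D j (dq i v)) + (Dq D i (dq i v) + (\<Sum>j\<in>{Suc (Suc i)..<Suc m}. Dq D (j - 1) (dq i v)))"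
    using i by (simp add: dq_Dq_less[OF v] dq_Dq_leibniz[OF v] 1 del: sum.op_ivl_Suc)
  also have "(\<Sum>j\<in>{Suc (Suc i)..<Suc m}. Dq D (j - 1) (dq i v)) = (\<Sum>j\<in>{Suc i..<m}. Dq D j (dq i v))"
    by (rule sum.reindex_bij_witness[of _ Suc "\<lambda>j. j - 1"]) auto
  also have "Dq D i (dq i v) + \<dots> = (\<Sum>j\<in>{i..<m}. Dq D j (dq i v))"
    using i by (subst (2) sum.atLeast_Suc_lessThan) auto
  also have "(\<Sum>j<i. Dq D j (dq i v)) + \<dots> = (\<Sum>j<m. Dq D j (dq i v))"
    unfolding lessThan_atLeast0 using i by (subst sum.atLeastLessThan_concat) auto
  finally show ?thesis using k by (simp add: Lq_def lessThan_Suc_atMost)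
qed

lemma dq_Lq_greater: assumes v: "v \<in> Cn n" and i: "m < i" "i < n" shows "dq i (Lq D m v) = Lq D m (dq i v)"
  using i by (simp add: Lq_def lsum dq_Dq_less[OF v])

text \<open>At the edge of the range only one of the two terms is present. The missing one is what becomes the
  contraction in \<open>bp_Yq\<close>.\<close>

lemma dq_Lq_eq: assumes v: "v \<in> Cn n" and m: "m < n"
  shows "dq m (Lq D m v) = Lq D m (dq m v) - dq m (Dq D (Suc m) v)"
proof -
  have "dq m (Lq D m v) = (\<Sum>j<m. Dq D j (dq m v)) + dq m (Dq D m v)"
    using m by (simp add: Lq_def lsum la dq_Dq_less[OF v] flip: lessThan_Suc_atMost)
  also have "dq m (Dq D m v) = Dq D m (dq m v) - dq m (Dq D (Suc m) v)"
    using dq_Dq_leibniz[OF v m] by (simp add: eq_diff_eq)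
  finally show ?thesis by (simp add: Lq_def flip: lessThan_Suc_atMost)
qed

lemma Dq_tqm: "v \<in> Cn n ==> m < n ==> Dq D (Suc m) ((tq ^^ m) v) = (tq ^^ m) (Dq D 1 v)"
proof (induction m)
  case (Suc m)
  then show ?case using Dq_tq[OF tqm_Cn[OF Suc.prems(1)], of "Suc m" m] by simp
qed simp

lemma bp_Lq: assumes v: "v \<in> Cn n" "m \<le> n" "0 < n"
  shows "bp n (Lq D m ((tq ^^ m) v)) =
     ((if m = 0 then 0 else Lq D (m - 1) ((tq ^^ (m - 1)) (bn n v)) - Lq D (m - 1) ((tq ^^ (m - 1)) (Sp (n - (m - 1)) v)))
       + Lq D m ((tq ^^ m) (Sp (n - m) v))) - (if m < n then (tq ^^ m) (eq D v) else 0)"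
proof -
  let ?w = "(tq ^^ m) v"
  note w = tqm_Cn[OF v(1), of m]
  have 1: "(\<Sum>i<m. cmul ((-1) ^ i) (dq i (Lq D m ?w))) =
     (if m = 0 then 0 else Lq D (m - 1) ((tq ^^ (m - 1)) (bn n v)) - Lq D (m - 1) ((tq ^^ (m - 1)) (Sp (n - (m - 1)) v)))"
  proof (cases "m = 0")
    case False
    have "(\<Sum>i<m. cmul ((-1) ^ i) (dq i (Lq D m ?w))) = Lq D (m - 1) (\<Sum>i<m. cmul ((-1) ^ i) (dq i ?w))"
      using v by (simp add: dq_Lq_less[OF w] lin_sum[OF Lq_lin] lin_scale[OF Lq_lin])
    also have "(\<Sum>i<m. cmul ((-1) ^ i) (dq i ?w)) = (tq ^^ (m - 1)) (bn n v - Sp (n - (m - 1)) v)"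
      using Sp_tqm_less[OF v(1), of m] False v by (simp add: Suc_diff_Suc diff_diff_right)
    finally show ?thesis using False by (simp add: la lin_diff[OF Lq_lin])
  qed simp
  have 2: "(\<Sum>i\<in>{m..<n}. cmul ((-1) ^ i) (dq i (Lq D m ?w))) = Lq D m ((tq ^^ m) (Sp (n - m) v)) - (if m < n then (tq ^^ m) (eq D v) else 0)"
  proof (cases "m < n")
    case True
    have e: "cmul ((-1) ^ m) (dq m (Dq D (Suc m) ?w)) = (tq ^^ m) (eq D v)"
      unfolding Dq_tqm[OF v(1) True] eq_def using True
      by (subst dq_tqm_ge[OF Dq_Cn[OF v(1)]]) (simp_all add: cmul_cmul flip: power_mult_distrib)
    have "(\<Sum>i\<in>{m..<n}. cmul ((-1) ^ i) (dq i (Lq D m ?w))) =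
       cmul ((-1) ^ m) (dq m (Lq D m ?w)) + (\<Sum>i\<in>{Suc m..<n}. cmul ((-1) ^ i) (dq i (Lq D m ?w)))"
      by (rule sum.atLeast_Suc_lessThan[OF True])
    also have "\<dots> = (cmul ((-1) ^ m) (Lq D m (dq m ?w)) + (\<Sum>i\<in>{Suc m..<n}. cmul ((-1) ^ i) (Lq D m (dq i ?w)))) - (tq ^^ m) (eq D v)"
      by (simp add: dq_Lq_eq[OF w True] dq_Lq_greater[OF w] cmul_diff e)
    also have "cmul ((-1) ^ m) (Lq D m (dq m ?w)) + (\<Sum>i\<in>{Suc m..<n}. cmul ((-1) ^ i) (Lq D m (dq i ?w)))
       = Lq D m (\<Sum>i\<in>{m..<n}. cmul ((-1) ^ i) (dq i ?w))"
      by (simp add: sum.atLeast_Suc_lessThan[OF True] lin_sum[OF Lq_lin] lin_as[OF Lq_lin])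
    finally show ?thesis using True v by (simp add: Sp_tqm_ge[OF v(1)])
  qed (use v in \<open>simp add: Sp_def lin_0[OF Lq_lin]\<close>)
  show ?thesis by (subst bp_split[OF v(2)]) (simp add: 1 2)
qed

lemma bp_Yq: assumes v: "v \<in> Cn n" "0 < n" shows "bp n (Yq D n v) = Yq D (n - 1) (bn n v) - Nq (n - 1) (eq D v)"
proof -
  have "bp n (Yq D n v) = (\<Sum>m\<le>n. ((if m = 0 then 0 else Lq D (m - 1) ((tq ^^ (m - 1)) (bn n v)) - Lq D (m - 1) ((tq ^^ (m - 1)) (Sp (n - (m - 1)) v)))
       + Lq D m ((tq ^^ m) (Sp (n - m) v))) - (if m < n then (tq ^^ m) (eq D v) else 0))"
    unfolding Yq_def lin_sum[OF bp_lin] by (rule sum.cong[OF refl], rule bp_Lq) (use v in auto)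
  also have "\<dots> = ((\<Sum>m<n. Lq D m ((tq ^^ m) (bn n v))) + Lq D n ((tq ^^ n) (Sp (n - n) v))) - (\<Sum>m<n. (tq ^^ m) (eq D v))"
    unfolding sum_subtractf
      telescope[of "\<lambda>m. Lq D m ((tq ^^ m) (bn n v))" "\<lambda>m. Lq D m ((tq ^^ m) (Sp (n - m) v))" n]
    by (simp flip: lessThan_Suc_atMost)
  also have "\<dots> = Yq D (n - 1) (bn n v) - Nq (n - 1) (eq D v)"
    using v(2) by (simp add: Yq_def Nq_def Sp_def lin_0[OF Lq_lin] flip: lessThan_Suc_atMost)
  finally show ?thesis .
qed

lemma Lq_tq: assumes v: "v \<in> Cn n" and m: "m < n" shows "tq (Lq D m v) = Lq D (Suc m) (tq v) - Dq D 0 (tq v)"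
proof -
  have "Lq D (Suc m) (tq v) = Dq D 0 (tq v) + (\<Sum>j\<le>m. Dq D (Suc j) (tq v))"
    unfolding Lq_def by (simp add: sum.atMost_Suc_shift del: sum.atMost_Suc)
  also have "(\<Sum>j\<le>m. Dq D (Suc j) (tq v)) = tq (Lq D m v)"
    using m by (simp add: Lq_def lsum Dq_tq[OF v])
  finally show ?thesis by simp
qed

lemma Lq_tq_full: assumes v: "v \<in> Cn n" shows "tq (Lq D n v) = Lq D n (tq v)"
proof (cases n)
  case 0 then show ?thesis using Dq0_tq[OF v] by (simp add: Lq_def)
next
  case (Suc k)
  have "tq (Lq D n v) = tq (Lq D k v) + tq (Dq D n v)" by (simp add: Suc Lq_def la)
  then show ?thesis using Lq_tq[OF v, of k] Dq0_tq[OF v] by (simp add: Suc)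
qed

lemma Yq_tq: assumes v: "v \<in> Cn n" shows "Yq D n v - tq (Yq D n v) = Dq D 0 (Nq n v) - Lq D n (Tq v)"
proof -
  let ?L = "\<lambda>m. Lq D m ((tq ^^ m) v)" and ?D = "\<lambda>m. Dq D 0 ((tq ^^ m) v)"
  have "tq (Yq D n v) = (\<Sum>m<n. tq (?L m)) + tq (?L n)"
    by (simp add: Yq_def lsum la flip: lessThan_Suc_atMost)
  also have "(\<Sum>m<n. tq (?L m)) = (\<Sum>m<n. ?L (Suc m)) - (\<Sum>m<n. ?D (Suc m))"
    unfolding sum_subtractf[symmetric] by (rule sum.cong) (use Lq_tq[OF tqm_Cn[OF v]] in auto)
  also have "tq (?L n) = Lq D n (Tq v)"
    using Lq_tq_full[OF tqm_Cn[OF v], of n] tq_full[OF v] by simp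
  finally have "tq (Yq D n v) = (\<Sum>m<n. ?L (Suc m)) - (\<Sum>m<n. ?D (Suc m)) + Lq D n (Tq v)" .
  moreover have "Yq D n v = ?D 0 + (\<Sum>m<n. ?L (Suc m))"
    unfolding Yq_def by (subst sum.atMost_shift) (simp add: Lq_def)
  moreover have "Dq D 0 (Nq n v) = ?D 0 + (\<Sum>m<n. ?D (Suc m))"
    unfolding Nq_def lin_sum[OF Dq_lin] by (subst sum.atMost_shift) simp
  ultimately show ?thesis by simp
qed

end

text \<open>Inserting a further unit next to the unit in the second slot contracts such chains. This disposes of the
  degenerate terms in Cartan's formula, so that no normalization of the complex is needed.\<close>

lemma s0_contract: assumes x: "x \<in> Cn n"
  shows "bn (Suc (Suc n)) (s0 (tq (sq x))) + s0 (bn (Suc n) (tq (sq x))) = tq (sq x)"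
proof -
  let ?y = "tq (sq x)"
  have y: "?y \<in> Cn (Suc n)" by (intro tq_Cn sq_Cn x)
  have T: "tq (sq (ten xs)) = cmul ((-1) ^ length xs) (ten (\<sigma> (last xs) # 1 # butlast xs))" if "length xs = Suc n" for xs
  proof -
    have "xs \<noteq> []" using that by auto
    then show ?thesis by (simp add: sq_ten tq_ten rot_def)
  qed
  have d0: "dq 0 (s0 ?y) = ?y"
    by (rule vCn_eqI[OF x, where F = "\<lambda>x. dq 0 (s0 (tq (sq x)))" and G = "\<lambda>x. tq (sq x)"]; (intro vl)?)
       (simp add: T lc lneg s0_ten dq_ten fc_def)
  have d1: "dq 1 (s0 ?y) = ?y"
    by (rule vCn_eqI[OF x, where F = "\<lambda>x. dq 1 (s0 (tq (sq x)))" and G = "\<lambda>x. tq (sq x)"]; (intro vl)?)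
       (simp add: T lc lneg s0_ten dq_ten fc_def)
  have d01: "s0 (dq 0 ?y) = s0 (dq 1 ?y)"
    by (rule vCn_eqI[OF x, where F = "\<lambda>x. s0 (dq 0 (tq (sq x)))" and G = "\<lambda>x. s0 (dq 1 (tq (sq x)))"]; (intro vl)?)
       (auto simp: T lc lneg s0_ten dq_ten fc_def length_Suc_conv)
  have d2: "dq 2 (s0 ?y) = ?y"
    by (rule vCn_eqI[OF x, where F = "\<lambda>x. dq 2 (s0 (tq (sq x)))" and G = "\<lambda>x. tq (sq x)"]; (intro vl)?)
       (auto simp: T lc lneg s0_ten dq_ten fc_def length_Suc_conv)
  have di: "dq (Suc (Suc i)) (s0 ?y) = s0 (dq (Suc i) ?y)" if i: "Suc i \<le> Suc n" "0 < i" for i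
  proof (rule vCn_eqI[OF x, where F = "\<lambda>x. dq (Suc (Suc i)) (s0 (tq (sq x)))" and G = "\<lambda>x. s0 (dq (Suc i) (tq (sq x)))"], goal_cases)
    case l: (3 xs)
    obtain ys z where xs: "xs = ys @ [z]" using l by (cases xs rule: rev_cases) auto
    obtain y ys' where ys: "ys = y # ys'" using l i xs by (cases ys) auto
    have "fc (Suc (Suc i)) (\<sigma> z # 1 # 1 # ys) = hd (fc (Suc i) (\<sigma> z # 1 # ys)) # 1 # tl (fc (Suc i) (\<sigma> z # 1 # ys))"
      using i l by (simp add: fc_def xs ys nth_Cons')
    moreover obtain u us where "fc (Suc i) (\<sigma> z # 1 # ys) = u # us"
      using length_fc[of "\<sigma> z # 1 # ys" "Suc i"] i l xs by (cases "fc (Suc i) (\<sigma> z # 1 # ys)") auto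
    ultimately show ?case
      using i l by (simp add: T lc lneg s0_ten dq_ten xs)
  qed (intro vl)+
  have "bn (Suc (Suc n)) (s0 ?y) = dq 0 (s0 ?y) - dq 1 (s0 ?y) + dq 2 (s0 ?y) + (\<Sum>i<n. cmul ((-1) ^ Suc (Suc (Suc i))) (dq (Suc (Suc (Suc i))) (s0 ?y)))"
    unfolding bn_def Sp_def
    by (simp add: sum.lessThan_Suc_shift cmul_minus numeral_2_eq_2 del: sum.lessThan_Suc power_Suc)
  also have "\<dots> = ?y + (\<Sum>i<n. cmul ((-1) ^ Suc (Suc (Suc i))) (s0 (dq (Suc (Suc i)) ?y)))"
    unfolding d0 d1 d2 by (simp add: di)
  also have "(\<Sum>i<n. cmul ((-1) ^ Suc (Suc (Suc i))) (s0 (dq (Suc (Suc i)) ?y))) = - (\<Sum>i<n. cmul ((-1) ^ Suc (Suc i)) (s0 (dq (Suc (Suc i)) ?y)))"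
    by (simp add: sum_negf cmul_minus)
  also have "(\<Sum>i<n. cmul ((-1) ^ Suc (Suc i)) (s0 (dq (Suc (Suc i)) ?y))) = s0 (bn (Suc n) ?y)"
    unfolding bn_def Sp_def
    by (simp add: sum.lessThan_Suc_shift cmul_minus lsum la lc d01 del: sum.lessThan_Suc power_Suc)
  finally show ?thesis by simp
qed

text \<open>Cartan's formula on cycles fixed by \<open>T\<close>, for the contraction by \<open>D\<close> and Connes'
  operator. Applying \<open>b\<close> to \<open>sYv\<close> gives \<open>(1 - t)Yv - sb'Yv\<close>, and the
  relations for \<open>Y\<close> turn this into \<open>D\<^sub>0 N v - L v + s N e v\<close>. Here
  \<open>D\<^sub>0 N v = e B v\<close>, because \<open>D\<close> kills the unit, and \<open>s N e v\<close>
  is \<open>B e v\<close> up to a degenerate boundary.\<close>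

theorem cartan:
  assumes D: "is_der D" and v: "v \<in> Cn n" "0 < n" "bn n v = 0" "Tq v = v"
  shows "\<exists>w\<in>Cn (Suc n). Bq (n - 1) (eq D v) + eq D (Bq n v) = Lq D n v + bn (Suc n) w"
proof -
  let ?u = "eq D v"
  let ?N = "Nq (n - 1) ?u"
  have u: "?u \<in> Cn (n - 1)" by (rule eq_Cn[OF D v(1,2)])
  have nn: "Suc (n - 1) = n" using v by simp
  have Tu: "Tq ?u = ?u" using Tq_eq[OF D v(1,2)] v(4) by simp
  have bu: "bn (n - 1) ?u = 0"
  proof (cases "n = 1")
    case False
    then have "bn (n - 1) ?u = - eq D (bn n v)" by (intro bn_eq[OF D v(1)]) (use v in auto)
    then show ?thesis by (simp add: v lin_0[OF eq_lin[OF D]])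
  qed (simp add: bn_def)
  have Nu: "?N \<in> Cn (n - 1)" by (rule Nq_Cn[OF u])
  have sNu: "sq ?N \<in> Cn n" using sq_Cn[OF Nu] nn by simp
  have tN: "tq ?N = ?N" using Nq_tq(2)[OF u] Tu by simp
  have sbN: "sq (bp (n - 1) ?N) = 0" using bp_Nq'[OF u] bu by simp
  have b1: "bn n (sq ?N) = 0" using bn_sq[OF Nu] nn sbN tN by simp
  have b2: "bp n (sq ?N) = ?N" using bp_sq[OF Nu] nn sbN by simp
  have b3: "bn n (tq (sq ?N)) = 0" using bn_tq[OF sNu] b1 b2 tN by simp
  have h: "bn (Suc n) (s0 (tq (sq ?N))) = tq (sq ?N)"
    using s0_contract[OF Nu, unfolded nn] b3 by simp
  let ?Y = "Yq D n v"
  have Y: "?Y \<in> Cn n" by (rule Yq_Cn[OF D v(1)])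
  have "bn (Suc n) (sq ?Y) = ?Y - tq ?Y - sq (bp n ?Y)" by (rule bn_sq[OF Y])
  also have "\<dots> = Dq D 0 (Nq n v) - Lq D n v + sq ?N"
    using Yq_tq[OF D v(1)] bp_Yq[OF D v(1,2)] v lin_0[OF Yq_lin[OF D]] by (simp add: lneg)
  finally have "bn (Suc n) (sq ?Y - s0 (tq (sq ?N))) = Dq D 0 (Nq n v) - Lq D n v + sq ?N - tq (sq ?N)"
    by (simp add: lin_diff[OF bn_lin] h[unfolded One_nat_def])
  moreover have "eq D (Bq n v) = Dq D 0 (Nq n v)"
    by (simp add: Bq_def lin_diff[OF eq_lin[OF D]] Dq0_sq[OF D Nq_Cn[OF v(1)]])
  ultimately have "Bq (n - 1) ?u + eq D (Bq n v) = Lq D n v + bn (Suc n) (sq ?Y - s0 (tq (sq ?N)))"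
    by (simp add: Bq_def)
  moreover have "sq ?Y - s0 (tq (sq ?N)) \<in> Cn (Suc n)"
    by (intro Cn_diff sq_Cn Y s0_Cn tq_Cn sNu)
  ultimately show ?thesis by blast
qed

lemma cartan_0:
  assumes D: "is_der D" and v: "v \<in> Cn 0" shows "eq D (Bq 0 v) = Lq D 0 v"
  by (simp add: Bq_def lin_diff[OF eq_lin[OF D]] Dq0_sq[OF D Nq_Cn[OF v]] Lq_def) (simp add: Nq_def)

end

section \<open>Double complexes with contractible columns and exact rows\<close>

text \<open>The first index is the Koszul degree and the second the bar degree. The columns are contracted by
  \<open>sv\<close>, and the rows of positive bar degree resolve the bar complex \<open>Bar\<close> through
  \<open>\<epsilon>\<close>. The row of bar degree zero is the Koszul complex whose homology is compared
  with that of \<open>Bar\<close>.\<close>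

locale double_complex =
  fixes C :: "nat => nat => 'v::ab_group_add set"
    and dh dv :: "nat => 'v => 'v" and sv :: "'v => 'v"
    and Bar :: "nat => 'w::ab_group_add set" and b :: "nat => 'w => 'w" and \<epsilon> :: "nat => 'v => 'w"
  assumes C_add: "x \<in> C p k ==> y \<in> C p k ==> x + y \<in> C p k"
    and C_diff: "x \<in> C p k ==> y \<in> C p k ==> x - y \<in> C p k"
    and dh_diff: "dh p (x - y) = dh p x - dh p y" and dv_diff: "dv k (x - y) = dv k x - dv k y"
    and sv_0: "sv 0 = 0" and \<epsilon>_diff: "\<epsilon> n (x - y) = \<epsilon> n x - \<epsilon> n y"
    and dh_C: "x \<in> C (Suc p) k ==> dh p x \<in> C p k" and dv_C: "x \<in> C p (Suc k) ==> dv k x \<in> C p k"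
    and sv_C: "x \<in> C p k ==> sv x \<in> C p (Suc k)"
    and dh_dh: "x \<in> C (Suc (Suc p)) k ==> dh p (dh (Suc p) x) = 0"
    and dv_dv: "x \<in> C p (Suc (Suc k)) ==> dv k (dv (Suc k) x) = 0"
    and dh_dv: "x \<in> C (Suc p) (Suc k) ==> dh p (dv k x) = dv k (dh p x)"
    and sv_contract: "x \<in> C p (Suc k) ==> dv (Suc k) (sv x) + sv (dv k x) = x"
    and sv_contract_0: "x \<in> C p 0 ==> dv 0 (sv x) = x"
    and rows: "x \<in> C (Suc p) (Suc k) ==> dh p x = 0 ==> \<exists>y\<in>C (Suc (Suc p)) (Suc k). x = dh (Suc p) y"
    and \<epsilon>_C: "x \<in> C 0 (Suc n) ==> \<epsilon> n x \<in> Bar n"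
    and \<epsilon>_exact: "x \<in> C 0 (Suc n) ==> \<epsilon> n x = 0 ==> \<exists>y\<in>C (Suc 0) (Suc n). x = dh 0 y"
    and \<epsilon>_dh: "y \<in> C (Suc 0) (Suc n) ==> \<epsilon> n (dh 0 y) = 0"
    and \<epsilon>_dv: "x \<in> C 0 (Suc (Suc n)) ==> \<epsilon> n (dv (Suc n) x) = b n (\<epsilon> (Suc n) x)"
    and \<epsilon>_onto: "w \<in> Bar n ==> \<exists>x\<in>C 0 (Suc n). \<epsilon> n x = w"
begin

lemma C_0: "x \<in> C p k ==> 0 \<in> C p k" using C_diff[of x p k x] by simp

lemma dh_0: "dh p 0 = 0" using dh_diff[of p 0 0] by simp
lemma dv_0: "dv p 0 = 0" using dv_diff[of p 0 0] by simp
lemma \<epsilon>_0: "\<epsilon> p 0 = 0" using \<epsilon>_diff[of p 0 0] by simp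
lemma dh_add: "dh p (x + y) = dh p x + dh p y"
  using dh_diff[of p x "0 - y"] dh_diff[of p 0 y] by (simp add: dh_0)
lemma dv_add: "dv p (x + y) = dv p x + dv p y"
  using dv_diff[of p x "0 - y"] dv_diff[of p 0 y] by (simp add: dv_0)
lemma \<epsilon>_add: "\<epsilon> p (x + y) = \<epsilon> p x + \<epsilon> p y"
  using \<epsilon>_diff[of p x "0 - y"] \<epsilon>_diff[of p 0 y] by (simp add: \<epsilon>_0)

lemma column_exact: assumes "x \<in> C p (Suc k)" "dv k x = 0" shows "x = dv (Suc k) (sv x)"
  using sv_contract[OF assms(1)] assms(2) by (simp add: sv_0)

text \<open>The staircase from the Koszul complex to the bar complex: go up a column by the contraction, across a row
  by the horizontal differential, and so on until the augmentation is reached.\<close>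

primrec stair :: "nat => nat => 'v => 'v" where
  "stair n 0 y = sv y"
| "stair n (Suc j) y = sv (dh (n - Suc j) (stair n j y))"

definition \<psi> :: "nat => 'v => 'w" where "\<psi> n y = \<epsilon> n (stair n n y)"

definition closed :: "nat => 'v => bool" where
  "closed n y \<longleftrightarrow> y \<in> C n 0 \<and> (n > 0 --> dh (n - 1) y = 0)"

lemma stair_C: "y \<in> C n 0 ==> k \<le> n ==> stair n k y \<in> C (n - k) (Suc k)"
proof (induction k)
  case (Suc k)
  then have "stair n k y \<in> C (Suc (n - Suc k)) (Suc k)" by (simp add: Suc_diff_Suc)
  then show ?case by (simp add: sv_C dh_C)
qed (simp add: sv_C)

lemma stair_dv: "closed n y ==> Suc k \<le> n ==> dv (Suc k) (stair n (Suc k) y) = dh (n - Suc k) (stair n k y)"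
proof (induction k)
  case 0
  then have y: "y \<in> C n 0" "dh (n - 1) y = 0" "n = Suc (n - 1)" by (auto simp: closed_def)
  have s: "sv y \<in> C (Suc (n - 1)) (Suc 0)" using sv_C[OF y(1)] y(3) by simp
  have "dv 0 (dh (n - 1) (sv y)) = 0" using dh_dv[OF s] y sv_contract_0[OF y(1)] by simp
  then show ?case using column_exact[OF dh_C[OF s]] by simp
next
  case (Suc k)
  have y: "y \<in> C n 0" using Suc.prems by (simp add: closed_def)
  let ?p = "n - Suc (Suc k)"
  have s: "stair n (Suc k) y \<in> C (Suc ?p) (Suc (Suc k))"
    using stair_C[OF y, of "Suc k"] Suc.prems by (simp add: Suc_diff_Suc)
  have s': "stair n k y \<in> C (Suc (Suc ?p)) (Suc k)"
    using stair_C[OF y, of k] Suc.prems by (simp add: Suc_diff_Suc)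
  have "dv (Suc k) (dh ?p (stair n (Suc k) y)) = dh ?p (dv (Suc k) (stair n (Suc k) y))"
    by (rule dh_dv[OF s, symmetric])
  also have "\<dots> = dh ?p (dh (Suc ?p) (stair n k y))"
    using Suc by (simp add: Suc_diff_Suc)
  also have "\<dots> = 0" by (rule dh_dh[OF s'])
  finally show ?case using column_exact[OF dh_C[OF s]] by simp
qed

text \<open>The staircase is run backwards: exactness of a row lifts \<open>dv x\<close> along \<open>dh\<close>, the
  lift is resolved by induction, and exactness of the column absorbs the difference.\<close>

lemma resolve:
  assumes "x \<in> C p (Suc k)"
    and "p > 0 ==> dh (p - 1) (dv k x) = 0" and "p = 0 ==> k > 0 ==> \<epsilon> (k - 1) (dv k x) = 0"
  shows "\<exists>y u v. closed (p + k) y \<and> u \<in> C (Suc p) (Suc k) \<and> v \<in> C p (Suc (Suc k)) \<and>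
     x = stair (p + k) k y + dh p u + dv (Suc k) v"
  using assms
proof (induction k arbitrary: p x)
  case 0
  let ?y = "dv 0 x"
  have y: "closed p ?y" using 0 by (auto simp: closed_def dv_C)
  have r: "x - sv ?y \<in> C p (Suc 0)" by (intro C_diff sv_C dv_C 0)
  have "dv 0 (x - sv ?y) = 0" by (simp add: dv_diff sv_contract_0[OF dv_C[OF 0(1)]])
  then have e: "x - sv ?y = dv (Suc 0) (sv (x - sv ?y))" by (rule column_exact[OF r])
  have "0 \<in> C p (Suc 0)" by (rule C_0[OF r])
  have u: "\<exists>u\<in>C (Suc p) (Suc 0). dh p u = 0"
  proof (cases p)
    case 0
    from \<epsilon>_exact[of 0 0] \<open>0 \<in> C p (Suc 0)\<close> 0 \<epsilon>_0 show ?thesis by metis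
  next
    case (Suc p')
    from rows[of 0 p' 0] \<open>0 \<in> C p (Suc 0)\<close> Suc dh_0 show ?thesis by metis
  qed
  then obtain u where u: "u \<in> C (Suc p) (Suc 0)" "dh p u = 0" by blast
  show ?case
    by (rule exI[of _ ?y], rule exI[of _ u], rule exI[of _ "sv (x - sv ?y)"])
       (use y u e sv_C[OF r] in \<open>simp add: algebra_simps\<close>)
next
  case (Suc k)
  let ?w = "dv (Suc k) x"
  have w: "?w \<in> C p (Suc k)" by (rule dv_C[OF Suc.prems(1)])
  have "\<exists>x'\<in>C (Suc p) (Suc k). ?w = dh p x'"
  proof (cases p)
    case 0 then show ?thesis using \<epsilon>_exact[of ?w k] Suc.prems(3) w by auto
  next
    case (Suc p') then show ?thesis using rows[of ?w p' k] Suc.prems(2) w by auto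
  qed
  then obtain x' where x': "x' \<in> C (Suc p) (Suc k)" "?w = dh p x'" by blast
  have "dh p (dv k x') = 0"
    using dh_dv[OF x'(1)] x'(2) dv_dv[OF Suc.prems(1)] by simp
  then obtain y u v where y: "closed (Suc p + k) y" and u: "u \<in> C (Suc (Suc p)) (Suc k)"
    and v: "v \<in> C (Suc p) (Suc (Suc k))" and e: "x' = stair (Suc p + k) k y + dh (Suc p) u + dv (Suc k) v"
    using Suc.IH[OF x'(1)] by auto
  let ?e = "stair (p + Suc k) (Suc k) y"
  have y': "closed (p + Suc k) y" using y by simp
  have eC: "?e \<in> C p (Suc (Suc k))"
    using stair_C[of y "p + Suc k" "Suc k"] y' by (simp add: closed_def)
  have "dv (Suc k) ?e = dh p (stair (p + Suc k) k y)"
    using stair_dv[OF y', of k] by simp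
  then have "?w = dv (Suc k) ?e + dv (Suc k) (dh p v)"
    using x'(2) e dh_dh[OF u] dh_dv[OF v] by (simp add: dh_add)
  moreover have r: "x - ?e - dh p v \<in> C p (Suc (Suc k))"
    by (intro C_diff Suc.prems eC dh_C v)
  ultimately have "x - ?e - dh p v = dv (Suc (Suc k)) (sv (x - ?e - dh p v))"
    by (intro column_exact) (simp_all add: dv_diff)
  then have "x = ?e + dh p v + dv (Suc (Suc k)) (sv (x - ?e - dh p v))" by (simp add: algebra_simps)
  then show ?case using y' v sv_C[OF r] by blast
qed

text \<open>The three theorems on \<open>\<psi>\<close> say that it induces an isomorphism from Koszul to bar
  homology.\<close>

theorem \<psi>_onto:
  assumes z: "z \<in> Bar n" and bz: "n > 0 ==> b (n - 1) z = 0"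
  shows "\<exists>y u. closed n y \<and> u \<in> Bar (Suc n) \<and> z = \<psi> n y + b n u"
proof -
  obtain x where x: "x \<in> C 0 (Suc n)" "\<epsilon> n x = z" using \<epsilon>_onto[OF z] by blast
  have "\<epsilon> (n - 1) (dv n x) = 0" if "n > 0"
    using \<epsilon>_dv[of x "n - 1"] x bz that by simp
  then obtain y u v where "closed n y" and u: "u \<in> C (Suc 0) (Suc n)" and v: "v \<in> C 0 (Suc (Suc n))"
    and e: "x = stair n n y + dh 0 u + dv (Suc n) v"
    using resolve[OF x(1)] by auto
  moreover have "z = \<psi> n y + b n (\<epsilon> (Suc n) v)"
    using x(2) e by (simp add: \<epsilon>_add \<psi>_def \<epsilon>_dh[OF u] \<epsilon>_dv[OF v])
  ultimately show ?thesis using \<epsilon>_C[OF v] by blast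
qed

theorem \<psi>_boundary:
  assumes y': "y' \<in> C (Suc n) 0"
  shows "\<exists>u\<in>Bar (Suc n). \<psi> n (dh n y') = b n u"
proof -
  let ?y = "dh n y'"
  have yC: "?y \<in> C n 0" by (rule dh_C[OF y'])
  have y: "closed n ?y" using yC dh_dh[of y' "n - 1" 0] y' by (cases n) (auto simp: closed_def)
  have "k \<le> n ==> \<exists>u v. u \<in> C (Suc (n - k)) (Suc k) \<and> v \<in> C (n - k) (Suc (Suc k)) \<and>
     stair n k ?y = dh (n - k) u + dv (Suc k) v" for k
  proof (induction k)
    case 0
    have r: "sv ?y - dh n (sv y') \<in> C n (Suc 0)" by (intro C_diff sv_C dh_C yC y')
    have "dv 0 (sv ?y - dh n (sv y')) = 0"
      using dh_dv[OF sv_C[OF y']] sv_contract_0[OF y'] sv_contract_0[OF yC] by (simp add: dv_diff)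
    then have "sv ?y - dh n (sv y') = dv (Suc 0) (sv (sv ?y - dh n (sv y')))"
      by (rule column_exact[OF r])
    then have "stair n 0 ?y = dh n (sv y') + dv (Suc 0) (sv (sv ?y - dh n (sv y')))"
      by (simp add: algebra_simps)
    then show ?case using sv_C[OF y'] sv_C[OF r] by (intro exI conjI) auto
  next
    case (Suc k)
    let ?p = "n - Suc k"
    have p: "n - k = Suc ?p" using Suc.prems by simp
    from Suc obtain u v where u: "u \<in> C (Suc (Suc ?p)) (Suc k)" and v: "v \<in> C (Suc ?p) (Suc (Suc k))"
      and e: "stair n k ?y = dh (Suc ?p) u + dv (Suc k) v" by (auto simp: p)
    let ?s = "stair n (Suc k) ?y"
    have s: "?s \<in> C ?p (Suc (Suc k))" by (rule stair_C[OF yC Suc.prems])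
    have "dv (Suc k) ?s = dv (Suc k) (dh ?p v)"
      using stair_dv[OF y Suc.prems] e dh_dh[OF u] dh_dv[OF v] by (simp add: dh_add)
    moreover have r: "?s - dh ?p v \<in> C ?p (Suc (Suc k))" by (intro C_diff s dh_C v)
    ultimately have "?s - dh ?p v = dv (Suc (Suc k)) (sv (?s - dh ?p v))"
      by (intro column_exact) (simp_all add: dv_diff)
    then have "?s = dh ?p v + dv (Suc (Suc k)) (sv (?s - dh ?p v))" by (simp add: algebra_simps)
    then show ?case using v sv_C[OF r] by (intro exI conjI) auto
  qed
  from this[of n] obtain u v where u: "u \<in> C (Suc 0) (Suc n)" and v: "v \<in> C 0 (Suc (Suc n))"
    and e: "stair n n ?y = dh 0 u + dv (Suc n) v" by auto
  have "\<psi> n ?y = b n (\<epsilon> (Suc n) v)"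
    by (simp add: \<psi>_def e \<epsilon>_add \<epsilon>_dh[OF u] \<epsilon>_dv[OF v])
  then show ?thesis using \<epsilon>_C[OF v] by blast
qed

theorem \<psi>_inj:
  assumes y: "closed n y" and w: "w \<in> Bar (Suc n)" "\<psi> n y = b n w"
  shows "\<exists>y'\<in>C (Suc n) 0. y = dh n y'"
proof -
  have yC: "y \<in> C n 0" using y by (simp add: closed_def)
  have "i \<le> n ==> \<exists>u v. u \<in> C (Suc i) (Suc (n - i)) \<and> v \<in> C i (Suc (Suc (n - i))) \<and>
     stair n (n - i) y = dh i u + dv (Suc (n - i)) v" for i
  proof (induction i)
    case 0
    obtain x where x: "x \<in> C 0 (Suc (Suc n))" "\<epsilon> (Suc n) x = w" using \<epsilon>_onto[OF w(1)] by blast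
    let ?s = "stair n n y"
    have s: "?s \<in> C 0 (Suc n)" using stair_C[OF yC, of n] by simp
    have r: "?s - dv (Suc n) x \<in> C 0 (Suc n)" by (intro C_diff s dv_C x)
    have "\<epsilon> n (?s - dv (Suc n) x) = 0"
      using w(2) x by (simp add: \<epsilon>_diff \<epsilon>_dv[OF x(1)] \<psi>_def)
    then obtain u where "u \<in> C (Suc 0) (Suc n)" "?s - dv (Suc n) x = dh 0 u" using \<epsilon>_exact[OF r] by blast
    then show ?case using x(1) by (intro exI[of _ u] exI[of _ x]) (simp add: algebra_simps)
  next
    case (Suc i)
    let ?j = "n - Suc i"
    have j: "n - i = Suc ?j" "n - Suc ?j = i" using Suc.prems by auto
    from Suc obtain u v where u: "u \<in> C (Suc i) (Suc (Suc ?j))" and v: "v \<in> C i (Suc (Suc (Suc ?j)))"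
      and e: "stair n (Suc ?j) y = dh i u + dv (Suc (Suc ?j)) v" by (auto simp: j)
    have "dh i (stair n ?j y) = dv (Suc ?j) (stair n (Suc ?j) y)"
      using stair_dv[OF y, of ?j] Suc.prems j by simp
    also have "\<dots> = dh i (dv (Suc ?j) u)"
      unfolding e using dv_dv[OF v] dh_dv[OF u] by (simp add: dv_add)
    finally have "dh i (stair n ?j y - dv (Suc ?j) u) = 0" by (simp add: dh_diff)
    moreover have "stair n ?j y - dv (Suc ?j) u \<in> C (Suc i) (Suc ?j)"
      using stair_C[OF yC, of ?j] Suc.prems dv_C[OF u] by (auto intro!: C_diff)
    ultimately obtain u' where "u' \<in> C (Suc (Suc i)) (Suc ?j)" "stair n ?j y - dv (Suc ?j) u = dh (Suc i) u'"
      using rows by blast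
    then show ?case using u by (intro exI[of _ u'] exI[of _ u]) (simp add: algebra_simps)
  qed
  from this[of n] obtain u v where u: "u \<in> C (Suc n) (Suc 0)" and v: "v \<in> C n (Suc (Suc 0))"
    and e: "sv y = dh n u + dv (Suc 0) v" by auto
  have "y = dh n (dv 0 u)"
    using sv_contract_0[OF yC] e dv_dv[OF v] dh_dv[OF u] by (simp add: dv_add)
  then show ?thesis using dv_C[OF u] by blast
qed

end

section \<open>The adjoint action and the Koszul complex\<close>

context qsl2
begin

lemma gen_nf: "a * b = scale q (b * a)" "a * c = scale q (c * a)" "c * b = b * c"
  "d * b = scale (inverse q) (b * d)" "d * c = scale (inverse q) (c * d)"
  "a * d = 1 + scale q (b * c)" "d * a = 1 + scale (inverse q) (b * c)"
  by (simp_all add: rel_ab rel_ac rel_bc rel_ad rel_da db dc)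

lemma subspc_diff: assumes "subspc cmul V" "x \<in> V" "y \<in> V" shows "x - y \<in> V"
proof -
  have e: "x - y = x + cmul (-1) y" by (simp add: cmul_minus)
  show ?thesis unfolding e using assms unfolding subspc_def by blast
qed

text \<open>The right adjoint action twisted by the inverse antipode, \<open>v \<mapsto> S\<^sup>-\<^sup>1(g\<^sub>1)
  v g\<^sub>2\<close>, on anything with a left and a right multiplication \<open>P l r v = l v r\<close>.
  Its coinvariants are those of the bimodule, because \<open>S\<^sup>-\<^sup>1(g\<^sub>2) g\<^sub>1 =
  \<epsilon>(g)\<close>.\<close>

definition adop :: "('a => 'a => tens => tens) => gen => tens => tens" where
  "adop P g v = (case g of
     GA => P d a v - cmul q (P b c v)
   | GB => P d b v - cmul q (P b d v)
   | GC => P a c v - cmul (inverse q) (P c a v)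
   | GD => P a d v - cmul (inverse q) (P c b v))"

lemma adop_rep:
  assumes V: "subspc cmul V" and cl: "\<And>l r v. v \<in> V ==> P l r v \<in> V" and l: "\<And>l r. vlin (P l r)"
    and l1: "\<And>r v. v \<in> V ==> lin scale cmul (\<lambda>l. P l r v)" and l2: "\<And>l v. v \<in> V ==> lin scale cmul (\<lambda>r. P l r v)"
    and c: "\<And>l r l' r' v. v \<in> V ==> P l r (P l' r' v) = P (l * l') (r' * r) v" and u: "\<And>v. v \<in> V ==> P 1 1 v = v"
  shows "SL2_rep q V (adop P)"
proof -
  have cl': "adop P g v \<in> V" if "v \<in> V" for g v
    using subspc_diff[OF V] V cl[OF that] unfolding adop_def subspc_def
    by (cases g) simp_all
  have lin: "vlin (adop P g)" for g
    unfolding adop_def[abs_def] by (cases g) (simp_all add: l vlin_minus vlin_cmul)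
  note e = adop_def lin_ads[OF l] c u gen_nf
    lin_as[OF l1] lin_as[OF l2]
    cmul_add cmul_diff cmul_cmul
  have "SL2_rels q (adop P) v" if v: "v \<in> V" for v
    unfolding SL2_rels_def
    by (intro conjI; rule poly_mapping_eqI; simp add: e v coords q0;
        simp add: field_simps q0)
  then show ?thesis
    unfolding SL2_rep_def using V cl' lin by auto
qed

text \<open>Right multiplication on both factors of a two-fold tensor, and left multiplication on the first with right
  multiplication on the second. They implement the comultiplication and \<open>S\<^sup>-\<^sup>1(y\<^sub>1)
  \<otimes> y\<^sub>2\<close>.\<close>

definition mm :: "'a => 'a => tens => tens" where
  "mm x z = mop (\<lambda>xs. ten [xs ! 0 * x, xs ! 1 * z])"
definition ll :: "'a => 'a => tens => tens" where
  "ll x z = mop (\<lambda>xs. ten [x * xs ! 0, xs ! 1 * z])"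

lemma mop2: "(\<And>y. lin scale cmul (\<lambda>x. g [x, y])) ==> (\<And>x. lin scale cmul (\<lambda>y. g [x, y])) ==> mop g (ten [x, y]) = g [x, y]"
  by (rule mop_ten) (auto simp: length_Suc_conv)

lemma ten2_lin1: "lin scale scale M ==> lin scale cmul (\<lambda>x. ten [M x, y])"
  and ten2_lin2: "lin scale scale M ==> lin scale cmul (\<lambda>x. ten [y, M x])"
  using ten_lin_comp[of M "[]" "[y]"] ten_lin_comp[of M "[y]" "[]"] by simp_all

lemma mm_ten: "mm x z (ten [u, v]) = ten [u * x, v * z]"
  unfolding mm_def by (subst mop2) (auto intro: ten2_lin1 ten2_lin2 mult_lin_l)
lemma ll_ten: "ll x z (ten [u, v]) = ten [x * u, v * z]"
  unfolding ll_def by (subst mop2) (auto intro: ten2_lin1 ten2_lin2 mult_lin_l mult_lin_r)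

lemma mm_lin: "vlin (mm x z)" and ll_lin: "vlin (ll x z)" by (simp_all add: mm_def ll_def mop_lin)
lemma mm_Cn: "v \<in> Cn (Suc 0) ==> mm x z v \<in> Cn (Suc 0)" and ll_Cn: "v \<in> Cn (Suc 0) ==> ll x z v \<in> Cn (Suc 0)"
  unfolding mm_def ll_def by (erule mop_Cn, simp add: ten_Cn)+

lemma mop_lin_par: "(\<And>l. lin scale cmul (\<lambda>x. g x (map bas l))) ==> lin scale cmul (\<lambda>x. mop (g x) v)"
  unfolding mop_def by (rule lin_lext_arg[OF vs_cmul])

lemma mm_lin1: "lin scale cmul (\<lambda>x. mm x z v)" and mm_lin2: "lin scale cmul (\<lambda>z. mm x z v)"
  and ll_lin1: "lin scale cmul (\<lambda>x. ll x z v)" and ll_lin2: "lin scale cmul (\<lambda>z. ll x z v)"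
  unfolding mm_def ll_def
  by (rule mop_lin_par, rule ten2_lin1 ten2_lin2, rule mult_lin_r mult_lin_l)+

lemma Cn1_eqI:
  assumes "w \<in> Cn (Suc 0)" "vlin F" "vlin G" "\<And>u v. F (ten [u, v]) = G (ten [u, v])"
  shows "F w = G w"
  by (rule vCn_eqI[OF assms(1-3)]) (auto simp: length_Suc_conv assms(4))

lemma mm_mm: assumes "v \<in> Cn (Suc 0)" shows "mm x z (mm x' z' v) = mm (x' * x) (z' * z) v"
  by (rule Cn1_eqI[OF assms lin_comp[OF mm_lin mm_lin] mm_lin]) (simp add: mm_ten mult.assoc)
lemma ll_ll: assumes "v \<in> Cn (Suc 0)" shows "ll x z (ll x' z' v) = ll (x * x') (z' * z) v"
  by (rule Cn1_eqI[OF assms lin_comp[OF ll_lin ll_lin] ll_lin]) (simp add: ll_ten mult.assoc)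
lemma mm_1: assumes "v \<in> Cn (Suc 0)" shows "mm 1 1 v = v"
  by (rule Cn1_eqI[OF assms mm_lin lin_id]) (simp add: mm_ten)
lemma ll_1: assumes "v \<in> Cn (Suc 0)" shows "ll 1 1 v = v"
  by (rule Cn1_eqI[OF assms ll_lin lin_id]) (simp add: ll_ten)

text \<open>Right multiplication by the coproducts of the generators. The relations hold, so the coproduct
  \<open>\<Delta>\<close> exists as the orbit of \<open>1 \<otimes> 1\<close>. In the same way
  \<open>\<Delta>'\<close>, which is \<open>S\<^sup>-\<^sup>1(y\<^sub>1) \<otimes> y\<^sub>2\<close>, arises
  from the adjoint action, without an antipode having to be constructed first.\<close>

definition dop :: "gen => tens => tens" where
  "dop g v = (case g of
     GA => mm a a v + mm b c v
   | GB => mm a b v + mm b d v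
   | GC => mm c a v + mm d c v
   | GD => mm c b v + mm d d v)"

lemma dop_rep: "SL2_rep q (Cn (Suc 0)) dop"
proof -
  have cl: "dop g v \<in> Cn (Suc 0)" if "v \<in> Cn (Suc 0)" for g v
    unfolding dop_def by (cases g) (use that mm_Cn Cn_add in auto)
  have lin: "vlin (dop g)" for g
    unfolding dop_def[abs_def] by (cases g) (simp_all add: mm_lin vlin_plus)
  note e = dop_def lin_as[OF mm_lin] mm_mm mm_1 gen_nf
    lin_as[OF mm_lin1] lin_as[OF mm_lin2]
    cmul_add cmul_diff cmul_cmul
  have "SL2_rels q (dop) v" if v: "v \<in> Cn (Suc 0)" for v
    unfolding SL2_rels_def
    by (intro conjI; rule poly_mapping_eqI; simp add: e v coords q0;
        simp add: field_simps q0)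
  then show ?thesis
    unfolding SL2_rep_def using Cn_subspc cl lin by auto
qed

lemma sop_rep: "SL2_rep q (Cn (Suc 0)) (adop ll)"
  by (rule adop_rep) (simp_all add: Cn_subspc ll_Cn ll_lin ll_lin1 ll_lin2 ll_ll ll_1)

lemma ten11: "ten [1, 1] \<in> Cn (Suc 0)" by (simp add: ten_Cn)

definition \<Delta> :: "'a => tens" where "\<Delta> y = ract dop y (ten [1, 1])"
definition \<Delta>' :: "'a => tens" where "\<Delta>' y = ract (adop ll) y (ten [1, 1])"

lemma \<Delta>_lin: "lin scale cmul \<Delta>" and \<Delta>'_lin: "lin scale cmul \<Delta>'"
  using ract_lin[OF dop_rep ten11] ract_lin[OF sop_rep ten11] by (simp_all add: \<Delta>_def[abs_def] \<Delta>'_def[abs_def])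
lemma \<Delta>_one: "\<Delta> 1 = ten [1, 1]" and \<Delta>'_one: "\<Delta>' 1 = ten [1, 1]"
  by (simp_all add: \<Delta>_def \<Delta>'_def ract_one[OF dop_rep ten11] ract_one[OF sop_rep ten11])
lemma \<Delta>_gen: "\<Delta> (y * gv g) = dop g (\<Delta> y)" and \<Delta>'_gen: "\<Delta>' (y * gv g) = adop ll g (\<Delta>' y)"
  by (simp_all add: \<Delta>_def \<Delta>'_def ract_mult[OF dop_rep ten11] ract_mult[OF sop_rep ten11])
lemma \<Delta>_Cn: "\<Delta> y \<in> Cn (Suc 0)" and \<Delta>'_Cn: "\<Delta>' y \<in> Cn (Suc 0)"
  by (simp_all add: \<Delta>_def \<Delta>'_def ract_closed[OF dop_rep ten11] ract_closed[OF sop_rep ten11])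

definition onl :: "('a => 'a) => tens => tens" where
  "onl f = mop (\<lambda>xs. ten (xs[length xs - 1 := f (xs ! (length xs - 1))]))"

lemma onl_lin: "vlin (onl f)" by (simp add: onl_def mop_lin)

lemma onl_ten: assumes "lin scale scale f" shows "onl f (ten (us @ [y])) = ten (us @ [f y])"
proof -
  have "onl f (ten (us @ [y])) = ten ((us @ [y])[length (us @ [y]) - 1 := f ((us @ [y]) ! (length (us @ [y]) - 1))])"
    unfolding onl_def by (rule mop_ten, rule ml_cong[OF ml_ap[OF assms, of _ "length (us @ [y]) - 1"]]) simp
  then show ?thesis by simp
qed

lemma snoc_eqI:
  assumes "v \<in> Cn n" "vlin F" "vlin G" "\<And>us y. length us = n ==> F (ten (us @ [y])) = G (ten (us @ [y]))"
  shows "F v = G v"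
  by (rule vCn_eqI[OF assms(1-3)]) (auto simp: length_Suc_conv_rev assms(4))

lemma mid_eqI:
  assumes "v \<in> Cn (Suc n)" "vlin F" "vlin G" "\<And>m us y. length us = n ==> F (ten (m # us @ [y])) = G (ten (m # us @ [y]))"
  shows "F v = G v"
  by (rule snoc_eqI[OF assms(1-3)]) (auto simp: length_Suc_conv assms(4))

lemma onl_Cn: assumes "v \<in> Cn n" shows "onl f v \<in> Cn n"
  unfolding onl_def by (rule mop_Cn[OF assms]) (simp add: ten_Cn)

lemma onl_onl: assumes "v \<in> Cn n" "lin scale scale f" "lin scale scale g"
  shows "onl f (onl g v) = onl (\<lambda>y. f (g y)) v"
  by (rule snoc_eqI[OF assms(1) lin_comp[OF onl_lin onl_lin] onl_lin])
     (simp add: onl_ten assms lin_comp[OF assms(3,2)])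

lemma onl_id: assumes "v \<in> Cn n" shows "onl (\<lambda>y. y) v = v"
  by (rule snoc_eqI[OF assms onl_lin lin_id]) (simp add: onl_ten lin_id)

lemma onl_add: assumes "v \<in> Cn n" "lin scale scale f" "lin scale scale g"
  shows "onl (\<lambda>y. f y + g y) v = onl f v + onl g v"
  by (rule snoc_eqI[OF assms(1) onl_lin vlin_plus[OF onl_lin onl_lin]])
     (simp add: onl_ten assms lin_plus[OF vs_scale] lin_add[OF ten_lin])

lemma onl_diff: assumes "v \<in> Cn n" "lin scale scale f" "lin scale scale g"
  shows "onl (\<lambda>y. f y - g y) v = onl f v - onl g v"
  by (rule snoc_eqI[OF assms(1) onl_lin vlin_minus[OF onl_lin onl_lin]])
     (simp add: onl_ten assms lin_minus[OF vs_scale] lin_diff[OF ten_lin])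

lemma onl_0: assumes "v \<in> Cn n" shows "onl (\<lambda>y. 0) v = 0"
  by (rule snoc_eqI[OF assms onl_lin vlin_zero]) (simp add: onl_ten lin_zero[OF vs_scale] lin_0[OF ten_lin])

abbreviation rr :: "'a => tens => tens" where "rr g \<equiv> onl (\<lambda>y. y * g)"

text \<open>Quotients for right division by \<open>b\<close>, then by \<open>c\<close> modulo \<open>b\<close>, then
  by \<open>a - 1\<close> modulo \<open>b\<close> and \<open>c\<close>, where the algebra has become that of
  Laurent polynomials in \<open>a\<close>. They show that \<open>b, c, a - 1\<close> is a regular sequence.\<close>

definition divb :: "'a => 'a" where
  "divb = blin scale (\<lambda>(i, j, k). if j = 0 then 0 else scale (q powi (- i)) (bas (i, j - 1, k)))"
definition divc :: "'a => 'a" where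
  "divc = blin scale (\<lambda>(i, j, k). if k = 0 then 0 else scale (q powi (- i)) (bas (i, j, k - 1)))"
definition resb :: "'a => 'a" where "resb y = y - divb y * b"
definition resbc :: "'a => 'a" where "resbc y = resb y - divc (resb y) * c"
definition diva :: "'a => 'a" where
  "diva = blin scale (\<lambda>(i, j, k). (\<Sum>l\<in>{0..<i}. bas (l, j, k)) - (\<Sum>l\<in>{i..<0}. bas (l, j, k)))"

lemma divb_lin: "lin scale scale divb" and divc_lin: "lin scale scale divc" and diva_lin: "lin scale scale diva"
  by (simp_all add: divb_def divc_def diva_def blin_lin[OF vs_scale])
lemma resb_lin: "lin scale scale resb"
  unfolding resb_def[abs_def] by (intro lin_minus[OF vs_scale] lin_id lin_comp[OF divb_lin mult_lin_l])
lemma resbc_lin: "lin scale scale resbc"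
  unfolding resbc_def[abs_def]
  by (intro lin_minus[OF vs_scale] resb_lin lin_comp[OF resb_lin lin_comp[OF divc_lin mult_lin_l]])

lemma bas_gens:
  "bas (i, j, k) * a = bas (i + 1, j, k) + scale (if i < 0 then q powi (2 * i + 1) else 0) (bas (i + 1, Suc j, Suc k))"
  "bas (i, j, k) * b = scale (q powi i) (bas (i, Suc j, k))"
  "bas (i, j, k) * c = scale (q powi i) (bas (i, j, Suc k))"
  "bas (i, j, k) * d = bas (i - 1, j, k) + scale (if i > 0 then q powi (2 * i - 1) else 0) (bas (i - 1, Suc j, Suc k))"
  using bas_mult_gen[of "(i, j, k)" GA] bas_mult_gen[of "(i, j, k)" GB] bas_mult_gen[of "(i, j, k)" GC] bas_mult_gen[of "(i, j, k)" GD]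
  by (simp_all add: pbw_op_single lin_add[OF lin_lext[OF vs_scale]] lext_single[OF vs_scale])

lemma qpp [simp]: "q powi (- i) * q powi i = 1" "q powi i * q powi (- i) = 1"
  using q0 by (simp_all flip: power_int_add)

lemma divb_bas: "divb (bas (i, j, k)) = (if j = 0 then 0 else scale (q powi (- i)) (bas (i, j - 1, k)))"
  and divc_bas: "divc (bas (i, j, k)) = (if k = 0 then 0 else scale (q powi (- i)) (bas (i, j, k - 1)))"
  and diva_bas: "diva (bas (i, j, k)) = (\<Sum>l\<in>{0..<i}. bas (l, j, k)) - (\<Sum>l\<in>{i..<0}. bas (l, j, k))"
  by (simp_all add: divb_def divc_def diva_def blin_bas[OF vs_scale])

lemma resb_bas: "resb (bas (i, j, k)) = (if j = 0 then bas (i, j, k) else 0)"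
  by (auto simp: resb_def divb_bas scale_mult_left bas_gens)

lemma resbc_bas: "resbc (bas (i, j, k)) = (if j = 0 \<and> k = 0 then bas (i, j, k) else 0)"
  by (auto simp: resbc_def resb_bas divc_bas scale_mult_left bas_gens lin_0[OF divc_lin])

lemma basis_ext:
  assumes "lin scale scale F" "lin scale scale G" "\<And>i j k. F (bas (i, j, k)) = G (bas (i, j, k))"
  shows "F = G"
proof
  fix y show "F y = G y"
    by (rule lin_basis_eqI[OF assms(1,2)]) (metis assms(3) prod_cases3)
qed

lemma divb_b: "(\<lambda>y. divb (y * b)) = (\<lambda>y. y)"
  by (rule basis_ext[OF lin_comp[OF mult_lin_l divb_lin] lin_id]) (simp add: bas_gens divb_bas lin_scale[OF divb_lin])

lemma resb_b: "(\<lambda>y. resb (y * b)) = (\<lambda>y. 0)"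
  using fun_cong[OF divb_b] by (simp add: resb_def)

lemma resb_c: "(\<lambda>y. divc (resb (y * c))) = resb"
  by (rule basis_ext[OF lin_comp[OF mult_lin_l lin_comp[OF resb_lin divc_lin]] resb_lin])
     (simp add: bas_gens resb_bas divc_bas lin_scale[OF divc_lin] lin_scale[OF resb_lin] lin_0[OF divc_lin])

lemma resbc_b: "(\<lambda>y. resbc (y * b)) = (\<lambda>y. 0)"
  using fun_cong[OF resb_b] by (simp add: resbc_def lin_0[OF divc_lin])

lemma resbc_c: "(\<lambda>y. resbc (y * c)) = (\<lambda>y. 0)"
  by (rule basis_ext[OF lin_comp[OF mult_lin_l resbc_lin] lin_zero[OF vs_scale]])
     (simp add: bas_gens resbc_bas lin_scale[OF resbc_lin])

lemma resbc_a: "(\<lambda>y. diva (resbc (y * a - y))) = resbc"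
proof (rule basis_ext[OF lin_comp[OF lin_minus[OF vs_scale mult_lin_l lin_id] lin_comp[OF resbc_lin diva_lin]] resbc_lin])
  fix i j k
  have "(\<Sum>l\<in>{0..<i+1}. bas (l, 0, 0)) - (\<Sum>l\<in>{i+1..<0}. bas (l, 0, 0))
      - ((\<Sum>l\<in>{0..<i}. bas (l, 0, 0)) - (\<Sum>l\<in>{i..<0}. bas (l, 0, 0))) = bas (i, 0, 0)"
  proof (cases "i \<ge> 0")
    case True
    then have "{0..<i+1} = insert i {0..<i}" by auto
    then show ?thesis using True by simp
  next
    case False
    then have "{i..<0} = insert i {i+1..<0}" by auto
    then show ?thesis using False by simp
  qed
  then show "diva (resbc (bas (i, j, k) * a - bas (i, j, k))) = resbc (bas (i, j, k))"
    by (simp add: bas_gens resbc_bas lin_ads[OF resbc_lin]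
        lin_diff[OF diva_lin] lin_0[OF diva_lin] diva_bas)
qed

lemma rr_b_inj: assumes v: "v \<in> Cn n" "rr b v = 0" shows "v = 0"
proof -
  have "v = onl divb (rr b v)"
    by (simp add: onl_onl[OF v(1) divb_lin mult_lin_l] divb_b onl_id[OF v(1)])
  then show ?thesis by (simp add: v lin_0[OF onl_lin])
qed

lemma rr_c_regular: assumes v: "v \<in> Cn n" and u: "u \<in> Cn n" and e: "rr c v = rr b u"
  shows "\<exists>w\<in>Cn n. v = rr b w"
proof
  have "onl resb (rr b u) = 0"
    by (simp add: onl_onl[OF u resb_lin mult_lin_l] resb_b onl_0[OF u])
  then have "onl divc (onl resb (rr c v)) = 0" by (simp add: e lin_0[OF onl_lin])
  then have "onl resb v = 0"
    by (simp add: onl_onl[OF v resb_lin mult_lin_l] onl_onl[OF v divc_lin lin_comp[OF mult_lin_l resb_lin]] resb_c)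
  moreover have "v = onl (\<lambda>y. divb y * b + resb y) v" by (simp add: resb_def onl_id[OF v])
  ultimately show "v = rr b (onl divb v)"
    by (simp add: onl_add[OF v lin_comp[OF divb_lin mult_lin_l] resb_lin] onl_onl[OF v mult_lin_l divb_lin])
qed (rule onl_Cn[OF v])

lemma rr_a_regular: assumes v: "v \<in> Cn n" and u: "u \<in> Cn n" "u' \<in> Cn n" and e: "rr a v - v = rr b u + rr c u'"
  shows "\<exists>w\<in>Cn n. \<exists>w'\<in>Cn n. v = rr b w + rr c w'"
proof (intro bexI)
  have "onl resbc (rr b u) = 0" "onl resbc (rr c u') = 0"
    by (simp_all add: onl_onl[OF u(1) resbc_lin mult_lin_l] resbc_b onl_0[OF u(1)]
      onl_onl[OF u(2) resbc_lin mult_lin_l] resbc_c onl_0[OF u(2)])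
  then have "onl diva (onl resbc (rr a v - v)) = 0" by (simp add: e lin_add[OF onl_lin] lin_0[OF onl_lin])
  moreover have "rr a v - v = onl (\<lambda>y. y * a - y) v"
    by (simp add: onl_diff[OF v mult_lin_l lin_id] onl_id[OF v])
  ultimately have "onl resbc v = 0"
    by (simp add: onl_onl[OF v resbc_lin lin_minus[OF vs_scale mult_lin_l lin_id]]
       onl_onl[OF v diva_lin lin_comp[OF lin_minus[OF vs_scale mult_lin_l lin_id] resbc_lin]] resbc_a)
  moreover have "v = onl (\<lambda>y. (divb y * b + divc (resb y) * c) + resbc y) v"
    by (simp add: resbc_def resb_def onl_id[OF v])
  ultimately show "v = rr b (onl divb v) + rr c (onl (\<lambda>y. divc (resb y)) v)"
    by (simp add: onl_add[OF v lin_plus[OF vs_scale lin_comp[OF divb_lin mult_lin_l] lin_comp[OF lin_comp[OF resb_lin divc_lin] mult_lin_l]] resbc_lin]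
       onl_add[OF v lin_comp[OF divb_lin mult_lin_l] lin_comp[OF lin_comp[OF resb_lin divc_lin] mult_lin_l]]
       onl_onl[OF v mult_lin_l divb_lin] onl_onl[OF v mult_lin_l lin_comp[OF resb_lin divc_lin]])
qed (intro onl_Cn v)+

end

context twisted
begin

definition Lo :: "'a => tens => tens" where
  "Lo l = mop (\<lambda>xs. ten (xs[0 := \<sigma> l * xs ! 0]))"

lemma Lo_lin: "vlin (Lo l)" by (simp add: Lo_def mop_lin)

lemma Lo_ten: "Lo l (ten (m # us)) = ten ((\<sigma> l * m) # us)"
proof -
  have "Lo l (ten (m # us)) = ten ((m # us)[0 := \<sigma> l * (m # us) ! 0])"
    unfolding Lo_def by (rule mop_ten, rule ml_ap[OF mult_lin_r])
  then show ?thesis by simp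
qed

lemma rr_ten: "rr r (ten (us @ [y])) = ten (us @ [y * r])"
  by (rule onl_ten[OF mult_lin_l])

lemma Lo_Cn: "v \<in> Cn n ==> Lo l v \<in> Cn n"
  unfolding Lo_def by (erule mop_Cn) (simp add: ten_Cn)

text \<open>Multiplication into the first and the last factor of a chain, the left one through
  \<open>\<sigma>\<close>; for a single factor both meet in it. The adjoint action \<open>\<rho>\<close>
  built from it commutes with the bar differential.\<close>

definition lr :: "'a => 'a => tens => tens" where "lr l r v = rr r (Lo l v)"

lemma lr_lin: "vlin (lr l r)" unfolding lr_def[abs_def] by (rule lin_comp[OF Lo_lin onl_lin])
lemma lr_Cn: "v \<in> Cn n ==> lr l r v \<in> Cn n" by (simp add: lr_def onl_Cn Lo_Cn)

lemma lr_single: "lr l r (ten [m]) = ten [\<sigma> l * m * r]"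
  using rr_ten[of r "[]"] by (simp add: lr_def Lo_ten)
lemma lr_mid: "lr l r (ten (m # us @ [y])) = ten ((\<sigma> l * m) # us @ [y * r])"
  using rr_ten[of r "(\<sigma> l * m) # us"] by (simp add: lr_def Lo_ten)

lemma Cn_cases_eqI:
  assumes "v \<in> Cn n" "vlin F" "vlin G" "\<And>m. F (ten [m]) = G (ten [m])"
    "\<And>m us y. F (ten (m # us @ [y])) = G (ten (m # us @ [y]))"
  shows "F v = G v"
proof (cases n)
  case 0
  then show ?thesis using Cn0_ten[of v] assms by metis
next
  case (Suc k)
  show ?thesis by (rule mid_eqI[of v k]) (use assms Suc in auto)
qed

lemma lr_lr: "v \<in> Cn n ==> lr l r (lr l' r' v) = lr (l * l') (r' * r) v"
  by (rule Cn_cases_eqI[OF _ lin_comp[OF lr_lin lr_lin] lr_lin])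
     (simp_all add: lr_single lr_mid \<sigma>_mult mult.assoc)
lemma lr_1: "v \<in> Cn n ==> lr 1 1 v = v"
  by (rule Cn_cases_eqI[OF _ lr_lin lin_id]) (simp_all add: lr_single lr_mid)

lemma ten_hd_lin: "lin scale scale M ==> lin scale cmul (\<lambda>x. ten (M x # us))"
  using ten_lin_comp[of M "[]" us] by simp
lemma ten_last_lin: "lin scale scale M ==> lin scale cmul (\<lambda>x. ten (m # us @ [M x]))"
  using ten_lin_comp[of M "m # us" "[]"] by simp

lemma \<sigma>_mult_lin: "lin scale scale (\<lambda>l. \<sigma> l * m)" by (rule lin_comp[OF \<sigma>_lin mult_lin_l])

lemma lr_lin1: assumes v: "v \<in> Cn n" shows "lin scale cmul (\<lambda>l. lr l r v)"
proof (rule linI)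
  have l1: "lin scale scale (\<lambda>x. \<sigma> x * m * r)" for m by (rule lin_comp[OF \<sigma>_mult_lin mult_lin_l])
  show "lr (x + y) r v = lr x r v + lr y r v" for x y
    by (rule Cn_cases_eqI[OF v lr_lin vlin_plus[OF lr_lin lr_lin]])
       (simp_all add: lr_single lr_mid lin_add[OF ten_hd_lin[OF \<sigma>_mult_lin]] lin_add[OF ten_hd_lin[OF l1]])
  show "lr (scale k x) r v = cmul k (lr x r v)" for k x
    by (rule Cn_cases_eqI[OF v lr_lin vlin_cmul[OF lr_lin]])
       (simp_all add: lr_single lr_mid lin_scale[OF ten_hd_lin[OF \<sigma>_mult_lin]] lin_scale[OF ten_hd_lin[OF l1]])
qed

lemma lr_lin2: assumes v: "v \<in> Cn n" shows "lin scale cmul (\<lambda>r. lr l r v)"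
proof (rule linI)
  show "lr l (x + y) v = lr l x v + lr l y v" for x y
    by (rule Cn_cases_eqI[OF v lr_lin vlin_plus[OF lr_lin lr_lin]])
       (simp_all add: lr_single lr_mid lin_add[OF ten_last_lin[OF mult_lin_r]] lin_add[OF ten_hd_lin[OF mult_lin_r]])
  show "lr l (scale k x) v = cmul k (lr l x v)" for k x
    by (rule Cn_cases_eqI[OF v lr_lin vlin_cmul[OF lr_lin]])
       (simp_all add: lr_single lr_mid lin_scale[OF ten_last_lin[OF mult_lin_r]] lin_scale[OF ten_hd_lin[OF mult_lin_r]])
qed

abbreviation \<rho> :: "gen => tens => tens" where "\<rho> \<equiv> adop lr"

lemma \<rho>_rep: "SL2_rep q (Cn n) \<rho>"
  by (rule adop_rep) (simp_all add: Cn_subspc lr_Cn lr_lin lr_lin1 lr_lin2 lr_lr lr_1)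

lemma \<rho>_lin: "vlin (\<rho> g)" and \<rho>_Cn: "v \<in> Cn n ==> \<rho> g v \<in> Cn n"
  using \<rho>_rep[of n] by (auto simp: SL2_rep_def)

lemma \<rho>_rel: assumes "v \<in> Cn n"
  shows "\<rho> GB (\<rho> GA v) = cmul q (\<rho> GA (\<rho> GB v))" "\<rho> GC (\<rho> GA v) = cmul q (\<rho> GA (\<rho> GC v))"
    "\<rho> GC (\<rho> GB v) = \<rho> GB (\<rho> GC v)" "\<rho> GA (\<rho> GD v) = v + cmul (inverse q) (\<rho> GC (\<rho> GB v))"
  using \<rho>_rep[of n] assms by (auto simp: SL2_rep_def SL2_rels_def)

lemma dq_Lo: assumes v: "v \<in> Cn n" and i: "i < n" shows "dq i (Lo l v) = Lo l (dq i v)"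
proof (rule vCn_eqI[OF v lin_comp[OF Lo_lin dq_lin] lin_comp[OF dq_lin Lo_lin]], goal_cases)
  case l: (1 xs)
  obtain m y us where xs: "xs = m # y # us" using l i by (cases xs; cases "tl xs") auto
  show ?case
    using l i by (cases i) (simp_all add: xs Lo_ten dq_ten fc_def mult.assoc)
qed

lemma dq_rr: assumes v: "v \<in> Cn n" and i: "i < n" shows "dq i (rr r v) = rr r (dq i v)"
proof (rule snoc_eqI[OF v lin_comp[OF onl_lin dq_lin] lin_comp[OF dq_lin onl_lin]])
  fix us :: "'a list" and y assume l: "length us = n"
  show "dq i (rr r (ten (us @ [y]))) = rr r (dq i (ten (us @ [y])))"
  proof (cases "Suc i = n")
    case True
    then have "fc i (us @ [z]) = take i us @ [us ! i * z]" for z using l by (simp add: fc_def nth_append)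
    then show ?thesis using l i by (simp add: rr_ten dq_ten mult.assoc)
  next
    case False
    then have "fc i (us @ [z]) = (take i us @ (us ! i * us ! Suc i) # drop (i + 2) us) @ [z]" for z
      using l i by (simp add: fc_def nth_append)
    then show ?thesis using l i rr_ten[of r "take i us @ (us ! i * us ! Suc i) # drop (i + 2) us"] by (simp add: rr_ten dq_ten)
  qed
qed

lemma dq_lr: "v \<in> Cn n ==> i < n ==> dq i (lr l r v) = lr l r (dq i v)"
  by (simp add: lr_def dq_Lo dq_rr[OF Lo_Cn])

lemma bp_lr: "v \<in> Cn n ==> bp n (lr l r v) = lr l r (bp n v)"
  by (simp add: bp_def Sp_def dq_lr lin_sum[OF lr_lin] lin_scale[OF lr_lin])

lemma bp_\<rho>: "v \<in> Cn n ==> bp n (\<rho> g v) = \<rho> g (bp n v)"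
  by (cases g) (simp_all add: adop_def bp_lr lin_ds[OF bp_lin])

subsection \<open>Freeness of the adjoint action\<close>

definition ins :: "'a => 'a list => tens => tens" where
  "ins m us = mop (\<lambda>xs. ten ((\<sigma> (xs ! 0) * m) # us @ [xs ! 1]))"

lemma ins_lin: "vlin (ins m us)" by (simp add: ins_def mop_lin)

lemma ins_ten: "ins m us (ten [u, v]) = ten ((\<sigma> u * m) # us @ [v])"
  unfolding ins_def
  by (subst mop2) (auto intro!: ten_hd_lin \<sigma>_mult_lin ten_last_lin[OF lin_id])

lemma ins_Cn: "w \<in> Cn (Suc 0) ==> ins m us w \<in> Cn (Suc (length us))"
  unfolding ins_def by (erule mop_Cn) (simp add: ten_Cn)

lemma ins_lin1: "lin scale cmul (\<lambda>m. ins m us w)"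
  unfolding ins_def by (rule mop_lin_par, rule ten_hd_lin, rule mult_lin_r)

lemma ins_lin_mid: "lin scale cmul (\<lambda>x. ins m (us @ x # vs) w)"
  unfolding ins_def
proof (rule mop_lin_par)
  fix l show "lin scale cmul (\<lambda>x. ten ((\<sigma> (map bas l ! 0) * m) # (us @ x # vs) @ [map bas l ! 1]))"
    using ten_lin[of "(\<sigma> (map bas l ! 0) * m) # us" "vs @ [map bas l ! 1]"] by simp
qed

text \<open>The coaction \<open>m \<otimes> \<dots> \<otimes> y \<mapsto> \<sigma>(y\<^sub>1) m \<otimes> \<dots>
  \<otimes> y\<^sub>2\<close> is \<open>coact \<Delta>\<close>; with \<open>\<Delta>'\<close> for
  \<open>\<Delta>\<close> it becomes a left inverse.\<close>

definition coact :: "('a => tens) => tens => tens" where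
  "coact D = mop (\<lambda>xs. ins (hd xs) (butlast (tl xs)) (D (last xs)))"

lemma coact_lin: "vlin (coact D)" by (simp add: coact_def mop_lin)

lemma coact_ten: assumes D: "lin scale cmul D" shows "coact D (ten (m # us @ [y])) = ins m us (D y)"
proof -
  have "coact D (ten (m # us @ [y])) = ins (hd (m # us @ [y])) (butlast (tl (m # us @ [y]))) (D (last (m # us @ [y])))"
    unfolding coact_def
  proof (rule mop_ten, rule mlI)
    fix ps qs :: "'a list" assume l: "length ps + length qs + 1 = length (m # us @ [y])"
    show "lin scale cmul (\<lambda>x. ins (hd (ps @ x # qs)) (butlast (tl (ps @ x # qs))) (D (last (ps @ x # qs))))"
    proof (cases ps)
      case Nil
      then have "qs \<noteq> []" using l by auto
      then show ?thesis using Nil by (simp add: ins_lin1)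
    next
      case (Cons p ps')
      then show ?thesis
        by (cases "qs = []") (auto simp: butlast_append ins_lin_mid intro: lin_comp[OF D ins_lin])
    qed
  qed
  then show ?thesis by simp
qed

lemma coact_Cn: assumes "\<And>y. D y \<in> Cn (Suc 0)" "v \<in> Cn (Suc n)" shows "coact D v \<in> Cn (Suc n)"
  unfolding coact_def
proof (rule mop_Cn[OF assms(2)])
  fix xs :: "'a list" assume l: "length xs = Suc (Suc n)"
  show "ins (hd xs) (butlast (tl xs)) (D (last xs)) \<in> Cn (Suc n)"
    using ins_Cn[OF assms(1), of "hd xs" "butlast (tl xs)" "last xs"] l by simp
qed

lemma P_lin1: "lin scale cmul (\<lambda>x. ten ((\<sigma> (u * x) * m) # us @ [v * z]))"
  by (rule ten_hd_lin, rule lin_comp[OF mult_lin_r \<sigma>_mult_lin])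

text \<open>The coaction untwists the adjoint action: it turns into right multiplication on the last factor, because
  \<open>S\<^sup>-\<^sup>1(g\<^sub>1)\<close> and the coproduct of \<open>g\<^sub>2\<close> collapse.\<close>

lemma coact_\<rho>: assumes v: "v \<in> Cn (Suc n)"
  shows "coact \<Delta> (\<rho> g v) = rr (gv g) (coact \<Delta> v)"
proof (rule mid_eqI[OF v lin_comp[OF \<rho>_lin coact_lin] lin_comp[OF coact_lin onl_lin]])
  fix m us y
  let ?g = "gv g"
  note t = coact_ten[OF \<Delta>_lin]
  note \<Delta>g = \<Delta>_gen[of y GA, simplified] \<Delta>_gen[of y GB, simplified] \<Delta>_gen[of y GC, simplified] \<Delta>_gen[of y GD, simplified]
  have s: "\<sigma> (u * x) * (\<sigma> l * m) = \<sigma> (u * (x * l)) * m" for u x l by (simp add: \<sigma>_mult mult.assoc)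
  have s1: "\<sigma> (u * 1) * m = \<sigma> u * m" for u by simp
  have R: "rr r (ten ((\<sigma> u * m) # us @ [w])) = ten ((\<sigma> u * m) # us @ [w * r])" for u w r
    using rr_ten[of r "(\<sigma> u * m) # us"] by simp
  define F where "F w = (case g of
     GA => ins (\<sigma> d * m) us (dop GA w) - cmul q (ins (\<sigma> b * m) us (dop GC w))
   | GB => ins (\<sigma> d * m) us (dop GB w) - cmul q (ins (\<sigma> b * m) us (dop GD w))
   | GC => ins (\<sigma> a * m) us (dop GC w) - cmul (inverse q) (ins (\<sigma> c * m) us (dop GA w))
   | GD => ins (\<sigma> a * m) us (dop GD w) - cmul (inverse q) (ins (\<sigma> c * m) us (dop GB w)))" for w
  have dl: "vlin (dop h)" for h using dop_rep by (auto simp: SL2_rep_def)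
  have "coact \<Delta> (\<rho> g (ten (m # us @ [y]))) = F (\<Delta> y)"
    by (cases g) (simp_all add: F_def adop_def lr_mid lin_ds[OF coact_lin] t \<Delta>g)
  also have "\<dots> = rr ?g (ins m us (\<Delta> y))"
  proof (rule Cn1_eqI[OF \<Delta>_Cn[of y], where F = F and G = "\<lambda>w. rr ?g (ins m us w)"])
    show "vlin (\<lambda>w. rr ?g (ins m us w))" by (rule lin_comp[OF ins_lin onl_lin])
    show "vlin F"
      unfolding F_def[abs_def] by (cases g) (simp_all add: vlin_minus vlin_cmul lin_comp[OF dl ins_lin])
    fix u w
    show "F (ten [u, w]) = rr ?g (ins m us (ten [u, w]))"
      by (cases g; simp add: F_def dop_def mm_ten ins_ten lin_add[OF ins_lin] s R gen_nf)
         (rule poly_mapping_eqI; simp add: s1 lin_as[OF P_lin1] coords q0; simp add: field_simps q0)+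
  qed
  also have "\<dots> = rr ?g (coact \<Delta> (ten (m # us @ [y])))" by (simp add: t)
  finally show "coact \<Delta> (\<rho> g (ten (m # us @ [y]))) = rr ?g (coact \<Delta> (ten (m # us @ [y])))" .
qed

lemma coact'_rr: assumes v: "v \<in> Cn (Suc n)"
  shows "coact \<Delta>' (rr (gv g) v) = \<rho> g (coact \<Delta>' v)"
proof (rule mid_eqI[OF v lin_comp[OF onl_lin coact_lin] lin_comp[OF coact_lin \<rho>_lin]])
  fix m us y
  let ?g = "gv g"
  note t = coact_ten[OF \<Delta>'_lin]
  have lrr: "lr l r (ins m us w) = ins m us (ll l r w)" if "w \<in> Cn (Suc 0)" for w l r
    by (rule Cn1_eqI[OF that lin_comp[OF ins_lin lr_lin] lin_comp[OF ll_lin ins_lin]])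
       (simp add: ins_ten lr_mid ll_ten \<sigma>_mult mult.assoc)
  have "coact \<Delta>' (rr ?g (ten (m # us @ [y]))) = ins m us (adop ll g (\<Delta>' y))"
    using rr_ten[of ?g "m # us"] by (simp add: t \<Delta>'_gen)
  also have "\<dots> = \<rho> g (ins m us (\<Delta>' y))"
    by (cases g) (simp_all add: adop_def lrr \<Delta>'_Cn lin_ds[OF ins_lin])
  finally show "coact \<Delta>' (rr ?g (ten (m # us @ [y]))) = \<rho> g (coact \<Delta>' (ten (m # us @ [y])))"
    by (simp add: t)
qed

lemma coact_one: "coact \<Delta> (ten (m # us @ [1])) = ten (m # us @ [1])"
  and coact'_one: "coact \<Delta>' (ten (m # us @ [1])) = ten (m # us @ [1])"
  by (simp_all add: coact_ten \<Delta>_lin \<Delta>'_lin \<Delta>_one \<Delta>'_one ins_ten)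

lemma last_lin: "lin scale cmul (\<lambda>y. ten (m # us @ [y]))"
  by (rule ten_last_lin[OF lin_id])

text \<open>Elementary tensors are generated under the adjoint action from those ending in one. This is the
  surjectivity of the Galois map of the Hopf algebra, and it drives the inductions on the last factor below.\<close>

lemma mid_gen:
  "ten (m # us @ [y * a]) = \<rho> GA (ten ((\<sigma> a * m) # us @ [y])) + \<rho> GC (ten ((\<sigma> b * m) # us @ [y]))"
  "ten (m # us @ [y * b]) = \<rho> GB (ten ((\<sigma> a * m) # us @ [y])) + \<rho> GD (ten ((\<sigma> b * m) # us @ [y]))"
  "ten (m # us @ [y * c]) = \<rho> GA (ten ((\<sigma> c * m) # us @ [y])) + \<rho> GC (ten ((\<sigma> d * m) # us @ [y]))"
  "ten (m # us @ [y * d]) = \<rho> GB (ten ((\<sigma> c * m) # us @ [y])) + \<rho> GD (ten ((\<sigma> d * m) # us @ [y]))"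
proof goal_cases
  have s: "\<sigma> x * (\<sigma> l * m) = \<sigma> (x * l) * m" for x l by (simp add: \<sigma>_mult mult.assoc)
  have l: "lin scale cmul (\<lambda>x. ten ((\<sigma> x * m) # us @ [z]))" for z
    by (rule ten_hd_lin[OF \<sigma>_mult_lin])
  note e = adop_def lr_mid s gen_nf lin_as[OF l] coords q0
  case 1 show ?case by (rule poly_mapping_eqI; simp add: e; simp add: field_simps q0)
  case 2 show ?case by (rule poly_mapping_eqI; simp add: e; simp add: field_simps q0)
  case 3 show ?case by (rule poly_mapping_eqI; simp add: e; simp add: field_simps q0)
  case 4 show ?case by (rule poly_mapping_eqI; simp add: e; simp add: field_simps q0)
qed

lemma mid_Cn: "length us = n ==> ten (m # us @ [y]) \<in> Cn (Suc n)" by (simp add: ten_Cn)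

lemma coact'_coact: assumes v: "v \<in> Cn (Suc n)" shows "coact \<Delta>' (coact \<Delta> v) = v"
proof (rule mid_eqI[OF v lin_comp[OF coact_lin coact_lin] lin_id])
  fix m :: 'a and us :: "'a list" and y assume l: "length us = n"
  show "coact \<Delta>' (coact \<Delta> (ten (m # us @ [y]))) = ten (m # us @ [y])"
  proof (induction y arbitrary: m rule: gen_induct)
    case one then show ?case by (simp add: coact_one coact'_one)
  next
    case (mult y g)
    have "coact \<Delta>' (coact \<Delta> (\<rho> h (ten (m # us @ [y])))) = \<rho> h (ten (m # us @ [y]))" for h m
      using mult coact_\<rho>[OF mid_Cn[OF l], of h] coact'_rr[OF coact_Cn[where D = \<Delta>, OF \<Delta>_Cn mid_Cn[OF l]], of h]
      by simp
    then show ?case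
      by (cases g) (simp_all add: mid_gen lin_add[OF coact_lin])
  qed (simp_all add: lin_as[OF last_lin] lin_as[OF coact_lin])
qed

text \<open>In positive bar degree the adjoint action is right multiplication in disguise, so the regular sequence
  \<open>b, c, a - 1\<close> is regular for it as well. In degree zero this fails, and the failure is the
  Hochschild homology.\<close>

lemma \<rho>_b_inj: assumes v: "v \<in> Cn (Suc n)" "\<rho> GB v = 0" shows "v = 0"
proof -
  have "rr b (coact \<Delta> v) = 0"
    using coact_\<rho>[OF v(1), of GB] v(2) by (simp add: lin_0[OF coact_lin])
  then have "coact \<Delta> v = 0" by (rule rr_b_inj[OF coact_Cn[where D = \<Delta>, OF \<Delta>_Cn v(1)]])
  then show ?thesis using coact'_coact[OF v(1)] by (simp add: lin_0[OF coact_lin])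
qed

lemma \<rho>_c_regular: assumes v: "v \<in> Cn (Suc n)" "u \<in> Cn (Suc n)" "\<rho> GC v = \<rho> GB u"
  shows "\<exists>w\<in>Cn (Suc n). v = \<rho> GB w"
proof -
  have "rr c (coact \<Delta> v) = rr b (coact \<Delta> u)"
    using coact_\<rho>[OF v(1), of GC] coact_\<rho>[OF v(2), of GB] v(3) by simp
  then obtain w where w: "w \<in> Cn (Suc n)" "coact \<Delta> v = rr b w"
    using rr_c_regular[OF coact_Cn[where D = \<Delta>, OF \<Delta>_Cn v(1)] coact_Cn[where D = \<Delta>, OF \<Delta>_Cn v(2)]] by auto
  have "v = \<rho> GB (coact \<Delta>' w)"
    using coact'_coact[OF v(1)] w(2) coact'_rr[OF w(1), of GB] by simp
  then show ?thesis using coact_Cn[where D = \<Delta>', OF \<Delta>'_Cn w(1)] by blast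
qed

lemma \<rho>_a_regular: assumes v: "v \<in> Cn (Suc n)" "u \<in> Cn (Suc n)" "u' \<in> Cn (Suc n)" "\<rho> GA v - v = \<rho> GB u + \<rho> GC u'"
  shows "\<exists>w\<in>Cn (Suc n). \<exists>w'\<in>Cn (Suc n). v = \<rho> GB w + \<rho> GC w'"
proof -
  note C = coact_Cn[where D = \<Delta>, OF \<Delta>_Cn]
  have "coact \<Delta> (\<rho> GA v - v) = coact \<Delta> (\<rho> GB u + \<rho> GC u')" by (simp add: v(4))
  then have "rr a (coact \<Delta> v) - coact \<Delta> v = rr b (coact \<Delta> u) + rr c (coact \<Delta> u')"
    using coact_\<rho>[OF v(1), of GA] coact_\<rho>[OF v(2), of GB] coact_\<rho>[OF v(3), of GC]
    by (simp add: lin_ad[OF coact_lin])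
  then obtain w w' where w: "w \<in> Cn (Suc n)" "w' \<in> Cn (Suc n)" "coact \<Delta> v = rr b w + rr c w'"
    using rr_a_regular[OF C[OF v(1)] C[OF v(2)] C[OF v(3)]] by auto
  have "v = \<rho> GB (coact \<Delta>' w) + \<rho> GC (coact \<Delta>' w')"
    using coact'_coact[OF v(1)] w(3) coact'_rr[OF w(1), of GB] coact'_rr[OF w(2), of GC]
    by (simp add: lin_add[OF coact_lin])
  then show ?thesis using coact_Cn[where D = \<Delta>', OF \<Delta>'_Cn w(1)] coact_Cn[where D = \<Delta>', OF \<Delta>'_Cn w(2)] by blast
qed

subsection \<open>Augmentation and contraction\<close>

text \<open>Appending a unit contracts the bar complex. It also splits the augmentation.\<close>

definition app1 :: "tens => tens" where "app1 = mop (\<lambda>xs. ten (xs @ [1]))"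
definition svq :: "tens => tens" where "svq = mop (\<lambda>xs. cmul ((-1) ^ (length xs - 1)) (ten (xs @ [1])))"

lemma app1_lin: "vlin app1" and svq_lin: "vlin svq" by (simp_all add: app1_def svq_def mop_lin)

lemma app1_ten: "app1 (ten xs) = ten (xs @ [1])"
  unfolding app1_def by (rule mop_ten[OF ml_snoc])
lemma app1_Cn: "v \<in> Cn n ==> app1 v \<in> Cn (Suc n)"
  unfolding app1_def by (erule mop_Cn) (simp add: ten_Cn)

lemma svq_app1: assumes v: "v \<in> Cn n" shows "svq v = cmul ((-1) ^ n) (app1 v)"
proof (rule vCn_eqI[OF v svq_lin vlin_cmul[OF app1_lin]], goal_cases)
  case l: (1 xs)
  have "svq (ten xs) = cmul ((-1) ^ (length xs - 1)) (ten (xs @ [1]))"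
    unfolding svq_def by (rule mop_ten, rule ml_cong[OF ml_cmul[OF ml_snoc]]) auto
  then show ?case using l by (simp add: app1_ten)
qed

lemma svq_Cn: "v \<in> Cn n ==> svq v \<in> Cn (Suc n)"
  by (simp add: svq_app1 Cn_cmul app1_Cn)

lemma dq_app1: assumes v: "v \<in> Cn n" and i: "i < n" shows "dq i (app1 v) = app1 (dq i v)"
proof (rule vCn_eqI[OF v lin_comp[OF app1_lin dq_lin] lin_comp[OF dq_lin app1_lin]], goal_cases)
  case l: (1 xs)
  then have "fc i (xs @ [1]) = fc i xs @ [1]" using i by (simp add: fc_def nth_append)
  then show ?case using l i by (simp add: app1_ten dq_ten)
qed

lemma dq_app1_eq: assumes v: "v \<in> Cn n" shows "dq n (app1 v) = v"
proof (rule vCn_eqI[OF v lin_comp[OF app1_lin dq_lin] lin_id], goal_cases)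
  case l: (1 xs)
  then obtain us y where "xs = us @ [y]" by (cases xs rule: rev_cases) auto
  then show ?case using l by (simp add: app1_ten dq_ten fc_def nth_append)
qed

lemma dq_last_app1: assumes v: "v \<in> Cn n" shows "dq (Suc n) (app1 v) = v"
proof (rule vCn_eqI[OF v lin_comp[OF app1_lin dq_lin] lin_id], goal_cases)
  case l: (1 xs)
  then obtain m us where "xs = m # us" by (cases xs) auto
  then show ?case using l by (simp add: app1_ten dq_ten fc_def)
qed

lemma bp_svq: assumes v: "v \<in> Cn n" shows "bp (Suc n) (svq v) + svq (bp n v) = v"
proof -
  have pm: "cmul ((-1) ^ k) (cmul ((-1) ^ k) w) = w" for k and w :: tens
    by (simp add: cmul_cmul flip: power_mult_distrib)
  have "bp (Suc n) (app1 v) = app1 (bp n v) + cmul ((-1) ^ n) v"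
    by (simp add: bp_def Sp_def dq_app1[OF v] dq_app1_eq[OF v] lin_sum[OF app1_lin] lin_scale[OF app1_lin])
  then have 1: "bp (Suc n) (svq v) = cmul ((-1) ^ n) (app1 (bp n v)) + v"
    by (simp add: svq_app1[OF v] lin_scale[OF bp_lin] cmul_add pm)
  show ?thesis
  proof (cases n)
    case 0 then show ?thesis using 1 by (simp add: bp_def Sp_def lin_0[OF app1_lin] lin_0[OF svq_lin])
  next
    case (Suc m)
    have "svq (bp n v) = cmul ((-1) ^ m) (app1 (bp n v))"
      using bp_Cn[OF v] Suc by (simp add: svq_app1)
    then show ?thesis unfolding 1 by (simp add: Suc cmul_minus)
  qed
qed

lemma dq_last_lr: "dq (Suc (length us)) (lr l r (ten (m # us @ [y]))) = ten ((\<sigma> (y * r * l) * m) # us)"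
  by (simp add: lr_mid dq_ten fc_def \<sigma>_mult mult.assoc)

lemma \<sigma>_hd_lin: "lin scale cmul (\<lambda>x. ten ((\<sigma> (y * x) * m) # us))"
  by (rule ten_hd_lin, rule lin_comp[OF mult_lin_r \<sigma>_mult_lin])

lemma aug_\<rho>: assumes v: "v \<in> Cn (Suc n)"
  shows "dq (Suc n) (\<rho> GA v) = dq (Suc n) v" "dq (Suc n) (\<rho> GB v) = 0" "dq (Suc n) (\<rho> GC v) = 0"
proof goal_cases
  have 0: "dq (Suc n) (ten (m # us @ [y])) = ten ((\<sigma> (y * 1) * m) # us)" if "length us = n" for m us y
    using that by (simp add: dq_ten fc_def)
  note e = adop_def lin_ds[OF dq_lin] dq_last_lr mult.assoc gen_nf lin_as[OF \<sigma>_hd_lin] 0 cmul_cmul q0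
  case 1 show ?case
    by (rule mid_eqI[OF v lin_comp[OF \<rho>_lin dq_lin] dq_lin]) (auto simp: e)
  case 2 show ?case
    by (rule mid_eqI[OF v lin_comp[OF \<rho>_lin dq_lin] vlin_zero]) (auto simp: e)
  case 3 show ?case
    by (rule mid_eqI[OF v lin_comp[OF \<rho>_lin dq_lin] vlin_zero]) (auto simp: e)
qed

lemma subspc_vimage: "lin s t F ==> subspc t V ==> subspc s {v. F v \<in> V}"
  unfolding subspc_def by (auto simp: lin_0 lin_add lin_scale)

text \<open>The image of the last Koszul differential.\<close>

definition Imk :: "nat => tens set" where
  "Imk n = {\<rho> GB u + \<rho> GC v + (\<rho> GA w - w) | u v w. u \<in> Cn n \<and> v \<in> Cn n \<and> w \<in> Cn n}"

lemma ImkI: "u \<in> Cn n ==> v \<in> Cn n ==> w \<in> Cn n ==> \<rho> GB u + \<rho> GC v + (\<rho> GA w - w) \<in> Imk n"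
  by (auto simp: Imk_def)

lemma Imk_subspc: "subspc cmul (Imk n)"
  unfolding subspc_def
proof (intro conjI ballI allI)
  show "0 \<in> Imk n" using ImkI[of 0 n 0 0] by (simp add: lin_0[OF \<rho>_lin] Cn_0)
next
  fix x y assume "x \<in> Imk n" "y \<in> Imk n"
  then obtain u v w u' v' w' where C: "u \<in> Cn n" "v \<in> Cn n" "w \<in> Cn n" "u' \<in> Cn n" "v' \<in> Cn n" "w' \<in> Cn n"
    and e: "x = \<rho> GB u + \<rho> GC v + (\<rho> GA w - w)" "y = \<rho> GB u' + \<rho> GC v' + (\<rho> GA w' - w')"
    by (auto simp: Imk_def)
  have "x + y = \<rho> GB (u + u') + \<rho> GC (v + v') + (\<rho> GA (w + w') - (w + w'))"
    by (simp add: e lin_add[OF \<rho>_lin])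
  then show "x + y \<in> Imk n" using C by (simp only: ImkI Cn_add)
next
  fix k x assume "x \<in> Imk n"
  then obtain u v w where C: "u \<in> Cn n" "v \<in> Cn n" "w \<in> Cn n" and e: "x = \<rho> GB u + \<rho> GC v + (\<rho> GA w - w)"
    by (auto simp: Imk_def)
  have "cmul k x = \<rho> GB (cmul k u) + \<rho> GC (cmul k v) + (\<rho> GA (cmul k w) - cmul k w)"
    by (simp add: e lin_scale[OF \<rho>_lin] cmul_add cmul_diff)
  then show "cmul k x \<in> Imk n" using C by (simp only: ImkI Cn_cmul)
qed

lemma Imk_b: "v \<in> Cn n ==> \<rho> GB v \<in> Imk n" and Imk_c: "v \<in> Cn n ==> \<rho> GC v \<in> Imk n"
  and Imk_a: "v \<in> Cn n ==> \<rho> GA v - v \<in> Imk n"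
  using ImkI[of v n 0 0] ImkI[of 0 n v 0] ImkI[of 0 n 0 v] by (simp_all add: lin_0[OF \<rho>_lin] Cn_0)

lemma Imk_add: "x \<in> Imk n ==> y \<in> Imk n ==> x + y \<in> Imk n"
  and Imk_cmul: "x \<in> Imk n ==> cmul k x \<in> Imk n"
  using Imk_subspc by (auto simp: subspc_def)
lemma Imk_diff: "x \<in> Imk n ==> y \<in> Imk n ==> x - y \<in> Imk n"
  by (rule subspc_diff[OF Imk_subspc])

lemma Imk_d: assumes v: "v \<in> Cn n" shows "\<rho> GD v - v \<in> Imk n"
proof -
  have "\<rho> GD v - v = cmul (inverse q) (\<rho> GC (\<rho> GB v)) - (\<rho> GA (\<rho> GD v) - \<rho> GD v)"
    using \<rho>_rel(4)[OF v] by simp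
  then show ?thesis by (simp only:) (intro Imk_diff Imk_cmul Imk_c Imk_a \<rho>_Cn v)
qed

text \<open>Modulo that image the last factor moves to the front, \<open>m \<otimes> \<dots> \<otimes> y = \<sigma>(y)
  m \<otimes> \<dots> \<otimes> 1\<close>. This is proved by induction on \<open>y\<close>, and it means
  that the twisted face is the cokernel of the Koszul differential.\<close>

lemma aug_section: assumes v: "v \<in> Cn (Suc n)" shows "v - app1 (dq (Suc n) v) \<in> Imk (Suc n)"
proof -
  have "v \<in> {v. v - app1 (dq (Suc n) v) \<in> Imk (Suc n)}"
  proof (rule Cn_induct[OF v])
    have l: "vlin (\<lambda>v. v - app1 (dq (Suc n) v))" by (intro vlin_minus lin_id lin_comp[OF dq_lin app1_lin])
    show "subspc cmul {v. v - app1 (dq (Suc n) v) \<in> Imk (Suc n)}"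
      by (rule subspc_vimage[OF l Imk_subspc])
    fix xs :: "'a list" assume "length xs = Suc (Suc n)"
    then obtain m us y where xs: "xs = m # us @ [y]" and l: "length us = n"
      by (cases xs; cases "tl xs" rule: rev_cases) auto
    have D: "dq (Suc n) (ten (m # us @ [y])) = ten ((\<sigma> y * m) # us)" for m y
      using l by (simp add: dq_ten fc_def)
    note M = mid_Cn[OF l]
    have "ten (m # us @ [y]) - ten ((\<sigma> y * m) # us @ [1]) \<in> Imk (Suc n)" for m
    proof (induction y arbitrary: m rule: gen_induct)
      case one
      then show ?case using Imk_subspc[of "Suc n"] by (simp add: subspc_def)
    next
      case (mult y g)
      let ?h = "\<lambda>x. ten ((\<sigma> x * m) # us @ [y])"
      have "(\<rho> GA (?h a) - ?h a) + \<rho> GC (?h b) \<in> Imk (Suc n)" "\<rho> GB (?h a) + (\<rho> GD (?h b) - ?h b) \<in> Imk (Suc n)"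
        "(\<rho> GA (?h c) - ?h c) + \<rho> GC (?h d) \<in> Imk (Suc n)" "\<rho> GB (?h c) + (\<rho> GD (?h d) - ?h d) \<in> Imk (Suc n)"
        by (intro Imk_add Imk_a Imk_b Imk_c Imk_d M)+
      then have "ten (m # us @ [y * gv g]) - ?h (gv g) \<in> Imk (Suc n)" by (cases g) (simp_all add: mid_gen algebra_simps)
      from Imk_add[OF this mult[of "\<sigma> (gv g) * m"]] show ?case
        by (simp add: \<sigma>_mult mult.assoc)
    next
      case (add y z)
      have l: "lin scale cmul (\<lambda>y. ten ((\<sigma> y * m) # us @ [1]))" by (rule ten_hd_lin[OF \<sigma>_mult_lin])
      from Imk_add[OF add(1,2)[of m]] show ?case by (simp add: lin_add[OF last_lin] lin_add[OF l] algebra_simps)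
    next
      case (scale k y)
      have l: "lin scale cmul (\<lambda>y. ten ((\<sigma> y * m) # us @ [1]))" by (rule ten_hd_lin[OF \<sigma>_mult_lin])
      from Imk_cmul[OF scale[of m], of k] show ?case
        by (simp add: lin_scale[OF last_lin] lin_scale[OF l] cmul_diff)
    qed
    then show "ten xs \<in> {v. v - app1 (dq (Suc n) v) \<in> Imk (Suc n)}"
      by (simp add: xs D app1_ten)
  qed
  then show ?thesis by simp
qed

subsection \<open>The Koszul double complex\<close>

abbreviation \<beta> :: "tens => tens" where "\<beta> \<equiv> \<rho> GB"
abbreviation \<gamma> :: "tens => tens" where "\<gamma> \<equiv> \<rho> GC"
abbreviation \<alpha> :: "complex => tens => tens" where "\<alpha> k v \<equiv> cmul k (\<rho> GA v) - v"

text \<open>The Koszul complex of the sequence \<open>b, c, a - 1\<close>, with terms of rank 1, 3, 3, 1. Triples with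
  zero entries serve in the degrees of rank one. The powers of \<open>q\<close> in \<open>\<alpha>\<close>
  compensate for \<open>a\<close> commuting with \<open>b\<close> and \<open>c\<close> only up to
  \<open>q\<close>.\<close>

definition KC :: "nat => nat => (tens \<times> tens \<times> tens) set" where
  "KC p k = (if p = 0 \<or> p = 3 then Cn k \<times> {0} \<times> {0} else if p = 1 \<or> p = 2 then Cn k \<times> Cn k \<times> Cn k else {0})"

definition Kd :: "nat => tens \<times> tens \<times> tens => tens \<times> tens \<times> tens" where
  "Kd p = (\<lambda>(u, v, w).
     if p = 0 then (\<beta> u + \<gamma> v + \<alpha> 1 w, 0, 0)
     else if p = 1 then (\<gamma> u - \<alpha> (inverse q) v, - \<beta> u - \<alpha> (inverse q) w, \<beta> v + \<gamma> w)
     else if p = 2 then (\<alpha> (inverse q * inverse q) u, \<gamma> u, - \<beta> u)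
     else 0)"

definition map3 :: "(tens => tens) => tens \<times> tens \<times> tens => tens \<times> tens \<times> tens" where
  "map3 f = (\<lambda>(u, v, w). (f u, f v, f w))"

lemma \<rho>_GA_comm: assumes "v \<in> Cn n"
  shows "\<rho> GA (\<rho> GB v) = cmul (inverse q) (\<rho> GB (\<rho> GA v))" "\<rho> GA (\<rho> GC v) = cmul (inverse q) (\<rho> GC (\<rho> GA v))"
  using \<rho>_rel(1,2)[OF assms] q0 by (simp_all add: cmul_cmul)

sublocale K: double_complex KC Kd "\<lambda>k. map3 (bp (Suc k))" "map3 svq" Cn "\<lambda>n. bn (Suc n)" "\<lambda>n x. dq (Suc n) (fst x)"
proof
  note r = lin_all[OF \<rho>_lin]
  note C = Cn_add Cn_diff Cn_uminus Cn_cmul \<rho>_Cn Cn_0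
  fix p k n :: nat and x y :: "tens \<times> tens \<times> tens" and w :: tens
  obtain u v t where x: "x = (u, v, t)" by (metis prod_cases3)
  obtain u' v' t' where y: "y = (u', v', t')" by (metis prod_cases3)
  show "x \<in> KC p k ==> y \<in> KC p k ==> x + y \<in> KC p k"
    by (auto simp: KC_def x y zero_prod_def C split: if_splits)
  show "x \<in> KC p k ==> y \<in> KC p k ==> x - y \<in> KC p k"
    by (auto simp: KC_def x y zero_prod_def C split: if_splits)
  show "Kd p (x - y) = Kd p x - Kd p y"
    by (simp add: Kd_def x y r cmul_diff zero_prod_def)
  show "map3 (bp (Suc k)) (x - y) = map3 (bp (Suc k)) x - map3 (bp (Suc k)) y"
    by (simp add: map3_def x y lin_diff[OF bp_lin])
  show "map3 svq 0 = 0" by (simp add: map3_def zero_prod_def lin_0[OF svq_lin])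
  show "dq (Suc n) (fst (x - y)) = dq (Suc n) (fst x) - dq (Suc n) (fst y)"
    by (simp add: lin_diff[OF dq_lin])
  show "x \<in> KC (Suc p) k ==> Kd p x \<in> KC p k"
    by (auto simp: KC_def Kd_def x zero_prod_def C split: if_splits)
  show "x \<in> KC p (Suc k) ==> map3 (bp (Suc k)) x \<in> KC p k"
    using bp_Cn[of _ "Suc k"] by (auto simp: KC_def map3_def x zero_prod_def split: if_splits)
  show "x \<in> KC p k ==> map3 svq x \<in> KC p (Suc k)"
    by (auto simp: KC_def map3_def x zero_prod_def svq_Cn lin_0[OF svq_lin] split: if_splits)
  show "Kd p (Kd (Suc p) x) = 0" if "x \<in> KC (Suc (Suc p)) k"
    using that \<rho>_rel(3)[of u k] \<rho>_rel(3)[of v k] \<rho>_rel(3)[of t k] \<rho>_GA_comm[of u k] \<rho>_GA_comm[of v k] \<rho>_GA_comm[of t k]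
    by (auto simp: KC_def Kd_def x zero_prod_def r cmul_cmul cmul_add cmul_diff split: if_splits)
  show "map3 (bp (Suc k)) (map3 (bp (Suc (Suc k))) x) = 0" if "x \<in> KC p (Suc (Suc k))"
    using that bp_bp[of _ "Suc k"] by (auto simp: KC_def map3_def x zero_prod_def split: if_splits)
  show "Kd p (map3 (bp (Suc k)) x) = map3 (bp (Suc k)) (Kd p x)" if "x \<in> KC (Suc p) (Suc k)"
    using that by (auto simp: KC_def Kd_def map3_def x zero_prod_def bp_\<rho> lin_add[OF bp_lin] lin_diff[OF bp_lin] lin_uminus[OF bp_lin] lin_scale[OF bp_lin] split: if_splits)
  show "map3 (bp (Suc (Suc k))) (map3 svq x) + map3 svq (map3 (bp (Suc k)) x) = x" if "x \<in> KC p (Suc k)"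
    using that by (auto simp: KC_def map3_def x zero_prod_def bp_svq lin_0[OF svq_lin] split: if_splits)
  show "map3 (bp (Suc 0)) (map3 svq x) = x" if "x \<in> KC p 0"
  proof -
    have "bp (Suc 0) (svq z) = z" if "z \<in> Cn 0" for z
      using bp_svq[OF that] by (simp add: bp_def Sp_def lin_0[OF svq_lin])
    then show ?thesis using that by (auto simp: KC_def map3_def x zero_prod_def lin_0[OF svq_lin] split: if_splits)
  qed
  show "\<exists>y\<in>KC (Suc (Suc p)) (Suc k). x = Kd (Suc p) y" if X: "x \<in> KC (Suc p) (Suc k)" and e: "Kd p x = 0"
  proof -
    consider "p = 0" | "p = 1" | "p = 2" | "p \<ge> 3" by linarith
    then show ?thesis
    proof cases
      \<comment> \<open>Exactness in the middle: \<open>a - 1\<close> is regular modulo \<open>b\<close> and \<open>c\<close>, then \<open>c\<close> modulo \<open>b\<close>, then \<open>b\<close> is injective.\<close>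
      case 1
      then have C1: "u \<in> Cn (Suc k)" "v \<in> Cn (Suc k)" "t \<in> Cn (Suc k)" using X by (auto simp: KC_def x)
      have e: "\<beta> u + \<gamma> v + (\<rho> GA t - t) = 0" using e 1 by (simp add: Kd_def x zero_prod_def)
      then have "\<rho> GA t - t = \<beta> (- u) + \<gamma> (- v)" by (simp add: r algebra_simps eq_neg_iff_add_eq_0)
      then obtain v2 v3 where v: "v2 \<in> Cn (Suc k)" "v3 \<in> Cn (Suc k)" "t = \<beta> v2 + \<gamma> v3"
        using \<rho>_a_regular[OF C1(3) Cn_uminus[OF C1(1)] Cn_uminus[OF C1(2)]] by auto
      let ?u = "u + \<alpha> (inverse q) v2" and ?v = "v + \<alpha> (inverse q) v3"
      have "\<beta> ?u + \<gamma> ?v = \<beta> u + \<gamma> v + (\<rho> GA t - t)"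
        by (simp add: v(3) r \<rho>_GA_comm[OF v(1)] \<rho>_GA_comm[OF v(2)])
      then have "\<beta> ?u + \<gamma> ?v = 0" using e by simp
      then have gv: "\<gamma> ?v = \<beta> (- ?u)" by (simp only: r(3) eq_neg_iff_add_eq_0 add.commute)
      then obtain w where w: "w \<in> Cn (Suc k)" "?v = \<beta> w"
        using \<rho>_c_regular[of ?v k "- ?u"] C1 v by (auto simp: C)
      have "\<beta> (?u + \<gamma> w) = 0"
        using gv \<rho>_rel(3)[OF w(1)] unfolding w(2) r(3) by (simp add: r(1))
      then have "?u + \<gamma> w = 0" using \<rho>_b_inj[of "?u + \<gamma> w" k] C1 v w by (simp add: C)
      then have "x = Kd (Suc p) (- w, v2, v3)"
        using w(2) v(3) 1 by (simp add: x Kd_def r(3) algebra_simps eq_neg_iff_add_eq_0)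
      then show ?thesis using 1 v w by (intro bexI[of _ "(- w, v2, v3)"]) (auto simp: KC_def C)
    next
      case 2
      then have C1: "u \<in> Cn (Suc k)" "v \<in> Cn (Suc k)" "t \<in> Cn (Suc k)" using X by (auto simp: KC_def x)
      have e: "\<gamma> u = \<alpha> (inverse q) v" "- \<beta> u = \<alpha> (inverse q) t" "\<beta> v + \<gamma> t = 0" using e 2 by (simp_all add: Kd_def x zero_prod_def)
      have "\<gamma> t = \<beta> (- v)" using e(3) by (simp add: r(3) eq_neg_iff_add_eq_0 add.commute)
      then obtain w where w: "w \<in> Cn (Suc k)" "t = \<beta> w"
        using \<rho>_c_regular[OF C1(3) Cn_uminus[OF C1(2)]] by auto
      have "\<beta> (v + \<gamma> w) = 0"
        using e(3) \<rho>_rel(3)[OF w(1)] w(2) by (simp add: r(1))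
      then have vw: "v + \<gamma> w = 0" using \<rho>_b_inj[of "v + \<gamma> w" k] C1 w by (simp add: C)
      have "\<beta> (u + \<alpha> (inverse q * inverse q) w) = 0"
        using e(2) w(2) \<rho>_GA_comm[OF w(1)]
        by (simp add: r cmul_cmul cmul_diff eq_neg_iff_add_eq_0) (simp add: algebra_simps)
      then have "u + \<alpha> (inverse q * inverse q) w = 0"
        using \<rho>_b_inj[of "u + \<alpha> (inverse q * inverse q) w" k] C1 w by (simp add: C)
      then have "x = Kd (Suc p) (- w, 0, 0)"
        using w(2) vw 2 by (simp add: x Kd_def r(3) eq_neg_iff_add_eq_0) (simp add: algebra_simps)
      then show ?thesis using 2 w by (intro bexI[of _ "(- w, 0, 0)"]) (auto simp: KC_def C)
    next
      case 3
      then have "u \<in> Cn (Suc k)" "v = 0" "t = 0" using X by (auto simp: KC_def x)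
      moreover have "\<beta> u = 0" using e 3 by (simp add: Kd_def x zero_prod_def)
      ultimately have "x = 0" using \<rho>_b_inj[of u k] by (simp add: x zero_prod_def)
      then show ?thesis using 3 by (intro bexI[of _ 0]) (auto simp: KC_def Kd_def zero_prod_def)
    next
      case 4
      then show ?thesis using X by (intro bexI[of _ 0]) (auto simp: KC_def Kd_def zero_prod_def split: if_splits)
    qed
  qed
  show "dq (Suc n) (fst x) \<in> Cn n" if "x \<in> KC 0 (Suc n)"
    using that dq_Cn[of u "Suc n" "Suc n"] by (auto simp: KC_def x)
  show "\<exists>y\<in>KC (Suc 0) (Suc n). x = Kd 0 y" if X: "x \<in> KC 0 (Suc n)" and e: "dq (Suc n) (fst x) = 0"
  proof -
    have u: "u \<in> Cn (Suc n)" "v = 0" "t = 0" using X by (auto simp: KC_def x)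
    have "u \<in> Imk (Suc n)" using aug_section[OF u(1)] e by (simp add: x lin_0[OF app1_lin])
    then obtain u1 v1 w1 where "u1 \<in> Cn (Suc n)" "v1 \<in> Cn (Suc n)" "w1 \<in> Cn (Suc n)" "u = \<beta> u1 + \<gamma> v1 + (\<rho> GA w1 - w1)"
      by (auto simp: Imk_def)
    then show ?thesis using u by (intro bexI[of _ "(u1, v1, w1)"]) (auto simp: KC_def Kd_def x)
  qed
  show "dq (Suc n) (fst (Kd 0 y)) = 0" if "y \<in> KC (Suc 0) (Suc n)"
    using that by (auto simp: KC_def Kd_def y aug_\<rho> lin_ad[OF dq_lin])
  show "dq (Suc n) (fst (map3 (bp (Suc (Suc n))) x)) = bn (Suc n) (dq (Suc (Suc n)) (fst x))" if "x \<in> KC 0 (Suc (Suc n))"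
    using that dq_last_bp[of u n] by (auto simp: KC_def map3_def x)
  show "\<exists>x\<in>KC 0 (Suc n). dq (Suc n) (fst x) = w" if "w \<in> Cn n"
    using dq_last_app1[OF that] app1_Cn[OF that] by (intro bexI[of _ "(app1 w, 0, 0)"]) (auto simp: KC_def)
qed

end

section \<open>The torus grading\<close>

context qsl2
begin

text \<open>The torus acts by \<open>a \<mapsto> \<lambda>a\<close>, \<open>b \<mapsto> \<mu>b\<close>, \<open>c
  \<mapsto> \<mu>\<^sup>-\<^sup>1 c\<close>, \<open>d \<mapsto> \<lambda>\<^sup>-\<^sup>1 d\<close>, and
  \<open>Dw x y\<close> are its infinitesimal generators.\<close>

definition wtc :: "complex => complex => idx => complex" where
  "wtc x y = (\<lambda>(i, j, k). x * of_int i + y * of_int (int j - int k))"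

definition Dw :: "complex => complex => 'a => 'a" where
  "Dw x y = blin scale (\<lambda>e. scale (wtc x y e) (bas e))"

lemma Dw_lin: "lin scale scale (Dw x y)" by (simp add: Dw_def blin_lin[OF vs_scale])
lemma Dw_bas: "Dw x y (bas e) = scale (wtc x y e) (bas e)" by (simp add: Dw_def blin_bas[OF vs_scale])

fun gwt :: "complex => complex => gen => complex" where
  "gwt x y GA = x" | "gwt x y GB = y" | "gwt x y GC = - y" | "gwt x y GD = - x"

lemma Dw_mult_gen: "Dw x y (z * gv g) = Dw x y z * gv g + scale (gwt x y g) (z * gv g)"
proof (rule lin_basis_eqI[where F = "\<lambda>z. Dw x y (z * gv g)"])
  show "lin scale scale (\<lambda>z. Dw x y (z * gv g))" by (rule lin_comp[OF mult_lin_l Dw_lin])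
  show "lin scale scale (\<lambda>z. Dw x y z * gv g + scale (gwt x y g) (z * gv g))"
    by (intro lin_plus[OF vs_scale] lin_cmul[OF vs_scale] lin_comp[OF Dw_lin mult_lin_l] mult_lin_l)
  fix e :: idx
  obtain i j k where e: "e = (i, j, k)" by (metis prod_cases3)
  note D = lin_as[OF Dw_lin]
  show "Dw x y (bas e * gv g) = Dw x y (bas e) * gv g + scale (gwt x y g) (bas e * gv g)"
    by (cases g)
       (simp_all add: e Dw_bas scale_mult_left bas_gens D wtc_def scale_right_distrib algebra_simps flip: scale_left_distrib)
qed

lemma Dw_one: "Dw x y 1 = 0"
  using Dw_bas[of x y "(0, 0, 0)"] by (simp add: bas_0 wtc_def)

lemma Dw_gen: "Dw x y (gv g) = scale (gwt x y g) (gv g)"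
  using Dw_mult_gen[of x y 1 g] by (simp add: Dw_one)

lemma Dw_mult: "Dw x y (u * z) = Dw x y u * z + u * Dw x y z"
proof (induction z rule: gen_induct)
  case (mult z g)
  have "Dw x y (u * (z * gv g)) = Dw x y (u * z * gv g)" by (simp add: mult.assoc)
  also have "\<dots> = Dw x y u * z * gv g + (u * Dw x y z * gv g + scale (gwt x y g) (u * z * gv g))"
    by (simp add: Dw_mult_gen mult.IH distrib_right add.assoc)
  also have "u * Dw x y z * gv g + scale (gwt x y g) (u * z * gv g) = u * Dw x y (z * gv g)"
    by (simp add: Dw_mult_gen distrib_left scale_mult_right mult.assoc)
  finally show ?case by (simp add: mult.assoc)
qed (simp_all add: Dw_one lin_as[OF Dw_lin] algebra_simps scale_mult_left scale_mult_right scale_right_distrib)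

lemma derivation_eq_Dw:
  assumes l: "lin scale scale \<delta>" and m: "\<And>u z. \<delta> (u * z) = \<delta> u * z + u * \<delta> z"
    and g: "\<And>g. \<delta> (gv g) = scale (gwt x y g) (gv g)"
  shows "\<delta> = Dw x y"
proof
  fix z show "\<delta> z = Dw x y z"
  proof (induction z rule: gen_induct)
    case one then show ?case using m[of 1 1] by (simp add: Dw_one)
  next
    case (mult z g) then show ?case by (simp add: m g Dw_mult Dw_gen)
  qed (simp_all add: lin_as[OF l] lin_as[OF Dw_lin])
qed

text \<open>The two integer weights are packed into one complex number, so that weight zero means that both vanish,
  and a single derivation \<open>Dw 1 \<i>\<close> has the weights as its eigenvalues.\<close>

definition wtl :: "complex => complex => idx list => complex" where
  "wtl x y l = sum_list (map (wtc x y) l)"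

abbreviation wt :: "idx list => complex" where "wt \<equiv> wtl 1 \<i>"

definition Pw :: "complex => tens => tens" where
  "Pw \<omega> = lext cmul (\<lambda>l. if wt l = \<omega> then single l 1 else 0)"

lemma Pw_lin: "vlin (Pw \<omega>)" by (simp add: Pw_def vlin_lext)

lemma Pw_single: "Pw \<omega> (single l 1) = (if wt l = \<omega> then single l 1 else 0)"
  by (simp add: Pw_def)

lemma lookup_lext: "lookup (lext cmul g f) y = (\<Sum>x\<in>keys f. lookup f x * lookup (g x) y)"
  by (simp add: lext_def lookup_sum lookup_cmul)

lemma lookup_diag: "lookup (lext cmul (\<lambda>l. cmul (h l) (single l 1)) v) l = h l * lookup v l"
  by (auto simp: lookup_lext lookup_cmul lookup_single when_def in_keys_iff mult.commute if_distrib[of "(*) _"] sum.delta cong: if_cong)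

lemma lookup_Pw: "lookup (Pw \<omega> v) l = (if wt l = \<omega> then lookup v l else 0)"
proof -
  have "Pw \<omega> = lext cmul (\<lambda>l. cmul (if wt l = \<omega> then 1 else 0) (single l 1))"
    unfolding Pw_def by (intro arg_cong[where f = "lext cmul"] ext) simp
  then show ?thesis by (simp add: lookup_diag)
qed

lemma Pw_Cn: "v \<in> Cn n ==> Pw \<omega> v \<in> Cn n"
  by (auto simp: Cn_def in_keys_iff lookup_Pw split: if_splits)

lemma Pw_Pw: "Pw \<omega> (Pw \<omega>' v) = (if \<omega> = \<omega>' then Pw \<omega> v else 0)"
  by (auto intro!: poly_mapping_eqI simp: lookup_Pw)

lemma Pw_decomp: "v = (\<Sum>\<omega>\<in>wt ` keys v. Pw \<omega> v)"
proof (rule poly_mapping_eqI)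
  fix l
  have "(\<Sum>\<omega>\<in>wt ` keys v. lookup (Pw \<omega> v) l) = lookup v l"
  proof (cases "l \<in> keys v")
    case True
    then show ?thesis by (simp add: lookup_Pw)
  qed (simp add: lookup_Pw in_keys_iff)
  then show "lookup v l = lookup (\<Sum>\<omega>\<in>wt ` keys v. Pw \<omega> v) l"
    by (simp add: lookup_sum)
qed

end

context twisted
begin

lemma scale_power: "(scale k y) ^ n = scale (k ^ n) (y ^ n)"
  by (induction n) (simp_all add: scale_mult_left scale_mult_right mult.commute)

lemma \<sigma>_power: "\<sigma> (y ^ n) = \<sigma> y ^ n"
  by (induction n) (simp_all add: \<sigma>_mult)

lemma \<sigma>_bas: "\<sigma> (bas (i, j, k)) = scale (q powi (- N * i)) (bas (i, j, k))"
proof -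
  have "\<sigma> (zpow i) = scale (q powi (- N * i)) (zpow i)"
    by (auto simp: zpow_def \<sigma>_power \<sigma>_gen scale_power power_int_power')
  then show ?thesis by (simp add: bas_def \<sigma>_mult \<sigma>_power \<sigma>_gen scale_mult_right)
qed

lemma \<sigma>_Dw: "Dw x y (\<sigma> z) = \<sigma> (Dw x y z)"
proof (rule lin_basis_eqI[OF lin_comp[OF \<sigma>_lin Dw_lin] lin_comp[OF Dw_lin \<sigma>_lin]])
  fix e :: idx obtain i j k where "e = (i, j, k)" by (metis prod_cases3)
  then show "Dw x y (\<sigma> (bas e)) = \<sigma> (Dw x y (bas e))"
    by (simp add: \<sigma>_bas Dw_bas lin_scale[OF Dw_lin] lin_scale[OF \<sigma>_lin] mult.commute)
qed

lemma Dw_der: "is_der (Dw x y)"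
  by (simp add: is_der_def Dw_lin Dw_mult \<sigma>_Dw)

lemma Dq_single:
  assumes "j < length l"
  shows "Dq (Dw x y) j (single l 1) = cmul (wtc x y (l ! j)) (single l 1)"
proof -
  have e: "(map bas l)[j := z] = take j (map bas l) @ z # drop (Suc j) (map bas l)" for z
    using assms by (simp add: upd_conv_take_nth_drop)
  have "(map bas l)[j := bas (l ! j)] = map bas l" using assms by (metis list_update_id nth_map)
  then show ?thesis
    using assms unfolding ten_bas[symmetric]
    by (simp add: Dq_ten[OF Dw_der] Dw_bas e lin_scale[OF ten_lin])
qed

lemma Lq_single:
  assumes "length l = Suc n"
  shows "Lq (Dw x y) n (single l 1) = cmul (wtl x y l) (single l 1)"
proof -
  have "Lq (Dw x y) n (single l 1) = (\<Sum>j\<le>n. cmul (wtc x y (l ! j)) (single l 1))"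
    using assms by (simp add: Lq_def Dq_single)
  also have "\<dots> = cmul (\<Sum>j\<le>n. wtc x y (l ! j)) (single l 1)" by (simp add: free.scale_sum_left)
  also have "(\<Sum>j\<le>n. wtc x y (l ! j)) = wtl x y l"
    using assms by (simp add: wtl_def sum_list_sum_nth atLeast0LessThan lessThan_Suc_atMost)
  finally show ?thesis .
qed

lemma lookup_Lq:
  assumes v: "v \<in> Cn n"
  shows "lookup (Lq (Dw x y) n v) l = wtl x y l * lookup v l"
proof -
  have "Lq (Dw x y) n v = lext cmul (\<lambda>l. cmul (wtl x y l) (single l 1)) v"
    by (rule lin_eqI[OF Lq_lin[OF Dw_der] vlin_lext]) (use v in \<open>auto simp: Cn_def Lq_single\<close>)
  then show ?thesis by (simp add: lookup_diag)
qed

abbreviation Lw :: "nat => tens => tens" where "Lw \<equiv> Lq (Dw 1 \<i>)"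

lemma Lw_Pw: assumes "v \<in> Cn n" shows "Lw n (Pw \<omega> v) = cmul \<omega> (Pw \<omega> v)"
  by (rule poly_mapping_eqI) (simp add: lookup_Lq[OF Pw_Cn[OF assms]] lookup_Pw lookup_cmul)

text \<open>The weight components are the eigenspaces of the Lie derivative. So an operator respects them, up to a
  shift, if it has the corresponding commutation relation with the Lie derivative, and this relation is
  checked slot by slot.\<close>

lemma Pw_comm:
  assumes G: "vlin G" "\<And>v. v \<in> Cn n ==> G v \<in> Cn m"
    "\<And>v. v \<in> Cn n ==> Lw m (G v) = G (Lw n v) + cmul \<kappa> (G v)" and v: "v \<in> Cn n"
  shows "Pw (\<omega> + \<kappa>) (G v) = G (Pw \<omega> v)"
proof (rule lin_eqI[OF lin_comp[OF G(1) Pw_lin] lin_comp[OF Pw_lin G(1)]])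
  fix l assume "l \<in> keys v"
  then have l: "length l = Suc n" using v by (auto simp: Cn_def)
  let ?s = "single l (1::complex)"
  have s: "?s \<in> Cn n" by (rule single_Cn[OF l])
  have "Lw m (G ?s) = cmul (wt l + \<kappa>) (G ?s)"
    by (simp add: G(3)[OF s] Lq_single[OF l] lin_scale[OF G(1)] free.scale_left_distrib)
  then have "wt l' * lookup (G ?s) l' = (wt l + \<kappa>) * lookup (G ?s) l'" for l'
    by (metis lookup_Lq[OF G(2)[OF s]] lookup_cmul)
  then have h: "lookup (G ?s) l' = 0 \<or> wt l' = wt l + \<kappa>" for l' by (metis mult_right_cancel)
  show "Pw (\<omega> + \<kappa>) (G ?s) = G (Pw \<omega> ?s)"
    by (rule poly_mapping_eqI) (use h in \<open>auto simp: Pw_single lookup_Pw lin_0[OF G(1)], metis add_right_cancel\<close>)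
qed

lemmas Pw_comm0 = Pw_comm[where \<kappa> = 0, simplified]

lemma dq_Lq: assumes D: "is_der D" and v: "v \<in> Cn n" and i: "i \<le> n" "0 < n"
  shows "dq i (Lq D n v) = Lq D (n - 1) (dq i v)"
proof (cases "i < n")
  case True then show ?thesis by (intro dq_Lq_less[OF D v]) auto
next
  case False
  then have i: "i = n" using i by simp
  have pm: "cmul ((-1) ^ n) (cmul ((-1) ^ n) w) = w" for w :: tens
    by (simp add: cmul_cmul flip: power_mult_distrib)
  have e: "dq n w = cmul ((-1) ^ n) (dq 0 (tq w))" if "w \<in> Cn n" for w
    using dq0_tq[OF that \<open>0 < n\<close>] pm by simp
  have "dq 0 (tq (Lq D n v)) = Lq D (n - 1) (dq 0 (tq v))"
    using dq_Lq_less[OF D tq_Cn[OF v], of 0 n] \<open>0 < n\<close> by (simp add: Lq_tq_full[OF D v])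
  then show ?thesis by (simp add: i e[OF v] e[OF Lq_Cn[OF D v]] lin_scale[OF Lq_lin[OF D]])
qed

lemma sq_Lq: assumes D: "is_der D" and v: "v \<in> Cn n" shows "Lq D (Suc n) (sq v) = sq (Lq D n v)"
proof -
  have z: "ten (0 # xs) = 0" for xs using lin_0[OF ten_lin[of "[]" xs]] by simp
  have "Dq D 0 (sq v) = 0"
    by (rule vCn_eqI[OF v lin_comp[OF sq_lin Dq_lin[OF D]] vlin_zero]) (simp add: sq_ten Dq_ten[OF D] D_one[OF D] z)
  moreover have "Dq D (Suc j) (sq v) = sq (Dq D j v)" for j
    by (rule vCn_eqI[OF v lin_comp[OF sq_lin Dq_lin[OF D]] lin_comp[OF Dq_lin[OF D] sq_lin]]) (simp add: sq_ten Dq_ten[OF D])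
  ultimately show ?thesis
    by (simp add: Lq_def sum.atMost_Suc_shift lsum del: sum.atMost_Suc)
qed

lemma app1_Lq: assumes D: "is_der D" and v: "v \<in> Cn n" shows "Lq D (Suc n) (app1 v) = app1 (Lq D n v)"
proof -
  have z: "ten (xs @ [0]) = 0" for xs using lin_0[OF ten_lin[of xs "[]"]] by simp
  have "Dq D (Suc n) (app1 v) = 0"
    by (rule vCn_eqI[OF v lin_comp[OF app1_lin Dq_lin[OF D]] vlin_zero])
       (simp add: app1_ten Dq_ten[OF D] D_one[OF D] nth_append list_update_append z)
  moreover have "Dq D j (app1 v) = app1 (Dq D j v)" if "j \<le> n" for j
    by (rule vCn_eqI[OF v lin_comp[OF app1_lin Dq_lin[OF D]] lin_comp[OF Dq_lin[OF D] app1_lin]])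
       (use that in \<open>simp add: app1_ten Dq_ten[OF D] nth_append list_update_append\<close>)
  ultimately show ?thesis by (simp add: Lq_def lin_sum[OF app1_lin])
qed

lemma Lo_Lq: assumes D: "is_der D" and v: "v \<in> Cn n" shows "Lq D n (Lo l v) = Lo l (Lq D n v) + Lo (D l) v"
proof -
  have "Dq D 0 (Lo l v) = Lo l (Dq D 0 v) + Lo (D l) v"
  proof (rule vCn_eqI[OF v lin_comp[OF Lo_lin Dq_lin[OF D]] vlin_plus[OF lin_comp[OF Dq_lin[OF D] Lo_lin] Lo_lin]], goal_cases)
    case (1 xs)
    then obtain m us where "xs = m # us" by (cases xs) auto
    then show ?case
      using lin_add[OF ten_lin[of "[]" us]] by (simp add: Lo_ten Dq_ten[OF D] D_mult[OF D] D_\<sigma>[OF D])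
  qed
  moreover have "Dq D (Suc j) (Lo l v) = Lo l (Dq D (Suc j) v)" for j
  proof (rule vCn_eqI[OF v lin_comp[OF Lo_lin Dq_lin[OF D]] lin_comp[OF Dq_lin[OF D] Lo_lin]], goal_cases)
    case (1 xs)
    then obtain m us where "xs = m # us" by (cases xs) auto
    then show ?case
      by (simp add: Lo_ten Dq_ten[OF D])
  qed
  moreover have "Lq D n w = Dq D 0 w + (\<Sum>j<n. Dq D (Suc j) w)" for w
    unfolding Lq_def by (rule sum.atMost_shift)
  ultimately show ?thesis by (simp add: lin_add[OF Lo_lin] lin_sum[OF Lo_lin] add_ac)
qed

lemma rr_Lq: assumes D: "is_der D" and v: "v \<in> Cn n" shows "Lq D n (rr r v) = rr r (Lq D n v) + rr (D r) v"
proof -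
  have "Dq D n (rr r v) = rr r (Dq D n v) + rr (D r) v"
  proof (rule snoc_eqI[OF v lin_comp[OF onl_lin Dq_lin[OF D]] vlin_plus[OF lin_comp[OF Dq_lin[OF D] onl_lin] onl_lin]])
    fix us :: "'a list" and y assume "length us = n"
    then show "Dq D n (rr r (ten (us @ [y]))) = rr r (Dq D n (ten (us @ [y]))) + rr (D r) (ten (us @ [y]))"
      using lin_add[OF ten_lin[of us "[]"]] by (simp add: rr_ten Dq_ten[OF D] D_mult[OF D] nth_append list_update_append)
  qed
  moreover have "Dq D j (rr r v) = rr r (Dq D j v)" if "j < n" for j
  proof (rule snoc_eqI[OF v lin_comp[OF onl_lin Dq_lin[OF D]] lin_comp[OF Dq_lin[OF D] onl_lin]])
    fix us :: "'a list" and y assume "length us = n"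
    then show "Dq D j (rr r (ten (us @ [y]))) = rr r (Dq D j (ten (us @ [y])))"
      using that by (simp add: rr_ten Dq_ten[OF D] nth_append list_update_append)
  qed
  moreover have "Lq D n w = (\<Sum>j<n. Dq D j w) + Dq D n w" for w
    by (simp add: Lq_def flip: lessThan_Suc_atMost)
  ultimately show ?thesis by (simp add: lin_add[OF onl_lin] lin_sum[OF onl_lin] add_ac)
qed

lemma lr_Lq: assumes D: "is_der D" and v: "v \<in> Cn n"
  shows "Lq D n (lr l r v) = lr l r (Lq D n v) + (lr (D l) r v + lr l (D r) v)"
  by (simp add: lr_def rr_Lq[OF D Lo_Cn[OF v]] Lo_Lq[OF D v] lin_add[OF onl_lin] add_ac)

text \<open>The weight of \<open>S\<^sup>-\<^sup>1(g\<^sub>1) v g\<^sub>2\<close> relative to \<open>v\<close>.\<close>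

definition gsh :: "gen => complex" where
  "gsh g = (case g of GA => 0 | GB => \<i> - 1 | GC => 1 - \<i> | GD => 0)"

lemma \<rho>_Lw: assumes v: "v \<in> Cn n" shows "Lw n (\<rho> g v) = \<rho> g (Lw n v) + cmul (gsh g) (\<rho> g v)"
proof -
  have D: "Dw 1 \<i> a = scale 1 a" "Dw 1 \<i> b = scale \<i> b" "Dw 1 \<i> c = scale (- \<i>) c" "Dw 1 \<i> d = scale (-1) d"
    using Dw_gen[of 1 \<i> GA] Dw_gen[of 1 \<i> GB] Dw_gen[of 1 \<i> GC] Dw_gen[of 1 \<i> GD]
    by (simp_all del: scale_minus_left scale_one)
  note e = adop_def lin_ds[OF Lq_lin[OF Dw_der]] lr_Lq[OF Dw_der v] D
    lin_scale[OF lr_lin1[OF v]] lin_scale[OF lr_lin2[OF v]] gsh_def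
  show ?thesis
    by (cases g; rule poly_mapping_eqI; simp add: e coords del: scale_minus_left scale_one; simp add: algebra_simps)
qed

lemma Pw_dq: "v \<in> Cn n ==> i \<le> n ==> 0 < n ==> Pw \<omega> (dq i v) = dq i (Pw \<omega> v)"
  by (rule Pw_comm0[of "dq i" n "n - 1"]) (use dq_Cn[of _ n i] in \<open>auto simp: dq_lin dq_Lq[OF Dw_der]\<close>)
lemma Pw_tq: "v \<in> Cn n ==> Pw \<omega> (tq v) = tq (Pw \<omega> v)"
  by (rule Pw_comm0[of tq n n]) (auto simp: tq_lin tq_Cn Lq_tq_full[OF Dw_der])
lemma Pw_sq: "v \<in> Cn n ==> Pw \<omega> (sq v) = sq (Pw \<omega> v)"
  by (rule Pw_comm0[of sq n "Suc n"]) (auto simp: sq_lin sq_Cn sq_Lq[OF Dw_der])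
lemma Pw_svq: "v \<in> Cn n ==> Pw \<omega> (svq v) = svq (Pw \<omega> v)"
  using Pw_comm0[of app1 n "Suc n" v \<omega>]
  by (simp add: app1_lin app1_Cn app1_Lq[OF Dw_der] svq_app1 svq_app1[OF Pw_Cn] lin_scale[OF Pw_lin])
lemma Pw_\<rho>: assumes v: "v \<in> Cn n" shows "Pw (\<omega> + gsh g) (\<rho> g v) = \<rho> g (Pw \<omega> v)"
  by (rule Pw_comm[OF \<rho>_lin _ _ v]) (auto intro: \<rho>_Cn \<rho>_Lw)
lemma Pw_tqm: "v \<in> Cn n ==> Pw \<omega> ((tq ^^ m) v) = (tq ^^ m) (Pw \<omega> v)"
  by (induction m) (simp_all add: Pw_tq[OF tqm_Cn])
lemma Pw_Nq: "v \<in> Cn n ==> Pw \<omega> (Nq n v) = Nq n (Pw \<omega> v)"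
  by (simp add: Nq_def lin_sum[OF Pw_lin] Pw_tqm)
lemma Pw_Bq: "v \<in> Cn n ==> Pw \<omega> (Bq n v) = Bq n (Pw \<omega> v)"
  by (simp add: Bq_def lin_diff[OF Pw_lin] Pw_tq[OF sq_Cn[OF Nq_Cn]] Pw_sq[OF Nq_Cn] Pw_Nq)
lemma Pw_bn: "v \<in> Cn n ==> Pw \<omega> (bn n v) = bn n (Pw \<omega> v)"
  by (auto simp: bn_def Sp_def lin_sum[OF Pw_lin] lin_scale[OF Pw_lin] lin_0[OF Pw_lin] Pw_dq intro!: sum.cong simp del: sum.lessThan_Suc)
lemma Pw_Tq: "v \<in> Cn n ==> Pw \<omega> (Tq v) = Tq (Pw \<omega> v)"
  by (metis tq_full Pw_tqm Pw_Cn)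

lemma Pw_Dq: "v \<in> Cn n ==> j \<le> n ==> Pw \<omega> (Dq (Dw x y) j v) = Dq (Dw x y) j (Pw \<omega> v)"
  by (rule lin_eqI[OF lin_comp[OF Dq_lin[OF Dw_der] Pw_lin] lin_comp[OF Pw_lin Dq_lin[OF Dw_der]]])
     (auto simp: Cn_def Dq_single Pw_single lin_scale[OF Pw_lin] lin_0[OF Dq_lin[OF Dw_der]])
lemma Pw_eq: "v \<in> Cn n ==> 0 < n ==> Pw \<omega> (eq (Dw x y) v) = eq (Dw x y) (Pw \<omega> v)"
  by (simp add: eq_def Pw_dq[OF Dq_Cn[OF Dw_der]] Pw_Dq)

lemma Tq_single: "Tq (single l 1) = cmul (q powi (- N * sum_list (map fst l))) (single l 1)"
proof (induction l)
  case Nil then show ?case using Tq_ten[of "[]"] ten_bas[of "[]"] by simp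
next
  case (Cons e l)
  obtain i j k where e: "e = (i, j, k)" by (metis prod_cases3)
  have "Tq (ten (map bas (e # l))) = cns (\<sigma> (bas e)) (ten (map \<sigma> (map bas l)))"
    unfolding Tq_ten by (simp add: ten.simps)
  also have "ten (map \<sigma> (map bas l)) = cmul (q powi (- N * sum_list (map fst l))) (ten (map bas l))"
    using Cons unfolding ten_bas[symmetric] Tq_ten .
  also have "cns (\<sigma> (bas e)) (cmul (q powi (- N * sum_list (map fst l))) (ten (map bas l)))
     = cmul (q powi (- N * sum_list (map fst l)) * q powi (- N * i)) (ten (map bas (e # l)))"
    by (simp add: e \<sigma>_bas lin_scale[OF cns_lin1] lin_scale[OF cns_lin2] cmul_cmul ten.simps)
  also have "q powi (- N * sum_list (map fst l)) * q powi (- N * i) = q powi (- N * sum_list (map fst (e # l)))"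
    using q0 by (simp add: e algebra_simps flip: power_int_add)
  finally show ?case unfolding ten_bas .
qed

lemma Re_wt: "Re (wt l) = of_int (sum_list (map fst l))"
  by (induction l) (auto simp: wtl_def wtc_def)

section \<open>The Koszul complex in weight zero\<close>

text \<open>The weight components of the Koszul complex, shifted so that the differentials preserve them.\<close>

definition PK :: "nat => complex => tens \<times> tens \<times> tens => tens \<times> tens \<times> tens" where
  "PK p \<omega> = (\<lambda>(u, v, t).
     if p = 1 then (Pw (\<omega> - gsh GB) u, Pw (\<omega> - gsh GC) v, Pw \<omega> t)
     else if p = 2 then (Pw \<omega> u, Pw (\<omega> - gsh GB) v, Pw (\<omega> - gsh GC) t)
     else (Pw \<omega> u, Pw \<omega> v, Pw \<omega> t))"

lemma Pw_\<rho>': assumes v: "v \<in> Cn n"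
  shows "Pw \<omega> (\<rho> GA v) = \<rho> GA (Pw \<omega> v)"
    "Pw \<omega> (\<beta> v) = \<beta> (Pw (\<omega> - gsh GB) v)" "Pw \<omega> (\<gamma> v) = \<gamma> (Pw (\<omega> - gsh GC) v)"
    "Pw (\<omega> - gsh GB) (\<gamma> v) = \<gamma> (Pw \<omega> v)" "Pw (\<omega> - gsh GC) (\<beta> v) = \<beta> (Pw \<omega> v)"
  using Pw_\<rho>[OF v, of \<omega> GA] Pw_\<rho>[OF v, of "\<omega> - gsh GB" GB] Pw_\<rho>[OF v, of "\<omega> - gsh GC" GC]
    Pw_\<rho>[OF v, of \<omega> GB] Pw_\<rho>[OF v, of \<omega> GC]
  by (simp_all add: gsh_def algebra_simps)

lemma gsh_cancel: "\<omega> - gsh GB - gsh GC = \<omega>" "\<omega> - gsh GC - gsh GB = \<omega>"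
  by (simp_all add: gsh_def)

lemma PK_KC: "x \<in> KC p k ==> PK p \<omega> x \<in> KC p k"
  by (cases x) (auto simp: KC_def PK_def zero_prod_def lin_0[OF Pw_lin] Pw_Cn split: if_splits)

lemma PK_Kd: assumes "x \<in> KC (Suc p) k" shows "PK p \<omega> (Kd p x) = Kd p (PK (Suc p) \<omega> x)"
proof -
  obtain u v t where x: "x = (u, v, t)" by (metis prod_cases3)
  note l = lin_all[OF Pw_lin] lin_0[OF \<rho>_lin]
  show ?thesis
    using assms by (auto simp: x KC_def PK_def Kd_def zero_prod_def l Pw_\<rho>' gsh_cancel split: if_splits)
qed

lemma PK_svq: assumes "x \<in> KC p k" shows "PK p \<omega> (map3 svq x) = map3 svq (PK p \<omega> x)"
  using assms by (cases x) (auto simp: KC_def PK_def map3_def zero_prod_def Pw_svq lin_0[OF Pw_lin] lin_0[OF svq_lin] split: if_splits)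

lemma PK_stair: "y \<in> KC n 0 ==> j \<le> n ==> PK (n - j) \<omega> (K.stair n j y) = K.stair n j (PK n \<omega> y)"
proof (induction j)
  case (Suc j)
  have s: "K.stair n j y \<in> KC (Suc (n - Suc j)) (Suc j)"
    using K.stair_C[of y n j] Suc.prems by (simp add: Suc_diff_Suc)
  then show ?case
    using Suc PK_Kd[OF s, of \<omega>] PK_svq[OF K.dh_C[OF s], of \<omega>] by (simp add: Suc_diff_Suc)
qed (simp add: PK_svq)

lemma Pw_\<psi>: assumes y: "y \<in> KC n 0" shows "Pw \<omega> (K.\<psi> n y) = K.\<psi> n (PK n \<omega> y)"
proof -
  let ?s = "K.stair n n y"
  have s: "?s \<in> KC 0 (Suc n)" using K.stair_C[OF y, of n] by simp
  then have f: "fst ?s \<in> Cn (Suc n)" by (auto simp: KC_def)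
  have "Pw \<omega> (dq (Suc n) (fst ?s)) = dq (Suc n) (Pw \<omega> (fst ?s))" by (rule Pw_dq[OF f]) auto
  also have "Pw \<omega> (fst ?s) = fst (PK 0 \<omega> ?s)" by (simp add: PK_def split_def)
  also have "PK 0 \<omega> ?s = K.stair n n (PK n \<omega> y)" using PK_stair[OF y, of n] by simp
  finally show ?thesis by (simp add: K.\<psi>_def)
qed

lemma PK_PK: "PK p \<omega> (PK p \<omega> x) = PK p \<omega> x"
  by (cases x) (simp add: PK_def Pw_Pw)

text \<open>Both the comparison map and the boundary are homogeneous, so a representation of a homogeneous cycle can
  be replaced by its component of the same weight.\<close>

theorem weight_cycle:
  assumes z: "z \<in> Cn n" "bn n z = 0" "Pw \<omega> z = z"
  shows "\<exists>y u. K.closed n y \<and> PK n \<omega> y = y \<and> u \<in> Cn (Suc n) \<and> z = K.\<psi> n y + bn (Suc n) u"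
proof -
  have "0 < n ==> bn (Suc (n - 1)) z = 0" using z(2) by simp
  then obtain y u where y: "K.closed n y" and u: "u \<in> Cn (Suc n)" and e: "z = K.\<psi> n y + bn (Suc n) u"
    using K.\<psi>_onto[OF z(1)] by blast
  have yC: "y \<in> KC n 0" using y by (simp add: K.closed_def)
  have "z = Pw \<omega> (K.\<psi> n y + bn (Suc n) u)" using e z(3) by simp
  also have "\<dots> = K.\<psi> n (PK n \<omega> y) + bn (Suc n) (Pw \<omega> u)"
    using Pw_bn[OF u] by (simp add: lin_add[OF Pw_lin] Pw_\<psi>[OF yC])
  finally have "z = K.\<psi> n (PK n \<omega> y) + bn (Suc n) (Pw \<omega> u)" .
  moreover have "K.closed n (PK n \<omega> y)"
    unfolding K.closed_def
  proof (intro conjI impI PK_KC yC)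
    assume n: "0 < n"
    have "PK (n - 1) \<omega> (Kd (n - 1) y) = Kd (n - 1) (PK n \<omega> y)"
      using PK_Kd[of y "n - 1" 0] yC n by simp
    moreover have "Kd (n - 1) y = 0" using y n by (simp add: K.closed_def)
    ultimately show "Kd (n - 1) (PK n \<omega> y) = 0" by (simp add: PK_def zero_prod_def lin_0[OF Pw_lin] split: if_splits)
  qed
  ultimately show ?thesis using PK_PK Pw_Cn[OF u] by blast
qed

text \<open>The Koszul complex has length three.\<close>

theorem no_homology_above_3:
  assumes z: "z \<in> Cn n" "bn n z = 0" "4 \<le> n"
  shows "\<exists>u\<in>Cn (Suc n). z = bn (Suc n) u"
proof -
  have "0 < n ==> bn (Suc (n - 1)) z = 0" using z(2) by simp
  then obtain y u where y: "K.closed n y" and u: "u \<in> Cn (Suc n)" and e: "z = K.\<psi> n y + bn (Suc n) u"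
    using K.\<psi>_onto[OF z(1)] by blast
  have "y = 0" using y z(3) by (auto simp: K.closed_def KC_def)
  have Kd0: "Kd p 0 = 0" for p by (rule K.dh_0)
  have sv0: "map3 svq 0 = 0" by (rule K.sv_0)
  have "K.stair n j 0 = 0" for j by (induction j) (simp_all add: sv0 Kd0)
  then have "K.\<psi> n y = 0" using \<open>y = 0\<close> by (simp add: K.\<psi>_def)
  then show ?thesis using u e by auto
qed

subsection \<open>Linearity of the comparison map\<close>

abbreviation sc :: "complex => tens \<times> tens \<times> tens => tens \<times> tens \<times> tens" where "sc k \<equiv> map3 (cmul k)"

lemma vs_sc: "vector_space sc"
  by unfold_locales (auto simp: map3_def algebra_simps cmul_add free.scale_left_distrib)

lemma Kd_lin: "lin sc sc (Kd p)"
  by (rule linI) (auto simp: Kd_def map3_def lin_as[OF \<rho>_lin] cmul_add cmul_diff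
     free.scale_left_commute zero_prod_def mult.commute)

lemma svq3_lin: "lin sc sc (map3 svq)"
  by (rule linI) (auto simp: map3_def lin_as[OF svq_lin])

lemma stair_lin: "lin sc sc (K.stair n j)"
proof (induction j)
  case 0 then show ?case by (simp add: svq3_lin[unfolded lin_def] lin_def)
next
  case (Suc j)
  from lin_comp[OF lin_comp[OF Suc Kd_lin] svq3_lin] show ?case by (simp add: lin_def)
qed

lemma \<psi>_lin: "lin sc cmul (K.\<psi> n)"
proof -
  have "lin sc cmul fst" by (rule linI) (auto simp: map3_def)
  from lin_comp[OF lin_comp[OF stair_lin this] dq_lin] show ?thesis by (simp add: lin_def K.\<psi>_def)
qed

subsection \<open>The Koszul operators on the weight zero part\<close>

abbreviation T :: "'a => tens" where "T y \<equiv> ten [y]"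

lemma T_lin: "lin scale cmul (\<lambda>y. T y)" using ten_lin[of "[]" "[]"] by simp

lemma T_bas: "T (bas e) = single [e] 1" using ten_bas[of "[e]"] by simp

text \<open>Bases of the weight spaces that occur in the weight zero part of the Koszul complex. All structure
  constants are multiples of \<open>\<nu>\<close>, and \<open>\<nu> k = q\<^bsup>N-2k\<^esup> - 1\<close>
  vanishes only for \<open>N = 2k\<close>: this is where the two cases of the theorem separate.\<close>

definition X :: "nat => tens" where "X k = T (bas (0, k, k))"
definition Y :: "nat => tens" where "Y k = T (bas (1, k, Suc k))"
definition W :: "nat => tens" where "W k = T (bas (-1, Suc k, k))"
definition \<nu> :: "nat => complex" where "\<nu> k = q powi N / (q ^ k * q ^ k) - 1"

lemma q_commute_power:
  assumes "x * y = scale k (y * x)" shows "x * y ^ n = scale (k ^ n) (y ^ n * x)"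
proof (induction n)
  case (Suc n)
  have "x * y ^ Suc n = x * y ^ n * y" by (simp add: power_Suc2 mult.assoc del: power_Suc)
  also have "\<dots> = scale (k ^ n) (y ^ n * (x * y))" by (simp add: Suc scale_mult_left mult.assoc)
  also have "\<dots> = scale (k ^ Suc n) (y ^ Suc n * x)"
    by (simp add: assms scale_mult_right power_Suc2 mult.assoc mult.commute[of k] del: power_Suc)
  finally show ?case .
qed simp

lemma gen_B: "d * (b ^ j * c ^ k) = scale (inverse q ^ (j + k)) (b ^ j * c ^ k * d)"
  "a * (b ^ j * c ^ k) = scale (q ^ (j + k)) (b ^ j * c ^ k * a)"
proof -
  note db = q_commute_power[OF local.db] and ab = q_commute_power[OF rel_ab]
    and dc = q_commute_power[OF local.dc] and ac = q_commute_power[OF rel_ac]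
  have "d * (b ^ j * c ^ k) = d * b ^ j * c ^ k" by (simp add: mult.assoc)
  also have "\<dots> = scale (inverse q ^ j) (b ^ j * (d * c ^ k))" by (simp add: db scale_mult_left mult.assoc)
  finally show "d * (b ^ j * c ^ k) = scale (inverse q ^ (j + k)) (b ^ j * c ^ k * d)"
    by (simp add: dc scale_mult_right power_add mult.assoc)
  have "a * (b ^ j * c ^ k) = a * b ^ j * c ^ k" by (simp add: mult.assoc)
  also have "\<dots> = scale (q ^ j) (b ^ j * (a * c ^ k))" by (simp add: ab scale_mult_left mult.assoc)
  finally show "a * (b ^ j * c ^ k) = scale (q ^ (j + k)) (b ^ j * c ^ k * a)"
    by (simp add: ac scale_mult_right power_add mult.assoc)
qed

lemma gen_bas:
  "b * bas (i, j, k) = bas (i, Suc j, k)" "c * bas (i, j, k) = bas (i, j, Suc k)"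
  "d * bas (0, j, k) = scale (inverse q ^ (j + k)) (bas (-1, j, k))"
  "a * bas (0, j, k) = scale (q ^ (j + k)) (bas (1, j, k))"
  "d * bas (1, j, k) = scale (inverse q ^ (j + k)) (bas (0, j, k) + scale (inverse q) (bas (0, Suc j, Suc k)))"
  "a * bas (-1, j, k) = scale (q ^ (j + k)) (bas (0, j, k) + scale q (bas (0, Suc j, Suc k)))"
  "d * bas (-1, j, k) = scale (inverse q ^ (j + k)) (bas (-2, j, k))"
  "a * bas (1, j, k) = scale (q ^ (j + k)) (bas (2, j, k))"
proof goal_cases
  have cb: "c * b ^ j = b ^ j * c"
    by (induction j) (simp_all add: rel_bc[symmetric] mult.assoc, metis mult.assoc rel_bc)
  have z: "zpow 0 = 1" "zpow 1 = a" "zpow (-1) = d" "zpow 2 = a * a" "zpow (-2) = d * d"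
    by (simp_all add: zpow_def numeral_2_eq_2)
  have bc: "b ^ j * c ^ k * (b * c) = b ^ Suc j * c ^ Suc k"
    by (metis cb_power mult.assoc power_Suc2)
  have dB: "d * (b ^ j * c ^ k * y) = scale (inverse q ^ (j + k)) (b ^ j * c ^ k * (d * y))" for y
    using gen_B(1)[of j k] by (metis mult.assoc scale_mult_left)
  have aB: "a * (b ^ j * c ^ k * y) = scale (q ^ (j + k)) (b ^ j * c ^ k * (a * y))" for y
    using gen_B(2)[of j k] by (metis mult.assoc scale_mult_left)
  case 1 show ?case by (simp add: bas_def mult.assoc)
  case 2 show ?case
    using cb by (simp add: bas_def mult.assoc) (metis mult.assoc)
  case 3 show ?case
    using dB[of 1] by (simp add: bas_def z)
  case 4 show ?case
    using aB[of 1] by (simp add: bas_def z)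
  case 5 show ?case
    using dB[of a] bc by (simp add: bas_def z rel_da distrib_left scale_mult_right del: power_Suc)
  case 6 show ?case
    using aB[of d] bc by (simp add: bas_def z rel_ad distrib_left scale_mult_right del: power_Suc)
  case 7 show ?case
    using dB[of d] by (simp add: bas_def z)
  case 8 show ?case
    using aB[of a] by (simp add: bas_def z)
qed

lemma qN: "q powi N \<noteq> 0" "q powi (- N) = 1 / q powi N"
  using q0 by (simp_all add: power_int_minus_divide)

lemma weight0_ops:
  "\<alpha> 1 (X k) = cmul (\<nu> k) (X k) + cmul (q * \<nu> (Suc k)) (X (Suc k))"
  "\<alpha> (inverse q * inverse q) (X k) = cmul (\<nu> (Suc k)) (X k) + cmul (inverse q * \<nu> (Suc k)) (X (Suc k))"
  "\<alpha> (inverse q) (Y k) = cmul (\<nu> (Suc k)) (Y k) + cmul (q * \<nu> (Suc (Suc k))) (Y (Suc k))"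
  "\<alpha> (inverse q) (W k) = cmul (\<nu> (Suc k)) (W k) + cmul (inverse q * \<nu> (Suc (Suc k))) (W (Suc k))"
  "\<beta> (X k) = cmul (q * \<nu> (Suc k)) (W k)"
  "\<gamma> (X k) = cmul (- (q * q ^ k * q ^ k / q powi N) * \<nu> (Suc k)) (Y k)"
  "\<beta> (Y k) = cmul q (\<alpha> 1 (X (Suc k)))"
  "\<gamma> (W k) = cmul (- (q * q ^ k * q ^ k / q powi N)) (\<alpha> 1 (X (Suc k)))"
  by (rule poly_mapping_eqI; simp add: X_def Y_def W_def adop_def lr_single \<sigma>_gen scale_mult_left gen_bas bas_gens distrib_right
     lin_as[OF T_lin] cmul_add cmul_cmul coords \<nu>_def;
    simp add: power3_eq_cube power_add q0 qN power_int_add power_int_diff power_int_minus_divide field_simps)+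

subsection \<open>Finitely supported sequences\<close>

text \<open>The Koszul differentials in these bases are compositions of the shift, of diagonal operators
  \<open>dg\<close> and of the unipotent operators \<open>U\<close>.\<close>

definition sh :: "(nat \<Rightarrow>\<^sub>0 complex) => (nat \<Rightarrow>\<^sub>0 complex)" where
  "sh = lext cmul (\<lambda>k. single (Suc k) 1)"
definition dg :: "(nat => complex) => (nat \<Rightarrow>\<^sub>0 complex) => (nat \<Rightarrow>\<^sub>0 complex)" where
  "dg h = lext cmul (\<lambda>k. cmul (h k) (single k 1))"
definition U :: "complex => (nat \<Rightarrow>\<^sub>0 complex) => (nat \<Rightarrow>\<^sub>0 complex)" where
  "U r p = p + cmul r (sh p)"

lemma sh_lin: "vlin sh" and dg_lin: "vlin (dg h)" by (simp_all add: sh_def dg_def vlin_lext)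
lemma U_lin: "vlin (U r)" unfolding U_def[abs_def] by (intro vlin_plus lin_id vlin_cmul sh_lin)

lemma lookup_dg: "lookup (dg h p) k = h k * lookup p k"
  by (simp add: dg_def lookup_diag)
lemma lookup_sh: "lookup (sh p) k = (if k = 0 then 0 else lookup p (k - 1))"
proof (cases k)
  case (Suc m)
  then show ?thesis
    by (auto simp: sh_def lookup_lext lookup_single when_def in_keys_iff if_distrib[of "(*) _"] sum.delta cong: if_cong)
qed (simp add: sh_def lookup_lext lookup_single)

lemma sh_single: "sh (single k 1) = single (Suc k) 1"
  and dg_single: "dg h (single k 1) = cmul (h k) (single k 1)"
  by (simp_all add: sh_def dg_def)

text \<open>At most one diagonal entry is zero. The top coefficient of \<open>p\<close> forces this entry right above
  the support of \<open>p\<close>, and then the lowest coefficient cannot be killed.\<close>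

lemma dg_U_inj:
  assumes h: "\<And>k. k \<noteq> k0 ==> h k \<noteq> 0" and r: "r \<noteq> 0" and e: "dg h (U r p) = 0"
  shows "p = 0"
proof (rule ccontr)
  assume "p \<noteq> 0"
  then have ne: "keys p \<noteq> {}" by simp
  let ?K = "Max (keys p)" and ?m = "Min (keys p)"
  have K: "?K \<in> keys p" and m: "?m \<in> keys p" using ne by (auto intro: Max_in Min_in)
  have z: "h k * (lookup p k + r * lookup (sh p) k) = 0" for k
    using arg_cong[OF e, of "\<lambda>w. lookup w k"] by (simp add: lookup_dg U_def coords)
  have "Suc ?K \<notin> keys p" using Max_ge[OF finite_keys, of "Suc ?K" p] by linarith
  then have "h (Suc ?K) = 0"
    using z[of "Suc ?K"] K r by (simp add: lookup_sh in_keys_iff)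
  then have "Suc ?K = k0" using h by blast
  moreover have "?m \<le> ?K" using Min_le[OF _ K] by simp
  ultimately have "h ?m \<noteq> 0" using h[of ?m] by auto
  moreover have "?m = 0 \<or> ?m - 1 \<notin> keys p" using Min_le[of "keys p" "?m - 1"] by fastforce
  ultimately show False using z[of ?m] m by (auto simp: lookup_sh in_keys_iff split: if_splits)
qed

text \<open>The relations \<open>h\<^sub>k e\<^sub>k + r h\<^bsub>k+1\<^esub> e\<^bsub>k+1\<^esub> = 0\<close> in the
  cokernel are solved away from \<open>k\<^sub>0\<close> in both directions, because only
  \<open>h\<^sub>k\<close> with \<open>k = k\<^sub>0\<close> can vanish. So
  \<open>e\<^bsub>k\<^sub>0\<^esub>\<close> spans the cokernel.\<close>

lemma dg_U_span:
  assumes h: "\<And>k. k \<noteq> k0 ==> h k \<noteq> 0" and r: "r \<noteq> 0"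
  shows "\<exists>t p'. p = cmul t (single k0 1) + dg h (U r p')"
proof -
  let ?P = "\<lambda>p. \<exists>t p'. p = cmul t (single k0 1) + dg h (U r p')"
  note l = lin_comp[OF U_lin dg_lin]
  have add: "?P (x + y)" if "?P x" "?P y" for x y
  proof -
    from that obtain t t' p p' where "x = cmul t (single k0 1) + dg h (U r p)" "y = cmul t' (single k0 1) + dg h (U r p')" by blast
    then have "x + y = cmul (t + t') (single k0 1) + dg h (U r (p + p'))"
      by (simp add: lin_add[OF l] free.scale_left_distrib)
    then show ?thesis by blast
  qed
  have mul: "?P (cmul k x)" if "?P x" for k x
  proof -
    from that obtain t p where "x = cmul t (single k0 1) + dg h (U r p)" by blast
    then have "cmul k x = cmul (k * t) (single k0 1) + dg h (U r (cmul k p))"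
      by (simp add: lin_scale[OF l] cmul_add)
    then show ?thesis by blast
  qed
  have im: "?P (dg h (U r p))" for p by (rule exI[of _ 0], rule exI[of _ p]) simp
  have rel: "dg h (U r (single k 1)) = cmul (h k) (single k 1) + cmul (r * h (Suc k)) (single (Suc k) 1)" for k
    by (simp add: U_def sh_single lin_as[OF dg_lin] dg_single)
  have 0: "?P (single k0 1)" by (rule exI[of _ 1], rule exI[of _ 0]) (simp add: lin_0[OF l])
  \<comment> \<open>Upwards the relation is solved for \<open>e (Suc k)\<close>, downwards for \<open>e k\<close>.\<close>
  have up: "?P (single (k0 + k) 1)" for k
  proof (induction k)
    case (Suc k)
    have nz: "r * h (Suc (k0 + k)) \<noteq> 0" using h[of "Suc (k0 + k)"] r by simp
    have "single (Suc (k0 + k)) 1 = cmul (1 / (r * h (Suc (k0 + k)))) (dg h (U r (single (k0 + k) 1)) + cmul (- h (k0 + k)) (single (k0 + k) 1))"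
      unfolding rel using nz by (simp add: cmul_add cmul_cmul free.scale_left_distrib[symmetric])
    moreover have "?P (cmul (1 / (r * h (Suc (k0 + k)))) (dg h (U r (single (k0 + k) 1)) + cmul (- h (k0 + k)) (single (k0 + k) 1)))"
      by (rule mul[OF add[OF im mul[OF Suc]]])
    ultimately show ?case by (simp only: add_Suc_right)
  qed (use 0 in simp)
  have down: "k \<le> k0 ==> ?P (single (k0 - k) 1)" for k
  proof (induction k)
    case (Suc k)
    let ?k = "k0 - Suc k"
    have k: "k0 - k = Suc ?k" using Suc.prems by simp
    have nz: "h ?k \<noteq> 0" using h[of ?k] Suc.prems by simp
    have "single ?k 1 = cmul (1 / h ?k) (dg h (U r (single ?k 1)) + cmul (- (r * h (Suc ?k))) (single (Suc ?k) 1))"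
      unfolding rel using nz by (simp add: cmul_add cmul_cmul free.scale_left_distrib[symmetric])
    moreover have "?P (single (Suc ?k) 1)" using Suc k by simp
    then have "?P (cmul (1 / h ?k) (dg h (U r (single ?k 1)) + cmul (- (r * h (Suc ?k))) (single (Suc ?k) 1)))"
      by (rule mul[OF add[OF im mul]])
    ultimately show ?case by (simp only:)
  qed (use 0 in simp)
  have "?P (single k 1)" for k
    using up[of "k - k0"] down[of "k0 - k"] by (cases "k \<le> k0") auto
  from poly_mapping_lin_induct[of ?P, OF add mul this] show ?thesis by blast
qed

abbreviation VX :: "(nat \<Rightarrow>\<^sub>0 complex) => tens" where "VX \<equiv> lext cmul X"
abbreviation VY :: "(nat \<Rightarrow>\<^sub>0 complex) => tens" where "VY \<equiv> lext cmul Y"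
abbreviation VW :: "(nat \<Rightarrow>\<^sub>0 complex) => tens" where "VW \<equiv> lext cmul W"

lemma XYW_Cn: "X k \<in> Cn 0" "Y k \<in> Cn 0" "W k \<in> Cn 0" by (simp_all add: X_def Y_def W_def ten_Cn)

lemma V_Cn: "VX p \<in> Cn 0" "VY p \<in> Cn 0" "VW p \<in> Cn 0" by (intro Cn_lext XYW_Cn)+

text \<open>The coefficients of \<open>\<gamma>\<close> in these bases.\<close>

definition vg :: "nat => complex" where "vg k = - (q * q ^ k * q ^ k / q powi N)"

lemma V_ops:
  "\<alpha> 1 (VX p) = VX (dg \<nu> (U q p))"
  "\<alpha> (inverse q * inverse q) (VX p) = VX (U (inverse q) (dg (\<lambda>k. \<nu> (Suc k)) p))"
  "\<alpha> (inverse q) (VY p) = VY (dg (\<lambda>k. \<nu> (Suc k)) (U q p))"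
  "\<alpha> (inverse q) (VW p) = VW (dg (\<lambda>k. \<nu> (Suc k)) (U (inverse q) p))"
  "\<beta> (VX p) = VW (dg (\<lambda>k. q * \<nu> (Suc k)) p)"
  "\<gamma> (VX p) = VY (dg (\<lambda>k. vg k * \<nu> (Suc k)) p)"
  "\<beta> (VY p) = cmul q (\<alpha> 1 (VX (sh p)))"
  "\<gamma> (VW p) = \<alpha> 1 (VX (sh (dg vg p)))"
proof goal_cases
  note c = lin_comp[OF _ \<rho>_lin] lin_comp[OF _ vlin_lext] lin_comp[OF _ dg_lin] lin_comp[OF _ U_lin] lin_comp[OF _ sh_lin]
    vlin_minus vlin_cmul vlin_lext dg_lin U_lin sh_lin lin_id
  note e = weight0_ops U_def sh_single dg_single lin_as[OF dg_lin] lin_scale[OF sh_lin]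
    lin_add[OF vlin_lext] lin_uminus[OF vlin_lext] lin_scale[OF vlin_lext] cmul_add cmul_cmul vg_def cmul_diff
  case 1 show ?case
    by (rule lin_eqI[where t = cmul and F = "\<lambda>p. \<alpha> 1 (VX p)"]; (intro c)?; simp add: e del: free.scale_one)
  case 2 show ?case
    by (rule lin_eqI[where t = cmul and F = "\<lambda>p. \<alpha> (inverse q * inverse q) (VX p)"]; (intro c)?; simp add: e mult.commute)
  case 3 show ?case
    by (rule lin_eqI[where t = cmul and F = "\<lambda>p. \<alpha> (inverse q) (VY p)"]; (intro c)?; simp add: e)
  case 4 show ?case
    by (rule lin_eqI[where t = cmul and F = "\<lambda>p. \<alpha> (inverse q) (VW p)"]; (intro c)?; simp add: e)
  case 5 show ?case
    by (rule lin_eqI[where t = cmul and F = "\<lambda>p. \<beta> (VX p)"]; (intro c)?; simp add: e)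
  case 6 show ?case
    by (rule lin_eqI[where t = cmul and F = "\<lambda>p. \<gamma> (VX p)"]; (intro c)?; simp add: e)
  case 7 show ?case
    by (rule lin_eqI[where t = cmul and F = "\<lambda>p. \<beta> (VY p)"]; (intro c)?; simp add: weight0_ops sh_single del: free.scale_one)
  have \<alpha>s: "\<alpha> 1 (cmul k w) = cmul k (\<alpha> 1 w)" for k w
    by (simp add: lin_scale[OF \<rho>_lin] cmul_diff)
  have \<gamma>W: "\<gamma> (W k) = cmul (vg k) (\<alpha> 1 (X (Suc k)))" for k by (simp only: vg_def weight0_ops)
  case 8 show ?case
    by (rule lin_eqI[where t = cmul and F = "\<lambda>p. \<gamma> (VW p)"]; (intro c)?;
        simp add: \<gamma>W sh_single dg_single lin_scale[OF sh_lin] lin_scale[OF vlin_lext] \<alpha>s del: free.scale_one)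
qed

lemma V_lookup: "lookup (VX p) [(0, k, k)] = lookup p k"
  "lookup (VY p) [(1, k, Suc k)] = lookup p k"
  "lookup (VW p) [(-1, Suc k, k)] = lookup p k"
  by (auto simp: X_def Y_def W_def T_bas lookup_lext lookup_single when_def in_keys_iff if_distrib[of "(*) _"] sum.delta cong: if_cong)

lemma V_inj: "VX p = VX p' ==> p = p'" "VY p = VY p' ==> p = p'" "VW p = VW p' ==> p = p'"
  by (rule poly_mapping_eqI; metis V_lookup)+

lemma wt_single_idx: "wt [(i, j, k)] = of_int i + \<i> * of_int (int j - int k)"
  by (simp add: wtl_def wtc_def)

lemma wt_eq_Complex: "of_int i + \<i> * of_int m = (of_int i' + \<i> * of_int m' :: complex) \<longleftrightarrow> i = i' \<and> m = m'"
  by (auto simp: complex_eq_iff)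

lemma lext_singles:
  assumes f: "inj f" and w: "\<And>l. lookup w l \<noteq> 0 ==> l \<in> range f"
  shows "\<exists>p. w = lext cmul (\<lambda>k. single (f k) 1) p"
proof
  show "w = lext cmul (\<lambda>k. single (f k) 1) (Poly_Mapping.map_key f w)"
  proof (rule poly_mapping_eqI)
    fix l
    show "lookup w l = lookup (lext cmul (\<lambda>k. single (f k) 1) (Poly_Mapping.map_key f w)) l"
    proof (cases "l \<in> range f")
      case True
      then obtain k where l: "l = f k" by blast
      have "(if f x = f k then 1 else 0) = (if x = k then 1 else 0 :: complex)" for x using f by (simp add: inj_eq)
      then show ?thesis
        using f by (auto simp: l lookup_lext lookup_single when_def map_key.rep_eq in_keys_iff if_distrib[of "(*) _"] sum.delta cong: if_cong)
    next
      case False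
      have "f x \<noteq> l" for x using False by blast
      then show ?thesis using w[of l] False by (auto simp: lookup_lext lookup_single when_def)
    qed
  qed
qed

lemma weight_support:
  assumes "w \<in> Cn 0" "Pw \<omega> w = w" "\<omega> = of_int i0 + \<i> * of_int m"
    and f: "\<And>j k. int j - int k = m ==> [(i0, j, k)] \<in> range f"
    and nz: "lookup w l \<noteq> 0"
  shows "l \<in> range f"
proof -
  obtain i j k where l: "l = [(i, j, k)]" using assms(1) nz by (fastforce simp: Cn_def in_keys_iff length_Suc_conv)
  have "wt l = \<omega>" using nz assms(2) lookup_Pw[of \<omega> w l] by (auto split: if_splits)
  then have "i = i0 \<and> int j - int k = m" using wt_eq_Complex[of i "int j - int k" i0 m] by (simp add: l wt_single_idx assms(3))
  then show ?thesis using f by (simp add: l)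
qed

lemma weight_VX: assumes "w \<in> Cn 0" "Pw 0 w = w" shows "\<exists>p. w = VX p"
  unfolding X_def T_bas
proof (rule lext_singles)
  show "inj (\<lambda>k. [(0::int, k, k)])" by (auto simp: inj_def)
  show "l \<in> range (\<lambda>k. [(0::int, k, k)])" if "lookup w l \<noteq> 0" for l
    by (rule weight_support[OF assms _ _ that, of 0 0]) auto
qed

lemma weight_VY: assumes "w \<in> Cn 0" "Pw (0 - gsh GB) w = w" shows "\<exists>p. w = VY p"
  unfolding Y_def T_bas
proof (rule lext_singles)
  show "inj (\<lambda>k. [(1::int, k, Suc k)])" by (auto simp: inj_def)
  show "l \<in> range (\<lambda>k. [(1::int, k, Suc k)])" if "lookup w l \<noteq> 0" for l
    by (rule weight_support[OF assms _ _ that, of 1 "-1"]) (auto simp: gsh_def)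
qed

lemma weight_VW: assumes "w \<in> Cn 0" "Pw (0 - gsh GC) w = w" shows "\<exists>p. w = VW p"
  unfolding W_def T_bas
proof (rule lext_singles)
  show "inj (\<lambda>k. [(-1::int, Suc k, k)])" by (auto simp: inj_def)
  show "l \<in> range (\<lambda>k. [(-1::int, Suc k, k)])" if "lookup w l \<noteq> 0" for l
    by (rule weight_support[OF assms _ _ that, of "-1" 1]) (auto simp: gsh_def image_iff)
qed

section \<open>Koszul homology in weight zero\<close>

abbreviation \<nu>' :: "nat => complex" where "\<nu>' k \<equiv> \<nu> (Suc k)"
abbreviation e :: "nat => (nat \<Rightarrow>\<^sub>0 complex)" where "e k \<equiv> single k 1"

text \<open>\<open>\<nu>\<close> vanishes at most at \<open>k\<^sub>0\<close>. The value \<open>k\<^sub>0 = 0\<close>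
  belongs to the regular case, in which the shifted sequence \<open>\<nu>'\<close> has no zero, and
  \<open>k\<^sub>0 = r + 1\<close> to the singular case.\<close>

definition nz_off :: "nat => bool" where "nz_off k0 \<longleftrightarrow> (\<forall>k. k \<noteq> k0 --> \<nu> k \<noteq> 0)"

lemma nz_offD: "nz_off k0 ==> k \<noteq> k0 ==> \<nu> k \<noteq> 0" by (simp add: nz_off_def)

lemma add_eq_swap: "w + x = y + z ==> z - x = w - (y :: 'x::ab_group_add)"
proof -
  assume a: "w + x = y + z"
  have "z - x = (y + z) - x - y" by simp
  then show ?thesis unfolding a[symmetric] by simp
qed

lemma V_single: "VX (e k) = X k" "VY (e k) = Y k" "VW (e k) = W k" by simp_all

lemmas V_simps = V_ops lin_all[OF vlin_lext]

lemma \<alpha>_lin: "vlin (\<alpha> k)" by (intro vlin_minus vlin_cmul \<rho>_lin lin_id)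

lemma \<alpha>_VX_inj:
  assumes "nz_off k0" "\<alpha> 1 (VX p) = 0" shows "p = 0"
proof -
  have "VX (dg \<nu> (U q p)) = VX 0" using assms(2) unfolding V_ops by (simp add: lin_0[OF vlin_lext])
  then have "dg \<nu> (U q p) = 0" by (rule V_inj)
  with nz_offD[OF assms(1)] q0 show ?thesis by (rule dg_U_inj)
qed

lemma weight0_KC:
  shows "y \<in> KC 0 0 ==> PK 0 0 y = y ==> \<exists>p. y = (VX p, 0, 0)"
    "y \<in> KC 3 0 ==> PK 3 0 y = y ==> \<exists>p. y = (VX p, 0, 0)"
    "y \<in> KC 1 0 ==> PK 1 0 y = y ==> \<exists>u w x. y = (VY u, VW w, VX x)"
    "y \<in> KC 2 0 ==> PK 2 0 y = y ==> \<exists>x u w. y = (VX x, VY u, VW w)"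
  using weight_VX weight_VY weight_VW by (cases y, force simp: KC_def PK_def)+

lemma Koszul_H0:
  assumes "nz_off k0" and "K.closed 0 y" "PK 0 0 y = y"
  shows "\<exists>t p. y = sc t (X k0, 0, 0) + Kd 0 (0, 0, VX p)"
proof -
  from assms(2) have "y \<in> KC 0 0" by (simp add: K.closed_def)
  then obtain x where y: "y = (VX x, 0, 0)" using weight0_KC(1) assms(3) by blast
  obtain t p where x: "x = cmul t (e k0) + dg \<nu> (U q p)"
    using dg_U_span[of k0 \<nu> q x] nz_offD[OF assms(1)] q0 by auto
  have "Kd 0 (0, 0, VX p) = (\<alpha> 1 (VX p), 0, 0)" by (simp add: Kd_def lin_0[OF \<rho>_lin])
  then have "y = sc t (X k0, 0, 0) + Kd 0 (0, 0, VX p)"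
    unfolding V_ops by (simp add: y x map3_def lin_as[OF vlin_lext])
  then show ?thesis by blast
qed

text \<open>The 1-cycles of weight zero: since \<open>\<alpha>\<close> is injective on weight zero, the third entry is
  determined by the first two.\<close>

definition c1 :: "(nat \<Rightarrow>\<^sub>0 complex) => (nat \<Rightarrow>\<^sub>0 complex) => tens \<times> tens \<times> tens" where
  "c1 u w = (VY u, VW w, VX (- cmul q (sh u) - sh (dg vg w)))"

lemma c1_lin: "c1 (u + u') (w + w') = c1 u w + c1 u' w'" "c1 (cmul t u) (cmul t w) = sc t (c1 u w)"
  by (simp_all add: c1_def map3_def V_simps lin_add[OF sh_lin] lin_add[OF dg_lin] lin_scale[OF sh_lin] lin_scale[OF dg_lin] cmul_add
     cmul_diff free.scale_left_commute)

lemma c1_unique: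
  assumes \<nu>: "nz_off k0" and "Kd 0 (VY u, VW w, VX x) = 0"
  shows "(VY u, VW w, VX x) = c1 u w"
proof -
  have "\<beta> (VY u) + \<gamma> (VW w) + \<alpha> 1 (VX x) = 0" using assms(2) by (simp only: Kd_def split if_True simp_thms zero_prod_def prod.inject)
  then have "\<alpha> 1 (VX (cmul q (sh u) + sh (dg vg w) + x)) = 0"
    unfolding V_ops(7,8) by (simp only: lin_as[OF vlin_lext] lin_as[OF \<alpha>_lin])
  with \<nu> have "cmul q (sh u) + sh (dg vg w) + x = 0" by (rule \<alpha>_VX_inj)
  then have "x = - cmul q (sh u) - sh (dg vg w)" by (metis add_eq_0_iff2 minus_add_distrib diff_conv_add_uminus add.commute)
  then show ?thesis by (simp add: c1_def)
qed

text \<open>The third entry need not be computed: the image is a cycle, and these are determined by their first two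
  entries.\<close>

lemma Kd_1_V:
  assumes \<nu>: "nz_off k0"
  shows "Kd 1 (VX x, VY u, VW w) = c1 (dg (\<lambda>k. vg k * \<nu>' k) x - dg \<nu>' (U q u)) (- dg (\<lambda>k. q * \<nu>' k) x - dg \<nu>' (U (inverse q) w))"
    (is "?l = c1 ?u ?w")
proof -
  have "\<exists>z. ?l = (VY ?u, VW ?w, VX z)"
  proof
    show "?l = (VY ?u, VW ?w, VX (dg \<nu> (U q (cmul q (sh u) + sh (dg vg w)))))"
      unfolding Kd_def by (simp add: V_simps free.scale_one lin_as[OF U_lin] lin_as[OF dg_lin] V_ops(1)[simplified] del: )
  qed
  then obtain z where z: "?l = (VY ?u, VW ?w, VX z)" ..
  have "(VX x, VY u, VW w) \<in> KC 2 0" by (simp add: KC_def V_Cn)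
  then have "Kd 0 ?l = 0" using K.dh_dh[of "(VX x, VY u, VW w)" 0 0] by (simp add: numeral_2_eq_2)
  then have "Kd 0 (VY ?u, VW ?w, VX z) = 0" by (simp only: z)
  from c1_unique[OF \<nu> this] show ?thesis by (simp only: z)
qed

lemma weight0_closed1:
  assumes \<nu>: "nz_off k0" and "K.closed 1 y" "PK 1 0 y = y"
  shows "\<exists>u w. y = c1 u w"
proof -
  from assms(2) have yC: "y \<in> KC 1 0" and c: "Kd 0 y = 0" by (auto simp: K.closed_def)
  then obtain u w x where y: "y = (VY u, VW w, VX x)" using weight0_KC(3) assms(3) by blast
  have "y = c1 u w" unfolding y by (rule c1_unique[OF \<nu>]) (use c y in auto)
  then show ?thesis by blast
qed

lemma vg_nz: "vg k \<noteq> 0" using q0 by (simp add: vg_def)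

text \<open>The first entry is removed using the diagonal operator, which is invertible, and the second one up to the
  cokernel described by \<open>dg_U_span\<close>.\<close>

lemma Koszul_H1_regular:
  assumes \<nu>: "nz_off 0" and "K.closed 1 y" "PK 1 0 y = y"
  shows "\<exists>t y'. y' \<in> KC 2 0 \<and> y = sc t (c1 0 (e 0)) + Kd 1 y'"
proof -
  obtain u w where y: "y = c1 u w" using weight0_closed1[OF assms] by blast
  have nz: "vg k * \<nu>' k \<noteq> 0" for k using nz_offD[OF \<nu>, of "Suc k"] vg_nz by simp
  let ?p = "dg (\<lambda>k. 1 / (vg k * \<nu>' k)) u"
  have u: "dg (\<lambda>k. vg k * \<nu>' k) ?p = u"
    using nz by (intro poly_mapping_eqI) (simp add: lookup_dg field_simps)
  obtain t p where w: "w + dg (\<lambda>k. q * \<nu>' k) ?p = cmul t (e 0) + dg \<nu>' (U (inverse q) p)"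
    using dg_U_span[of 0 \<nu>' "inverse q" "w + dg (\<lambda>k. q * \<nu>' k) ?p"] nz_offD[OF \<nu>] q0 by auto
  have "Kd 1 (VX ?p, VY 0, VW (- p)) = c1 u (w - cmul t (e 0))"
    unfolding Kd_1_V[OF \<nu>] u lin_0[OF U_lin] lin_0[OF dg_lin] lin_uminus[OF U_lin] lin_uminus[OF dg_lin]
    using add_eq_swap[OF w] by simp
  moreover have "c1 u w = sc t (c1 0 (e 0)) + c1 u (w - cmul t (e 0))"
    by (simp add: c1_lin(1)[symmetric] c1_lin(2)[symmetric])
  moreover have "(VX ?p, VY 0, VW (- p)) \<in> KC 2 0" by (simp add: KC_def V_Cn)
  ultimately have "(VX ?p, VY 0, VW (- p)) \<in> KC 2 0 \<and> y = sc t (c1 0 (e 0)) + Kd 1 (VX ?p, VY 0, VW (- p))"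
    using y by (simp only: simp_thms)
  then show ?thesis by blast
qed

text \<open>The entries are reduced independently of each other, each with a one-dimensional cokernel.\<close>

lemma Koszul_H1_singular:
  assumes \<nu>: "nz_off (Suc r)" and "K.closed 1 y" "PK 1 0 y = y"
  shows "\<exists>s t y'. y' \<in> KC 2 0 \<and> y = sc s (c1 (e r) 0) + sc t (c1 0 (e r)) + Kd 1 y'"
proof -
  obtain u w where y: "y = c1 u w" using weight0_closed1[OF assms] by blast
  have nz: "k \<noteq> r ==> \<nu>' k \<noteq> 0" for k using nz_offD[OF \<nu>, of "Suc k"] by simp
  obtain t p where w: "w = cmul t (e r) + dg \<nu>' (U (inverse q) p)"
    using dg_U_span[of r \<nu>' "inverse q" w] nz q0 by auto
  obtain s p' where u: "u = cmul s (e r) + dg \<nu>' (U q p')"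
    using dg_U_span[of r \<nu>' q u] nz q0 by auto
  have "Kd 1 (VX 0, VY (- p'), VW (- p)) = c1 (u - cmul s (e r)) (w - cmul t (e r))"
    unfolding Kd_1_V[OF \<nu>] lin_0[OF U_lin] lin_0[OF dg_lin] lin_uminus[OF U_lin] lin_uminus[OF dg_lin]
    using w u by (simp add: algebra_simps)
  moreover have "c1 u w = sc s (c1 (e r) 0) + sc t (c1 0 (e r)) + c1 (u - cmul s (e r)) (w - cmul t (e r))"
    by (simp add: c1_lin(1)[symmetric] c1_lin(2)[symmetric])
  moreover have "(VX 0, VY (- p'), VW (- p)) \<in> KC 2 0" by (simp add: KC_def V_Cn)
  ultimately have "(VX 0, VY (- p'), VW (- p)) \<in> KC 2 0 \<and> y = sc s (c1 (e r) 0) + sc t (c1 0 (e r)) + Kd 1 (VX 0, VY (- p'), VW (- p))"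
    using y by (simp only: simp_thms)
  then show ?thesis by blast
qed

lemma weight0_closed2:
  assumes \<nu>: "nz_off k0" and "K.closed 2 y" "PK 2 0 y = y"
  shows "\<exists>x w. y = (VX x, VY (- cmul (inverse q) (dg vg w)), VW w) \<and> dg \<nu>' (cmul q x + U (inverse q) w) = 0"
proof -
  from assms(2) have yC: "y \<in> KC 2 0" and c: "Kd 1 y = 0" by (auto simp: K.closed_def)
  then obtain x u w where y: "y = (VX x, VY u, VW w)" using weight0_KC(4) assms(3) by blast
  have c1: "c1 (dg (\<lambda>k. vg k * \<nu>' k) x - dg \<nu>' (U q u)) (- dg (\<lambda>k. q * \<nu>' k) x - dg \<nu>' (U (inverse q) w)) = 0"
    using c unfolding y Kd_1_V[OF \<nu>] .
  then have "VW (- dg (\<lambda>k. q * \<nu>' k) x - dg \<nu>' (U (inverse q) w)) = VW 0" by (simp add: c1_def zero_prod_def lin_0[OF vlin_lext])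
  then have "- dg (\<lambda>k. q * \<nu>' k) x - dg \<nu>' (U (inverse q) w) = 0" by (rule V_inj)
  then have "dg (\<lambda>k. q * \<nu>' k) x + dg \<nu>' (U (inverse q) w) = 0"
    by (metis add_uminus_conv_diff minus_add_distrib neg_equal_0_iff_equal)
  moreover have "dg (\<lambda>k. q * \<nu>' k) x = dg \<nu>' (cmul q x)"
    by (rule poly_mapping_eqI) (simp add: lookup_dg lookup_cmul)
  ultimately have e1: "dg \<nu>' (cmul q x + U (inverse q) w) = 0" by (simp add: lin_add[OF dg_lin])
  have "\<beta> (VY u) + \<gamma> (VW w) = 0" using c by (simp only: y Kd_def split if_False if_True zero_prod_def prod.inject one_neq_zero simp_thms)
  then have "\<alpha> 1 (VX (cmul q (sh u) + sh (dg vg w))) = 0"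
    unfolding V_ops(7,8) by (simp only: lin_as[OF vlin_lext] lin_as[OF \<alpha>_lin])
  with \<nu> have "cmul q (sh u) + sh (dg vg w) = 0" by (rule \<alpha>_VX_inj)
  then have s: "sh (cmul q u + dg vg w) = 0" by (simp add: lin_as[OF sh_lin])
  have "u = - cmul (inverse q) (dg vg w)"
  proof (rule poly_mapping_eqI)
    fix k
    have "lookup (sh (cmul q u + dg vg w)) (Suc k) = 0" using s by simp
    then have "q * lookup u k + vg k * lookup w k = 0" by (simp add: lookup_sh coords lookup_dg)
    then have "q * lookup u k = - (vg k * lookup w k)" by (simp add: eq_neg_iff_add_eq_0)
    then show "lookup u k = lookup (- cmul (inverse q) (dg vg w)) k"
      using q0 by (simp add: lookup_cmul lookup_dg lookup_minus field_simps)
  qed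
  then show ?thesis using y e1 by blast
qed

lemma Kd_2_V: "Kd 2 (VX p, 0, 0) = (VX (U (inverse q) (dg \<nu>' p)), VY (dg (\<lambda>k. vg k * \<nu>' k) p), VW (- dg (\<lambda>k. q * \<nu>' k) p))"
  unfolding Kd_def by (simp add: V_ops(2,5,6) lin_uminus[OF vlin_lext])

lemma Koszul_H2_regular:
  assumes \<nu>: "nz_off 0" and "K.closed 2 y" "PK 2 0 y = y"
  shows "\<exists>y'\<in>KC 3 0. y = Kd 2 y'"
proof -
  obtain x w where y: "y = (VX x, VY (- cmul (inverse q) (dg vg w)), VW w)" and xw: "dg \<nu>' (cmul q x + U (inverse q) w) = 0"
    using weight0_closed2[OF assms] by blast
  have nz: "\<nu>' k \<noteq> 0" for k using nz_offD[OF \<nu>, of "Suc k"] by simp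
  let ?p = "- cmul (inverse q) (dg (\<lambda>k. 1 / \<nu>' k) w)"
  have "cmul q x + U (inverse q) w = 0"
    using xw nz by (intro poly_mapping_eqI) (metis lookup_dg lookup_zero mult_eq_0_iff)
  then have "cmul q x = - U (inverse q) w" by (simp add: eq_neg_iff_add_eq_0)
  then have "cmul (inverse q) (cmul q x) = cmul (inverse q) (- U (inverse q) w)" by simp
  then have x: "x = - cmul (inverse q) (U (inverse q) w)" using q0 by simp
  have 1: "dg \<nu>' ?p = - cmul (inverse q) w" using nz by (intro poly_mapping_eqI) (simp add: lookup_dg lookup_cmul lookup_minus)
  have 2: "dg (\<lambda>k. vg k * \<nu>' k) ?p = - cmul (inverse q) (dg vg w)"
    using nz by (intro poly_mapping_eqI) (simp add: lookup_dg lookup_cmul lookup_minus)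
  have 3: "- dg (\<lambda>k. q * \<nu>' k) ?p = w"
    using nz q0 by (intro poly_mapping_eqI) (simp add: lookup_dg lookup_cmul lookup_minus)
  have "y = Kd 2 (VX ?p, 0, 0)"
    unfolding Kd_2_V 1 2 3 y x by (simp add: lin_uminus[OF U_lin] lin_scale[OF U_lin])
  moreover have "(VX ?p, 0, 0) \<in> KC 3 0" by (simp add: KC_def V_Cn)
  ultimately show ?thesis by blast
qed

text \<open>Here \<open>\<nu>'\<close> vanishes exactly at \<open>r\<close>, so the equation for \<open>x\<close>
  leaves its coefficient at \<open>r\<close> free, and the coefficient of \<open>w\<close> at
  \<open>r\<close> is out of reach of boundaries. These are the two parameters.\<close>

lemma Koszul_H2_singular:
  assumes \<nu>: "nz_off (Suc r)" "\<nu> (Suc r) = 0" and "K.closed 2 y" "PK 2 0 y = y"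
  shows "\<exists>s t. \<exists>y'\<in>KC 3 0. y = sc s (X r, 0, 0) + sc t (- X (Suc r), Y r, cmul (q * q) (W r)) + Kd 2 y'"
proof -
  obtain x w where y: "y = (VX x, VY (- cmul (inverse q) (dg vg w)), VW w)" and xw: "dg \<nu>' (cmul q x + U (inverse q) w) = 0"
    using weight0_closed2[OF \<nu>(1) assms(3,4)] by blast
  have nz: "k \<noteq> r ==> \<nu>' k \<noteq> 0" for k using nz_offD[OF \<nu>(1), of "Suc k"] by simp
  let ?w = "lookup w" and ?x = "lookup x"
  let ?p = "- cmul (inverse q) (dg (\<lambda>k. if k = r then 0 else 1 / \<nu>' k) w)"
  \<comment> \<open>\<open>?p\<close> solves the equations away from \<open>r\<close>, and \<open>?t\<close> and \<open>?s\<close> are what is left at \<open>r\<close>, corrected by the shift.\<close>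
  let ?t = "?w r / (q * q)" and ?s = "?x r + inverse q * inverse q * (if r = 0 then 0 else ?w (r - 1))"
  have qN: "q powi N = q * q * q ^ r * q ^ r" using \<nu>(2) q0 by (simp add: \<nu>_def field_simps)
  have solve: "q * z = - z' ==> z = - inverse q * z'" for z z' using q0 by (simp add: field_simps)
  have xk: "k \<noteq> r ==> ?x k = - inverse q * (?w k + inverse q * (if k = 0 then 0 else ?w (k - 1)))" for k
  proof -
    assume k: "k \<noteq> r"
    have "\<nu>' k * (q * ?x k + (?w k + inverse q * (if k = 0 then 0 else ?w (k - 1)))) = 0"
      using arg_cong[OF xw, of "\<lambda>p. lookup p k"] by (simp add: lookup_dg coords U_def lookup_sh)
    then have "q * ?x k = - (?w k + inverse q * (if k = 0 then 0 else ?w (k - 1)))"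
      using nz[OF k] by (simp only: mult_eq_0_iff eq_neg_iff_add_eq_0 simp_thms)
    then show ?thesis by (rule solve)
  qed
  have P: "lookup (dg \<nu>' ?p) k = (if k = r then 0 else - (inverse q * ?w k))" for k
    using nz[of k] by (simp add: lookup_dg lookup_cmul)
  have 1: "x = cmul ?s (e r) - cmul ?t (e (Suc r)) + U (inverse q) (dg \<nu>' ?p)"
  proof (rule poly_mapping_eqI)
    fix k
    have R: "lookup (cmul ?s (e r) - cmul ?t (e (Suc r)) + U (inverse q) (dg \<nu>' ?p)) k
      = (if k = r then ?s else 0) - (if k = Suc r then ?t else 0)
        + ((if k = r then 0 else - (inverse q * ?w k)) + inverse q * (if k = 0 then 0 else if k - 1 = r then 0 else - (inverse q * ?w (k - 1))))"
      by (auto simp: coords lookup_sh U_def lookup_single when_def P)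
    show "?x k = lookup (cmul ?s (e r) - cmul ?t (e (Suc r)) + U (inverse q) (dg \<nu>' ?p)) k"
    proof (cases "k = r")
      case True then show ?thesis unfolding R by (cases k) (auto simp: algebra_simps)
    next
      case False
      show ?thesis unfolding R xk[OF False] using False q0
        by (cases k) (auto simp: algebra_simps divide_inverse)
    qed
  qed
  have 2: "- cmul (inverse q) (dg vg w) = cmul ?t (e r) + dg (\<lambda>k. vg k * \<nu>' k) ?p"
    using nz q0 by (intro poly_mapping_eqI) (auto simp: coords lookup_dg lookup_single when_def vg_def qN field_simps)
  have 3: "w = cmul (?t * (q * q)) (e r) - dg (\<lambda>k. q * \<nu>' k) ?p"
    using nz q0 by (intro poly_mapping_eqI) (auto simp: coords lookup_dg lookup_single when_def field_simps)
  have "(VX x, VY (- cmul (inverse q) (dg vg w)), VW w) = sc ?s (X r, 0, 0) + sc ?t (- X (Suc r), Y r, cmul (q * q) (W r)) + Kd 2 (VX ?p, 0, 0)"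
    unfolding Kd_2_V by (subst 3, subst 2, subst 1) (simp add: map3_def lin_add[OF vlin_lext] lin_diff[OF vlin_lext] lin_uminus[OF vlin_lext] lin_scale[OF vlin_lext])
  moreover have "(VX ?p, 0, 0) \<in> KC 3 0" by (simp add: KC_def V_Cn)
  ultimately show ?thesis unfolding y by blast
qed

lemma weight0_closed3:
  assumes "K.closed 3 y" "PK 3 0 y = y"
  shows "\<exists>x. y = (VX x, 0, 0) \<and> dg \<nu>' x = 0"
proof -
  from assms(1) have yC: "y \<in> KC 3 0" and c: "Kd 2 y = 0" by (auto simp: K.closed_def)
  then obtain x where y: "y = (VX x, 0, 0)" using weight0_KC(2) assms(2) by blast
  have "VW (- dg (\<lambda>k. q * \<nu>' k) x) = VW 0" using c unfolding y Kd_2_V by (simp add: zero_prod_def lin_0[OF vlin_lext])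
  then have "- dg (\<lambda>k. q * \<nu>' k) x = 0" by (rule V_inj)
  then have "dg (\<lambda>k. q * \<nu>' k) x = 0" by simp
  then have "dg \<nu>' x = 0" using q0 by (intro poly_mapping_eqI) (metis lookup_dg lookup_zero mult_eq_0_iff)
  then show ?thesis using y by blast
qed

lemma Koszul_H3_regular:
  assumes \<nu>: "nz_off 0" and "K.closed 3 y" "PK 3 0 y = y"
  shows "y = 0"
proof -
  obtain x where y: "y = (VX x, 0, 0)" and x: "dg \<nu>' x = 0" using weight0_closed3[OF assms(2,3)] by blast
  have "x = 0" using x nz_offD[OF \<nu>] by (intro poly_mapping_eqI) (metis lookup_dg lookup_zero mult_eq_0_iff Zero_not_Suc)
  then show ?thesis by (simp add: y zero_prod_def lin_0[OF vlin_lext])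
qed

lemma Koszul_H3_singular:
  assumes \<nu>: "nz_off (Suc r)" and "K.closed 3 y" "PK 3 0 y = y"
  shows "\<exists>t. y = sc t (X r, 0, 0)"
proof -
  obtain x where y: "y = (VX x, 0, 0)" and x: "dg \<nu>' x = 0" using weight0_closed3[OF assms(2,3)] by blast
  have "lookup x k = 0" if "k \<noteq> r" for k using x nz_offD[OF \<nu>, of "Suc k"] that by (metis lookup_dg lookup_zero mult_eq_0_iff Suc_inject)
  then have "x = cmul (lookup x r) (e r)"
    by (intro poly_mapping_eqI) (auto simp: lookup_cmul lookup_single when_def)
  then have "VX x = cmul (lookup x r) (X r)" by (metis lin_scale[OF vlin_lext] V_single(1))
  then show ?thesis by (auto simp: y map3_def)
qed

subsection \<open>Nonvanishing classes\<close>

lemma vs_complex: "vector_space ((*) :: complex => _)" by unfold_locales (simp_all add: algebra_simps)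

text \<open>A functional with geometric weights, divided by the diagonal entries, kills the relations that
  \<open>dg_U_span\<close> uses.\<close>

lemma functional_dg_U:
  assumes nz: "\<And>k. h k \<noteq> 0" and g: "\<And>k. g k + r * g (Suc k) = 0"
  shows "lext (*) (\<lambda>k. g k / h k) (dg h (U r p)) = (0 :: complex)"
proof (rule lin_eqI[OF lin_comp[OF lin_comp[OF U_lin dg_lin] lin_lext[OF vs_complex]] lin_zero[OF vs_complex]])
  fix k
  have E: "dg h (U r (e k)) = single k (h k) + single (Suc k) (r * h (Suc k))"
    by (rule poly_mapping_eqI) (simp add: U_def sh_single lookup_dg coords lookup_single when_def)
  show "lext (*) (\<lambda>k. g k / h k) (dg h (U r (e k))) = 0"
    unfolding E lin_add[OF lin_lext[OF vs_complex]] lext_single[OF vs_complex] using nz[of k] nz[of "Suc k"] g[of k] by simp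
qed

lemma PK_onto:
  assumes "y = Kd n y'" "PK n 0 y = y" "y' \<in> KC (Suc n) 0"
  shows "\<exists>y''\<in>KC (Suc n) 0. PK (Suc n) 0 y'' = y'' \<and> y = Kd n y''"
  using PK_Kd[OF assms(3), of 0] PK_KC[OF assms(3), of 0] assms(1,2) PK_PK by metis

lemma X_0_not_boundary:
  assumes \<nu>: "nz_off 0" and y': "y' \<in> KC 1 0"
  shows "(X 0, 0, 0) \<noteq> Kd 0 y'"
proof
  assume a: "(X 0, 0, 0) = Kd 0 y'"
  have "Pw 0 (X 0) = X 0" by (rule poly_mapping_eqI) (auto simp: lookup_Pw X_def T_bas lookup_single when_def wt_single_idx)
  then have "PK 0 0 (X 0, 0, 0) = (X 0, 0, 0)" by (simp add: PK_def lin_0[OF Pw_lin])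
  from PK_onto[OF a this] y' obtain y'' where y'': "y'' \<in> KC 1 0" "PK 1 0 y'' = y''" and b: "(X 0, 0, 0) = Kd 0 y''" by auto
  then obtain u w x where y: "y'' = (VY u, VW w, VX x)" using weight0_KC(3) by blast
  have "X 0 = \<beta> (VY u) + \<gamma> (VW w) + \<alpha> 1 (VX x)" using b y by (simp only: Kd_def split if_True simp_thms prod.inject)
  also have "\<dots> = \<alpha> 1 (VX (cmul q (sh u) + sh (dg vg w) + x))"
    unfolding V_ops(7,8) by (simp only: lin_as[OF vlin_lext] lin_as[OF \<alpha>_lin])
  finally have "VX (e 0) = VX (dg \<nu> (U q (cmul q (sh u) + sh (dg vg w) + x)))" by (simp only: V_ops V_single)
  then have g: "e 0 = dg \<nu> (U q (cmul q (sh u) + sh (dg vg w) + x))" (is "_ = dg \<nu> (U q ?p)") by (rule V_inj)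
  have "\<nu> 0 \<noteq> 0" using arg_cong[OF g, of "\<lambda>p. lookup p 0"] by (auto simp: lookup_dg lookup_one)
  then have nz: "\<nu> k \<noteq> 0" for k using nz_offD[OF \<nu>, of k] by (cases "k = 0") auto
  have "lext (*) (\<lambda>k. (- 1 / q) ^ k / \<nu> k) (e 0) = (0 :: complex)"
    unfolding g by (rule functional_dg_U[OF nz]) (use q0 in simp)
  then show False using nz[of 0] by (simp add: vs_complex del: single_one)
qed

lemma PK_c1: "PK 1 0 (c1 u w) = c1 u w"
proof -
  have "Pw 0 (VX p) = VX p" for p
    by (rule lin_eqI[where t = cmul and F = "\<lambda>p. Pw 0 (VX p)"]; (intro lin_comp[OF _ Pw_lin] vlin_lext)?)
      (auto intro!: poly_mapping_eqI simp: lookup_Pw X_def T_bas lookup_single when_def wt_single_idx)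
  moreover have "Pw (0 - gsh GB) (VY p) = VY p" for p
    by (rule lin_eqI[where t = cmul and F = "\<lambda>p. Pw (0 - gsh GB) (VY p)"]; (intro lin_comp[OF _ Pw_lin] vlin_lext)?)
      (auto intro!: poly_mapping_eqI simp: lookup_Pw Y_def T_bas lookup_single when_def wt_single_idx gsh_def)
  moreover have "Pw (0 - gsh GC) (VW p) = VW p" for p
    by (rule lin_eqI[where t = cmul and F = "\<lambda>p. Pw (0 - gsh GC) (VW p)"]; (intro lin_comp[OF _ Pw_lin] vlin_lext)?)
      (auto intro!: poly_mapping_eqI simp: lookup_Pw W_def T_bas lookup_single when_def wt_single_idx gsh_def)
  ultimately show ?thesis by (simp add: PK_def c1_def)
qed

text \<open>A linear functional on the pairs \<open>(u, w)\<close> kills the boundaries but not \<open>(0,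
  e\<^sub>0)\<close>. The factor \<open>-q\<^sup>N\<close> in its weights on \<open>u\<close> makes the two
  contributions of \<open>x\<close> cancel.\<close>

lemma c1_not_boundary_regular:
  assumes \<nu>: "nz_off 0" and y': "y' \<in> KC 2 0"
  shows "c1 0 (e 0) \<noteq> Kd 1 y'"
proof
  assume a: "c1 0 (e 0) = Kd 1 y'"
  from PK_onto[OF a PK_c1] y' obtain y'' where y'': "y'' \<in> KC 2 0" "PK 2 0 y'' = y''" and b: "c1 0 (e 0) = Kd 1 y''"
    by (auto simp: numeral_2_eq_2)
  then obtain x u w where y: "y'' = (VX x, VY u, VW w)" using weight0_KC(4) by blast
  have c: "c1 0 (e 0) = c1 (dg (\<lambda>k. vg k * \<nu>' k) x - dg \<nu>' (U q u)) (- dg (\<lambda>k. q * \<nu>' k) x - dg \<nu>' (U (inverse q) w))"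
    using b unfolding y Kd_1_V[OF \<nu>] .
  have 1: "0 = dg (\<lambda>k. vg k * \<nu>' k) x - dg \<nu>' (U q u)" by (rule V_inj(2)) (use c in \<open>simp only: c1_def prod.inject\<close>)
  have 2: "e 0 = - dg (\<lambda>k. q * \<nu>' k) x - dg \<nu>' (U (inverse q) w)" by (rule V_inj(3)) (use c in \<open>simp only: c1_def prod.inject\<close>)
  let ?u = "lext (*) (\<lambda>k. - (q powi N) * (- 1 / q) ^ k / \<nu>' k) :: _ => complex"
    and ?w = "lext (*) (\<lambda>k. (- q) ^ k / \<nu>' k) :: _ => complex"
  note vs = vs_complex
  note l = lin_lext[OF vs]
  have nz: "\<nu>' k \<noteq> 0" for k using nz_offD[OF \<nu>, of "Suc k"] by simp
  have X: "?u (dg (\<lambda>k. vg k * \<nu>' k) x) = ?w (dg (\<lambda>k. q * \<nu>' k) x)"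
  proof (rule lin_eqI[OF lin_comp[OF dg_lin l] lin_comp[OF dg_lin l]])
    fix k
    have p: "(- 1 / q) ^ k = (- 1) ^ k / q ^ k" "(- q) ^ k = (- 1) ^ k * q ^ k" by (simp only: power_divide, simp only: power_minus[of q])
    have "vg k * z * (- Q * (s / p) / z) = q * z * (s * p / z)" if "vg k = - (q * p * p / Q)" "Q \<noteq> 0" "p \<noteq> 0" "z \<noteq> 0" for Q s p z
      unfolding that(1) using that(2-) by (simp add: field_simps)
    from this[OF vg_def qN(1) _ nz] q0 show "?u (dg (\<lambda>k. vg k * \<nu>' k) (e k)) = ?w (dg (\<lambda>k. q * \<nu>' k) (e k))"
      by (simp only: dg_single cmul_single lext_single[OF vs] mult_1_right p power_not_zero simp_thms)
  qed
  have "- Q * P + q * (- Q * (- 1 / q * P)) = 0" "P + inverse q * (- q * P) = 0" for Q P using q0 by simp_all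
  then have U: "?u (dg \<nu>' (U q u)) = 0" and W: "?w (dg \<nu>' (U (inverse q) w)) = 0"
    by (rule_tac [!] functional_dg_U[OF nz]) (simp_all only: power_Suc)
  have "?w (e 0) = - ?w (dg (\<lambda>k. q * \<nu>' k) x)"
    using arg_cong[OF 2, of ?w] unfolding lin_diff[OF l] lin_uminus[OF l] W by simp
  moreover have "?u (dg (\<lambda>k. vg k * \<nu>' k) x) = 0"
    using arg_cong[OF 1, of ?u] unfolding lin_diff[OF l] lin_0[OF l] U by simp
  ultimately have "?w (e 0) = 0" using X by simp
  then show False using nz[of 0] by (simp add: vs del: single_one)
qed

text \<open>The functional that detects classes in the singular case: on boundaries the coefficient of
  \<open>W\<^sub>r\<close> carries the factor \<open>\<nu>'\<^sub>r = 0\<close>.\<close>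

definition tW :: "nat => tens \<times> tens \<times> tens => complex" where
  "tW r y = lookup (fst (snd y)) [(-1, Suc r, r)]"

lemma tW_lin: "tW r (y + y') = tW r y + tW r y'" "tW r (y - y') = tW r y - tW r y'" "tW r (sc k y) = k * tW r y"
  by (simp_all add: tW_def lookup_add lookup_minus map3_def lookup_cmul split_def)

lemma tW_boundary:
  assumes \<nu>: "nz_off (Suc r)" "\<nu> (Suc r) = 0" and y': "y' \<in> KC 2 0"
  shows "tW r (Kd 1 y') = 0"
proof -
  have "tW r (Kd 1 y') = tW r (PK 1 0 (Kd 1 y'))"
    by (simp add: tW_def PK_def split_def lookup_Pw wt_single_idx gsh_def)
  also have "PK 1 0 (Kd 1 y') = Kd 1 (PK 2 0 y')" using PK_Kd[of y' 1 0 0] y' by (simp add: numeral_2_eq_2)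
  finally have t: "tW r (Kd 1 y') = tW r (Kd 1 (PK 2 0 y'))" .
  from y' have "PK 2 0 y' \<in> KC 2 0" "PK 2 0 (PK 2 0 y') = PK 2 0 y'" by (simp_all add: PK_KC PK_PK)
  then obtain x u w where y: "PK 2 0 y' = (VX x, VY u, VW w)" using weight0_KC(4) by blast
  show ?thesis unfolding t y Kd_1_V[OF \<nu>(1)]
    by (simp add: tW_def c1_def V_lookup lookup_dg lookup_minus \<nu>(2))
qed

end

section \<open>Mixed complexes\<close>

locale mixed_complex =
  fixes scl :: "complex => 'v::ab_group_add => 'v" and M :: "int => 'v set" and b B :: "int => 'v => 'v"
  assumes vs: "vector_space scl" and M: "subspc scl (M n)" and M_diff: "x \<in> M n ==> y \<in> M n ==> x - y \<in> M n"
    and M_neg: "n < 0 ==> M n = {0}"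
    and b_lin: "lin scl scl (b n)" and B_lin: "lin scl scl (B n)"
    and b_M: "x \<in> M n ==> b n x \<in> M (n - 1)" and B_M: "x \<in> M n ==> B n x \<in> M (n + 1)"
    and b_b: "x \<in> M n ==> b (n - 1) (b n x) = 0" and B_B: "x \<in> M n ==> B (n + 1) (B n x) = 0"
    and b_B: "x \<in> M n ==> b (n + 1) (B n x) + B (n - 1) (b n x) = 0"
begin
lemmas scl_0 = module.scale_zero_right[OF iffD2[OF module_iff_vector_space vs]]
  and scl_add = module.scale_right_distrib[OF iffD2[OF module_iff_vector_space vs]]

lemma M_0: "0 \<in> M n" using M by (simp add: subspc_def)
lemma M_add: "x \<in> M n ==> y \<in> M n ==> x + y \<in> M n" using M by (simp add: subspc_def)
lemma M_scl: "x \<in> M n ==> scl k x \<in> M n" using M by (simp add: subspc_def)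
lemma M_uminus: "x \<in> M n ==> - x \<in> M n" using M_diff[OF M_0] by fastforce

lemmas mixed_simps = lin_add[OF b_lin] lin_add[OF B_lin] lin_diff[OF b_lin] lin_diff[OF B_lin] lin_scale[OF b_lin] lin_scale[OF B_lin]
  lin_0[OF b_lin] lin_0[OF B_lin] lin_uminus[OF b_lin] lin_uminus[OF B_lin]

definition cyc :: "int => 'v => bool" where "cyc n z \<longleftrightarrow> z \<in> M n \<and> b n z = 0"
definition bdry :: "int => 'v => bool" where "bdry n z \<longleftrightarrow> (\<exists>w\<in>M (n + 1). z = b (n + 1) w)"

text \<open>The terms of the spectral sequence of a mixed complex, as far as they matter. A cycle survives to the
  second page if its image under \<open>B\<close> is a boundary, and it vanishes there if it is of the form
  \<open>B u + b v\<close> with a cycle \<open>u\<close>. \<open>E2zero\<close> and \<open>E2line\<close>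
  say that the second page is zero, or a line spanned by the class of \<open>g\<close>.\<close>

definition d1_image :: "int => 'v => bool" where
  "d1_image n z \<longleftrightarrow> (\<exists>u v. cyc (n - 1) u \<and> v \<in> M (n + 1) \<and> z = B (n - 1) u + b (n + 1) v)"
definition E2zero :: "int => bool" where
  "E2zero n \<longleftrightarrow> (\<forall>z. cyc n z --> bdry (n + 1) (B n z) --> d1_image n z)"
definition E2line :: "int => 'v => bool" where
  "E2line n g \<longleftrightarrow> cyc n g \<and> bdry (n + 1) (B n g) \<and> \<not> d1_image n g \<and>
     (\<forall>z. cyc n z --> bdry (n + 1) (B n z) --> (\<exists>k. d1_image n (z - scl k g)))"

lemma E2zero_neg: "n < 0 ==> E2zero n"
proof -
  assume n: "n < 0"
  have "d1_image n 0" unfolding d1_image_def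
    by (rule exI[of _ 0], rule exI[of _ 0]) (simp add: cyc_def M_0 mixed_simps)
  then show "E2zero n" using M_neg[OF n] by (simp add: E2zero_def cyc_def)
qed

definition Tot :: "int set => int => (int => 'v) set" where
  "Tot P n = {z. \<forall>p. z p \<in> (if p \<in> P then M (n - 2 * p) else {0})}"
definition Dt :: "int set => int => (int => 'v) => int => 'v" where
  "Dt P n z = (\<lambda>p. if p \<in> P then b (n - 2 * p) (z p) + B (n - 2 * p - 2) (z (p + 1)) else 0)"

lemma Tot_col: "z \<in> Tot P n ==> p \<in> P ==> z p \<in> M (n - 2 * p)" by (metis (mono_tags, lifting) Tot_def mem_Collect_eq)
lemma Tot_out: "z \<in> Tot P n ==> p \<notin> P ==> z p = 0" by (metis (mono_tags, lifting) Tot_def mem_Collect_eq singletonD)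
lemma TotI: "(\<And>p. p \<in> P ==> z p \<in> M (n - 2 * p)) ==> (\<And>p. p \<notin> P ==> z p = 0) ==> z \<in> Tot P n" by (simp add: Tot_def)

lemma Tot_diff: "x \<in> Tot P n ==> y \<in> Tot P n ==> x - y \<in> Tot P n"
  by (intro TotI) (simp_all add: M_diff Tot_col Tot_out)
lemma Tot_add: "x \<in> Tot P n ==> y \<in> Tot P n ==> x + y \<in> Tot P n"
  by (intro TotI) (simp_all add: M_add Tot_col Tot_out)
lemma Tot_scl: "x \<in> Tot P n ==> (\<lambda>p. scl k (x p)) \<in> Tot P n"
  by (intro TotI) (simp_all add: M_scl Tot_col Tot_out scl_0)

lemma Dt_add: "Dt P n (x + y) = Dt P n x + Dt P n y" by (rule ext) (simp add: Dt_def mixed_simps algebra_simps)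
lemma Dt_diff: "Dt P n (x - y) = Dt P n x - Dt P n y" by (rule ext) (simp add: Dt_def mixed_simps algebra_simps)
lemma Dt_scl: "Dt P n (\<lambda>p. scl k (z p)) p = scl k (Dt P n z p)"
  by (simp add: Dt_def mixed_simps scl_0 scl_add)

lemma Dt_Tot:
  assumes z: "z \<in> Tot P (n + 1)" and P: "\<And>p. p \<in> P ==> p + 1 \<in> P"
  shows "Dt P (n + 1) z \<in> Tot P n"
proof (rule TotI)
  fix p assume p: "p \<in> P"
  have "b (n + 1 - 2 * p) (z p) \<in> M (n - 2 * p)" using b_M[OF Tot_col[OF z p]] by (simp add: algebra_simps)
  moreover have "B (n + 1 - 2 * p - 2) (z (p + 1)) \<in> M (n - 2 * p)" using B_M[OF Tot_col[OF z P[OF p]]] by (simp add: algebra_simps)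
  ultimately show "Dt P (n + 1) z p \<in> M (n - 2 * p)" using p by (simp add: Dt_def M_add)
qed (simp add: Dt_def)

lemma Dt_Dt:
  assumes z: "z \<in> Tot P (n + 1)" and P: "\<And>p. p \<in> P ==> p + 1 \<in> P"
  shows "Dt P n (Dt P (n + 1) z) = 0"
proof (rule ext)
  fix p
  show "Dt P n (Dt P (n + 1) z) p = 0 p"
  proof (cases "p \<in> P")
    case True
    note p = Tot_col[OF z True] and p1 = Tot_col[OF z P[OF True]] and p2 = Tot_col[OF z P[OF P[OF True]]]
    have "b (n - 2 * p) (b (n + 1 - 2 * p) (z p)) = 0" using b_b[OF p] by (simp add: algebra_simps)
    moreover have "B (n - 2 * p - 2) (B (n - 2 * p - 3) (z (p + 1 + 1))) = 0" using B_B[OF p2] by (simp add: algebra_simps)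
    moreover have "b (n - 2 * p) (B (n - 2 * p - 1) (z (p + 1))) + B (n - 2 * p - 2) (b (n - 2 * p - 1) (z (p + 1))) = 0"
      using b_B[OF p1] by (simp add: algebra_simps)
    ultimately show ?thesis using True P[OF True] by (simp add: Dt_def mixed_simps algebra_simps)
  qed (simp add: Dt_def)
qed

subsection \<open>Cyclic homology from the second page\<close>

lemma remove_top:
  assumes u: "cyc (n - 2 * p - 1) u" and v: "v \<in> M (n - 2 * p + 1)" and p: "0 \<le> p"
  shows "\<exists>y\<in>Tot {0..} (n + 1). Dt {0..} (n + 1) y p = B (n - 2 * p - 1) u + b (n - 2 * p + 1) v \<and> (\<forall>p'>p. Dt {0..} (n + 1) y p' = 0)"
proof (rule bexI)
  let ?y = "\<lambda>p'. if p' = p then v else if p' = p + 1 then u else 0"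
  show "?y \<in> Tot {0..} (n + 1)"
    using u v p by (intro TotI) (auto simp: cyc_def M_0 algebra_simps)
  show "Dt {0..} (n + 1) ?y p = B (n - 2 * p - 1) u + b (n - 2 * p + 1) v \<and> (\<forall>p'>p. Dt {0..} (n + 1) ?y p' = 0)"
    using u p by (auto simp: Dt_def mixed_simps cyc_def algebra_simps)
qed

text \<open>The top component of a total cycle survives to the second page. In column zero the condition on
  \<open>B\<close> is about degree \<open>n + 1\<close>, where the homology is assumed to vanish.\<close>

lemma top_cycle:
  assumes z: "z \<in> Tot {0..} n" "Dt {0..} n z = 0" and top: "\<forall>p'>p. z p' = 0" and p: "0 \<le> p"
    and H: "\<And>w. cyc (n + 1) w ==> bdry (n + 1) w"
  shows "cyc (n - 2 * p) (z p)" "bdry (n - 2 * p + 1) (B (n - 2 * p) (z p))"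
proof goal_cases
  have zp: "z p \<in> M (n - 2 * p)" using Tot_col[OF z(1)] p by simp
  have "Dt {0..} n z p = 0" using z(2) by simp
  then show c: "cyc (n - 2 * p) (z p)" using top p zp by (simp add: Dt_def cyc_def mixed_simps)
  case 2 show ?case
  proof (cases "p = 0")
    case True
    have "cyc (n + 1) (B n (z 0))" using B_M[OF zp] b_B[OF zp] c by (simp add: cyc_def True mixed_simps)
    then show ?thesis using H True by simp
  next
    case False
    have "Dt {0..} n z (p - 1) = 0" using z(2) by simp
    then have "b (n - 2 * p + 2) (z (p - 1)) + B (n - 2 * p) (z p) = 0" using False p by (simp add: Dt_def algebra_simps)
    then have "B (n - 2 * p) (z p) = b (n - 2 * p + 2) (- z (p - 1))" by (simp add: mixed_simps add_eq_0_iff)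
    moreover have "- z (p - 1) \<in> M (n - 2 * p + 2)" using M_uminus[OF Tot_col[OF z(1), of "p - 1"]] False p by (simp add: algebra_simps)
    ultimately show ?thesis by (force simp: bdry_def algebra_simps)
  qed
qed

lemma Dt_Tot0: "z \<in> Tot {0..} (n + 1) ==> Dt {0..} (n + 1) z \<in> Tot {0..} n" by (rule Dt_Tot) simp_all
lemma Dt_Dt0: "z \<in> Tot {0..} (n + 1) ==> Dt {0..} n (Dt {0..} (n + 1) z) = 0" by (rule Dt_Dt) simp_all

text \<open>As long as the second page vanishes, the top component can be removed by a boundary.\<close>

lemma reduce_columns:
  assumes H: "\<And>w. cyc (n + 1) w ==> bdry (n + 1) w" and l: "- 1 \<le> l"
  shows "(\<And>p. l < p ==> p \<le> l + int k ==> E2zero (n - 2 * p)) ==> z \<in> Tot {0..} n ==> Dt {0..} n z = 0 ==>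
    \<forall>p>l + int k. z p = 0 ==> \<exists>y\<in>Tot {0..} (n + 1). \<forall>p>l. (z - Dt {0..} (n + 1) y) p = 0"
proof (induction k arbitrary: z)
  case 0
  then show ?case by (intro bexI[of _ 0]) (auto simp: Dt_def mixed_simps Tot_def M_0)
next
  case (Suc k)
  let ?p = "l + int (Suc k)"
  have p: "0 \<le> ?p" using l by simp
  note t = top_cycle[OF Suc.prems(2,3,4) p H]
  have "d1_image (n - 2 * ?p) (z ?p)" using Suc.prems(1)[of ?p] t by (simp add: E2zero_def)
  then obtain u v where u: "cyc (n - 2 * ?p - 1) u" and v: "v \<in> M (n - 2 * ?p + 1)" and zp: "z ?p = B (n - 2 * ?p - 1) u + b (n - 2 * ?p + 1) v"
    unfolding d1_image_def by blast
  from remove_top[OF u v p] obtain y where y: "y \<in> Tot {0..} (n + 1)" and yp: "Dt {0..} (n + 1) y ?p = z ?p" "\<forall>p'>?p. Dt {0..} (n + 1) y p' = 0"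
    unfolding zp by blast
  let ?z = "z - Dt {0..} (n + 1) y"
  have z1: "?z \<in> Tot {0..} n" by (intro Tot_diff Suc.prems Dt_Tot0 y)
  have z2: "Dt {0..} n ?z = 0" unfolding Dt_diff Suc.prems(3) Dt_Dt0[OF y] by simp
  have z3: "\<forall>p>l + int k. ?z p = 0"
  proof (intro allI impI)
    fix p assume "p > l + int k"
    then have "p = ?p \<or> p > ?p" by auto
    then show "?z p = 0" using yp Suc.prems(4) by auto
  qed
  from Suc.IH[OF Suc.prems(1) z1 z2 z3] obtain y' where y': "y' \<in> Tot {0..} (n + 1)" "\<forall>p>l. (?z - Dt {0..} (n + 1) y') p = 0"
    by auto
  show ?case using Tot_add[OF y y'(1)] y'(2) by (intro bexI[of _ "y + y'"]) (unfold Dt_add, simp_all add: algebra_simps)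
qed

text \<open>Columns with vanishing second page are cleared from the top down. In the column \<open>p\<^sub>0\<close>
  the multiple of \<open>g\<close> is subtracted together with its completion \<open>z\<^sub>0\<close> to a
  total cycle.\<close>

theorem line_spans:
  assumes g: "E2line (n - 2 * p0) g" and p0: "0 \<le> p0"
    and H: "\<And>w. cyc (n + 1) w ==> bdry (n + 1) w"
    and E2: "\<And>p. 0 \<le> p ==> p \<noteq> p0 ==> E2zero (n - 2 * p)"
    and z0: "z0 \<in> Tot {0..} n" "Dt {0..} n z0 = 0" "z0 p0 = g" "\<forall>p>p0. z0 p = 0"
    and z: "z \<in> Tot {0..} n" "Dt {0..} n z = 0"
  shows "\<exists>k. \<exists>y\<in>Tot {0..} (n + 1). z = (\<lambda>p. scl k (z0 p)) + Dt {0..} (n + 1) y"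
proof -
  \<comment> \<open>Columns far to the right vanish, since chains have nonnegative degree.\<close>
  have "\<forall>p>p0 + int (nat \<bar>n\<bar>). z p = 0"
    using Tot_col[OF z(1)] M_neg p0 by (smt (verit) atLeast_iff singletonD nat_0_le)
  from reduce_columns[OF H _ _ z this] obtain y1 where y1: "y1 \<in> Tot {0..} (n + 1)" "\<forall>p>p0. (z - Dt {0..} (n + 1) y1) p = 0"
    using p0 E2 by auto
  let ?z1 = "z - Dt {0..} (n + 1) y1"
  have z1: "?z1 \<in> Tot {0..} n" "Dt {0..} n ?z1 = 0"
    using Dt_Dt0[OF y1(1)] z by (auto intro!: Tot_diff Dt_Tot0 y1 simp: Dt_diff)
  note t = top_cycle[OF z1 y1(2) p0 H]
  obtain k u v where u: "cyc (n - 2 * p0 - 1) u" and v: "v \<in> M (n - 2 * p0 + 1)"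
    and e: "?z1 p0 - scl k g = B (n - 2 * p0 - 1) u + b (n - 2 * p0 + 1) v"
    using g t unfolding E2line_def d1_image_def by blast
  from remove_top[OF u v p0] obtain y2 where y2: "y2 \<in> Tot {0..} (n + 1)" "Dt {0..} (n + 1) y2 p0 = ?z1 p0 - scl k g" "\<forall>p>p0. Dt {0..} (n + 1) y2 p = 0"
    unfolding e by blast
  let ?kz = "\<lambda>p. scl k (z0 p)"
  note s0 = scl_0[of k]
  have kD: "Dt {0..} n ?kz = 0" by (rule ext) (simp add: Dt_scl z0(2) scl_0)
  let ?z2 = "?z1 - ?kz - Dt {0..} (n + 1) y2"
  have z2: "?z2 \<in> Tot {0..} n" "Dt {0..} n ?z2 = 0"
    using Dt_Dt0[OF y2(1)] z1 kD by (auto intro!: Tot_diff Dt_Tot0 y1 y2 Tot_scl z0 z simp: Dt_diff)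
  have t2: "\<forall>p>- 1 + int (nat p0). ?z2 p = 0"
  proof (intro allI impI)
    fix p assume "p > - 1 + int (nat p0)"
    then have "p = p0 \<or> p > p0" using p0 by auto
    then show "?z2 p = 0" using y2 y1(2) z0 s0 by auto
  qed
  from reduce_columns[OF H _ _ z2 t2] obtain y3 where y3: "y3 \<in> Tot {0..} (n + 1)" "\<forall>p>- 1. (?z2 - Dt {0..} (n + 1) y3) p = 0"
    using p0 E2 by auto
  have "(?z2 - Dt {0..} (n + 1) y3) p = 0" for p
    using y3(2) Tot_out[OF Tot_diff[OF z2(1) Dt_Tot0[OF y3(1)]], of p] by (cases "p > -1") auto
  then have "z = ?kz + Dt {0..} (n + 1) (y1 + y2 + y3)" by (intro ext) (simp add: Dt_add algebra_simps)
  then show ?thesis using Tot_add[OF Tot_add[OF y1(1) y2(1)] y3(1)] by blast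
qed

text \<open>Degeneration is needed only as far as a boundary could reach: above \<open>p\<^sub>0\<close> at most two
  components of \<open>y\<close> matter. The vanishing of the second page in degree \<open>n - 2p\<^sub>0 -
  3\<close> lets the upper one be removed, whence the lower one can be replaced by a cycle.\<close>

theorem line_nonzero:
  assumes g: "E2line (n - 2 * p0) g" and p0: "0 \<le> p0"
    and E2: "E2zero (n - 2 * p0 - 3)" and neg: "n - 2 * p0 - 5 < 0"
    and z0: "z0 p0 = g" "\<forall>p>p0. z0 p = 0"
    and z: "z \<in> Tot {0..} n" "\<forall>p\<ge>p0. z p = 0" and y: "y \<in> Tot {0..} (n + 1)"
  shows "z0 \<noteq> z + Dt {0..} (n + 1) y"
proof
  assume e: "z0 = z + Dt {0..} (n + 1) y"
  let ?m = "n - 2 * p0"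
  have y0: "y p0 \<in> M (?m + 1)" and y1: "y (p0 + 1) \<in> M (?m - 1)" and y2: "y (p0 + 2) \<in> M (?m - 3)" and y3: "y (p0 + 3) = 0"
    using Tot_col[OF y, of p0] Tot_col[OF y, of "p0 + 1"] Tot_col[OF y, of "p0 + 2"] Tot_col[OF y, of "p0 + 3"] p0 M_neg[OF neg]
    by (simp_all add: algebra_simps)
  have e0: "g = b (?m + 1) (y p0) + B (?m - 1) (y (p0 + 1))"
    using fun_cong[OF e, of p0] z z0 p0 by (simp add: Dt_def algebra_simps)
  have e1: "b (?m - 1) (y (p0 + 1)) + B (?m - 3) (y (p0 + 2)) = 0"
    using fun_cong[OF e, of "p0 + 1"] z z0 p0 by (simp add: Dt_def algebra_simps)
  have e2: "b (?m - 3) (y (p0 + 2)) = 0"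
    using fun_cong[OF e, of "p0 + 2"] z z0 p0 y3 by (simp add: Dt_def algebra_simps mixed_simps)
  have "bdry (?m - 3 + 1) (B (?m - 3) (y (p0 + 2)))"
    unfolding bdry_def using M_uminus[OF y1] e1 by (intro bexI[of _ "- y (p0 + 1)"]) (simp_all add: mixed_simps add_eq_0_iff add.commute)
  then have "d1_image (?m - 3) (y (p0 + 2))" using E2 e2 y2 by (simp add: E2zero_def cyc_def)
  then obtain u v where u: "cyc (?m - 4) u" and v: "v \<in> M (?m - 2)" and y2e: "y (p0 + 2) = B (?m - 4) u + b (?m - 2) v"
    unfolding d1_image_def by auto
  let ?u = "y (p0 + 1) - B (?m - 2) v"
  have BBu: "B (?m - 3) (B (?m - 4) u) = 0" using B_B[of u "?m - 4"] u by (simp add: cyc_def)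
  have bB: "b (?m - 1) (B (?m - 2) v) + B (?m - 3) (b (?m - 2) v) = 0" using b_B[OF v] by (simp add: algebra_simps)
  have "b (?m - 1) (y (p0 + 1)) = - B (?m - 3) (b (?m - 2) v)" using e1 BBu by (simp add: y2e mixed_simps add_eq_0_iff)
  then have "b (?m - 1) ?u = 0" using bB by (simp add: mixed_simps add_eq_0_iff)
  moreover have "?u \<in> M (?m - 1)" using M_diff[OF y1] B_M[OF v] by simp
  ultimately have "cyc (?m - 1) ?u" by (simp add: cyc_def)
  moreover have "B (?m - 1) ?u = B (?m - 1) (y (p0 + 1))" using B_B[OF v] by (simp add: mixed_simps)
  ultimately have "d1_image ?m g" unfolding d1_image_def using e0 y0 by (intro exI[of _ ?u] exI[of _ "y p0"]) (simp add: add.commute)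
  then show False using g by (simp add: E2line_def)
qed

subsection \<open>Periodic cyclic homology\<close>

text \<open>The periodic complex continues the cyclic one to columns of negative index, that is, to higher degrees of
  the mixed complex. There the homology vanishes, so a solution of \<open>z = D y\<close> can be continued
  column by column.\<close>

theorem extend_boundary:
  assumes H: "\<And>k w. n + 1 < k ==> cyc k w ==> bdry k w"
    and z: "z \<in> Tot UNIV n" "Dt UNIV n z = 0"
    and y: "y \<in> Tot {0..} (n + 1)" "\<forall>p\<ge>0. z p = Dt {0..} (n + 1) y p"
  shows "\<exists>y'\<in>Tot UNIV (n + 1). z = Dt UNIV (n + 1) y' \<and> (\<forall>p\<ge>0. y' p = y p)"
proof -
  have zM: "z p \<in> M (n - 2 * p)" for p using Tot_col[OF z(1)] by simp
  have zc: "b (n - 2 * p) (z p) = - B (n - 2 * p - 2) (z (p + 1))" for p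
    using fun_cong[OF z(2), of p] by (simp add: Dt_def eq_neg_iff_add_eq_0)
  let ?P = "\<lambda>k x. x \<in> M (n + 1 + 2 * int k) \<and>
     B (n + 2 * int k) (b (n + 2 * int k + 1) x) = B (n + 2 * int k) (z (- int k))"
  let ?Q = "\<lambda>k x y. b (n + 2 * int k + 3) y = z (- int (Suc k)) - B (n + 1 + 2 * int k) x"
  have y0: "y 0 \<in> M (n + 1)" and y1: "y 1 \<in> M (n - 1)" using Tot_col[OF y(1), of 0] Tot_col[OF y(1), of 1] by auto
  have "z 0 = b (n + 1) (y 0) + B (n - 1) (y 1)" using y(2) by (simp add: Dt_def)
  then have init: "?P 0 (y 0)" using y0 B_B[OF y1] by (simp add: mixed_simps)
  have step: "\<exists>y. ?P (Suc k) y \<and> ?Q k x y" if "?P k x" for k x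
  proof -
    let ?m = "n + 2 * int k"
    let ?w = "z (- int (Suc k)) - B (?m + 1) x"
    have x: "x \<in> M (?m + 1)" using that by (simp add: algebra_simps)
    have zk: "z (- int (Suc k)) \<in> M (?m + 2)" using zM[of "- int (Suc k)"] by (simp add: algebra_simps)
    have "b (?m + 2) (z (- int (Suc k))) = - B ?m (z (- int k))" using zc[of "- int (Suc k)"] by (simp add: algebra_simps)
    moreover have "b (?m + 2) (B (?m + 1) x) + B ?m (b (?m + 1) x) = 0" using b_B[OF x] by (simp add: algebra_simps)
    ultimately have "b (?m + 2) ?w = 0" using that by (simp add: mixed_simps add_eq_0_iff2)
    moreover have "?w \<in> M (?m + 2)" using M_diff[OF zk] B_M[OF x] by (simp add: algebra_simps)
    ultimately have "bdry (?m + 2) ?w" using H[of "?m + 2" ?w] by (simp add: cyc_def)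
    then obtain y where y: "y \<in> M (?m + 3)" "?w = b (?m + 3) y" by (auto simp: bdry_def algebra_simps)
    have "B (?m + 2) (b (?m + 3) y) = B (?m + 2) (z (- int (Suc k)))"
      using B_B[OF x] unfolding y(2)[symmetric] by (simp add: mixed_simps add.commute)
    then show ?thesis using y by (intro exI[of _ y]) (simp add: algebra_simps)
  qed
  obtain f where f0: "f 0 = y 0" and f: "\<And>k. ?P k (f k)" "\<And>k. ?Q k (f k) (f (Suc k))"
    using dependent_nat_choice[of "\<lambda>k x. ?P k x \<and> (k = 0 --> x = y 0)" ?Q] init step by (metis nat.distinct(1))
  define y' where "y' p = (if 0 \<le> p then y p else f (nat (- p)))" for p
  have "y' \<in> Tot UNIV (n + 1)"
  proof (rule TotI)
    fix p show "y' p \<in> M (n + 1 - 2 * p)" using f(1)[of "nat (- p)"] Tot_col[OF y(1), of p] by (auto simp: y'_def)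
  qed simp
  moreover have "z = Dt UNIV (n + 1) y'"
  proof (rule ext)
    fix p
    show "z p = Dt UNIV (n + 1) y' p"
    proof (cases "0 \<le> p")
      case True
      then show ?thesis using y(2) by (simp add: Dt_def y'_def)
    next
      case False
      define k where "k = nat (- p - 1)"
      have k: "p = - int (Suc k)" using False by (simp add: k_def)
      have 1: "y' p = f (Suc k)" using False by (simp add: y'_def k nat_add_distrib Suc_nat_eq_nat_zadd1)
      have 2: "y' (p + 1) = f k" by (cases k) (simp_all add: y'_def k f0 nat_add_distrib)
      have d: "n + 1 - 2 * p = n + 2 * int k + 3" "n + 2 * int k + 3 - 2 = n + 1 + 2 * int k" by (simp_all add: k)
      have "Dt UNIV (n + 1) y' p = b (n + 2 * int k + 3) (f (Suc k)) + B (n + 1 + 2 * int k) (f k)"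
        by (simp only: Dt_def UNIV_I if_True 1 2 d)
      then show ?thesis using f(2)[of k] k by simp
    qed
  qed
  ultimately show ?thesis by (auto simp: y'_def)
qed

text \<open>The case \<open>z = 0\<close> of the continuation of boundaries, one degree lower.\<close>

theorem extend_cycle:
  assumes H: "\<And>k w. n < k ==> cyc k w ==> bdry k w"
    and z: "z \<in> Tot {0..} n" "Dt {0..} n z = 0"
  shows "\<exists>z'\<in>Tot UNIV n. Dt UNIV n z' = 0 \<and> (\<forall>p\<ge>0. z' p = z p)"
proof -
  have "Dt UNIV (n - 1) 0 = 0" by (rule ext) (simp add: Dt_def mixed_simps)
  from extend_boundary[of "n - 1" 0 z, OF H _ this] z show ?thesis by (auto simp: Tot_def M_0)
qed

end

section \<open>The invariant subcomplex\<close>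

context twisted
begin

text \<open>The eigenvalues of \<open>T\<close> on basis tensors. Since \<open>T\<close> is diagonal, the coinvariants
  \<open>C / im (1 - T)\<close> are isomorphic to the invariants through the spectral projection
  \<open>Pt\<close>. On invariants \<open>b\<close> and \<open>B\<close> form a mixed complex on the nose.\<close>

definition te :: "idx list => complex" where "te l = q powi (- N * sum_list (map fst l))"
definition Pt :: "tens => tens" where
  "Pt = lext cmul (\<lambda>l. cmul (if te l = 1 then 1 else 0) (single l 1))"

lemma Pt_lin: "vlin Pt" by (simp add: Pt_def vlin_lext)
lemma lookup_Pt: "lookup (Pt v) l = (if te l = 1 then lookup v l else 0)"
  by (simp add: Pt_def lookup_diag)

lemma lookup_Tq: "lookup (Tq v) l = te l * lookup v l"
proof -
  have "Tq v = lext cmul (\<lambda>l. cmul (te l) (single l 1)) v"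
    by (rule lin_eqI[OF Tq_lin vlin_lext]) (simp add: Tq_single te_def)
  then show ?thesis by (simp add: lookup_diag)
qed

lemma Pt_Cn: "v \<in> Cn n ==> Pt v \<in> Cn n"
  by (auto simp: Cn_def in_keys_iff lookup_Pt split: if_splits)

lemma Tq_Pt: "Tq (Pt v) = Pt v" by (rule poly_mapping_eqI) (simp add: lookup_Tq lookup_Pt)
lemma Pt_fixed: "Tq v = v ==> Pt v = v"
  by (rule poly_mapping_eqI) (metis (no_types) lookup_Tq lookup_Pt mult_cancel_right1)
lemma Pt_coinvariant: "Pt (g - Tq g) = 0"
  by (rule poly_mapping_eqI) (simp add: lookup_Tq lookup_Pt lookup_minus)

lemma Pt_kernel:
  assumes v: "v \<in> Cn n" "Pt v = 0" shows "\<exists>g\<in>Cn n. v = g - Tq g"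
proof (rule bexI)
  \<comment> \<open>Where \<open>te\<close> is \<open>1\<close> the coefficient is \<open>1 / 0 = 0\<close>, in agreement with \<open>Pt v = 0\<close>.\<close>
  let ?g = "lext cmul (\<lambda>l. cmul (1 / (1 - te l)) (single l 1)) v"
  have g: "lookup ?g l = 1 / (1 - te l) * lookup v l" for l by (simp only: lookup_diag)
  have "lookup v l = 0" if "te l = 1" for l
    using arg_cong[OF v(2), of "\<lambda>v. lookup v l"] that by (simp add: lookup_Pt)
  then have "lookup v l = (1 - te l) * (1 / (1 - te l) * lookup v l)" for l by (cases "te l = 1") auto
  then show "v = ?g - Tq ?g"
    by (intro poly_mapping_eqI) (simp only: lookup_minus lookup_Tq g left_diff_distrib mult_1_left)
  show "?g \<in> Cn n" using v(1) by (auto simp: Cn_def in_keys_iff g)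
qed

text \<open>An operator that commutes with \<open>T\<close> respects both its kernel and its image, hence the
  projection.\<close>

lemma Pt_comm:
  assumes F: "vlin F" "\<And>v. v \<in> Cn n ==> Tq (F v) = F (Tq v)" and v: "v \<in> Cn n"
  shows "Pt (F v) = F (Pt v)"
proof -
  have "v - Pt v \<in> Cn n" by (intro Cn_diff Pt_Cn v)
  moreover have "Pt (v - Pt v) = 0" by (rule poly_mapping_eqI) (simp add: lookup_Pt lookup_minus)
  ultimately obtain g where g: "g \<in> Cn n" "v - Pt v = g - Tq g" using Pt_kernel by blast
  have "v = Pt v + (g - Tq g)" using g(2) by (simp add: algebra_simps)
  then have "F v = F (Pt v + (g - Tq g))" by simp
  also have "\<dots> = F (Pt v) + (F g - Tq (F g))" by (simp add: lin_ad[OF F(1)] F(2)[OF g(1)])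
  finally have "Pt (F v) = Pt (F (Pt v)) + Pt (F g - Tq (F g))" by (simp add: lin_add[OF Pt_lin])
  also have "\<dots> = F (Pt v)" using F(2)[OF Pt_Cn[OF v]] by (simp add: Pt_coinvariant Tq_Pt Pt_fixed)
  finally show ?thesis .
qed

lemma Pt_bn: "v \<in> Cn n ==> Pt (bn n v) = bn n (Pt v)" by (rule Pt_comm[OF bn_lin Tq_bn])
lemma Pt_Bq: "v \<in> Cn n ==> Pt (Bq n v) = Bq n (Pt v)" by (rule Pt_comm[OF Bq_lin Tq_Bq])

text \<open>The invariant mixed complex, extended by zero to negative degrees.\<close>

definition MI :: "int => tens set" where "MI n = (if n < 0 then {0} else {v \<in> Cn (nat n). Tq v = v})"
definition bI :: "int => tens => tens" where "bI n = (if n < 0 then (\<lambda>_. 0) else bn (nat n))"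
definition BI :: "int => tens => tens" where "BI n = (if n < 0 then (\<lambda>_. 0) else Bq (nat n))"

lemma MI_nat: "MI (int n) = {v \<in> Cn n. Tq v = v}" by (simp add: MI_def)
lemma bI_nat: "bI (int n) = bn n" and BI_nat: "BI (int n) = Bq n" by (simp_all add: bI_def BI_def)
lemma bn_0: "bn 0 v = 0" by (simp add: bn_def)

lemma MI_Suc: "MI (1 + int n) = {v \<in> Cn (Suc n). Tq v = v}" "MI (int n + 1) = {v \<in> Cn (Suc n). Tq v = v}"
  "bI (1 + int n) = bn (Suc n)" "bI (int n + 1) = bn (Suc n)" "bI 0 = bn 0" "BI 0 = Bq 0" "BI (1 + int n) = Bq (Suc n)" "BI (int n + 1) = Bq (Suc n)"
  using MI_nat[of "Suc n"] bI_nat[of "Suc n"] BI_nat[of "Suc n"] bI_nat[of 0] BI_nat[of 0] by (simp_all add: add.commute)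

lemma MI_cases:
  assumes "x \<in> MI n"
  obtains "n < 0" "x = 0" | m where "n = int m" "x \<in> Cn m" "Tq x = x"
  using assms that(2)[of "nat n"] that(1) by (cases "n < 0") (auto simp: MI_def)

lemma Bq_Bq_invariant: assumes v: "v \<in> Cn n" "Tq v = v" shows "Bq (Suc n) (Bq n v) = 0"
proof -
  obtain g where g: "Bq (Suc n) (Bq n v) = g - Tq g" using Bq_Bq[OF v(1)] by blast
  have "Tq (Bq (Suc n) (Bq n v)) = Bq (Suc n) (Bq n v)" using v by (simp add: Tq_Bq[OF Bq_Cn[OF v(1)]] Tq_Bq)
  then have "Bq (Suc n) (Bq n v) = Pt (Bq (Suc n) (Bq n v))" by (simp add: Pt_fixed)
  then show ?thesis by (simp add: g Pt_coinvariant)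
qed

sublocale I: mixed_complex cmul MI bI BI
proof
  show "subspc cmul (MI n)" for n
    by (auto simp: subspc_def MI_def Cn_0 Cn_add Cn_cmul lin_as[OF Tq_lin])
  show "x \<in> MI n ==> y \<in> MI n ==> x - y \<in> MI n" for x y n by (auto simp: MI_def Cn_diff lin_diff[OF Tq_lin] split: if_splits)
  show "n < 0 ==> MI n = {0}" for n by (simp add: MI_def)
  show "vlin (bI n)" "vlin (BI n)" for n by (simp_all add: bI_def BI_def bn_lin Bq_lin vlin_zero)
  fix x n assume x: "x \<in> MI n"
  show "bI n x \<in> MI (n - 1)"
    using x
  proof (rule MI_cases)
    fix m assume m: "n = int m" "x \<in> Cn m" "Tq x = x"
    then show ?thesis by (cases m) (auto simp: bI_nat MI_Suc bn_0 MI_def bn_Cn_Suc Tq_bn Cn_0)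
  qed (simp add: MI_def bI_def)
  show "BI n x \<in> MI (n + 1)"
    using x
  proof (rule MI_cases)
    fix m assume m: "n = int m" "x \<in> Cn m" "Tq x = x"
    then have "Bq m x \<in> MI (int (Suc m))" by (simp add: MI_Suc Bq_Cn Tq_Bq)
    then show ?thesis by (simp add: BI_nat m(1) add.commute)
  qed (simp add: MI_def BI_def Cn_0)
  show "bI (n - 1) (bI n x) = 0"
    using x
  proof (rule MI_cases)
    fix m assume m: "n = int m" "x \<in> Cn m" "Tq x = x"
    then show ?thesis by (cases m) (auto simp: bI_nat MI_Suc bn_0 bI_def[of "-1"] bn_bn)
  qed (simp add: bI_def)
  show "BI (n + 1) (BI n x) = 0"
    using x
  proof (rule MI_cases)
    fix m assume m: "n = int m" "x \<in> Cn m" "Tq x = x"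
    have "BI (n + 1) = Bq (Suc m)" using BI_nat[of "Suc m"] m(1) by (simp add: add.commute)
    then show ?thesis using m by (simp add: BI_nat Bq_Bq_invariant)
  qed (simp add: BI_def)
  show "bI (n + 1) (BI n x) + BI (n - 1) (bI n x) = 0"
    using x
  proof (rule MI_cases)
    fix m assume m: "n = int m" "x \<in> Cn m" "Tq x = x"
    have 1: "bI (n + 1) = bn (Suc m)" using bI_nat[of "Suc m"] m(1) by (simp add: add.commute)
    show ?thesis
    proof (cases m)
      case 0 then show ?thesis using m bn_Bq[OF m(2)] 1 by (simp add: MI_Suc BI_def[of "-1"] bn_0)
    next
      case (Suc k)
      have "BI (n - 1) = Bq (m - 1)" using BI_nat[of k] m(1) Suc by simp
      then show ?thesis using bn_Bq[OF m(2)] m by (simp add: MI_Suc BI_nat bI_nat)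
    qed
  qed (simp add: BI_def bI_def)
qed

lemma I_cyc: "I.cyc (int n) z \<longleftrightarrow> z \<in> Cn n \<and> Tq z = z \<and> bn n z = 0"
  by (auto simp: I.cyc_def MI_nat bI_nat)

text \<open>Being a boundary in the full complex is the more convenient notion. For invariant chains it agrees with
  being a boundary in the invariant complex, by projecting.\<close>

definition bdr :: "nat => tens => bool" where "bdr n z \<longleftrightarrow> (\<exists>u\<in>Cn (Suc n). z = bn (Suc n) u)"

lemma bdrI: "u \<in> Cn (Suc n) ==> bdr n (bn (Suc n) u)" by (auto simp: bdr_def)
lemma bdr_add: "bdr n x ==> bdr n y ==> bdr n (x + y)"
  unfolding bdr_def by (metis Cn_add lin_add[OF bn_lin])
lemma bdr_cmul: "bdr n x ==> bdr n (cmul k x)"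
  unfolding bdr_def by (metis Cn_cmul lin_scale[OF bn_lin])
lemma bdr_0: "bdr n 0" unfolding bdr_def by (rule bexI[of _ 0]) (simp_all add: Cn_0)
lemma bdr_uminus: "bdr n x ==> bdr n (- x)" unfolding bdr_def by (metis Cn_uminus lin_uminus[OF bn_lin])
lemma bdr_diff: "bdr n x ==> bdr n y ==> bdr n (x - y)"
  using bdr_add[of n x "- y"] bdr_uminus[of n y] by simp
lemma bdr_cong: "bdr n (x - y) ==> bdr n x \<longleftrightarrow> bdr n y"
  using bdr_add[of n "x - y" y] bdr_diff[of n x "x - y"] by auto

lemma I_bdry: assumes z: "Tq z = z" shows "I.bdry (int n) z \<longleftrightarrow> bdr n z"
proof
  have n: "int n + 1 = int (Suc n)" by simp
  show "I.bdry (int n) z ==> bdr n z" by (auto simp: I.bdry_def MI_Suc bdr_def)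
  assume "bdr n z"
  then obtain u where u: "u \<in> Cn (Suc n)" "z = bn (Suc n) u" by (auto simp: bdr_def)
  have "z = bn (Suc n) (Pt u)" using Pt_fixed[OF z] Pt_bn[OF u(1)] u(2) by simp
  then show "I.bdry (int n) z" unfolding I.bdry_def MI_Suc using Pt_Cn[OF u(1)] Tq_Pt by blast
qed

lemma bdr_Pw: assumes z: "bdr n z" "Pw \<omega> z = z" shows "\<exists>u\<in>Cn (Suc n). Pw \<omega> u = u \<and> z = bn (Suc n) u"
proof -
  obtain u where u: "u \<in> Cn (Suc n)" "z = bn (Suc n) u" using z by (auto simp: bdr_def)
  have "z = bn (Suc n) (Pw \<omega> u)" using Pw_bn[OF u(1)] z(2) u(2) by simp
  then show ?thesis using Pw_Cn[OF u(1)] Pw_Pw by (intro bexI[of _ "Pw \<omega> u"]) auto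
qed

lemma d1_imageI:
  assumes v: "v \<in> Cn (Suc n)" "Tq v = v" and u: "0 < n ==> u \<in> Cn (n - 1) \<and> Tq u = u \<and> bn (n - 1) u = 0"
  shows "I.d1_image (int n) ((if n = 0 then 0 else Bq (n - 1) u) + bn (Suc n) v)"
proof -
  let ?u = "if n = 0 then 0 else u"
  have n: "int n + 1 = int (Suc n)" by simp
  have "I.cyc (int n - 1) ?u"
    using u by (cases n) (auto simp: I.cyc_def I.M_0 I.mixed_simps MI_def bI_def)
  moreover have "v \<in> MI (int n + 1)" using v by (simp only: n MI_nat) simp
  moreover have "(if n = 0 then 0 else Bq (n - 1) u) = BI (int n - 1) ?u"
    by (cases n) (simp_all add: BI_def)
  moreover have "bn (Suc n) v = bI (int n + 1) v" by (simp only: n bI_nat)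
  ultimately show ?thesis unfolding I.d1_image_def by (intro exI[of _ ?u] exI[of _ v]) (simp only: simp_thms)
qed

lemma d1_image_bdr: "Tq z = z ==> bdr n z ==> I.d1_image (int n) z"
proof -
  assume z: "Tq z = z" "bdr n z"
  then obtain u where u: "u \<in> Cn (Suc n)" "z = bn (Suc n) u" by (auto simp: bdr_def)
  have "z = bn (Suc n) (Pt u)" using Pt_fixed[OF z(1)] Pt_bn[OF u(1)] u(2) by simp
  then show ?thesis
    using d1_imageI[of "Pt u" n 0, OF Pt_Cn[OF u(1)] Tq_Pt] by (cases "n = 0") (simp_all add: Cn_0)
qed

lemma d1_image_add: "I.d1_image n x ==> I.d1_image n y ==> I.d1_image n (x + y)"
proof -
  assume "I.d1_image n x" "I.d1_image n y"
  then obtain u v u' v' where "I.cyc (n - 1) u" "v \<in> MI (n + 1)" "x = BI (n - 1) u + bI (n + 1) v"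
    "I.cyc (n - 1) u'" "v' \<in> MI (n + 1)" "y = BI (n - 1) u' + bI (n + 1) v'"
    unfolding I.d1_image_def by blast
  then show ?thesis unfolding I.d1_image_def
    by (intro exI[of _ "u + u'"] exI[of _ "v + v'"]) (simp add: I.cyc_def I.M_add I.mixed_simps add_ac)
qed

text \<open>Contractions act on Hochschild homology, since they anticommute with \<open>b\<close>.\<close>

lemma eq_bdr: assumes D: "is_der D" and z: "bdr (Suc n) z" shows "bdr n (eq D z)"
proof -
  obtain u where u: "u \<in> Cn (Suc (Suc n))" "z = bn (Suc (Suc n)) u" using z by (auto simp: bdr_def)
  have "eq D z = bn (Suc n) (- eq D u)" using bn_eq[OF D u(1)] u(2) by (simp add: lin_uminus[OF bn_lin])
  moreover have "- eq D u \<in> Cn (Suc n)" using Cn_uminus[OF eq_Cn[OF D u(1)]] by simp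
  ultimately show ?thesis using bdrI by simp
qed

lemma d1_image_cmul: "I.d1_image n x ==> I.d1_image n (cmul k x)"
proof -
  assume "I.d1_image n x"
  then obtain u v where "I.cyc (n - 1) u" "v \<in> MI (n + 1)" "x = BI (n - 1) u + bI (n + 1) v"
    unfolding I.d1_image_def by blast
  then show ?thesis unfolding I.d1_image_def
    by (intro exI[of _ "cmul k u"] exI[of _ "cmul k v"]) (simp add: I.cyc_def I.M_scl I.mixed_simps cmul_add)
qed

text \<open>In nonzero weight the Lie derivative is multiplication by the weight, hence invertible. By Cartan's
  formula every class on the second page is then zero.\<close>

lemma nonzero_weight:
  assumes z: "I.cyc (int n) z" "Pw \<omega> z = z" "\<omega> \<noteq> 0" and B: "bdr (Suc n) (Bq n z)"
  shows "I.d1_image (int n) z"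
proof -
  let ?D = "Dw 1 \<i>"
  have zC: "z \<in> Cn n" "Tq z = z" "bn n z = 0" using z(1) by (simp_all add: I_cyc)
  have L: "Lq ?D n z = cmul \<omega> z" using Lw_Pw[OF zC(1), of \<omega>] z(2) by simp
  have eB: "bdr n (eq ?D (Bq n z))" by (rule eq_bdr[OF Dw_der B])
  obtain y where y: "I.d1_image (int n) y" "Tq y = y" "bdr n (cmul \<omega> z - y)"
  proof (cases n)
    case 0
    then show ?thesis using that[of 0] eB cartan_0[OF Dw_der] zC(1) L d1_image_bdr[of 0 n] by (simp add: bdr_0 lin_0[OF Tq_lin])
  next
    case (Suc k)
    then have n: "0 < n" by simp
    have u: "eq ?D z \<in> Cn k" "Tq (eq ?D z) = eq ?D z" using eq_Cn[OF Dw_der zC(1) n] Tq_eq[OF Dw_der zC(1) n] Suc zC(2) by simp_all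
    have "bn k (eq ?D z) = 0"
      using bn_eq[OF Dw_der zC(1)] Suc zC(3) by (cases k) (simp_all add: bn_0 lin_0[OF eq_lin[OF Dw_der]])
    then have "I.d1_image (int n) (Bq k (eq ?D z))"
      using d1_imageI[of 0 n "eq ?D z"] Suc u by (simp add: Cn_0 lin_0[OF Tq_lin] lin_0[OF bn_lin])
    moreover obtain w where w: "w \<in> Cn (Suc n)" "Bq k (eq ?D z) + eq ?D (Bq n z) = cmul \<omega> z + bn (Suc n) w"
      using cartan[OF Dw_der zC(1) n zC(3,2), of 1 "\<i>"] L Suc by auto
    then have "cmul \<omega> z - Bq k (eq ?D z) = eq ?D (Bq n z) - bn (Suc n) w" by (simp add: algebra_simps)
    then have "bdr n (cmul \<omega> z - Bq k (eq ?D z))" using bdr_diff[OF eB bdrI[OF w(1)]] by simp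
    ultimately show ?thesis using that Tq_Bq[OF u(1)] u(2) by simp
  qed
  have "Tq (cmul \<omega> z - y) = cmul \<omega> z - y" by (simp add: lin_ds[OF Tq_lin] y zC)
  from d1_image_add[OF d1_image_bdr[OF this y(3)] y(1)] have "I.d1_image (int n) (cmul \<omega> z)" by simp
  from d1_image_cmul[OF this, of "1 / \<omega>"] show ?thesis using z(3) by simp
qed

lemma Tq_weight0: assumes "Pw 0 z = z" shows "Tq z = z"
proof (rule poly_mapping_eqI)
  fix l
  have "wt l = 0 ==> te l = 1" using Re_wt[of l] by (simp add: te_def)
  then show "lookup (Tq z) l = lookup z l" using lookup_Pw[of 0 z l] assms by (auto simp: lookup_Tq split: if_splits)
qed

lemma Pw_Tq_fixed: "z \<in> Cn n ==> Tq z = z ==> Tq (Pw \<omega> z) = Pw \<omega> z" by (simp flip: Pw_Tq)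

lemma component_boundary:
  assumes z: "I.cyc (int n) z" and B: "I.bdry (int n + 1) (BI (int n) z)"
  shows "bdr (Suc n) (Bq n (Pw \<omega> z))"
proof -
  have zC: "z \<in> Cn n" "Tq z = z" using z by (simp_all add: I_cyc)
  have "Tq (Bq n z) = Bq n z" using Tq_Bq[OF zC(1)] zC(2) by simp
  from I_bdry[OF this, of "Suc n"] B have "bdr (Suc n) (Bq n z)" by (simp add: BI_nat add.commute)
  then obtain u where u: "u \<in> Cn (Suc (Suc n))" "Bq n z = bn (Suc (Suc n)) u" by (auto simp: bdr_def)
  have "Bq n (Pw \<omega> z) = bn (Suc (Suc n)) (Pw \<omega> u)" using u Pw_Bq[OF zC(1)] Pw_bn[OF u(1)] by simp
  then show ?thesis using Pw_Cn[OF u(1)] by (auto simp: bdr_def)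
qed

text \<open>Hence the second page is that of the weight zero part.\<close>

lemma weight0_d1_image:
  assumes z: "I.cyc (int n) z" and B: "I.bdry (int n + 1) (BI (int n) z)" and z0: "I.d1_image (int n) (Pw 0 z - y)"
  shows "I.d1_image (int n) (z - y)"
proof -
  have zC: "z \<in> Cn n" "Tq z = z" "bn n z = 0" using z by (simp_all add: I_cyc)
  have w: "I.d1_image (int n) (Pw \<omega> z)" if "\<omega> \<noteq> 0" for \<omega>
    using zC Pw_bn[OF zC(1), of \<omega>] by (intro nonzero_weight[OF _ _ that component_boundary[OF z B]])
      (simp_all add: I_cyc Pw_Cn Pw_Tq_fixed lin_0[OF Pw_lin] Pw_Pw)
  let ?\<Omega> = "wt ` keys z"
  have s: "finite S ==> 0 \<notin> S ==> I.d1_image (int n) (\<Sum>\<omega>\<in>S. Pw \<omega> z)" for S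
  proof (induction S rule: finite_induct)
    case empty then show ?case using d1_image_bdr[of 0 n] by (simp add: bdr_0)
  next
    case (insert x S) then show ?case using w by (auto intro!: d1_image_add)
  qed
  have "z = Pw 0 z + (\<Sum>\<omega>\<in>?\<Omega> - {0}. Pw \<omega> z)"
  proof (cases "0 \<in> ?\<Omega>")
    case True
    then show ?thesis using Pw_decomp[of z] sum.remove[of ?\<Omega> 0 "\<lambda>\<omega>. Pw \<omega> z"] by simp
  next
    case False
    then have "Pw 0 z = 0" by (intro poly_mapping_eqI) (auto simp: lookup_Pw in_keys_iff image_iff)
    then show ?thesis using Pw_decomp[of z] False by simp
  qed
  then have e: "z - y = (Pw 0 z - y) + (\<Sum>\<omega>\<in>?\<Omega> - {0}. Pw \<omega> z)" by (simp only: diff_add_eq)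
  show ?thesis by (subst e, rule d1_image_add[OF z0 s]) auto
qed

text \<open>In weight zero the Lie derivatives of the torus vanish, so Cartan's formula says that \<open>B\<close>
  anticommutes with contractions up to homology. The three derivations are the ones that occur below, the
  last one being the given \<open>\<partial>\<^sup>-\<^sub>H\<close>.\<close>

lemma Lq_weight0: assumes z: "z \<in> Cn n" "Pw 0 z = z" and xy: "(x, y) = (1, 0) \<or> (x, y) = (0, 1) \<or> (x, y) = (-1, -1)"
  shows "Lq (Dw x y) n z = 0"
proof (rule poly_mapping_eqI)
  fix l
  have w: "wtl x y l = x * of_int (sum_list (map fst l)) + y * of_int (sum_list (map (\<lambda>(i, j, k). int j - int k) l))" for x y
    by (induction l) (auto simp: wtl_def wtc_def algebra_simps)
  have "lookup z l \<noteq> 0 ==> wt l = 0" using z(2) lookup_Pw[of 0 z l] by (auto split: if_splits)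
  then have "lookup z l \<noteq> 0 ==> wtl x y l = 0"
    unfolding w using complex_eq_iff[of "of_int (sum_list (map fst l)) + \<i> * of_int (sum_list (map (\<lambda>(i, j, k). int j - int k) l))" 0] by simp
  then show "lookup (Lq (Dw x y) n z) l = lookup 0 l" by (auto simp: lookup_Lq[OF z(1)])
qed

section \<open>Classes in low degrees\<close>

lemma dq_list: "i < length xs ==> 2 \<le> length xs ==> dq i (ten xs) = ten (if Suc i < length xs then take i xs @ (xs ! i * xs ! Suc i) # drop (i + 2) xs
              else (\<sigma> (last xs) * hd xs) # butlast (tl xs))"
  by (simp add: dq_ten fc_def)

lemma bn_ten:
  "bn 1 (ten [m, g]) = ten [m * g] - ten [\<sigma> g * m]"
  "bn 2 (ten [m, g, h]) = ten [m * g, h] - ten [m, g * h] + ten [\<sigma> h * m, g]"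
  "bn 3 (ten [m, g, h, k]) = ten [m * g, h, k] - ten [m, g * h, k] + ten [m, g, h * k] - ten [\<sigma> k * m, g, h]"
  by (simp_all add: bn_def Sp_def dq_list numeral_2_eq_2 numeral_3_eq_3 cmul_minus)

lemma ten2_lin: "lin scale cmul (\<lambda>m. ten [m, h])" "lin scale cmul (\<lambda>h. ten [m, h])"
  using ten_lin[of "[]" "[h]"] ten_lin[of "[m]" "[]"] by simp_all

lemmas T2 = lin_add[OF ten2_lin(1)] lin_add[OF ten2_lin(2)] lin_scale[OF ten2_lin(1)] lin_scale[OF ten2_lin(2)]

lemma bdr_leibniz: "bdr 1 (ten [m, g * h] - ten [m * g, h] - ten [\<sigma> h * m, g])"
proof -
  have "bdr 1 (- bn 2 (ten [m, g, h]))" using bdrI[of "ten [m, g, h]" 1] by (intro bdr_uminus) (simp add: ten_Cn numeral_2_eq_2)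
  then show ?thesis by (simp add: bn_ten algebra_simps)
qed

lemma bdr_unit: "bdr 1 (ten [m, 1])"
  using bdr_uminus[OF bdr_leibniz[of m 1 1]] by (simp add: \<sigma>_one)

lemma \<sigma>_rules:
  "\<sigma> a * (\<sigma> d * m) = m + scale q (b * (c * m))"
  "\<sigma> d * (\<sigma> a * m) = m + scale (inverse q) (b * (c * m))"
  "\<sigma> d * (c * m) = scale (inverse q) (c * (\<sigma> d * m))"
  "\<sigma> a * (b * m) = scale q (b * (\<sigma> a * m))"
  "c * (b * m) = b * (c * m)"
proof goal_cases
  have ad: "\<sigma> a * \<sigma> d = a * d" and da: "\<sigma> d * \<sigma> a = d * a"
    using q0 by (simp_all add: \<sigma>_gen scale_mult_left scale_mult_right power_int_minus)
  have "\<sigma> a * (\<sigma> d * m) = (\<sigma> a * \<sigma> d) * m" by (simp only: mult.assoc)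
  then show "\<sigma> a * (\<sigma> d * m) = m + scale q (b * (c * m))"
    by (simp add: ad rel_ad distrib_right scale_mult_left mult.assoc)
  have "\<sigma> d * (\<sigma> a * m) = (\<sigma> d * \<sigma> a) * m" by (simp only: mult.assoc)
  then show "\<sigma> d * (\<sigma> a * m) = m + scale (inverse q) (b * (c * m))"
    by (simp add: da rel_da distrib_right scale_mult_left mult.assoc)
  have "d * (c * m) = (d * c) * m" by (simp only: mult.assoc)
  then show "\<sigma> d * (c * m) = scale (inverse q) (c * (\<sigma> d * m))"
    by (simp add: \<sigma>_gen dc scale_mult_left scale_mult_right mult.assoc mult.commute)
  have "a * (b * m) = (a * b) * m" by (simp only: mult.assoc)
  then show "\<sigma> a * (b * m) = scale q (b * (\<sigma> a * m))"
    by (simp add: \<sigma>_gen rel_ab scale_mult_left scale_mult_right mult.assoc mult.commute)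
  case 5 show ?case by (metis mult.assoc rel_bc)
qed

lemma \<sigma>_bc: "\<sigma> b = b" "\<sigma> c = c" by (simp_all add: \<sigma>_gen)

lemma svq_T: "svq (T m) = ten [m, 1]"
  by (simp add: svq_app1[OF ten_Cn[of "[m]" 0, simplified]] app1_ten)

lemma \<rho>_ten2: "lr l r (ten [m, 1]) = ten [\<sigma> l * m, r]" using lr_mid[of l r m "[]" 1] by simp

lemma map3_simp: "map3 f (u, v, w) = (f u, f v, f w)" by (simp add: map3_def)

text \<open>In degree one the staircase amounts to the Koszul differential of \<open>(u \<otimes> 1, v \<otimes> 1, w
  \<otimes> 1)\<close>, up to sign.\<close>

lemma \<psi>_T: "K.\<psi> 1 (T u, T v, T w) = - (ten [\<sigma> d * u, b] - cmul q (ten [b * u, d]) - cmul (inverse q) (ten [c * v, a])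
    + ten [\<sigma> a * v, c] + ten [\<sigma> d * w, a] - cmul q (ten [b * w, c]) - ten [w, 1])"
proof -
  let ?y = "\<beta> (ten [u, 1]) + \<gamma> (ten [v, 1]) + \<alpha> 1 (ten [w, 1])"
  have y: "?y \<in> Cn 1" by (intro Cn_add Cn_diff Cn_cmul \<rho>_Cn ten_Cn) simp_all
  have "K.\<psi> 1 (T u, T v, T w) = dq 2 (svq ?y)"
    by (simp add: K.\<psi>_def map3_simp svq_T Kd_def numeral_2_eq_2)
  also have "\<dots> = - dq 2 (app1 ?y)" unfolding svq_app1[OF y] by (simp add: cmul_minus lin_uminus[OF dq_lin])
  also have "dq 2 (app1 ?y) = ?y" using dq_last_app1[OF y] by (simp only: numeral_2_eq_2 One_nat_def)
  finally show ?thesis by (simp add: adop_def \<rho>_ten2 \<sigma>_bc lin_add[OF lr_lin] algebra_simps)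
qed

text \<open>Koszul chains that represent \<open>m \<otimes> c\<close>, \<open>m \<otimes> a\<close> and \<open>m
  \<otimes> b\<close> up to sign. They are found by solving for the terms of \<open>\<psi>_T\<close>; in the
  last one the Leibniz rule trades the factor \<open>d\<close> for \<open>b\<close>, \<open>c\<close> and
  \<open>a\<close>.\<close>

definition yc :: "'a => tens \<times> tens \<times> tens" where "yc m = (T 0, T (\<sigma> d * m), T (c * m))"
definition ya :: "'a => tens \<times> tens \<times> tens" where "ya m = (T 0, T (b * m), T (\<sigma> a * m))"
definition yb :: "'a => tens \<times> tens \<times> tens" where
  "yb m = (T (\<sigma> a * m), T 0, T 0) + sc (inverse q) (yc (b * m * b)) - ya (b * m * d)"

lemma ten_0: "ten [0, h] = 0" "T 0 = 0" using lin_0[OF ten2_lin(1)] lin_0[OF T_lin] by simp_all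

lemma \<psi>_yc: "bdr 1 (ten [m, c] + K.\<psi> 1 (yc m))"
  using bdr_unit[of "c * m"] unfolding yc_def \<psi>_T by (simp add: \<sigma>_rules T2 ten_0 mult.assoc)

lemma \<psi>_ya: "bdr 1 (ten [m, a] + K.\<psi> 1 (ya m))"
  using bdr_unit[of "\<sigma> a * m"] q0 unfolding ya_def \<psi>_T by (simp add: \<sigma>_rules T2 ten_0 mult.assoc)

lemma ten_\<sigma>a_d: "bdr 1 (ten [\<sigma> a * m, d] - cmul (inverse q) (ten [m * b, c] + ten [c * m, b]) + ten [m * d, a])"
proof -
  have "bdr 1 (cmul (inverse q) (ten [m, b * c] - ten [m * b, c] - ten [\<sigma> c * m, b]) + ten [m, 1]
     - (ten [m, d * a] - ten [m * d, a] - ten [\<sigma> a * m, d]))"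
    by (intro bdr_add bdr_diff bdr_cmul bdr_leibniz bdr_unit)
  then show ?thesis by (simp add: rel_da T2 \<sigma>_bc cmul_add cmul_diff algebra_simps)
qed

lemma yb_b: "K.\<psi> 1 (yb m) = K.\<psi> 1 (T (\<sigma> a * m), T 0, T 0) + cmul (inverse q) (K.\<psi> 1 (yc (b * m * b))) - K.\<psi> 1 (ya (b * m * d))"
  unfolding yb_def by (simp add: lin_ads[OF \<psi>_lin])

lemma \<psi>_yb: "bdr 1 (ten [m, b] + K.\<psi> 1 (yb m))"
proof -
  have "bdr 1 ((ten [\<sigma> a * (b * m), d] - cmul (inverse q) (ten [b * m * b, c] + ten [c * (b * m), b]) + ten [b * m * d, a])
      + cmul (inverse q) (ten [b * m * b, c] + K.\<psi> 1 (yc (b * m * b))) - (ten [b * m * d, a] + K.\<psi> 1 (ya (b * m * d))))"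
    by (intro bdr_add bdr_diff bdr_cmul ten_\<sigma>a_d \<psi>_yc \<psi>_ya)
  moreover have "(ten [\<sigma> a * (b * m), d] - cmul (inverse q) (ten [b * m * b, c] + ten [c * (b * m), b]) + ten [b * m * d, a])
      + cmul (inverse q) (ten [b * m * b, c] + K.\<psi> 1 (yc (b * m * b))) - (ten [b * m * d, a] + K.\<psi> 1 (ya (b * m * d))) = ten [m, b] + K.\<psi> 1 (yb m)"
    unfolding yb_b \<psi>_T by (simp add: \<sigma>_rules T2 ten_0 cmul_add)
  ultimately show ?thesis by simp
qed

lemma Kd_yc: "Kd 0 (yc m) = (T (m * c - c * m), 0, 0)"
  using q0 by (simp add: Kd_def yc_def adop_def lr_single \<sigma>_rules \<sigma>_bc ten_0 lin_0[OF lr_lin] mult.assoc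
    lin_ads[OF T_lin] scale_mult_left distrib_right)

lemma Kd_ya: "Kd 0 (ya m) = (T (m * a - \<sigma> a * m), 0, 0)"
  using q0 by (simp add: Kd_def ya_def adop_def lr_single \<sigma>_rules \<sigma>_bc ten_0 lin_0[OF lr_lin] mult.assoc
    lin_ads[OF T_lin] scale_mult_left distrib_right)

lemma Kd_yb: "Kd 0 (yb m) = (T (m * b - b * m), 0, 0)"
proof -
  \<comment> \<open>The terms other than \<open>mb\<close> are cancelled by the corrections \<open>yc\<close> and \<open>ya\<close> in \<open>yb\<close>.\<close>
  have 1: "Kd 0 (T (\<sigma> a * m), T 0, T 0) = (T (m * b + scale (inverse q) (b * (c * (m * b))) - scale q (b * (\<sigma> a * (m * d)))), 0, 0)"
    by (simp add: Kd_def adop_def lr_single \<sigma>_rules \<sigma>_bc ten_0 lin_0[OF lr_lin] lin_0[OF \<rho>_lin] mult.assoc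
      lin_ads[OF T_lin] scale_mult_left distrib_right)
  show ?thesis unfolding yb_def lin_ads[OF Kd_lin] Kd_yc Kd_ya 1
    using q0 by (simp add: map3_def zero_prod_def mult.assoc rel_da \<sigma>_rules distrib_left scale_mult_right lin_ads[OF T_lin]
      rel_bc[symmetric] cmul_diff)
qed

subsection \<open>The fundamental cycle\<close>

text \<open>The fundamental cycle with \<open>m\<close> multiplied into its zeroth factor.\<close>

definition FC :: "'a => tens" where
  "FC m = cmul (- q) (ten [m * d, b, a, c]) + ten [m * d, a, b, c]
   + cmul (q\<^sup>2) (ten [m * d, b, c, a]) - ten [m * d, a, c, b]
   - cmul (q\<^sup>2) (ten [m * d, c, b, a]) + cmul q (ten [m * d, c, a, b])
   + ten [m * c, b, a, d] - cmul (inverse q) (ten [m * c, a, b, d])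
   - ten [m * c, b, d, a] - cmul (q - inverse q) (ten [m * c, b, c, b])
   + ten [m * c, a, d, b] + cmul q (ten [m * c, d, b, a])
   - ten [m * c, d, a, b]"

lemma ten3_lin: "lin scale cmul (\<lambda>m. ten [m, g, h])" "lin scale cmul (\<lambda>g. ten [m, g, h])" "lin scale cmul (\<lambda>h. ten [m, g, h])"
  using ten_lin[of "[]" "[g, h]"] ten_lin[of "[m]" "[h]"] ten_lin[of "[m, g]" "[]"] by simp_all

lemmas T3 = lin_add[OF ten3_lin(1)] lin_add[OF ten3_lin(2)] lin_add[OF ten3_lin(3)]
  lin_scale[OF ten3_lin(1)] lin_scale[OF ten3_lin(2)] lin_scale[OF ten3_lin(3)]

lemma FC_Cn: "FC m \<in> Cn 3"
  unfolding FC_def by (intro Cn_add Cn_diff Cn_cmul ten_Cn) simp_all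

lemma eq_ten: "is_der D ==> eq D (ten (x # y # zs)) = ten (x * D y # zs)"
  by (simp add: eq_def Dq_ten dq_list)

lemma Dw_values: "Dw x y a = scale x a" "Dw x y b = scale y b" "Dw x y c = scale (- y) c" "Dw x y d = scale (- x) d"
  using Dw_gen[of x y GA] Dw_gen[of x y GB] Dw_gen[of x y GC] Dw_gen[of x y GD] by simp_all

text \<open>The first capped class is the one of the theorem. A second contraction leads down to degree one, where
  classes can be detected.\<close>

definition ccap :: "'a => tens" where "ccap m = eq (Dw (-1) (-1)) (FC m)"
definition zcap :: "'a => tens" where "zcap m = eq (Dw 1 0) (ccap m)"

context
  fixes m :: 'a and \<kappa> :: complex
  assumes m: "a * m = scale \<kappa> (m * a)" "d * m = scale (1 / \<kappa>) (m * d)" "b * m = m * b" "c * m = m * c"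
    and \<kappa>: "\<kappa> \<noteq> 0" "q powi N = q * q * \<kappa>"
begin

lemma m_left: "a * (m * x) = scale \<kappa> (m * (a * x))" "d * (m * x) = scale (1 / \<kappa>) (m * (d * x))"
  "b * (m * x) = m * (b * x)" "c * (m * x) = m * (c * x)"
  using m by (metis mult.assoc scale_mult_left)+

lemma FC_cycle: "bn 3 (FC m) = 0"
proof -
  have N: "q powi (- N) = 1 / (q * q * \<kappa>)" using \<kappa> qN by simp
  note nf = mult.assoc m_left rel_ab rel_ac rel_bc[symmetric] rel_ad rel_da db dc \<sigma>_gen \<kappa>(2) N
    scale_mult_left scale_mult_right distrib_left T3
  show ?thesis unfolding FC_def lin_ads[OF bn_lin] bn_ten(3)
    by (rule poly_mapping_eqI; simp add: nf coords; simp add: q0 \<kappa> field_simps power2_eq_square)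
qed

lemma a_left: "a * (b * x) = scale q (b * (a * x))" "a * (c * x) = scale q (c * (a * x))"
  by (metis mult.assoc scale_mult_left rel_ab rel_ac)+

text \<open>Only six terms of the fundamental cycle survive both contractions. The terms ending in \<open>a\<close>
  and \<open>d\<close> are traded for terms ending in \<open>b\<close> and \<open>c\<close> by
  \<open>ten_\<sigma>a_d\<close>.\<close>

lemma zcap: "bdr 1 (zcap m - (ten [m * b, c] + ten [m * c, b] + cmul (q - inverse q) (ten [m * c * b * c, b])))"
proof -
  have e: "zcap m = cmul q (ten [m * d * b * a, c]) + cmul q (ten [m * d * c * a, b]) - ten [m * c * b * a, d]
     - ten [m * c * b * d, a] + ten [m * c * a * d, b] - ten [m * c * d * a, b]"
    unfolding zcap_def ccap_def FC_def
    by (rule poly_mapping_eqI; simp add: lin_ads[OF eq_lin[OF Dw_der]]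
       eq_ten[OF Dw_der] Dw_values scale_mult_right scale_mult_left T2 T3 ten_0 lin_uminus[OF ten2_lin(1)] mult.assoc coords)
  let ?x = "m * (b * c)"
  have N: "q powi (- N) = 1 / (q * q * \<kappa>)" using \<kappa> qN by simp
  have "bdr 1 (- (ten [\<sigma> a * ?x, d] - cmul (inverse q) (ten [?x * b, c] + ten [c * ?x, b]) + ten [?x * d, a]))"
    by (intro bdr_uminus ten_\<sigma>a_d)
  also have "- (ten [\<sigma> a * ?x, d] - cmul (inverse q) (ten [?x * b, c] + ten [c * ?x, b]) + ten [?x * d, a])
    = zcap m - (ten [m * b, c] + ten [m * c, b] + cmul (q - inverse q) (ten [m * c * b * c, b]))"
    unfolding e
    by (rule poly_mapping_eqI; simp add: mult.assoc m_left a_left \<sigma>_rules(5) rel_ab rel_ac rel_bc[symmetric] rel_ad rel_da db dc \<sigma>_gen \<kappa>(2) N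
      scale_mult_left scale_mult_right distrib_left T2 coords; simp add: q0 \<kappa> field_simps)
  finally show ?thesis .
qed

end

section \<open>The second page in weight zero\<close>

text \<open>Linear algebra modulo boundaries: two independent classes in a space spanned by two classes form a basis.
  This way the Koszul computation need only bound the dimension, and the generators are never computed under
  \<open>\<psi>\<close>.\<close>

lemma bdr_span2:
  assumes H: "\<And>z. Z z ==> \<exists>s t. bdr n (z - cmul s g1 - cmul t g2)"
    and e: "Z e1" "Z e2" and ind: "\<And>x y. bdr n (cmul x e1 + cmul y e2) ==> x = 0 \<and> y = 0" and z: "Z z"
  shows "\<exists>x y. bdr n (z - cmul x e1 - cmul y e2)"
proof -
  obtain s1 t1 where 1: "bdr n (e1 - cmul s1 g1 - cmul t1 g2)" using H[OF e(1)] by blast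
  obtain s2 t2 where 2: "bdr n (e2 - cmul s2 g1 - cmul t2 g2)" using H[OF e(2)] by blast
  obtain s t where 3: "bdr n (z - cmul s g1 - cmul t g2)" using H[OF z] by blast
  let ?D = "s1 * t2 - s2 * t1"
  note bb = bdr_add[OF bdr_cmul bdr_cmul] bdr_diff[OF bdr_cmul bdr_cmul] bdr_diff[OF _ bdr_cmul]
  have "?D \<noteq> 0"
  proof
    assume D: "?D = 0"
    have "cmul t2 (e1 - cmul s1 g1 - cmul t1 g2) - cmul t1 (e2 - cmul s2 g1 - cmul t2 g2) = cmul t2 e1 + cmul (- t1) e2 - cmul ?D g1"
      by (rule poly_mapping_eqI) (simp add: coords algebra_simps)
    then have "bdr n (cmul t2 e1 + cmul (- t1) e2)" using bb(2)[OF 1 2, of t2 t1] D by simp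
    from ind[OF this] have t: "t1 = 0" "t2 = 0" by simp_all
    have "cmul s2 (e1 - cmul s1 g1 - cmul t1 g2) - cmul s1 (e2 - cmul s2 g1 - cmul t2 g2) = cmul s2 e1 + cmul (- s1) e2 + cmul ?D g2"
      by (rule poly_mapping_eqI) (simp add: coords algebra_simps)
    then have "bdr n (cmul s2 e1 + cmul (- s1) e2)" using bb(2)[OF 1 2, of s2 s1] D by simp
    from ind[OF this] have "s1 = 0" by simp
    then have "bdr n (cmul 1 e1 + cmul 0 e2)" using 1 t by simp
    from ind[OF this] show False by simp
  qed
  \<comment> \<open>Cramer's rule.\<close>
  define x where "x = (s * t2 - t * s2) / ?D"
  define y where "y = (s1 * t - t1 * s) / ?D"
  have xD: "x * ?D = s * t2 - t * s2" and yD: "y * ?D = s1 * t - t1 * s" using \<open>?D \<noteq> 0\<close> by (simp_all add: x_def y_def)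
  have "(x * s1 + y * s2) * ?D = (x * ?D) * s1 + (y * ?D) * s2" by (simp add: algebra_simps)
  also have "\<dots> = s * ?D" unfolding xD yD by (simp add: algebra_simps)
  finally have xs: "x * s1 + y * s2 = s" using \<open>?D \<noteq> 0\<close> by simp
  have "(x * t1 + y * t2) * ?D = (x * ?D) * t1 + (y * ?D) * t2" by (simp add: algebra_simps)
  also have "\<dots> = t * ?D" unfolding xD yD by (simp add: algebra_simps)
  finally have yt: "x * t1 + y * t2 = t" using \<open>?D \<noteq> 0\<close> by simp
  have "bdr n ((z - cmul s g1 - cmul t g2) - (cmul x (e1 - cmul s1 g1 - cmul t1 g2) + cmul y (e2 - cmul s2 g1 - cmul t2 g2)))"
    by (intro bdr_diff bdr_add bdr_cmul 1 2 3)
  also have "(z - cmul s g1 - cmul t g2) - (cmul x (e1 - cmul s1 g1 - cmul t1 g2) + cmul y (e2 - cmul s2 g1 - cmul t2 g2)) = z - cmul x e1 - cmul y e2"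
    unfolding xs[symmetric] yt[symmetric]
    by (rule poly_mapping_eqI) (simp add: coords algebra_simps)
  finally show ?thesis by blast
qed

lemma bdr_span1:
  assumes H: "\<And>z. Z z ==> \<exists>t. bdr n (z - cmul t g)" and e: "Z e1" "\<not> bdr n e1" and z: "Z z"
  shows "\<exists>x. bdr n (z - cmul x e1)"
proof -
  obtain t1 where 1: "bdr n (e1 - cmul t1 g)" using H[OF e(1)] by blast
  obtain t where 3: "bdr n (z - cmul t g)" using H[OF z] by blast
  have t1: "t1 \<noteq> 0" using 1 e(2) by auto
  have "bdr n ((z - cmul t g) - cmul (t / t1) (e1 - cmul t1 g))" by (intro bdr_diff bdr_cmul 1 3)
  also have "(z - cmul t g) - cmul (t / t1) (e1 - cmul t1 g) = z - cmul (t / t1) e1"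
    using t1 by (intro poly_mapping_eqI) (simp add: lookup_minus lookup_cmul algebra_simps)
  finally show ?thesis by blast
qed

definition wcyc :: "nat => tens => bool" where "wcyc n z \<longleftrightarrow> z \<in> Cn n \<and> bn n z = 0 \<and> Pw 0 z = z"

lemma \<psi>_0: "u \<in> Cn 0 ==> K.\<psi> 0 (u, v, w) = u"
  using dq_last_app1[of u 0] by (simp add: K.\<psi>_def map3_simp svq_app1)

lemma \<psi>_bdr: "y' \<in> KC (Suc n) 0 ==> bdr n (K.\<psi> n (Kd n y'))"
  using K.\<psi>_boundary[of y' n] by (auto simp: bdr_def)

lemma wcyc_Koszul:
  assumes "wcyc n z" obtains y where "K.closed n y" "PK n 0 y = y" "bdr n (z - K.\<psi> n y)"
proof -
  obtain y u where y: "K.closed n y" "PK n 0 y = y" "u \<in> Cn (Suc n)" "z = K.\<psi> n y + bn (Suc n) u"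
    using weight_cycle[of z n 0] assms unfolding wcyc_def by blast
  then have "bdr n (z - K.\<psi> n y)" by (auto simp: bdr_def)
  with y show ?thesis using that by blast
qed

lemma wcyc_reduce:
  assumes "bdr n (z - K.\<psi> n y)" "y = S + Kd n y'" "y' \<in> KC (Suc n) 0"
  shows "bdr n (z - K.\<psi> n S)"
  using bdr_add[OF assms(1) \<psi>_bdr[OF assms(3)]] by (simp add: assms(2) lin_add[OF \<psi>_lin] algebra_simps)

lemma H0_span: assumes \<nu>: "nz_off k0" and z: "wcyc 0 z" shows "\<exists>t. bdr 0 (z - cmul t (X k0))"
proof -
  obtain y where y: "K.closed 0 y" "PK 0 0 y = y" "bdr 0 (z - K.\<psi> 0 y)" using wcyc_Koszul[OF z] .
  obtain t p where "y = sc t (X k0, 0, 0) + Kd 0 (0, 0, VX p)" using Koszul_H0[OF \<nu> y(1,2)] by blast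
  from wcyc_reduce[OF y(3) this] have "bdr 0 (z - K.\<psi> 0 (sc t (X k0, 0, 0)))" by (simp add: KC_def V_Cn Cn_0)
  then show ?thesis by (auto simp: lin_scale[OF \<psi>_lin] \<psi>_0 XYW_Cn)
qed

lemma H1_span_regular: assumes \<nu>: "nz_off 0" and z: "wcyc 1 z" shows "\<exists>t. bdr 1 (z - cmul t (K.\<psi> 1 (c1 0 (e 0))))"
proof -
  obtain y where y: "K.closed 1 y" "PK 1 0 y = y" "bdr 1 (z - K.\<psi> 1 y)" using wcyc_Koszul[OF z] .
  obtain t y' where y': "y' \<in> KC 2 0" "y = sc t (c1 0 (e 0)) + Kd 1 y'" using Koszul_H1_regular[OF \<nu> y(1,2)] by blast
  from wcyc_reduce[OF y(3) y'(2)] y'(1) have "bdr 1 (z - K.\<psi> 1 (sc t (c1 0 (e 0))))" by (simp add: numeral_2_eq_2)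
  then show ?thesis unfolding lin_scale[OF \<psi>_lin] by blast
qed

lemma H1_span_singular: assumes \<nu>: "nz_off (Suc r)" and z: "wcyc 1 z"
  shows "\<exists>s t. bdr 1 (z - cmul s (K.\<psi> 1 (c1 (e r) 0)) - cmul t (K.\<psi> 1 (c1 0 (e r))))"
proof -
  obtain y where y: "K.closed 1 y" "PK 1 0 y = y" "bdr 1 (z - K.\<psi> 1 y)" using wcyc_Koszul[OF z] .
  obtain s t y' where y': "y' \<in> KC 2 0" "y = (sc s (c1 (e r) 0) + sc t (c1 0 (e r))) + Kd 1 y'" using Koszul_H1_singular[OF \<nu> y(1,2)] by blast
  from wcyc_reduce[OF y(3) y'(2)] y'(1) have "bdr 1 (z - K.\<psi> 1 (sc s (c1 (e r) 0) + sc t (c1 0 (e r))))" by (simp add: numeral_2_eq_2)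
  then show ?thesis unfolding lin_as[OF \<psi>_lin] diff_diff_eq by blast
qed

lemma H2_span_regular: assumes \<nu>: "nz_off 0" and z: "wcyc 2 z" shows "bdr 2 z"
proof -
  obtain y where y: "K.closed 2 y" "PK 2 0 y = y" "bdr 2 (z - K.\<psi> 2 y)" using wcyc_Koszul[OF z] .
  obtain y' where y': "y' \<in> KC 3 0" "y = sc 0 y + Kd 2 y'" using Koszul_H2_regular[OF \<nu> y(1,2)]
    by (cases y) (auto simp: map3_simp simp flip: zero_prod_def)
  from wcyc_reduce[OF y(3) y'(2)] y'(1) have "bdr 2 (z - K.\<psi> 2 (sc 0 y))" by (simp add: numeral_3_eq_3)
  then show ?thesis unfolding lin_scale[OF \<psi>_lin] by simp
qed

lemma H2_span_singular: assumes \<nu>: "nz_off (Suc r)" "\<nu> (Suc r) = 0" and z: "wcyc 2 z"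
  shows "\<exists>s t. bdr 2 (z - cmul s (K.\<psi> 2 (X r, 0, 0)) - cmul t (K.\<psi> 2 (- X (Suc r), Y r, cmul (q * q) (W r))))"
proof -
  obtain y where y: "K.closed 2 y" "PK 2 0 y = y" "bdr 2 (z - K.\<psi> 2 y)" using wcyc_Koszul[OF z] .
  obtain s t y' where y': "y' \<in> KC 3 0" "y = (sc s (X r, 0, 0) + sc t (- X (Suc r), Y r, cmul (q * q) (W r))) + Kd 2 y'"
    using Koszul_H2_singular[OF \<nu> y(1,2)] by blast
  from wcyc_reduce[OF y(3) y'(2)] y'(1) have "bdr 2 (z - K.\<psi> 2 (sc s (X r, 0, 0) + sc t (- X (Suc r), Y r, cmul (q * q) (W r))))" by (simp add: numeral_3_eq_3)
  then show ?thesis unfolding lin_as[OF \<psi>_lin] diff_diff_eq by blast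
qed

lemma H3_span_regular: assumes \<nu>: "nz_off 0" and z: "wcyc 3 z" shows "bdr 3 z"
proof -
  obtain y where y: "K.closed 3 y" "PK 3 0 y = y" "bdr 3 (z - K.\<psi> 3 y)" using wcyc_Koszul[OF z] .
  have "y = 0" by (rule Koszul_H3_regular[OF \<nu> y(1,2)])
  then show ?thesis using y(3) lin_0[OF \<psi>_lin, of 3] by simp
qed

lemma H3_span_singular: assumes \<nu>: "nz_off (Suc r)" and z: "wcyc 3 z"
  shows "\<exists>t. bdr 3 (z - cmul t (K.\<psi> 3 (X r, 0, 0)))"
proof -
  obtain y where y: "K.closed 3 y" "PK 3 0 y = y" "bdr 3 (z - K.\<psi> 3 y)" using wcyc_Koszul[OF z] .
  obtain t where "y = sc t (X r, 0, 0)" using Koszul_H3_singular[OF \<nu> y(1,2)] by blast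
  then show ?thesis using y(3) unfolding \<open>y = _\<close> lin_scale[OF \<psi>_lin] by blast
qed

lemma \<nu>_zero: "\<nu> k = 0 \<longleftrightarrow> N = 2 * int k"
proof -
  have "q powi N / (q ^ k * q ^ k) = q powi (N - 2 * int k)"
    using q0 by (simp add: power_int_diff power_int_mult power_int_of_nat power_mult power2_eq_square power_mult_distrib mult.commute)
  then have "\<nu> k = 0 \<longleftrightarrow> q powi (N - 2 * int k) = 1" by (simp add: \<nu>_def)
  then show ?thesis by (simp add: q_powi_eq_1)
qed

lemma nz_off_regular: "(\<nexists>r::nat. N = 2 * int r + 2) ==> nz_off 0"
  unfolding nz_off_def \<nu>_zero by (metis mult_2 of_nat_Suc distrib_left mult.right_neutral add.commute not0_implies_Suc)
lemma nz_off_singular: "N = 2 * int r + 2 ==> nz_off (Suc r)" "N = 2 * int r + 2 ==> \<nu> (Suc r) = 0"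
  unfolding nz_off_def \<nu>_zero by auto

lemma weight0I: assumes v: "v \<in> Cn n" "Lw n v = 0" shows "Pw 0 v = v"
proof (rule poly_mapping_eqI)
  fix l
  have "wt l * lookup v l = 0" using arg_cong[OF v(2), of "\<lambda>v. lookup v l"] by (simp add: lookup_Lq[OF v(1)])
  then show "lookup (Pw 0 v) l = lookup v l" by (auto simp: lookup_Pw)
qed

definition hw :: "complex => 'a => bool" where "hw \<omega> x \<longleftrightarrow> Dw 1 \<i> x = scale \<omega> x"

lemma hw_gens: "hw 1 a" "hw \<i> b" "hw (- \<i>) c" "hw (- 1) d" "hw 0 1"
  by (simp_all add: hw_def Dw_values Dw_one)
lemma hw_mult: "hw w x ==> hw w' y ==> hw (w + w') (x * y)"
  by (simp add: hw_def Dw_mult scale_mult_left scale_mult_right scale_left_distrib)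
lemma hw_bas: "hw (wtc 1 \<i> i) (bas i)" by (simp add: hw_def Dw_bas)

text \<open>The Lie derivative acts on a tensor of homogeneous factors by the sum of their weights.\<close>

lemma ten_weight0:
  assumes xs: "length xs = Suc n" and h: "list_all2 hw ws xs" and s: "sum_list ws = 0"
  shows "Pw 0 (ten xs) = ten xs"
proof (rule weight0I)
  show "ten xs \<in> Cn n" by (rule ten_Cn[OF xs])
  have l: "length ws = Suc n" using h xs by (simp add: list_all2_lengthD)
  have "Dq (Dw 1 \<i>) j (ten xs) = cmul (ws ! j) (ten xs)" if "j \<le> n" for j
  proof -
    have j: "j < length xs" using that xs by simp
    have "Dw 1 \<i> (xs ! j) = scale (ws ! j) (xs ! j)" using list_all2_nthD2[OF h j] by (simp add: hw_def)
    then have "Dq (Dw 1 \<i>) j (ten xs) = ten (take j xs @ scale (ws ! j) (xs ! j) # drop (Suc j) xs)"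
      using j by (simp add: Dq_ten[OF Dw_der] upd_conv_take_nth_drop)
    also have "\<dots> = cmul (ws ! j) (ten (take j xs @ xs ! j # drop (Suc j) xs))" by (rule lin_scale[OF ten_lin])
    finally show ?thesis using j by (simp flip: id_take_nth_drop)
  qed
  then have "Lw n (ten xs) = (\<Sum>j\<le>n. cmul (ws ! j) (ten xs))" by (simp add: Lq_def)
  also have "\<dots> = cmul (\<Sum>j\<le>n. ws ! j) (ten xs)" by (simp add: free.scale_sum_left)
  also have "(\<Sum>j\<le>n. ws ! j) = sum_list ws" using l by (simp add: sum_list_sum_nth atLeast0LessThan lessThan_Suc_atMost)
  finally show "Lw n (ten xs) = 0" using s by simp
qed

lemma wcyc_Cn: "wcyc n z ==> z \<in> Cn n" and wcyc_bn: "wcyc n z ==> bn n z = 0" and wcyc_Pw: "wcyc n z ==> Pw 0 z = z"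
  and wcyc_Tq: "wcyc n z ==> Tq z = z"
  by (simp_all add: wcyc_def Tq_weight0)

lemma wcyc_add: "wcyc n x ==> wcyc n y ==> wcyc n (x + y)" and wcyc_cmul: "wcyc n x ==> wcyc n (cmul k x)"
  by (simp_all add: wcyc_def Cn_add Cn_cmul lin_add[OF bn_lin] lin_add[OF Pw_lin] lin_scale[OF bn_lin] lin_scale[OF Pw_lin])

lemma wcyc_diff: "wcyc n u ==> wcyc n v ==> wcyc n (u - v)"
  using wcyc_add[of n u "cmul (-1) v"] wcyc_cmul[of n v "-1"] by (simp add: cmul_minus)

lemma wcyc_Bq: assumes z: "wcyc n z" shows "wcyc (Suc n) (Bq n z)"
  using bn_Bq[OF wcyc_Cn[OF z]] z by (simp add: wcyc_def Bq_Cn Pw_Bq wcyc_Tq[OF z])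

lemma Pw_wcyc: "I.cyc (int n) z ==> wcyc n (Pw 0 z)"
  using Pw_bn[of z n 0] by (auto simp: I_cyc wcyc_def Pw_Cn Pw_Pw lin_0[OF Pw_lin])

text \<open>Since \<open>B\<close> anticommutes with \<open>b\<close> on invariant chains.\<close>

lemma B_bdr: assumes x: "bdr n x" "Pw 0 x = x" shows "bdr (Suc n) (Bq n x)"
proof -
  obtain u where u: "u \<in> Cn (Suc n)" "Pw 0 u = u" "x = bn (Suc n) u" using bdr_Pw[OF x] by blast
  have "Bq n x = bn (Suc (Suc n)) (- Bq (Suc n) u)" using bn_Bq[OF u(1)] Tq_weight0[OF u(2)] by (simp add: u(3) lin_uminus[OF bn_lin])
  then show ?thesis using bdrI[OF Cn_uminus[OF Bq_Cn[OF u(1)]]] by simp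
qed

lemma bdr_cmul_cancel: "bdr n (cmul k x) ==> \<not> bdr n x ==> k = 0"
  using bdr_cmul[of n "cmul k x" "1 / k"] by (cases "k = 0") auto

lemma E2zeroI:
  assumes "\<And>z. wcyc n z ==> bdr (Suc n) (Bq n z) ==> I.d1_image (int n) z"
  shows "I.E2zero (int n)"
  unfolding I.E2zero_def
proof (intro allI impI)
  fix z assume z: "I.cyc (int n) z" and B: "I.bdry (int n + 1) (BI (int n) z)"
  have "I.d1_image (int n) (Pw 0 z - 0)" using assms[OF Pw_wcyc[OF z] component_boundary[OF z B]] by simp
  from weight0_d1_image[OF z B this] show "I.d1_image (int n) z" by simp
qed

lemma E2lineI:
  assumes g: "wcyc n g" "bdr (Suc n) (Bq n g)"
    and span: "\<And>z. wcyc n z ==> bdr (Suc n) (Bq n z) ==> \<exists>k. I.d1_image (int n) (z - cmul k g)"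
    and nz: "\<And>u. (0 < n ==> wcyc (n - 1) u) ==> \<not> bdr n (g - (if n = 0 then 0 else Bq (n - 1) u))"
  shows "I.E2line (int n) g"
  unfolding I.E2line_def
proof (intro conjI allI impI notI)
  show "I.cyc (int n) g" using g by (simp add: I_cyc wcyc_Cn wcyc_bn wcyc_Tq)
  have "Tq (Bq n g) = Bq n g" using wcyc_Tq[OF wcyc_Bq[OF g(1)]] .
  from I_bdry[OF this, of "Suc n"] g(2) show "I.bdry (int n + 1) (BI (int n) g)" by (simp add: BI_nat add.commute)
next
  fix z assume z: "I.cyc (int n) z" and B: "I.bdry (int n + 1) (BI (int n) z)"
  obtain k where "I.d1_image (int n) (Pw 0 z - cmul k g)" using span[OF Pw_wcyc[OF z] component_boundary[OF z B]] by blast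
  from weight0_d1_image[OF z B this] show "\<exists>k. I.d1_image (int n) (z - cmul k g)" by blast
next
  assume "I.d1_image (int n) g"
  then obtain u v where u: "I.cyc (int n - 1) u" and v: "v \<in> MI (int n + 1)" and e: "g = BI (int n - 1) u + bI (int n + 1) v"
    unfolding I.d1_image_def by blast
  have v': "v \<in> Cn (Suc n)" "bI (int n + 1) v = bn (Suc n) v" using v by (simp_all add: MI_Suc)
  have g0: "g = Pw 0 (BI (int n - 1) u) + bn (Suc n) (Pw 0 v)"
    using wcyc_Pw[OF g(1)] Pw_bn[OF v'(1)] e v'(2) lin_add[OF Pw_lin] by metis
  show False
  proof (cases n)
    case 0
    then have "g = bn (Suc n) (Pw 0 v)" using g0 by (simp add: BI_def lin_0[OF Pw_lin])
    then show False using nz[of 0] 0 bdrI[OF Pw_Cn[OF v'(1)]] by auto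
  next
    case (Suc k)
    then have u': "I.cyc (int k) u" "BI (int n - 1) u = Bq k u" using u by (simp_all add: BI_nat)
    have "g = Bq k (Pw 0 u) + bn (Suc n) (Pw 0 v)" using g0 u' Pw_Bq[of u k] by (simp add: I_cyc)
    then have "bdr n (g - Bq k (Pw 0 u))" using bdrI[OF Pw_Cn[OF v'(1)]] by simp
    then show False using nz[of "Pw 0 u"] Suc Pw_wcyc[OF u'(1)] by simp
  qed
qed

lemma bdr_d1: "wcyc n z ==> bdr n z ==> I.d1_image (int n) z" by (rule d1_image_bdr[OF wcyc_Tq])

theorem no_homology: "n > 3 ==> I.cyc n z ==> I.bdry n z"
proof -
  assume n: "n > 3" and z: "I.cyc n z"
  then obtain m where m: "n = int m" by (metis nat_0_le order.strict_implies_order order.strict_trans zero_less_numeral)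
  have z': "z \<in> Cn m" "Tq z = z" "bn m z = 0" using z by (simp_all add: m I_cyc)
  have "bdr m z" using no_homology_above_3[OF z'(1,3)] n m by (auto simp: bdr_def)
  then show ?thesis unfolding m I_bdry[OF z'(2)] .
qed

lemma Bq_0_T: "Bq 0 (T m) = ten [1, m] + ten [\<sigma> m, 1]"
  by (simp add: Bq_def Nq_def sq_ten tq_ten rot_def cmul_minus)

lemma yc_KC: "yc m \<in> KC 1 0" and ya_KC: "ya m \<in> KC 1 0" and yb_KC: "yb m \<in> KC 1 0"
  by (simp_all add: yc_def ya_def yb_def KC_def ten_Cn map3_simp Cn_add Cn_diff Cn_cmul)

lemma bas_X: "bas (0, k, k) = b ^ k * c ^ k" by (simp add: bas_def zpow_def)

context
  assumes regular: "nz_off 0"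
begin

lemma X_0: "X 0 = T 1" by (simp add: X_def bas_X)

text \<open>The comparison map is injective on homology, so it suffices that \<open>X\<^sub>0\<close> is not a Koszul
  boundary.\<close>

lemma unit_nonzero: "\<not> bdr 0 (T 1)"
proof
  assume "bdr 0 (T 1)"
  then obtain u where u: "u \<in> Cn (Suc 0)" "X 0 = bn (Suc 0) u" unfolding bdr_def X_0 by blast
  have "K.closed 0 (X 0, 0, 0)" by (simp add: K.closed_def KC_def XYW_Cn)
  moreover have "K.\<psi> 0 (X 0, 0, 0) = bn (Suc 0) u" unfolding u(2)[symmetric] by (rule \<psi>_0[OF XYW_Cn(1)])
  ultimately obtain y' where "y' \<in> KC (Suc 0) 0" "(X 0, 0, 0) = Kd 0 y'"
    using K.\<psi>_inj[of 0 "(X 0, 0, 0)" u] u(1) by blast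
  then show False using X_0_not_boundary[OF regular] by simp
qed

lemma yc_b: "yc b = sc (q powi N / q) (c1 0 (e 0))"
proof -
  have "\<sigma> d * b = scale (q powi N / q) (bas (-1, 1, 0))"
    using gen_bas(3)[of 1 0] by (simp add: \<sigma>_gen scale_mult_left bas_def zpow_def divide_inverse)
  then have 1: "T (\<sigma> d * b) = cmul (q powi N / q) (W 0)" by (simp add: W_def lin_scale[OF T_lin])
  have 2: "T (c * b) = X 1" by (simp add: X_def bas_X rel_bc)
  have "VX (- cmul q (sh 0) - sh (dg vg (e 0))) = cmul (- vg 0) (X 1)"
    using sh_single[of 0] by (simp add: lin_0[OF sh_lin] dg_single lin_scale[OF sh_lin] lin_uminus[OF vlin_lext] lin_scale[OF vlin_lext] del: single_one)
  moreover have k: "q powi N / q * - vg 0 = 1" using q0 qN by (simp add: vg_def)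
  have "cmul (q powi N / q) (cmul (- vg 0) (X 1)) = X 1" unfolding cmul_cmul k by simp
  ultimately show ?thesis by (simp add: yc_def c1_def map3_simp 1 2 ten_0 mult.commute lin_0[OF vlin_lext] V_single del: single_one)
qed

lemma bc_nonzero: "\<not> bdr 1 (ten [b, c])"
proof
  assume "bdr 1 (ten [b, c])"
  then have "bdr 1 (K.\<psi> 1 (yc b))" using bdr_diff[OF \<psi>_yc[of b]] by fastforce
  then obtain u where u: "u \<in> Cn (Suc 1)" "K.\<psi> 1 (yc b) = bn (Suc 1) u" by (auto simp: bdr_def)
  have "K.closed 1 (yc b)" using Kd_yc[of b] yc_KC[of b] by (simp add: K.closed_def rel_bc ten_0 zero_prod_def)
  from K.\<psi>_inj[OF this u] obtain y' where y': "y' \<in> KC (Suc 1) 0" "yc b = Kd 1 y'" by blast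
  let ?k = "q / q powi N"
  have k: "?k * (q powi N / q) = 1" using q0 qN by simp
  have "sc ?k (yc b) = c1 0 (e 0)" unfolding yc_b vector_space.vector_space_assms(3)[OF vs_sc] k
    by (simp add: map3_def split_def)
  then have "c1 0 (e 0) = Kd 1 (sc ?k y')" by (simp add: y'(2) lin_scale[OF Kd_lin])
  moreover have "sc ?k y' \<in> KC 2 0" using y'(1) by (cases y') (auto simp: KC_def map3_simp Cn_cmul)
  ultimately show False using c1_not_boundary_regular[OF regular] by blast
qed

lemma wcyc_unit: "wcyc 0 (T 1)"
  using ten_weight0[of "[1]" 0 "[0]"] by (simp add: wcyc_def ten_Cn bn_0 hw_gens)

lemma B_unit: "bdr 1 (Bq 0 (T 1))"
  unfolding Bq_0_T by (simp add: \<sigma>_one) (rule bdr_add; rule bdr_unit[simplified])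

theorem regular_E2_0: "I.E2line 0 (T 1)"
proof -
  have "I.E2line (int 0) (T 1)"
  proof (rule E2lineI)
    show "bdr (Suc 0) (Bq 0 (T 1))" using B_unit by simp
    show "\<exists>k. I.d1_image (int 0) (z - cmul k (T 1))" if z: "wcyc 0 z" for z
    proof -
      obtain t where t: "bdr 0 (z - cmul t (T 1))" using H0_span[OF regular z] unfolding X_0 by blast
      have "wcyc 0 (z - cmul t (T 1))" by (rule wcyc_diff[OF z wcyc_cmul[OF wcyc_unit]])
      then show ?thesis using bdr_d1[OF _ t] by blast
    qed
  qed (use unit_nonzero wcyc_unit in simp_all)
  then show ?thesis by simp
qed

lemma wcyc_bc: "wcyc 1 (ten [b, c])"
  unfolding wcyc_def bn_ten
  using ten_weight0[of "[b, c]" 1 "[\<i>, - \<i>]"] by (simp add: ten_Cn hw_gens \<sigma>_bc rel_bc)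

text \<open>The class is not hit by \<open>B\<close>, because \<open>H\<^sub>0\<close> is spanned by the unit and
  \<open>B 1 \<sim> 0\<close>.\<close>

theorem regular_E2_1: "I.E2line 1 (ten [b, c])"
proof -
  have "I.E2line (int 1) (ten [b, c])"
  proof (rule E2lineI[OF wcyc_bc])
    show "bdr (Suc 1) (Bq 1 (ten [b, c]))"
      using H2_span_regular[OF regular, of "Bq 1 (ten [b, c])"] wcyc_Bq[OF wcyc_bc] by (simp add: numeral_2_eq_2)
    show "\<exists>k. I.d1_image (int 1) (z - cmul k (ten [b, c]))" if z: "wcyc 1 z" for z
    proof -
      obtain t where t: "bdr 1 (z - cmul t (ten [b, c]))"
        using bdr_span1[of "wcyc 1" 1, OF H1_span_regular[OF regular] wcyc_bc bc_nonzero z] by blast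
      have "wcyc 1 (z - cmul t (ten [b, c]))" by (rule wcyc_diff[OF z wcyc_cmul[OF wcyc_bc]])
      then show ?thesis using bdr_d1[OF _ t] by blast
    qed
    show "\<not> bdr 1 (ten [b, c] - (if (1::nat) = 0 then 0 else Bq (1 - 1) u))" if "0 < (1::nat) ==> wcyc (1 - 1) u" for u
    proof
      assume b: "bdr 1 (ten [b, c] - (if (1::nat) = 0 then 0 else Bq (1 - 1) u))"
      have u: "wcyc 0 u" using that by simp
      obtain t where t: "bdr 0 (u - cmul t (T 1))" using H0_span[OF regular u] unfolding X_0 by blast
      have w: "wcyc 0 (u - cmul t (T 1))" by (rule wcyc_diff[OF u wcyc_cmul[OF wcyc_unit]])
      have "bdr 1 (Bq 0 (u - cmul t (T 1)))" using B_bdr[OF t wcyc_Pw[OF w]] by simp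
      then have "bdr 1 (Bq 0 (u - cmul t (T 1)) + cmul t (Bq 0 (T 1)))" by (intro bdr_add bdr_cmul B_unit)
      then have "bdr 1 (Bq 0 u)" by (simp add: lin_ds[OF Bq_lin])
      from bdr_add[OF b this] show False using bc_nonzero by simp
    qed
  qed
  then show ?thesis by simp
qed

theorem regular_E2_23: "I.E2zero 2" "I.E2zero 3"
proof -
  have "I.E2zero (int 2)" by (rule E2zeroI) (rule bdr_d1[OF _ H2_span_regular[OF regular]])
  then show "I.E2zero 2" by simp
  have "I.E2zero (int 3)" by (rule E2zeroI) (rule bdr_d1[OF _ H3_span_regular[OF regular]])
  then show "I.E2zero 3" by simp
qed

end

context
  fixes r :: nat assumes N: "N = 2 * int r + 2"
begin

abbreviation xr :: 'a where "xr \<equiv> b ^ r * c ^ r"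

lemmas singular = nz_off_singular[OF N]

lemma x_rules: "a * xr = scale (q ^ r * q ^ r) (xr * a)" "d * xr = scale (1 / (q ^ r * q ^ r)) (xr * d)" "b * xr = xr * b" "c * xr = xr * c"
    "q ^ r * q ^ r \<noteq> 0" "q powi N = q * q * (q ^ r * q ^ r)"
proof goal_cases
  case 1 show ?case using gen_B(2)[of r r] by (simp add: power_add)
  case 2 show ?case using gen_B(1)[of r r] by (simp add: power_add divide_inverse power_inverse)
  have "b * xr = bas (0, Suc r, r)" using gen_bas(1)[of 0 r r] by (simp add: bas_X)
  moreover have "xr * b = bas (0, Suc r, r)"
    unfolding bas_def zpow_def by (simp add: mult.assoc cb_power) (metis mult.assoc power_Suc2 power_Suc)
  ultimately show "b * xr = xr * b" by simp
  have "c * xr = bas (0, r, Suc r)" using gen_bas(2)[of 0 r r] by (simp add: bas_X)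
  moreover have "xr * c = bas (0, r, Suc r)" unfolding bas_def zpow_def by (simp add: mult.assoc power_Suc2 del: power_Suc)
  ultimately show "c * xr = xr * c" by simp
  case 5 show ?case using q0 by simp
  case 6 show ?case using singular(2) q0 by (simp add: \<nu>_def field_simps)
qed

lemma tW_nonzero:
  assumes y: "y \<in> KC 1 0" "Kd 0 y = 0" "tW r y \<noteq> 0" and z: "bdr 1 (z + K.\<psi> 1 y)"
  shows "\<not> bdr 1 z"
proof
  assume "bdr 1 z"
  then have "bdr 1 (K.\<psi> 1 y)" using bdr_diff[OF z] by fastforce
  then obtain u where u: "u \<in> Cn (Suc 1)" "K.\<psi> 1 y = bn (Suc 1) u" by (auto simp: bdr_def)
  have "K.closed 1 y" using y by (simp add: K.closed_def)
  from K.\<psi>_inj[OF this u] obtain y' where y': "y' \<in> KC (Suc 1) 0" "y = Kd 1 y'" by blast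
  then show False using tW_boundary[OF singular, of y'] y(3) by (simp add: numeral_2_eq_2)
qed

lemma lookup_T_bas: "lookup (T (scale k (bas i))) [j] = (if i = j then k else 0)"
  by (simp add: lin_scale[OF T_lin] T_bas lookup_cmul lookup_single when_def)

lemma tW_yc: "tW r (yc (bas (0, j, k))) = (if (j, k) = (Suc r, r) then q powi N * inverse q ^ (j + k) else 0)"
  unfolding tW_def yc_def by (auto simp: \<sigma>_gen scale_mult_left gen_bas lookup_T_bas)

lemma bas_mult_bc: "bas (0, j, k) * b = bas (0, Suc j, k)" "bas (0, j, k) * c = bas (0, j, Suc k)"
  "b ^ j * c ^ k = bas (0, j, k)"
  by (simp_all add: bas_def zpow_def mult.assoc cb_power power_Suc2 del: power_Suc)

lemma tW_yb: "r \<le> j ==> tW r (yb (bas (0, j, k))) = 0"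
proof -
  assume j: "r \<le> j"
  have 1: "b * bas (0, j, k) * b = bas (0, Suc (Suc j), k)" by (simp add: gen_bas bas_mult_bc)
  have "bas (0, j', k') * d = bas (-1, j', k')" for j' k' by (simp add: bas_def zpow_def)
  then have 2: "b * (b * bas (0, j, k) * d) = bas (-1, Suc (Suc j), k)" by (simp add: gen_bas)
  have 3: "tW r (ya (b * bas (0, j, k) * d)) = 0" using j
    unfolding tW_def ya_def 2 by (simp add: T_bas lookup_single)
  show ?thesis
    using j unfolding yb_def tW_lin 1 tW_yc 3 by (simp add: tW_def ten_0)
qed

definition sym1 :: tens where "sym1 = ten [xr * b, c] + ten [xr * c, b]"
abbreviation e1 :: tens where "e1 \<equiv> Bq 0 (X (Suc r))"
abbreviation e2 :: tens where "e2 \<equiv> ten [xr * b, c]"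
abbreviation Pb :: tens where "Pb \<equiv> Bq 1 e2"
abbreviation cap :: tens where "cap \<equiv> ccap xr"

text \<open>The symmetric class \<open>x\<^sup>r b \<otimes> c + x\<^sup>r c \<otimes> b\<close>, with \<open>x =
  bc\<close>, has the value \<open>q\<close> under the detecting functional.\<close>

lemma Y1: "bdr 1 (sym1 + K.\<psi> 1 (yc (xr * b) + yb (xr * c)))" "Kd 0 (yc (xr * b) + yb (xr * c)) = 0"
  "tW r (yc (xr * b) + yb (xr * c)) = q"
proof goal_cases
  have "bdr 1 ((ten [xr * b, c] + K.\<psi> 1 (yc (xr * b))) + (ten [xr * c, b] + K.\<psi> 1 (yb (xr * c))))"
    by (intro bdr_add \<psi>_yc \<psi>_yb)
  then show "bdr 1 (sym1 + K.\<psi> 1 (yc (xr * b) + yb (xr * c)))" by (simp add: sym1_def lin_add[OF \<psi>_lin] algebra_simps)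
  case 2 show ?case
    unfolding lin_add[OF Kd_lin] Kd_yc Kd_yb by (simp add: bas_mult_bc gen_bas ten_0 zero_prod_def)
  have "tW r (yc (xr * b)) = q"
    unfolding bas_mult_bc tW_yc using x_rules(6) q0 by (simp add: power_add field_simps)
  moreover have "tW r (yb (xr * c)) = 0" unfolding bas_mult_bc by (rule tW_yb) simp
  ultimately show "tW r (yc (xr * b) + yb (xr * c)) = q" by (simp add: tW_lin)
qed

lemma sym1_nonzero: "\<not> bdr 1 sym1"
  by (rule tW_nonzero[OF K.C_add[OF yc_KC yb_KC] Y1(2) _ Y1(1)]) (simp only: Y1(3) q0 not_False_eq_True)

lemma zcap_nonzero: "\<not> bdr 1 (zcap xr)"
proof -
  let ?k = "q - inverse q"
  let ?y = "yc (xr * b) + yb (xr * c) + sc ?k (yb (xr * c * b * c))"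
  have 1: "xr * c * b * c = bas (0, Suc r, Suc (Suc r))" by (simp add: bas_mult_bc)
  have c: "sc k y \<in> KC 1 0" if "y \<in> KC 1 0" for k y using that by (cases y) (auto simp: KC_def map3_simp Cn_cmul)
  have "bdr 1 ((zcap xr - (sym1 + cmul ?k (ten [xr * c * b * c, b]))) + (sym1 + K.\<psi> 1 (yc (xr * b) + yb (xr * c)))
      + cmul ?k (ten [xr * c * b * c, b] + K.\<psi> 1 (yb (xr * c * b * c))))"
    unfolding sym1_def[symmetric] by (intro bdr_add bdr_cmul \<psi>_yb Y1(1)) (use zcap[OF x_rules] in \<open>simp add: sym1_def\<close>)
  then have "bdr 1 (zcap xr + K.\<psi> 1 ?y)"
    by (simp add: lin_as[OF \<psi>_lin] cmul_add algebra_simps)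
  moreover have "Kd 0 ?y = 0"
    unfolding lin_as[OF Kd_lin] Kd_yc Kd_yb
    by (simp add: bas_mult_bc gen_bas ten_0 map3_simp zero_prod_def)
  moreover have "tW r ?y = q"
    using Y1(3) tW_yb[of "Suc r" "Suc (Suc r)"] by (simp only: tW_lin 1) simp
  moreover have "?y \<in> KC 1 0" by (intro K.C_add c yc_KC yb_KC)
  ultimately show ?thesis using tW_nonzero q0 by metis
qed

text \<open>The class of \<open>1 \<otimes> x\<^sup>k\<close> is computed by splitting off one factor \<open>x =
  bc\<close> at a time by the Leibniz rule. The induction needs a general power \<open>x\<^sup>j\<close> in
  the zeroth factor.\<close>

lemma leibniz_power: "bdr 1 (ten [bas (0, j, j), bas (0, k, k)] - cmul (of_nat k) (ten [bas (0, j + k - 1, j + k - 1) * b, c] + ten [bas (0, j + k - 1, j + k - 1) * c, b]))"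
proof (induction k arbitrary: j)
  case 0 then show ?case using bdr_unit[of "bas (0, j, j)"] by (simp add: bas_0)
next
  case (Suc k)
  let ?s = "ten [bas (0, j + k, j + k) * b, c] + ten [bas (0, j + k, j + k) * c, b]"
  have bb: "bas (0, j, j) * bas (0, k, k) = bas (0, j + k, j + k)"
  proof (induction k)
    case (Suc k)
    have f: "bas (0, Suc k, Suc k) = bas (0, k, k) * b * c" by (simp only: bas_mult_bc)
    have "bas (0, j, j) * bas (0, Suc k, Suc k) = bas (0, j, j) * bas (0, k, k) * b * c" by (simp only: f mult.assoc)
    then show ?case by (simp only: Suc bas_mult_bc add_Suc_right)
  qed (simp add: bas_0)
  have Sk: "bas (0, Suc k, Suc k) = bas (0, k, k) * (b * c)" by (simp add: bas_mult_bc flip: mult.assoc)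
  have \<sigma>bc: "\<sigma> (b * c) * bas (0, j, j) = bas (0, Suc j, Suc j)" by (simp add: \<sigma>_mult \<sigma>_bc mult.assoc gen_bas)
  have "bdr 1 ((ten [bas (0, j, j), bas (0, k, k) * (b * c)] - ten [bas (0, j, j) * bas (0, k, k), b * c] - ten [\<sigma> (b * c) * bas (0, j, j), bas (0, k, k)])
     + (ten [bas (0, j + k, j + k), b * c] - ten [bas (0, j + k, j + k) * b, c] - ten [\<sigma> c * bas (0, j + k, j + k), b])
     + (ten [bas (0, Suc j, Suc j), bas (0, k, k)] - cmul (of_nat k) (ten [bas (0, Suc j + k - 1, Suc j + k - 1) * b, c] + ten [bas (0, Suc j + k - 1, Suc j + k - 1) * c, b])))"
    by (intro bdr_add bdr_leibniz Suc)
  then show ?case unfolding \<sigma>bc bb Sk[symmetric]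
    by (simp add: \<sigma>_bc gen_bas bas_mult_bc free.scale_left_distrib algebra_simps)
qed

text \<open>So \<open>B x\<^sup>r\<^sup>+\<^sup>1\<close> is \<open>r + 1\<close> times the symmetric class, and
  nonzero in characteristic zero.\<close>

lemma e1_class: "bdr 1 (e1 - cmul (of_nat (Suc r)) sym1)"
proof -
  have "bdr 1 ((ten [bas (0, 0, 0), bas (0, Suc r, Suc r)] - cmul (of_nat (Suc r)) (ten [bas (0, 0 + Suc r - 1, 0 + Suc r - 1) * b, c] + ten [bas (0, 0 + Suc r - 1, 0 + Suc r - 1) * c, b]))
     + ten [\<sigma> (bas (0, Suc r, Suc r)), 1])"
    by (intro bdr_add leibniz_power bdr_unit)
  then show ?thesis by (simp add: X_def Bq_0_T bas_0 sym1_def bas_mult_bc algebra_simps)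
qed

lemma e1_nonzero: "\<not> bdr 1 e1"
proof
  assume "bdr 1 e1"
  then have "bdr 1 (cmul (of_nat (Suc r)) sym1)" using bdr_cong[OF e1_class] by blast
  from bdr_cmul_cancel[OF this sym1_nonzero] show False by (simp del: of_nat_Suc)
qed

lemma wcyc_X: "wcyc 0 (X k)"
  using ten_weight0[of "[bas (0, k, k)]" 0 "[0]"] hw_bas[of "(0, k, k)"] by (simp add: wcyc_def ten_Cn bn_0 X_def wtc_def)

lemma wcyc_e1: "wcyc 1 e1" using wcyc_Bq[OF wcyc_X] by simp

lemma hw_x: "hw 0 xr" using hw_bas[of "(0, r, r)"] by (simp add: bas_X wtc_def)

lemma wcyc_e2: "wcyc 1 e2"
  unfolding wcyc_def bn_ten
  using ten_weight0[of "[xr * b, c]" 1 "[0 + \<i>, - \<i>]"] hw_mult[OF hw_x hw_gens(2)] by (simp add: ten_Cn hw_gens \<sigma>_bc bas_mult_bc gen_bas)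

lemma wcyc_P: "wcyc 2 Pb" using wcyc_Bq[OF wcyc_e2] by (simp add: numeral_2_eq_2)

lemma B_e1: "Bq 1 e1 = 0" using Bq_Bq_invariant[OF wcyc_Cn[OF wcyc_X] wcyc_Tq[OF wcyc_X]] by simp
lemma B_P: "Bq 2 Pb = 0" using Bq_Bq_invariant[OF wcyc_Cn[OF wcyc_e2] wcyc_Tq[OF wcyc_e2]] by (simp add: numeral_2_eq_2)

text \<open>By Cartan's formula in weight zero, contracting \<open>B(x\<^sup>r b \<otimes> c)\<close> amounts to
  applying \<open>-B\<close> to the contraction \<open>x\<^sup>r b D(c)\<close>, which is a multiple of
  \<open>x\<^sup>r\<^sup>+\<^sup>1\<close>.\<close>

lemma contract_P:
  assumes xy: "(u, v) = (1, 0) \<or> (u, v) = (0, 1)"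
  shows "bdr 1 (eq (Dw u v) Pb - cmul v e1)"
proof -
  note z = wcyc_Cn[OF wcyc_e2] wcyc_bn[OF wcyc_e2] wcyc_Tq[OF wcyc_e2]
  have "Lq (Dw u v) 1 e2 = 0" using Lq_weight0[OF z(1) wcyc_Pw[OF wcyc_e2], of u v] xy by auto
  with cartan[OF Dw_der z(1) _ z(2,3), of u v] obtain w where w: "w \<in> Cn (Suc 1)" "Bq 0 (eq (Dw u v) e2) + eq (Dw u v) Pb = bn (Suc 1) w"
    by auto
  have "eq (Dw u v) e2 = cmul (- v) (X (Suc r))"
    by (simp add: eq_ten[OF Dw_der] Dw_values scale_mult_right X_def lin_uminus[OF T_lin] lin_scale[OF T_lin] bas_mult_bc cmul_minus)
  then have "eq (Dw u v) Pb - cmul v e1 = bn (Suc 1) w" using w(2) by (simp add: lin_scale[OF Bq_lin] lin_uminus[OF Bq_lin] cmul_minus)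
  then show ?thesis using bdrI[OF w(1)] by simp
qed

lemma P_nonzero: "\<not> bdr 2 Pb"
proof
  assume "bdr 2 Pb"
  then have "bdr (Suc 1) Pb" by (simp add: numeral_2_eq_2)
  from eq_bdr[OF Dw_der this] have "bdr 1 (eq (Dw 0 1) Pb)" .
  then show False using bdr_cong[OF contract_P[of 0 1]] e1_nonzero by simp
qed

text \<open>Applying \<open>B\<close> kills the first class, which is in the image of \<open>B\<close>, but not the
  second one.\<close>

lemma e_independent: assumes "bdr 1 (cmul s e1 + cmul t e2)" shows "s = 0 \<and> t = 0"
proof -
  have "bdr (Suc 1) (Bq 1 (cmul s e1 + cmul t e2))"
    by (rule B_bdr[OF assms wcyc_Pw[OF wcyc_add[OF wcyc_cmul[OF wcyc_e1] wcyc_cmul[OF wcyc_e2]]]])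
  then have "bdr 2 (cmul t Pb)" unfolding lin_as[OF Bq_lin] B_e1 by (simp add: numeral_2_eq_2)
  then have t: "t = 0" using bdr_cmul_cancel P_nonzero by blast
  then show ?thesis using assms bdr_cmul_cancel e1_nonzero by auto
qed

lemma wcyc_FC: "wcyc 3 (FC xr)"
proof -
  note l = lin_ads[OF Pw_lin]
  have d: "hw (- 1) (xr * d)" and c: "hw (- \<i>) (xr * c)" using hw_mult[OF hw_x hw_gens(4)] hw_mult[OF hw_x hw_gens(3)] by simp_all
  have 1: "Pw 0 (ten [xr * d, g1, g2, g3]) = ten [xr * d, g1, g2, g3]" if "hw w1 g1" "hw w2 g2" "hw w3 g3" "w1 + w2 + w3 = 1" for g1 g2 g3 w1 w2 w3
    using ten_weight0[of "[xr * d, g1, g2, g3]" 3 "[- 1, w1, w2, w3]"] that d by (simp add: add.assoc)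
  have 2: "Pw 0 (ten [xr * c, g1, g2, g3]) = ten [xr * c, g1, g2, g3]" if "hw w1 g1" "hw w2 g2" "hw w3 g3" "w1 + w2 + w3 = \<i>" for g1 g2 g3 w1 w2 w3
    using ten_weight0[of "[xr * c, g1, g2, g3]" 3 "[- \<i>, w1, w2, w3]"] that c by (simp add: add.assoc)
  note g = hw_gens
  have "Pw 0 (FC xr) = FC xr" unfolding FC_def l
    by (simp add: 1[OF g(2) g(1) g(3)] 1[OF g(1) g(2) g(3)] 1[OF g(2) g(3) g(1)] 1[OF g(1) g(3) g(2)] 1[OF g(3) g(2) g(1)] 1[OF g(3) g(1) g(2)]
       2[OF g(2) g(1) g(4)] 2[OF g(1) g(2) g(4)] 2[OF g(2) g(4) g(1)] 2[OF g(2) g(3) g(2)] 2[OF g(1) g(4) g(2)] 2[OF g(4) g(2) g(1)] 2[OF g(4) g(1) g(2)])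
  then show ?thesis by (simp add: wcyc_def FC_Cn FC_cycle[OF x_rules])
qed

lemma wcyc_cap: "wcyc 2 cap"
proof -
  have "bn (3 - 1) cap = 0" unfolding ccap_def
    by (subst bn_eq[OF Dw_der FC_Cn]) (simp_all add: FC_cycle[OF x_rules] lin_0[OF eq_lin[OF Dw_der]])
  then show ?thesis
    using eq_Cn[OF Dw_der FC_Cn, of "-1" "-1" xr] Pw_eq[OF FC_Cn, of 0 "-1" "-1" xr] wcyc_Pw[OF wcyc_FC] by (simp add: wcyc_def ccap_def)
qed

text \<open>The contraction by \<open>Dw 1 0\<close> kills \<open>B(x\<^sup>r b \<otimes> c)\<close>, since
  \<open>c\<close> does not see the first weight, but not the capped fundamental class.\<close>

lemma cap_independent: assumes "bdr 2 (cmul s Pb + cmul t cap)" shows "s = 0 \<and> t = 0"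
proof -
  have "bdr (Suc 1) (cmul s Pb + cmul t cap)" using assms by (simp add: numeral_2_eq_2)
  from eq_bdr[OF Dw_der this, of 1 0] have "bdr 1 (cmul s (eq (Dw 1 0) Pb) + cmul t (zcap xr))"
    by (simp add: zcap_def lin_as[OF eq_lin[OF Dw_der]])
  moreover have "bdr 1 (cmul s (eq (Dw 1 0) Pb))" using bdr_cmul[OF contract_P[of 1 0]] by simp
  ultimately have "bdr 1 (cmul t (zcap xr))" using bdr_diff by fastforce
  then have t: "t = 0" using bdr_cmul_cancel zcap_nonzero by blast
  then show ?thesis using assms bdr_cmul_cancel P_nonzero by auto
qed

lemma H1_basis: "wcyc 1 z ==> \<exists>s t. bdr 1 (z - cmul s e1 - cmul t e2)"
  by (rule bdr_span2[where Z = "wcyc 1"]) (use H1_span_singular[OF singular(1)] wcyc_e1 wcyc_e2 e_independent in blast)+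

lemma H2_basis: "wcyc 2 z ==> \<exists>s t. bdr 2 (z - cmul s Pb - cmul t cap)"
  by (rule bdr_span2[where Z = "wcyc 2"]) (use H2_span_singular[OF singular] wcyc_P wcyc_cap cap_independent in blast)+

lemma B_FC: "bdr 4 (Bq 3 (FC xr))"
  using no_homology_above_3[of "Bq 3 (FC xr)" 4] wcyc_Bq[OF wcyc_FC] by (auto simp: wcyc_def bdr_def)

text \<open>Cartan's formula again: \<open>B\<close> of the contraction is minus the contraction of \<open>B\<close>
  of the fundamental cycle, and the latter is a boundary because there is no homology in degree four.\<close>

lemma B_cap: "bdr 3 (Bq 2 cap)"
proof -
  note z = wcyc_Cn[OF wcyc_FC] wcyc_bn[OF wcyc_FC] wcyc_Tq[OF wcyc_FC]
  have "Lq (Dw (-1) (-1)) 3 (FC xr) = 0" using Lq_weight0[OF z(1) wcyc_Pw[OF wcyc_FC]] by auto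
  with cartan[OF Dw_der z(1) _ z(2,3), of "-1" "-1"] obtain w where w: "w \<in> Cn (Suc 3)" "Bq 2 cap + eq (Dw (-1) (-1)) (Bq 3 (FC xr)) = bn (Suc 3) w"
    by (auto simp: ccap_def)
  have "bdr 3 (eq (Dw (-1) (-1)) (Bq 3 (FC xr)))" by (rule eq_bdr[OF Dw_der]) (use B_FC in simp)
  then have "bdr 3 (bn (Suc 3) w - eq (Dw (-1) (-1)) (Bq 3 (FC xr)))" by (intro bdr_diff bdrI w)
  then show ?thesis unfolding w(2)[symmetric] by simp
qed

lemma B_image_d1: "wcyc n u ==> I.d1_image (int (Suc n)) (Bq n u)"
  using d1_imageI[of 0 "Suc n" u] by (simp add: Cn_0 wcyc_Cn wcyc_bn wcyc_Tq)

lemma B_modulo: assumes "bdr n (u - v)" "wcyc n u" "wcyc n v" shows "bdr (Suc n) (Bq n u - Bq n v)"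
  using B_bdr[OF assms(1) wcyc_Pw[OF wcyc_diff[OF assms(2,3)]]] by (simp add: lin_diff[OF Bq_lin])

text \<open>The complex \<open>(H, B)\<close> is \<open>\<langle>x\<^sup>r\<^sup>+\<^sup>1\<rangle> \<rightarrow>
  \<langle>B x\<^sup>r\<^sup>+\<^sup>1, x\<^sup>r b \<otimes> c\<rangle> \<rightarrow> \<langle>B(x\<^sup>r
  b \<otimes> c), cap\<rangle> \<rightarrow> \<langle>x\<^sup>r d\<A>\<rangle>\<close> with \<open>B\<close>
  zero on the last two generators. The following four theorems read off its homology.\<close>

theorem singular_E2_0: "I.E2zero 0"
proof -
  have "I.E2zero (int 0)"
  proof (rule E2zeroI)
    fix z assume z: "wcyc 0 z" and B: "bdr (Suc 0) (Bq 0 z)"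
    obtain t where t: "bdr 0 (z - cmul t (X (Suc r)))" using H0_span[OF singular(1) z] by blast
    have "bdr (Suc 0) (Bq 0 z - (Bq 0 z - Bq 0 (cmul t (X (Suc r)))))" by (rule bdr_diff[OF B B_modulo[OF t z wcyc_cmul[OF wcyc_X]]])
    then have "bdr 1 (cmul t e1)" by (simp add: lin_scale[OF Bq_lin])
    then have "t = 0" using bdr_cmul_cancel e1_nonzero by blast
    then show "I.d1_image (int 0) z" using t by (intro bdr_d1 z) simp
  qed
  then show ?thesis by simp
qed

theorem singular_E2_1: "I.E2zero 1"
proof -
  have "I.E2zero (int 1)"
  proof (rule E2zeroI)
    fix z assume z: "wcyc 1 z" and B: "bdr (Suc 1) (Bq 1 z)"
    obtain s t where st: "bdr 1 (z - cmul s e1 - cmul t e2)" using H1_basis[OF z] by blast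
    note w = wcyc_add[OF wcyc_cmul[OF wcyc_e1, of s] wcyc_cmul[OF wcyc_e2, of t]]
    have "bdr (Suc 1) (Bq 1 z - (Bq 1 z - Bq 1 (cmul s e1 + cmul t e2)))" by (rule bdr_diff[OF B B_modulo[OF _ z w]]) (use st in \<open>simp add: diff_diff_eq\<close>)
    then have "bdr 2 (cmul t Pb)" unfolding lin_as[OF Bq_lin] B_e1 by (simp add: numeral_2_eq_2)
    then have "t = 0" using bdr_cmul_cancel P_nonzero by blast
    then have "bdr 1 (z - Bq 0 (cmul s (X (Suc r))))" using st by (simp add: lin_scale[OF Bq_lin])
    moreover have "I.d1_image (int 1) (Bq 0 (cmul s (X (Suc r))))" using B_image_d1[OF wcyc_cmul[OF wcyc_X], of s "Suc r"] by simp
    moreover have "wcyc 1 (z - Bq 0 (cmul s (X (Suc r))))" using wcyc_diff[OF z] wcyc_Bq[OF wcyc_cmul[OF wcyc_X]] by simp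
    ultimately have "I.d1_image (int 1) (z - Bq 0 (cmul s (X (Suc r))) + Bq 0 (cmul s (X (Suc r))))"
      using d1_image_add[OF bdr_d1] by blast
    then show "I.d1_image (int 1) z" by simp
  qed
  then show ?thesis by simp
qed

theorem singular_E2_2: "I.E2line 2 cap"
proof -
  have "I.E2line (int 2) cap"
  proof (rule E2lineI[OF wcyc_cap])
    show "bdr (Suc 2) (Bq 2 cap)" using B_cap by simp
    show "\<exists>k. I.d1_image (int 2) (z - cmul k cap)" if z: "wcyc 2 z" for z
    proof -
      obtain s t where st: "bdr 2 (z - cmul s Pb - cmul t cap)" using H2_basis[OF z] by blast
      have B: "cmul s Pb = Bq 1 (cmul s e2)" by (simp add: lin_scale[OF Bq_lin])
      have "I.d1_image (int (Suc 1)) (cmul s Pb)" unfolding B by (rule B_image_d1[OF wcyc_cmul[OF wcyc_e2]])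
      then have B2: "I.d1_image (int 2) (cmul s Pb)" by (simp only: numeral_2_eq_2 One_nat_def)
      have w: "wcyc 2 (z - cmul s Pb - cmul t cap)" by (rule wcyc_diff[OF wcyc_diff[OF z wcyc_cmul[OF wcyc_P]] wcyc_cmul[OF wcyc_cap]])
      have "I.d1_image (int 2) (z - cmul s Pb - cmul t cap + cmul s Pb)"
        by (rule d1_image_add[OF bdr_d1[OF w st] B2])
      moreover have "z - cmul s Pb - cmul t cap + cmul s Pb = z - cmul t cap" by simp
      ultimately show ?thesis by metis
    qed
    show "\<not> bdr 2 (cap - (if (2::nat) = 0 then 0 else Bq (2 - 1) u))" if "0 < (2::nat) ==> wcyc (2 - 1) u" for u
    proof
      assume b: "bdr 2 (cap - (if (2::nat) = 0 then 0 else Bq (2 - 1) u))"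
      have u: "wcyc 1 u" using that by simp
      obtain s t where st: "bdr 1 (u - cmul s e1 - cmul t e2)" using H1_basis[OF u] by blast
      note w = wcyc_add[OF wcyc_cmul[OF wcyc_e1, of s] wcyc_cmul[OF wcyc_e2, of t]]
      have "bdr (Suc 1) (Bq 1 u - Bq 1 (cmul s e1 + cmul t e2))" by (rule B_modulo[OF _ u w]) (use st in \<open>simp add: diff_diff_eq\<close>)
      then have "bdr 2 (Bq 1 u - cmul t Pb)" unfolding lin_as[OF Bq_lin] B_e1 by (simp add: numeral_2_eq_2)
      from bdr_add[OF b this] have "bdr 2 (cmul (- t) Pb + cmul 1 cap)" by (simp add: cmul_minus)
      from cap_independent[OF this] show False by simp
    qed
  qed
  then show ?thesis by simp
qed

theorem singular_E2_3: "I.E2line 3 (FC xr)"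
proof -
  have FC_nonzero: "\<not> bdr 3 (FC xr)"
  proof
    assume "bdr 3 (FC xr)"
    then have "bdr (Suc 2) (FC xr)" by simp
    from eq_bdr[OF Dw_der this, of "-1" "-1"] have "bdr 2 (cmul 0 Pb + cmul 1 cap)" by (simp add: ccap_def)
    from cap_independent[OF this] show False by simp
  qed
  have "I.E2line (int 3) (FC xr)"
  proof (rule E2lineI[OF wcyc_FC])
    show "bdr (Suc 3) (Bq 3 (FC xr))" using B_FC by simp
    show "\<exists>k. I.d1_image (int 3) (z - cmul k (FC xr))" if z: "wcyc 3 z" for z
    proof -
      obtain t where t: "bdr 3 (z - cmul t (FC xr))"
        using bdr_span1[of "wcyc 3" 3, OF H3_span_singular[OF singular(1)] wcyc_FC FC_nonzero z] by blast
      show ?thesis using bdr_d1[OF wcyc_diff[OF z wcyc_cmul[OF wcyc_FC]] t] by blast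
    qed
    show "\<not> bdr 3 (FC xr - (if (3::nat) = 0 then 0 else Bq (3 - 1) u))" if "0 < (3::nat) ==> wcyc (3 - 1) u" for u
    proof
      assume b: "bdr 3 (FC xr - (if (3::nat) = 0 then 0 else Bq (3 - 1) u))"
      have u: "wcyc 2 u" using that by simp
      obtain s t where st: "bdr 2 (u - cmul s Pb - cmul t cap)" using H2_basis[OF u] by blast
      note w = wcyc_add[OF wcyc_cmul[OF wcyc_P, of s] wcyc_cmul[OF wcyc_cap, of t]]
      have "bdr (Suc 2) (Bq 2 u - Bq 2 (cmul s Pb + cmul t cap))" by (rule B_modulo[OF _ u w]) (use st in \<open>simp add: diff_diff_eq\<close>)
      then have "bdr 3 (Bq 2 u - cmul t (Bq 2 cap))" unfolding lin_as[OF Bq_lin] B_P by simp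
      then have "bdr 3 (Bq 2 u - cmul t (Bq 2 cap) + cmul t (Bq 2 cap))" by (intro bdr_add bdr_cmul B_cap)
      then have "bdr 3 (Bq 2 u)" by simp
      then have "bdr 3 (if (3::nat) = 0 then 0 else Bq (3 - 1) u)" by simp
      from bdr_add[OF b this] FC_nonzero show False by simp
    qed
  qed
  then show ?thesis by simp
qed

end

end

section \<open>Chains as tensors\<close>

lemma chains_add: "x \<in> chains n ==> y \<in> chains n ==> x + y \<in> chains n"
  unfolding chains_def using Poly_Mapping.keys_add[of x y] by blast
lemma chains_cmul: "x \<in> chains n ==> cmul k x \<in> chains n"
  unfolding chains_def using keys_cmul[of k x] by blast
lemma chains_0: "0 \<in> chains n" by (simp add: chains_def)
lemma chains_diff: "x \<in> chains n ==> y \<in> chains n ==> x - y \<in> chains n"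
  using chains_add[of x n "cmul (-1) y"] chains_cmul[of y n "-1"] by (simp add: cmul_minus)
lemma chains_sum: "(\<And>i. i \<in> S ==> f i \<in> chains n) ==> sum f S \<in> chains n"
  by (induction S rule: infinite_finite_induct) (auto simp: chains_0 chains_add)
lemma chains_lext: "(\<And>x. x \<in> keys f ==> g x \<in> chains n) ==> lext cmul g f \<in> chains n"
  unfolding lext_def by (intro chains_sum chains_cmul)
lemma chains_tensor: "xs \<noteq> [] ==> int (length xs) = n + 1 ==> tensor xs \<in> chains n"
  by (simp add: chains_def tensor_def)
lemma chains_neg: assumes "n < 0" shows "chains n = {0}"
proof -
  have "f = 0" if "f \<in> chains n" for f :: "'a chain"
  proof -
    have "xs \<notin> keys f" for xs
    proof
      assume "xs \<in> keys f"
      then have "xs \<noteq> []" "int (length xs) = n + 1" using that by (auto simp: chains_def)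
      then show False using assms by (cases xs) auto
    qed
    then have "keys f = {}" by blast
    then show ?thesis by simp
  qed
  then show ?thesis using chains_0 by blast
qed
lemma chains_keys: "f \<in> chains (int n) ==> xs \<in> keys f ==> length xs = Suc n"
  by (auto simp: chains_def)

context twisted
begin

text \<open>Evaluation of formal chains in the tensor power, and a section of it. The relations of the tensor product
  are exactly the kernel of the evaluation.\<close>

definition \<tau> :: "'a chain => tens" where "\<tau> = lin_ext ten"
definition lft :: "tens => 'a chain" where "lft = lext cmul (\<lambda>l. tensor (map bas l))"

lemma \<tau>_lin: "vlin \<tau>" by (simp add: \<tau>_def lin_ext_lext vlin_lext)
lemma lft_lin: "vlin lft" by (simp add: lft_def vlin_lext)
lemma \<tau>_tensor: "\<tau> (tensor xs) = ten xs" by (simp add: \<tau>_def lin_ext_lext tensor_def)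

lemma \<tau>_Cn: "f \<in> chains (int n) ==> \<tau> f \<in> Cn n"
  unfolding \<tau>_def lin_ext_lext by (intro Cn_lext ten_Cn chains_keys)

lemma lft_chains: "w \<in> Cn n ==> lft w \<in> chains (int n)"
  unfolding lft_def by (intro chains_lext chains_tensor) (auto simp: Cn_def)

lemma \<tau>_lft: "\<tau> (lft w) = w"
  by (rule lin_eqI[OF lin_comp[OF lft_lin \<tau>_lin] lin_id]) (simp add: lft_def \<tau>_tensor ten_bas)

lemma tensor_rels_add: "x \<in> tensor_rels scale n ==> y \<in> tensor_rels scale n ==> x + y \<in> tensor_rels scale n"
  unfolding tensor_rels_def by (rule free.span_add)
lemma tensor_rels_cmul: "x \<in> tensor_rels scale n ==> cmul k x \<in> tensor_rels scale n"
  unfolding tensor_rels_def by (rule free.span_scale)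
lemma tensor_rels_0: "0 \<in> tensor_rels scale n"
  unfolding tensor_rels_def by (rule free.span_zero)
lemma tensor_rels_slot_add: "int (length us + length vs) = n ==>
    tensor (us @ (x + y) # vs) - tensor (us @ x # vs) - tensor (us @ y # vs) \<in> tensor_rels scale n"
  unfolding tensor_rels_def by (rule free.span_base) blast
lemma tensor_rels_slot_scale: "int (length us + length vs) = n ==>
    tensor (us @ scale k x # vs) - cmul k (tensor (us @ x # vs)) \<in> tensor_rels scale n"
  unfolding tensor_rels_def by (rule free.span_base) blast

text \<open>Factors are expanded in the monomial basis one after the other, each time modulo multilinearity;
  \<open>l\<close> collects the factors already expanded.\<close>

lemma expand_tensor:
  "int (length l + length xs) = n + 1 ==>
    tensor (map bas l @ xs) - lext cmul (\<lambda>l'. tensor (map bas (l @ l'))) (ten xs) \<in> tensor_rels scale n"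
proof (induction xs arbitrary: l)
  case Nil then show ?case by (simp add: tensor_rels_0 ten.simps(1))
next
  case (Cons x xs)
  let ?E = "lext cmul (\<lambda>l'. tensor (map bas (l @ l')))"
  let ?V = "{x. tensor (map bas l @ x # xs) - ?E (ten (x # xs)) \<in> tensor_rels scale n}"
  have len: "int (length (map bas l) + length xs) = n" using Cons.prems by simp
  have E: "vlin ?E" by (rule vlin_lext)
  have tl: "lin scale cmul (\<lambda>x. ten (x # xs))" using ten_lin[of "[]" xs] by simp
  have V: "subspc scale ?V"
    unfolding subspc_def
  proof (intro conjI ballI allI)
    have s: "x \<in> ?V ==> scale k x \<in> ?V" for x k
    proof -
      assume x: "x \<in> ?V"
      have "(tensor (map bas l @ scale k x # xs) - cmul k (tensor (map bas l @ x # xs))) + cmul k (tensor (map bas l @ x # xs) - ?E (ten (x # xs))) \<in> tensor_rels scale n"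
        using x by (intro tensor_rels_add tensor_rels_cmul tensor_rels_slot_scale len) simp
      then show "scale k x \<in> ?V" by (simp add: lin_scale[OF tl] lin_scale[OF E] cmul_diff del: map_append)
    qed
    then show "\<And>k x. x \<in> ?V ==> scale k x \<in> ?V" .
    fix x y assume x: "x \<in> ?V" and y: "y \<in> ?V"
    have "(tensor (map bas l @ (x + y) # xs) - tensor (map bas l @ x # xs) - tensor (map bas l @ y # xs))
       + (tensor (map bas l @ x # xs) - ?E (ten (x # xs))) + (tensor (map bas l @ y # xs) - ?E (ten (y # xs))) \<in> tensor_rels scale n"
      using x y by (intro tensor_rels_add tensor_rels_slot_add len) simp_all
    then show "x + y \<in> ?V" by (simp add: lin_add[OF tl] lin_add[OF E] algebra_simps del: map_append)
  next
    have "tensor (map bas l @ scale 0 0 # xs) - cmul 0 (tensor (map bas l @ 0 # xs)) \<in> tensor_rels scale n"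
      by (rule tensor_rels_slot_scale[OF len])
    then show "0 \<in> ?V" by (simp add: lin_0[OF tl] lin_0[OF E] del: map_append)
  qed
  have bV: "bas i \<in> ?V" for i
  proof -
    have "tensor (map bas (l @ [i]) @ xs) - lext cmul (\<lambda>l'. tensor (map bas ((l @ [i]) @ l'))) (ten xs) \<in> tensor_rels scale n"
      using Cons.prems by (intro Cons.IH) simp
    moreover have "?E (ten (bas i # xs)) = lext cmul (\<lambda>l'. tensor (map bas ((l @ [i]) @ l'))) (ten xs)"
      unfolding ten.simps by (rule lin_eqI[OF lin_comp[OF cns_lin2 E] vlin_lext]) (simp add: cns_bas)
    ultimately show ?thesis by simp
  qed
  have "x = (\<Sum>i\<in>keys (co x). scale (lookup (co x) i) (bas i))"
    using bas_co[of x] by (simp add: lext_def)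
  moreover have "\<dots> \<in> ?V" using V bV by (intro subspc_sum[OF V]) (auto simp: subspc_def)
  ultimately have "x \<in> ?V" by simp
  then show ?case by simp
qed

lemma expand_chain: assumes f: "f \<in> chains n" shows "f - lft (\<tau> f) \<in> tensor_rels scale n"
proof -
  let ?G = "\<lambda>f. f - lft (\<tau> f)"
  have G: "vlin ?G" by (intro vlin_minus lin_id lin_comp[OF \<tau>_lin lft_lin])
  have V: "subspc cmul (tensor_rels scale n)" by (simp add: subspc_def tensor_rels_0 tensor_rels_add tensor_rels_cmul)
  have "?G (tensor xs) \<in> tensor_rels scale n" if "xs \<in> keys f" for xs
    using expand_tensor[of "[]" xs n] that f by (simp add: lft_def \<tau>_tensor chains_def)
  then have "lext cmul (\<lambda>xs. ?G (tensor xs)) f \<in> tensor_rels scale n"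
    unfolding lext_def by (intro subspc_sum[OF V] tensor_rels_cmul)
  then show ?thesis using lin_eq_lext[OF G, of f] by (simp add: tensor_def)
qed

lemma tensor_rels_kernel: "tensor_rels scale n = {f \<in> chains n. \<tau> f = 0}"
proof (intro equalityI subsetI)
  fix f assume "f \<in> {f \<in> chains n. \<tau> f = 0}"
  then show "f \<in> tensor_rels scale n" using expand_chain[of f n] by (simp add: lin_0[OF lft_lin])
next
  let ?V = "{f \<in> chains n. \<tau> f = 0}"
  have "free.subspace ?V"
    by (rule free.subspaceI) (auto simp: chains_0 chains_add chains_cmul lin_0[OF \<tau>_lin] lin_add[OF \<tau>_lin] lin_scale[OF \<tau>_lin])
  then have "tensor_rels scale n \<subseteq> ?V"
    unfolding tensor_rels_def
    by (intro free.span_minimal) (auto intro!: chains_diff chains_cmul chains_tensor simp: lin_ds[OF \<tau>_lin] \<tau>_tensor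
      lin_as[OF ten_lin])
  then show "\<And>f. f \<in> tensor_rels scale n ==> f \<in> ?V" by blast
qed

lemma chains_eqI:
  assumes "vlin F" "vlin G" "f \<in> chains (int n)" and "\<And>xs. length xs = Suc n ==> F (tensor xs) = G (tensor xs)"
  shows "F f = G f"
  by (rule lin_eqI[OF assms(1,2)]) (use assms(4) chains_keys[OF assms(3)] in \<open>auto simp: tensor_def\<close>)

lemma ext_lin: "vlin (lin_ext g)" by (simp add: lin_ext_lext vlin_lext)
lemma ext_tensor: "lin_ext g (tensor xs) = g xs" by (simp add: lin_ext_lext tensor_def)

lemma ext_chains: "f \<in> chains (int n) ==> (\<And>xs. length xs = Suc n ==> g xs \<in> chains m) ==> lin_ext g f \<in> chains m"
  unfolding lin_ext_lext by (intro chains_lext) (auto dest: chains_keys)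

lemma hoch_b_lin: "vlin (hoch_b \<sigma>)" and cyc_t_lin: "vlin (cyc_t \<sigma>)" and cyc_T_lin: "vlin (cyc_T \<sigma>)"
  and cyc_N_lin: "vlin (cyc_N \<sigma>)" and cyc_s_lin: "vlin cyc_s"
  by (simp_all add: hoch_b_def cyc_t_def cyc_T_def cyc_N_def cyc_s_def ext_lin)

lemma connes_B_lin: "vlin (connes_B \<sigma>)"
  unfolding connes_B_def[abs_def] by (intro vlin_minus lin_comp[OF _ cyc_t_lin] lin_comp[OF _ cyc_s_lin] cyc_N_lin)

lemma hoch_b_chains: assumes f: "f \<in> chains (int n)" shows "hoch_b \<sigma> f \<in> chains (int n - 1)"
  unfolding hoch_b_def
proof (rule ext_chains[OF f])
  fix xs :: "'a list" assume l: "length xs = Suc n"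
  show "(let n = length xs - 1 in if n = 0 then 0
     else (\<Sum>i<n. cmul ((-1) ^ i) (tensor (take i xs @ (xs ! i * xs ! Suc i) # drop (i + 2) xs)))
          + cmul ((-1) ^ n) (tensor ((\<sigma> (last xs) * hd xs) # butlast (tl xs)))) \<in> chains (int n - 1)"
    using l by (auto simp: Let_def chains_0 intro!: chains_add chains_sum chains_cmul chains_tensor)
qed

lemma \<tau>_hoch_b: assumes f: "f \<in> chains (int n)" shows "\<tau> (hoch_b \<sigma> f) = bn n (\<tau> f)"
proof (rule chains_eqI[OF lin_comp[OF hoch_b_lin \<tau>_lin] lin_comp[OF \<tau>_lin bn_lin] f], goal_cases)
  case l: (1 xs)
  show ?case
  proof (cases "n = 0")
    case True then show ?thesis using l by (simp add: hoch_b_def ext_tensor lin_0[OF \<tau>_lin] bn_0)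
  next
    case False
    have "bn n (ten xs) = (\<Sum>i<n. cmul ((-1) ^ i) (dq i (ten xs))) + cmul ((-1) ^ n) (dq n (ten xs))" using False by (simp add: bn_def Sp_def)
    then show ?thesis using False l
      by (simp add: hoch_b_def ext_tensor Let_def lin_add[OF \<tau>_lin] lin_sum[OF \<tau>_lin] lin_scale[OF \<tau>_lin] \<tau>_tensor dq_list)
  qed
qed

lemma cyc_t_chains: "f \<in> chains (int n) ==> cyc_t \<sigma> f \<in> chains (int n)"
  unfolding cyc_t_def by (erule ext_chains) (auto intro!: chains_cmul chains_tensor)

lemma \<tau>_cyc_t: assumes f: "f \<in> chains (int n)" shows "\<tau> (cyc_t \<sigma> f) = tq (\<tau> f)"
proof (rule chains_eqI[OF lin_comp[OF cyc_t_lin \<tau>_lin] lin_comp[OF \<tau>_lin tq_lin] f], goal_cases)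
  case (1 xs)
  then have "xs \<noteq> []" by auto
  then show ?case
    by (simp add: cyc_t_def ext_tensor lin_scale[OF \<tau>_lin] \<tau>_tensor tq_ten rot_def)
qed

lemma cyc_t_pow: "f \<in> chains (int n) ==> (cyc_t \<sigma> ^^ i) f \<in> chains (int n) \<and> \<tau> ((cyc_t \<sigma> ^^ i) f) = (tq ^^ i) (\<tau> f)"
  by (induction i) (auto simp: cyc_t_chains \<tau>_cyc_t)

lemma tensor_Suc: "length xs = Suc n ==> tensor xs \<in> chains (int n)" by (intro chains_tensor) auto

lemma cyc_T_chains: "f \<in> chains (int n) ==> cyc_T \<sigma> f \<in> chains (int n)"
  unfolding cyc_T_def by (erule ext_chains) (use cyc_t_pow[OF tensor_Suc] in blast)

lemma \<tau>_cyc_T: assumes f: "f \<in> chains (int n)" shows "\<tau> (cyc_T \<sigma> f) = Tq (\<tau> f)"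
proof (rule chains_eqI[OF lin_comp[OF cyc_T_lin \<tau>_lin] lin_comp[OF \<tau>_lin Tq_lin] f], goal_cases)
  case l: (1 xs)
  show ?case
    using cyc_t_pow[OF tensor_Suc[OF l], of "Suc n"] tq_full[OF ten_Cn[OF l]] l
    by (simp add: cyc_T_def ext_tensor \<tau>_tensor del: funpow.simps)
qed

lemma cyc_N_chains: "f \<in> chains (int n) ==> cyc_N \<sigma> f \<in> chains (int n)"
  unfolding cyc_N_def by (erule ext_chains) (use cyc_t_pow[OF tensor_Suc] in \<open>blast intro: chains_sum\<close>)

lemma \<tau>_cyc_N: assumes f: "f \<in> chains (int n)" shows "\<tau> (cyc_N \<sigma> f) = Nq n (\<tau> f)"
proof (rule chains_eqI[OF lin_comp[OF cyc_N_lin \<tau>_lin] lin_comp[OF \<tau>_lin Nq_lin] f], goal_cases)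
  case l: (1 xs)
  show ?case
    using cyc_t_pow[OF tensor_Suc[OF l]] l
    by (simp add: cyc_N_def ext_tensor \<tau>_tensor lin_sum[OF \<tau>_lin] Nq_def lessThan_Suc_atMost del: sum.lessThan_Suc)
qed

lemma cyc_s_chains: "f \<in> chains (int n) ==> cyc_s f \<in> chains (int (Suc n))"
  unfolding cyc_s_def by (erule ext_chains) (auto intro!: chains_tensor)

lemma \<tau>_cyc_s: assumes f: "f \<in> chains (int n)" shows "\<tau> (cyc_s f) = sq (\<tau> f)"
  by (rule chains_eqI[OF lin_comp[OF cyc_s_lin \<tau>_lin] lin_comp[OF \<tau>_lin sq_lin] f]) (simp add: cyc_s_def ext_tensor \<tau>_tensor sq_ten)

lemma connes_B_chains: "f \<in> chains (int n) ==> connes_B \<sigma> f \<in> chains (int (Suc n))"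
  unfolding connes_B_def by (intro chains_diff cyc_t_chains cyc_s_chains cyc_N_chains)

lemma \<tau>_connes_B: assumes f: "f \<in> chains (int n)" shows "\<tau> (connes_B \<sigma> f) = Bq n (\<tau> f)"
  using cyc_s_chains[OF cyc_N_chains[OF f]]
  by (simp only: connes_B_def lin_diff[OF \<tau>_lin] \<tau>_cyc_t \<tau>_cyc_s[OF cyc_N_chains[OF f]] \<tau>_cyc_N[OF f] Bq_def)

subsection \<open>Passing to the invariant subcomplex\<close>

text \<open>The evaluation followed by the spectral projection identifies the quotient complex with the invariant
  mixed complex.\<close>

definition pr :: "'a chain => tens" where "pr f = Pt (\<tau> f)"

lemma pr_lin: "vlin pr" unfolding pr_def[abs_def] by (rule lin_comp[OF \<tau>_lin Pt_lin])

lemma pr_MI: "f \<in> chains n ==> pr f \<in> MI n"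
proof (cases "n < 0")
  case True
  then show "f \<in> chains n ==> pr f \<in> MI n" by (simp add: chains_neg MI_def lin_0[OF pr_lin])
next
  case False
  then obtain m where "n = int m" by (metis nat_0_le not_less)
  then show "f \<in> chains n ==> pr f \<in> MI n" by (simp add: MI_nat pr_def Pt_Cn \<tau>_Cn Tq_Pt)
qed

lemma lft_MI: "v \<in> MI n ==> lft v \<in> chains n" and pr_lft: "v \<in> MI n ==> pr (lft v) = v"
  by (auto elim!: MI_cases simp: lft_chains lin_0[OF lft_lin] chains_0 lin_0[OF pr_lin]) (simp add: pr_def \<tau>_lft Pt_fixed)

text \<open>The kernel of \<open>Pt\<close> is the image of \<open>1 - T\<close>, and that of \<open>\<tau>\<close>
  consists of the tensor relations.\<close>

lemma cyc_rels_kernel: "cyc_rels scale \<sigma> n = {f \<in> chains n. pr f = 0}"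
proof (cases "n < 0")
  case True
  have "tensor_rels scale n = {0}" using True by (auto simp: tensor_rels_kernel chains_neg lin_0[OF \<tau>_lin])
  then show ?thesis using True by (auto simp: cyc_rels_def chains_neg lin_0[OF pr_lin] lin_0[OF cyc_T_lin])
next
  case False
  then obtain m where n: "n = int m" by (metis nat_0_le not_less)
  show ?thesis
  proof (intro equalityI subsetI)
    fix f assume "f \<in> cyc_rels scale \<sigma> n"
    then obtain g h where g: "g \<in> tensor_rels scale n" and h: "h \<in> chains n" and f: "f = g + (h - cyc_T \<sigma> h)"
      by (auto simp: cyc_rels_def elim!: set_plus_elim)
    have "\<tau> f = \<tau> h - Tq (\<tau> h)" using g h by (simp add: f tensor_rels_kernel lin_ad[OF \<tau>_lin] n \<tau>_cyc_T)
    then have "pr f = 0" by (simp add: pr_def Pt_coinvariant)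
    moreover have "f \<in> chains n" using g h unfolding f tensor_rels_kernel n by (auto intro!: chains_add chains_diff cyc_T_chains)
    ultimately show "f \<in> {f \<in> chains n. pr f = 0}" by simp
  next
    fix f assume f: "f \<in> {f \<in> chains n. pr f = 0}"
    then obtain g where g: "g \<in> Cn m" "\<tau> f = g - Tq g" using Pt_kernel[OF \<tau>_Cn, of f m] by (auto simp: pr_def n)
    let ?h = "lft g"
    have h: "?h \<in> chains n" using lft_chains[OF g(1)] n by simp
    have "f - (?h - cyc_T \<sigma> ?h) \<in> tensor_rels scale n"
      using f h g(2) cyc_T_chains[of ?h m] unfolding tensor_rels_kernel
      by (auto intro!: chains_diff simp: n lin_diff[OF \<tau>_lin] \<tau>_cyc_T \<tau>_lft)
    then show "f \<in> cyc_rels scale \<sigma> n" unfolding cyc_rels_def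
      using h by (intro set_plus_intro[of "f - (?h - cyc_T \<sigma> ?h)" _ "?h - cyc_T \<sigma> ?h", simplified]) auto
  qed
qed

lemma op_0: "hoch_b \<sigma> 0 = 0" "connes_B \<sigma> 0 = 0" "pr 0 = 0" by (simp_all add: lin_0[OF hoch_b_lin] lin_0[OF connes_B_lin] lin_0[OF pr_lin])

lemma hoch_b_pr: "f \<in> chains n ==> hoch_b \<sigma> f \<in> chains (n - 1) \<and> pr (hoch_b \<sigma> f) = bI n (pr f)"
proof (cases "n < 0")
  case True
  then show "f \<in> chains n ==> ?thesis" by (simp add: chains_neg op_0 bI_def)
next
  case False
  then obtain m where n: "n = int m" by (metis nat_0_le not_less)
  show "f \<in> chains n ==> ?thesis" using hoch_b_chains[of f m] by (simp add: n pr_def \<tau>_hoch_b bI_nat Pt_bn \<tau>_Cn)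
qed

lemma connes_B_pr: "f \<in> chains n ==> connes_B \<sigma> f \<in> chains (n + 1) \<and> pr (connes_B \<sigma> f) = BI n (pr f)"
proof (cases "n < 0")
  case True
  then show "f \<in> chains n ==> ?thesis" by (simp add: chains_neg op_0 BI_def chains_0)
next
  case False
  then obtain m where n: "n = int m" by (metis nat_0_le not_less)
  show "f \<in> chains n ==> ?thesis" using connes_B_chains[of f m] by (simp add: n pr_def \<tau>_connes_B BI_nat Pt_Bq \<tau>_Cn add.commute)
qed

end

section \<open>Cyclic and periodic cyclic homology\<close>

lemma coset_eq_iff:
  fixes R :: "'x::ab_group_add set"
  assumes R: "0 \<in> R" "\<And>u v. u \<in> R ==> v \<in> R ==> u - v \<in> R"
  shows "x +o R = y +o R \<longleftrightarrow> x - y \<in> R"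
proof
  assume "x +o R = y +o R"
  then have "x + 0 \<in> y +o R" using R(1) unfolding elt_set_plus_def by blast
  then show "x - y \<in> R" by (auto simp: elt_set_plus_def)
next
  assume d: "x - y \<in> R"
  have neg: "u \<in> R ==> - u \<in> R" for u using R(2)[OF R(1), of u] by simp
  have add: "u \<in> R ==> w \<in> R ==> u + w \<in> R" for u w using R(2)[of u "- w"] neg[of w] by simp
  show "x +o R = y +o R"
  proof (intro equalityI subsetI)
    fix w assume "w \<in> x +o R"
    then obtain u where "u \<in> R" "w = x + u" by (auto simp: elt_set_plus_def)
    then have "w = y + ((x - y) + u)" "(x - y) + u \<in> R" using add d by simp_all
    then show "w \<in> y +o R" unfolding elt_set_plus_def by blast
  next
    fix w assume "w \<in> y +o R"
    then obtain u where "u \<in> R" "w = y + u" by (auto simp: elt_set_plus_def)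
    then have "w = x + (u - (x - y))" "u - (x - y) \<in> R" using R(2) d by simp_all
    then show "w \<in> x +o R" unfolding elt_set_plus_def by blast
  qed
qed

context mixed_complex
begin

lemma bdry_d1_image: "bdry n z ==> d1_image n z"
proof -
  assume "bdry n z"
  then obtain w where "w \<in> M (n + 1)" "z = b (n + 1) w" by (auto simp: bdry_def)
  moreover have "cyc (n - 1) 0" by (simp add: cyc_def M_0 mixed_simps)
  ultimately show ?thesis unfolding d1_image_def by (intro exI[of _ 0] exI[of _ w]) (simp add: mixed_simps)
qed

text \<open>The completions of a surviving class to a total cycle in columns \<open>0\<close>, \<open>1\<close> and
  \<open>2\<close>. Only in column \<open>2\<close> could a later differential obstruct it, and the
  vanishing of the second page in the target degree rules this out.\<close>

lemma column0: assumes g: "cyc n g"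
  shows "\<exists>z\<in>Tot {0..} n. Dt {0..} n z = 0 \<and> z 0 = g \<and> (\<forall>p>0. z p = 0)"
proof (rule bexI)
  let ?z = "\<lambda>p::int. if p = 0 then g else 0"
  show "?z \<in> Tot {0..} n" using g by (intro TotI) (auto simp: cyc_def M_0)
  show "Dt {0..} n ?z = 0 \<and> ?z 0 = g \<and> (\<forall>p>0. ?z p = 0)"
    using g by (auto simp: Dt_def cyc_def mixed_simps fun_eq_iff)
qed

lemma column1: assumes g: "cyc (n - 2) g" "bdry (n - 1) (B (n - 2) g)"
  shows "\<exists>z\<in>Tot {0..} n. Dt {0..} n z = 0 \<and> z 1 = g \<and> (\<forall>p>1. z p = 0)"
proof -
  obtain w where w: "w \<in> M n" "B (n - 2) g = b n w" using g(2) by (auto simp: bdry_def)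
  let ?z = "\<lambda>p::int. if p = 1 then g else if p = 0 then - w else 0"
  show ?thesis
  proof (rule bexI)
    show "?z \<in> Tot {0..} n" using g w by (intro TotI) (auto simp: cyc_def M_0 M_uminus)
    show "Dt {0..} n ?z = 0 \<and> ?z 1 = g \<and> (\<forall>p>1. ?z p = 0)"
      using g w by (auto simp: Dt_def cyc_def mixed_simps fun_eq_iff)
  qed
qed

lemma column2: assumes g: "cyc (n - 4) g" "bdry (n - 3) (B (n - 4) g)" and E2: "E2zero (n - 1)"
  shows "\<exists>z\<in>Tot {0..} n. Dt {0..} n z = 0 \<and> z 2 = g \<and> (\<forall>p>2. z p = 0)"
proof -
  obtain w where w: "w \<in> M (n - 2)" "B (n - 4) g = b (n - 2) w" using g(2) by (auto simp: bdry_def)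
  have gM: "g \<in> M (n - 4)" using g by (simp add: cyc_def)
  have "B (n - 3) (b (n - 2) w) = 0" using B_B[OF gM] by (simp flip: w(2))
  then have "cyc (n - 1) (B (n - 2) w)" using B_M[OF w(1)] b_B[OF w(1)] by (simp add: cyc_def)
  moreover have "B (n - 1) (B (n - 2) w) = 0" using B_B[OF w(1)] by simp
  then have "bdry n (B (n - 1) (B (n - 2) w))" unfolding bdry_def by (intro bexI[of _ 0]) (simp_all add: mixed_simps M_0)
  ultimately have "d1_image (n - 1) (B (n - 2) w)" using E2 by (simp add: E2zero_def)
  then obtain u v where u: "cyc (n - 2) u" and v: "v \<in> M n" "B (n - 2) w = B (n - 2) u + b n v"
    unfolding d1_image_def by auto
  let ?z = "\<lambda>p::int. if p = 2 then g else if p = 1 then u - w else if p = 0 then v else 0"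
  show ?thesis
  proof (rule bexI)
    show "?z \<in> Tot {0..} n" using gM w u v by (intro TotI) (auto simp: cyc_def M_0 M_diff)
    show "Dt {0..} n ?z = 0 \<and> ?z 2 = g \<and> (\<forall>p>2. ?z p = 0)"
      using g w u v by (auto simp: Dt_def cyc_def mixed_simps fun_eq_iff)
  qed
qed

end

context twisted
begin

text \<open>Total chains, cycles and boundaries are transported to the invariant mixed complex column by column.\<close>

abbreviation PR :: "(int => 'a chain) => int => tens" where "PR z \<equiv> (\<lambda>p. pr (z p))"
abbreviation CY :: "int set => int => (int => 'a chain) set" where
  "CY P \<equiv> cycles (tot_chains P) (tot_rels scale \<sigma> P) (tot_d \<sigma> P)"
abbreviation BD :: "int set => int => (int => 'a chain) set" where
  "BD P \<equiv> boundaries (tot_chains P) (tot_rels scale \<sigma> P) (tot_d \<sigma> P)"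

lemma deg: "(n - p) - p = n - 2 * (p :: int)" by simp

lemma tot_col: "z \<in> tot_chains P n ==> p \<in> P ==> z p \<in> chains (n - 2 * p)"
  unfolding tot_chains_def deg by (metis (mono_tags, lifting) mem_Collect_eq)
lemma tot_out: "z \<in> tot_chains P n ==> p \<notin> P ==> z p = 0"
  unfolding tot_chains_def by (metis (mono_tags, lifting) mem_Collect_eq singletonD)
lemma totI: "(\<And>p. p \<in> P ==> z p \<in> chains (n - 2 * p)) ==> (\<And>p. p \<notin> P ==> z p = 0) ==> z \<in> tot_chains P n"
  unfolding tot_chains_def deg by simp

lemma tot_diff: "y \<in> tot_chains P n ==> z \<in> tot_chains P n ==> y - z \<in> tot_chains P n"
  by (intro totI) (simp_all add: tot_col tot_out chains_diff)
lemma tot_add: "y \<in> tot_chains P n ==> z \<in> tot_chains P n ==> y + z \<in> tot_chains P n"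
  by (intro totI) (simp_all add: tot_col tot_out chains_add)
lemma tot_scale: "z \<in> tot_chains P n ==> tot_mul k z \<in> tot_chains P n"
  by (intro totI) (simp_all add: tot_mul_def tot_col tot_out chains_cmul)

lemma PR_diff: "PR (y - z) = PR y - PR z" and PR_add: "PR (y + z) = PR y + PR z" and PR_mul: "PR (tot_mul k z) = (\<lambda>p. cmul k (PR z p))"
  by (simp_all add: fun_eq_iff lin_ads[OF pr_lin] tot_mul_def)

lemma PR_Tot: "z \<in> tot_chains P n ==> PR z \<in> I.Tot P n"
  by (intro I.TotI) (simp_all add: pr_MI tot_col tot_out op_0)

lemma lift_Tot: "y \<in> I.Tot P n ==> (\<lambda>p. lft (y p)) \<in> tot_chains P n" "y \<in> I.Tot P n ==> PR (\<lambda>p. lft (y p)) = y"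
proof -
  assume y: "y \<in> I.Tot P n"
  show "(\<lambda>p. lft (y p)) \<in> tot_chains P n"
    by (intro totI) (simp_all add: lft_MI I.Tot_col[OF y] I.Tot_out[OF y] lin_0[OF lft_lin])
  show "PR (\<lambda>p. lft (y p)) = y"
  proof (rule ext)
    fix p show "pr (lft (y p)) = y p"
      using pr_lft[OF I.Tot_col[OF y], of p] I.Tot_out[OF y, of p] by (cases "p \<in> P") (simp_all add: lin_0[OF lft_lin] op_0)
  qed
qed

lemma tot_rels_iff: "z \<in> tot_rels scale \<sigma> P n \<longleftrightarrow> z \<in> tot_chains P n \<and> PR z = 0"
proof -
  have "z p \<in> (if p \<in> P then cyc_rels scale \<sigma> (n - 2 * p) else {0}) \<longleftrightarrow>
      z p \<in> (if p \<in> P then chains (n - 2 * p) else {0}) \<and> pr (z p) = 0" for p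
    by (auto simp: cyc_rels_kernel op_0)
  then show ?thesis unfolding tot_rels_def tot_chains_def deg fun_eq_iff by auto
qed

lemma tot_d_PR:
  assumes z: "z \<in> tot_chains P n" and P: "\<forall>p\<in>P. p + 1 \<in> P"
  shows "tot_d \<sigma> P z \<in> tot_chains P (n - 1)" "PR (tot_d \<sigma> P z) = I.Dt P n (PR z)"
proof goal_cases
  have c: "hoch_b \<sigma> (z p) \<in> chains (n - 1 - 2 * p)" "pr (hoch_b \<sigma> (z p)) = bI (n - 2 * p) (pr (z p))" if "p \<in> P" for p
    using hoch_b_pr[OF tot_col[OF z that]] by (simp_all add: algebra_simps)
  have d: "connes_B \<sigma> (z (p + 1)) \<in> chains (n - 1 - 2 * p)" "pr (connes_B \<sigma> (z (p + 1))) = BI (n - 2 * p - 2) (pr (z (p + 1)))" if "p \<in> P" for p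
    using connes_B_pr[OF tot_col[OF z bspec[OF P that]]] by (simp_all add: algebra_simps)
  case 1 show ?case by (intro totI) (simp_all add: tot_d_def chains_add c d)
  case 2 show ?case
    by (rule ext) (simp add: tot_d_def I.Dt_def lin_add[OF pr_lin] c d op_0)
qed

lemma cycles_iff:
  assumes P: "\<forall>p\<in>P. p + 1 \<in> P"
  shows "z \<in> CY P n \<longleftrightarrow> z \<in> tot_chains P n \<and> I.Dt P n (PR z) = 0"
  using tot_d_PR[OF _ P, of z n] by (auto simp: cycles_def tot_rels_iff)

lemma boundaries_iff:
  assumes P: "\<forall>p\<in>P. p + 1 \<in> P"
  shows "z \<in> BD P n \<longleftrightarrow> z \<in> tot_chains P n \<and> (\<exists>y\<in>I.Tot P (n + 1). PR z = I.Dt P (n + 1) y)"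
proof
  assume "z \<in> BD P n"
  then obtain u y where u: "u \<in> tot_rels scale \<sigma> P n" and y: "y \<in> tot_chains P (n + 1)" and z: "z = u + tot_d \<sigma> P y"
    by (auto simp: boundaries_def elim!: set_plus_elim)
  note d = tot_d_PR[OF y P]
  have "z \<in> tot_chains P n" unfolding z using u d(1) by (intro tot_add) (simp_all add: tot_rels_iff)
  moreover have "PR z = I.Dt P (n + 1) (PR y)" unfolding z PR_add d(2) using u by (simp add: tot_rels_iff)
  ultimately show "z \<in> tot_chains P n \<and> (\<exists>y\<in>I.Tot P (n + 1). PR z = I.Dt P (n + 1) y)" using PR_Tot[OF y] by blast
next
  assume "z \<in> tot_chains P n \<and> (\<exists>y\<in>I.Tot P (n + 1). PR z = I.Dt P (n + 1) y)"
  then obtain y where z: "z \<in> tot_chains P n" and y: "y \<in> I.Tot P (n + 1)" "PR z = I.Dt P (n + 1) y" by blast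
  let ?y = "\<lambda>p. lft (y p)"
  note l = lift_Tot[OF y(1)]
  note d = tot_d_PR[OF l(1) P]
  have "z - tot_d \<sigma> P ?y \<in> tot_rels scale \<sigma> P n"
    unfolding tot_rels_iff PR_diff d(2) l(2) using tot_diff[OF z] d(1) y(2) by simp
  then have "(z - tot_d \<sigma> P ?y) + tot_d \<sigma> P ?y \<in> BD P n" unfolding boundaries_def using l(1) by (intro set_plus_intro) auto
  then show "z \<in> BD P n" by simp
qed

lemma half_line: "\<forall>p\<in>{0..}. p + 1 \<in> {0::int..}" and whole_line: "\<forall>p\<in>UNIV. p + 1 \<in> (UNIV :: int set)" by simp_all

lemmas CY_half = cycles_iff[OF half_line] and BD_half = boundaries_iff[OF half_line]
  and CY_whole = cycles_iff[OF whole_line] and BD_whole = boundaries_iff[OF whole_line]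

lemma BD_group:
  assumes P: "\<forall>p\<in>P. p + 1 \<in> P"
  shows "0 \<in> BD P n" "u \<in> BD P n ==> v \<in> BD P n ==> u - v \<in> BD P n"
proof -
  have 0: "0 \<in> I.Tot P (n + 1)" by (intro I.TotI) (simp_all add: I.M_0)
  have "I.Dt P (n + 1) 0 = 0" by (rule ext) (simp add: I.Dt_def I.mixed_simps)
  then show "0 \<in> BD P n" unfolding boundaries_iff[OF P]
    using 0 by (intro conjI bexI[of _ 0] totI) (auto simp: chains_0 op_0 fun_eq_iff)
  assume "u \<in> BD P n" "v \<in> BD P n"
  then obtain y y' where y: "u \<in> tot_chains P n" "y \<in> I.Tot P (n + 1)" "PR u = I.Dt P (n + 1) y"
    and y': "v \<in> tot_chains P n" "y' \<in> I.Tot P (n + 1)" "PR v = I.Dt P (n + 1) y'"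
    unfolding boundaries_iff[OF P] by blast
  show "u - v \<in> BD P n" unfolding boundaries_iff[OF P] PR_diff y(3) y'(3)
    using tot_diff[OF y(1) y'(1)] I.Tot_diff[OF y(2) y'(2)] I.Dt_diff[of P "n + 1" y y'] by metis
qed

lemma BD_coset:
  assumes P: "\<forall>p\<in>P. p + 1 \<in> P"
  shows "u +o BD P n = v +o BD P n \<longleftrightarrow> u - v \<in> BD P n"
  by (rule coset_eq_iff) (fact BD_group[OF P])+

subsection \<open>Lines in cyclic homology\<close>

text \<open>The representatives are lifted along \<open>lft\<close>, except in column \<open>p\<^sub>0\<close>, where
  \<open>x\<close> itself is put in place of the lift of its projection.\<close>

theorem line_criterion:
  assumes x: "x \<in> chains (n - 2 * p0)" "\<tau> (hoch_b \<sigma> x) = 0" and p0: "0 \<le> p0"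
    and g: "I.E2line (n - 2 * p0) (pr x)"
    and n: "3 \<le> n" "n - 2 * p0 - 5 < 0"
    and E2: "\<And>p. 0 \<le> p ==> p \<noteq> p0 ==> I.E2zero (n - 2 * p)" "I.E2zero (n - 2 * p0 - 3)"
    and z0: "\<exists>z\<in>I.Tot {0..} n. I.Dt {0..} n z = 0 \<and> z p0 = pr x \<and> (\<forall>p>p0. z p = 0)"
  shows "HC_line_spanned_by scale \<sigma> n p0 x"
proof -
  obtain y where y: "y \<in> I.Tot {0..} n" "I.Dt {0..} n y = 0" "y p0 = pr x" "\<forall>p>p0. y p = 0" using z0 by blast
  define z where "z = (\<lambda>p. if p = p0 then x else lft (y p))"
  have z: "z \<in> tot_chains {0..} n"
    using tot_col[OF lift_Tot(1)[OF y(1)]] tot_out[OF lift_Tot(1)[OF y(1)]] x p0 by (intro totI) (auto simp: z_def)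
  have PRz: "PR z = y" using fun_cong[OF lift_Tot(2)[OF y(1)]] y(3) by (auto simp: z_def fun_eq_iff)
  have zc: "z \<in> CY {0..} n" using z PRz y(2) by (simp add: CY_half)
  have ztop: "\<forall>p>p0. z p = 0" using y(4) by (simp add: z_def lin_0[OF lft_lin])
  have H: "\<And>w. I.cyc (n + 1) w ==> I.bdry (n + 1) w" using no_homology n(1) by simp
  have "x \<in> hoch_cycles scale \<sigma> (n - 2 * p0)"
    using x hoch_b_pr[OF x(1)] by (simp add: hoch_cycles_def cycles_def tensor_rels_kernel)
  moreover have "0 \<in> E1_boundaries scale \<sigma> (n - 2 * p0)"
  proof -
    have "0 + hoch_b \<sigma> 0 \<in> cyc_rels scale \<sigma> (n - 2 * p0) + hoch_b \<sigma> ` chains (n - 2 * p0 + 1)"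
      by (intro set_plus_intro imageI) (simp_all add: cyc_rels_kernel chains_0 op_0)
    then show ?thesis by (simp add: E1_boundaries_def boundaries_def op_0)
  qed
  ultimately have rep: "represents scale \<sigma> n p0 x z"
    using zc ztop by (simp add: represents_def HC_cycles_def z_def)
  have nz: "HC_class scale \<sigma> n z \<notin> HC_filt scale \<sigma> (p0 - 1) n"
  proof
    assume "HC_class scale \<sigma> n z \<in> HC_filt scale \<sigma> (p0 - 1) n"
    then obtain w where w: "w \<in> CY {0..} n" "\<forall>p>p0 - 1. w p = 0" and e: "z +o BD {0..} n = w +o BD {0..} n"
      by (auto simp: HC_filt_def HC_class_def HC_cycles_def HC_boundaries_def)
    have "z - w \<in> BD {0..} n" using e BD_coset[OF half_line, of z n w] by simp
    then obtain u where u: "u \<in> I.Tot {0..} (n + 1)" "PR (z - w) = I.Dt {0..} (n + 1) u" by (auto simp: BD_half)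
    have wt: "w \<in> tot_chains {0..} n" using w(1) by (simp add: CY_half)
    have "y = PR w + I.Dt {0..} (n + 1) u" using u(2) unfolding PR_diff PRz by (simp add: algebra_simps)
    moreover have "\<forall>p\<ge>p0. PR w p = 0" using w(2) by (simp add: op_0)
    ultimately show False
      using I.line_nonzero[OF g p0 E2(2) n(2) y(3,4) PR_Tot[OF wt] _ u(1)] by blast
  qed
  have span: "HC scale \<sigma> n = range (\<lambda>k. HC_class scale \<sigma> n (tot_mul k z))"
  proof (intro equalityI subsetI)
    fix \<xi> assume "\<xi> \<in> HC scale \<sigma> n"
    then obtain w where w: "w \<in> CY {0..} n" "\<xi> = w +o BD {0..} n" by (auto simp: HC_def homology_def)
    have wt: "w \<in> tot_chains {0..} n" "I.Dt {0..} n (PR w) = 0" using w(1) by (simp_all add: CY_half)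
    obtain k u where u: "u \<in> I.Tot {0..} (n + 1)" "PR w = (\<lambda>p. cmul k (y p)) + I.Dt {0..} (n + 1) u"
      using I.line_spans[OF g p0 H E2(1) y PR_Tot[OF wt(1)] wt(2)] by blast
    have "PR (w - tot_mul k z) = I.Dt {0..} (n + 1) u"
      unfolding PR_diff PR_mul u(2) using fun_cong[OF PRz] by (simp add: fun_eq_iff)
    then have "w - tot_mul k z \<in> BD {0..} n"
      unfolding BD_half using tot_diff[OF wt(1) tot_scale[OF z]] u(1) by blast
    then have "\<xi> = HC_class scale \<sigma> n (tot_mul k z)" using BD_coset[OF half_line, of w n] w(2) by (simp add: HC_class_def HC_boundaries_def)
    then show "\<xi> \<in> range (\<lambda>k. HC_class scale \<sigma> n (tot_mul k z))" by blast
  next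
    fix \<xi> assume "\<xi> \<in> range (\<lambda>k. HC_class scale \<sigma> n (tot_mul k z))"
    then obtain k where k: "\<xi> = HC_class scale \<sigma> n (tot_mul k z)" by blast
    have "I.Dt {0..} n (\<lambda>p. cmul k (y p)) p = cmul k (I.Dt {0..} n y p)" for p
      by (rule I.Dt_scl)
    then have "I.Dt {0..} n (PR (tot_mul k z)) = 0" using y(2) PRz by (simp add: PR_mul fun_eq_iff)
    then have "tot_mul k z \<in> CY {0..} n" using tot_scale[OF z] by (simp add: CY_half)
    then show "\<xi> \<in> HC scale \<sigma> n" unfolding k by (auto simp: HC_def homology_def HC_class_def HC_boundaries_def)
  qed
  show ?thesis unfolding HC_line_spanned_by_def using rep nz span by blast
qed

subsection \<open>Periodic cyclic homology\<close>

context
  fixes m s :: int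
  assumes m: "3 \<le> m"
begin

abbreviation nn :: int where "nn \<equiv> m + 2 * s"

text \<open>The canonical map for total degrees that differ by \<open>2s\<close>.\<close>

definition pc :: "(int => 'a chain) => int => 'a chain" where
  "pc z = (\<lambda>p. if 0 \<le> p then z (p + s) else 0)"

lemma periodic_to_cyclic_pc: "periodic_to_cyclic nn m = pc"
  by (intro ext) (simp add: periodic_to_cyclic_def pc_def)

lemma shift_Tot: "y \<in> I.Tot UNIV nn \<longleftrightarrow> (\<lambda>p. y (p + s)) \<in> I.Tot UNIV m"
proof -
  have "(\<forall>p. y p \<in> MI (nn - 2 * p)) \<longleftrightarrow> (\<forall>p. y (p + s) \<in> MI (nn - 2 * (p + s)))" by (metis diff_add_cancel)
  then show ?thesis by (simp add: I.Tot_def algebra_simps)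
qed

lemma shift_Tot1: "y \<in> I.Tot UNIV (nn + 1) \<longleftrightarrow> (\<lambda>p. y (p + s)) \<in> I.Tot UNIV (m + 1)"
proof -
  have "(\<forall>p. y p \<in> MI (nn + 1 - 2 * p)) \<longleftrightarrow> (\<forall>p. y (p + s) \<in> MI (nn + 1 - 2 * (p + s)))" by (metis diff_add_cancel)
  then show ?thesis by (simp add: I.Tot_def algebra_simps)
qed

lemma shift_Dt: "I.Dt UNIV m (\<lambda>p. y (p + s)) = (\<lambda>p. I.Dt UNIV nn y (p + s))"
  by (rule ext) (simp add: I.Dt_def algebra_simps)
lemma shift_Dt1: "I.Dt UNIV (m + 1) (\<lambda>p. y (p + s)) = (\<lambda>p. I.Dt UNIV (nn + 1) y (p + s))"
  by (rule ext) (simp add: I.Dt_def algebra_simps)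

lemma pc_chains: "z \<in> tot_chains UNIV nn ==> pc z \<in> tot_chains {0..} m"
  using tot_col[of z UNIV nn "_ + s"] by (intro totI) (simp_all add: pc_def algebra_simps)

lemma restrict_Tot: "y \<in> I.Tot UNIV k ==> (\<lambda>p. if 0 \<le> p then y p else 0) \<in> I.Tot {0..} k"
  by (intro I.TotI) (simp_all add: I.Tot_col)
lemma restrict_Dt: "0 \<le> p ==> I.Dt {0..} k (\<lambda>p. if 0 \<le> p then y p else 0) p = I.Dt UNIV k y p"
  by (simp add: I.Dt_def)

lemma PR_pc: "PR (pc z) = (\<lambda>p. if 0 \<le> p then PR z (p + s) else 0)" by (auto simp: pc_def op_0)

lemma pc_cycle: assumes z: "z \<in> CY UNIV nn" shows "pc z \<in> CY {0..} m"
proof -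
  have z': "z \<in> tot_chains UNIV nn" "I.Dt UNIV nn (PR z) = 0" using z by (simp_all add: CY_whole)
  have "I.Dt {0..} m (PR (pc z)) p = 0" for p
    using restrict_Dt[of p m "\<lambda>p. PR z (p + s)"] fun_cong[OF shift_Dt[of "PR z"], of p] z'(2)
    by (cases "0 \<le> p") (simp_all add: PR_pc, simp add: I.Dt_def)
  then show ?thesis using pc_chains[OF z'(1)] by (simp add: CY_half fun_eq_iff)
qed

lemma pc_boundary: assumes z: "z \<in> BD UNIV nn" shows "pc z \<in> BD {0..} m"
proof -
  obtain y where z': "z \<in> tot_chains UNIV nn" and y: "y \<in> I.Tot UNIV (nn + 1)" "PR z = I.Dt UNIV (nn + 1) y" using z by (auto simp: BD_whole)
  let ?y = "\<lambda>p. if 0 \<le> p then y (p + s) else 0"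
  have y1: "?y \<in> I.Tot {0..} (m + 1)" by (rule restrict_Tot) (use y(1) shift_Tot1 in simp)
  have "PR (pc z) p = I.Dt {0..} (m + 1) ?y p" for p
  proof (cases "0 \<le> p")
    case True
    have "PR (pc z) p = I.Dt UNIV (nn + 1) y (p + s)" using fun_cong[OF y(2), of "p + s"] True by (simp only: pc_def if_True)
    also have "\<dots> = I.Dt UNIV (m + 1) (\<lambda>p. y (p + s)) p" by (simp only: shift_Dt1)
    also have "\<dots> = I.Dt {0..} (m + 1) ?y p" by (rule restrict_Dt[OF True, symmetric])
    finally show ?thesis .
  qed (simp add: pc_def op_0 I.Dt_def)
  then show ?thesis using pc_chains[OF z'] y1 by (auto simp: BD_half)
qed

lemma pc_diff: "pc (u - v) = pc u - pc v" and pc_add: "pc (u + v) = pc u + pc v" by (auto simp: pc_def)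

lemma HP_to_HC_class: assumes z: "z \<in> CY UNIV nn"
  shows "HP_to_HC scale \<sigma> nn m (z +o BD UNIV nn) = pc z +o BD {0..} m"
proof (intro equalityI subsetI)
  note G = BD_group[OF half_line]
  fix w assume "w \<in> HP_to_HC scale \<sigma> nn m (z +o BD UNIV nn)"
  then obtain \<beta> \<gamma> where \<beta>: "\<beta> \<in> BD UNIV nn" and \<gamma>: "\<gamma> \<in> BD {0..} m" and w: "w = pc (z + \<beta>) + \<gamma>"
    by (auto simp: HP_to_HC_def periodic_to_cyclic_pc HC_boundaries_def elt_set_plus_def elim!: set_plus_elim)
  have "0 - pc \<beta> \<in> BD {0..} m" by (rule G(2)[OF G(1) pc_boundary[OF \<beta>]])
  from G(2)[OF \<gamma> this] have "pc \<beta> + \<gamma> \<in> BD {0..} m" by (simp add: add.commute)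
  moreover have "w = pc z + (pc \<beta> + \<gamma>)" by (simp add: w pc_add add.assoc)
  ultimately show "w \<in> pc z +o BD {0..} m" by (auto simp: elt_set_plus_def)
next
  fix w assume "w \<in> pc z +o BD {0..} m"
  then obtain \<gamma> where \<gamma>: "\<gamma> \<in> BD {0..} m" "w = pc z + \<gamma>" by (auto simp: elt_set_plus_def)
  have "z \<in> z +o BD UNIV nn" using BD_group(1)[OF whole_line, of nn] unfolding elt_set_plus_def by force
  then show "w \<in> HP_to_HC scale \<sigma> nn m (z +o BD UNIV nn)"
    unfolding HP_to_HC_def periodic_to_cyclic_pc HC_boundaries_def \<gamma>(2) using \<gamma>(1) by (intro set_plus_intro imageI)
qed

text \<open>A bounding chain for the columns of nonnegative index extends to all columns by
  \<open>extend_boundary\<close>, since the homology vanishes above degree three.\<close>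

lemma pc_injective: assumes z: "z \<in> CY UNIV nn" and b: "pc z \<in> BD {0..} m" shows "z \<in> BD UNIV nn"
proof -
  have z': "z \<in> tot_chains UNIV nn" "I.Dt UNIV nn (PR z) = 0" using z by (simp_all add: CY_whole)
  obtain y where y: "y \<in> I.Tot {0..} (m + 1)" "PR (pc z) = I.Dt {0..} (m + 1) y" using b by (auto simp: BD_half)
  let ?z = "\<lambda>p. PR z (p + s)"
  have "\<exists>y'\<in>I.Tot UNIV (m + 1). ?z = I.Dt UNIV (m + 1) y' \<and> (\<forall>p\<ge>0. y' p = y p)"
  proof (rule I.extend_boundary[OF _ _ _ y(1)])
    show "\<And>k w. m + 1 < k ==> I.cyc k w ==> I.bdry k w" using no_homology m by simp
    show "?z \<in> I.Tot UNIV m" using shift_Tot PR_Tot[OF z'(1)] by simp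
    show "I.Dt UNIV m ?z = 0" using shift_Dt[of "PR z"] z'(2) by (simp add: fun_eq_iff)
    show "\<forall>p\<ge>0. ?z p = I.Dt {0..} (m + 1) y p" using fun_cong[OF y(2)] by (metis (no_types, lifting) PR_pc)
  qed
  then obtain y' where y': "y' \<in> I.Tot UNIV (m + 1)" "?z = I.Dt UNIV (m + 1) y'" by blast
  let ?y = "\<lambda>p. y' (p - s)"
  have y1: "?y \<in> I.Tot UNIV (nn + 1)" using shift_Tot1[of ?y] y'(1) by simp
  have "PR z p = I.Dt UNIV (nn + 1) ?y p" for p
    using fun_cong[OF shift_Dt1[of ?y], of "p - s"] fun_cong[OF y'(2), of "p - s"] by simp
  then show ?thesis using z'(1) y1 by (auto simp: BD_whole)
qed

lemma pc_surjective: assumes w: "w \<in> CY {0..} m" shows "\<exists>z\<in>CY UNIV nn. pc z = w"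
proof -
  have w': "w \<in> tot_chains {0..} m" "I.Dt {0..} m (PR w) = 0" using w by (simp_all add: CY_half)
  have "\<exists>y\<in>I.Tot UNIV m. I.Dt UNIV m y = 0 \<and> (\<forall>p\<ge>0. y p = PR w p)"
    by (rule I.extend_cycle[OF _ PR_Tot[OF w'(1)] w'(2)]) (use no_homology m in simp)
  then obtain y where y: "y \<in> I.Tot UNIV m" "I.Dt UNIV m y = 0" "\<forall>p\<ge>0. y p = PR w p" by blast
  define v where "v = (\<lambda>p. if 0 \<le> p then w p else lft (y p))"
  have PRv: "PR v = y" using y(3) fun_cong[OF lift_Tot(2)[OF y(1)]] by (auto simp: v_def fun_eq_iff)
  let ?z = "\<lambda>p. v (p - s)"
  have vch: "v p \<in> chains (m - 2 * p)" for p
    using tot_col[OF w'(1), of p] tot_col[OF lift_Tot(1)[OF y(1)], of p] by (simp add: v_def)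
  have "?z \<in> tot_chains UNIV nn"
  proof (rule totI)
    fix p show "?z p \<in> chains (nn - 2 * p)" using vch[of "p - s"] by (simp add: algebra_simps)
  qed simp
  moreover have "I.Dt UNIV nn (PR ?z) = 0"
  proof (rule ext)
    fix p
    have "(\<lambda>p. PR ?z (p + s)) = y" using PRv by (simp add: fun_eq_iff)
    then have "I.Dt UNIV m (\<lambda>p. PR ?z (p + s)) (p - s) = 0" using y(2) by (simp only: zero_fun_apply)
    then show "I.Dt UNIV nn (PR ?z) p = 0 p" unfolding shift_Dt[of "PR ?z"] by (simp only: diff_add_cancel zero_fun_apply)
  qed
  moreover have "pc ?z = w" using tot_out[OF w'(1)] by (auto simp: pc_def v_def fun_eq_iff)
  ultimately show ?thesis by (auto simp: CY_whole intro!: bexI[of _ ?z])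
qed

theorem periodic_bij: "bij_betw (HP_to_HC scale \<sigma> nn m) (HP scale \<sigma> nn) (HC scale \<sigma> m)"
  unfolding bij_betw_def
proof
  show "inj_on (HP_to_HC scale \<sigma> nn m) (HP scale \<sigma> nn)"
  proof (rule inj_onI)
    fix \<xi> \<eta> assume "\<xi> \<in> HP scale \<sigma> nn" "\<eta> \<in> HP scale \<sigma> nn" and e: "HP_to_HC scale \<sigma> nn m \<xi> = HP_to_HC scale \<sigma> nn m \<eta>"
    then obtain u v where u: "u \<in> CY UNIV nn" "\<xi> = u +o BD UNIV nn" and v: "v \<in> CY UNIV nn" "\<eta> = v +o BD UNIV nn"
      by (auto simp: HP_def homology_def)
    have "pc u - pc v \<in> BD {0..} m" using e BD_coset[OF half_line, of "pc u" m "pc v"] by (simp add: u v HP_to_HC_class)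
    then have "pc (u - v) \<in> BD {0..} m" by (simp add: pc_diff)
    moreover have "u - v \<in> CY UNIV nn" using u(1) v(1) unfolding CY_whole PR_diff I.Dt_diff by (simp add: tot_diff)
    ultimately have "u - v \<in> BD UNIV nn" by (intro pc_injective)
    then show "\<xi> = \<eta>" using BD_coset[OF whole_line, of u nn v] by (simp add: u v)
  qed
  show "HP_to_HC scale \<sigma> nn m ` HP scale \<sigma> nn = HC scale \<sigma> m"
  proof (intro equalityI subsetI)
    fix \<xi> assume "\<xi> \<in> HP_to_HC scale \<sigma> nn m ` HP scale \<sigma> nn"
    then obtain u where u: "u \<in> CY UNIV nn" "\<xi> = pc u +o BD {0..} m" by (auto simp: HP_def homology_def HP_to_HC_class)
    then show "\<xi> \<in> HC scale \<sigma> m" using pc_cycle[OF u(1)] by (auto simp: HC_def homology_def)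
  next
    fix \<xi> assume "\<xi> \<in> HC scale \<sigma> m"
    then obtain w where w: "w \<in> CY {0..} m" "\<xi> = w +o BD {0..} m" by (auto simp: HC_def homology_def)
    obtain z where z: "z \<in> CY UNIV nn" "pc z = w" using pc_surjective[OF w(1)] by blast
    have "\<xi> = HP_to_HC scale \<sigma> nn m (z +o BD UNIV nn)" using HP_to_HC_class[OF z(1)] z(2) w(2) by simp
    then show "\<xi> \<in> HP_to_HC scale \<sigma> nn m ` HP scale \<sigma> nn" using z(1) by (auto simp: HP_def homology_def)
  qed
qed

end

end

subsection \<open>The four generators\<close>

context twisted
begin

lemma \<tau>_fundamental: "\<tau> (left_mult y (fundamental_cycle q a b c d)) = FC y"
proof -
  have t: "\<tau> (left_mult y (tensor (z # zs))) = ten (y * z # zs)" for z zs by (simp add: left_mult_def ext_tensor \<tau>_tensor)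
  have l: "vlin (\<lambda>f. \<tau> (left_mult y f))" unfolding left_mult_def by (intro lin_comp[OF _ \<tau>_lin] ext_lin)
  show ?thesis unfolding fundamental_cycle_def FC_def lin_ads[OF l] t ..
qed

lemma \<tau>_cap:
  assumes \<delta>: "\<delta> = Dw (-1) (-1)"
  shows "\<tau> (left_mult y (cap_derivation \<delta> (fundamental_cycle q a b c d))) = ccap y"
proof -
  have t: "\<tau> (left_mult y (cap_derivation \<delta> (tensor (z # z' # zs)))) = ten (y * z * \<delta> z' # zs)" for z z' zs
    by (simp add: left_mult_def cap_derivation_def ext_tensor \<tau>_tensor mult.assoc)
  have l: "vlin (\<lambda>f. \<tau> (left_mult y (cap_derivation \<delta> f)))" unfolding left_mult_def cap_derivation_def by (intro lin_comp[OF _ \<tau>_lin] lin_comp[OF ext_lin ext_lin])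
  have e: "eq (Dw (-1) (-1)) (ten (z # z' # zs)) = ten (z * \<delta> z' # zs)" for z z' zs by (simp add: eq_ten[OF Dw_der] \<delta>)
  note el = eq_lin[OF Dw_der]
  show ?thesis unfolding fundamental_cycle_def ccap_def FC_def lin_ads[OF l] t
    lin_ads[OF el] e ..
qed

lemma left_mult_chains: "f \<in> chains (int n) ==> left_mult y f \<in> chains (int n)"
  unfolding left_mult_def by (erule ext_chains) (auto intro!: chains_tensor)

lemma cap_chains: "f \<in> chains (int (Suc n)) ==> cap_derivation \<delta> f \<in> chains (int n)"
  unfolding cap_derivation_def by (erule ext_chains) (auto intro!: chains_tensor)

lemma fundamental_chains: "fundamental_cycle q a b c d \<in> chains (int 3)"
  unfolding fundamental_cycle_def by (intro chains_add chains_diff chains_cmul chains_tensor) simp_all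

lemma E2zero_4: "I.E2zero 4"
  using no_homology I.bdry_d1_image by (simp add: I.E2zero_def)

lemma representative:
  assumes x: "x \<in> chains (int n)" "\<tau> x = g" and g: "I.E2line (int n) g"
  shows "\<tau> (hoch_b \<sigma> x) = 0" "pr x = g"
  using g x by (auto simp: \<tau>_hoch_b I.E2line_def I_cyc pr_def Pt_fixed)

theorem singular_lines:
  assumes N: "N = 2 * int r + 2" and \<delta>: "\<delta> = Dw (-1) (-1)"
  shows "HC_line_spanned_by scale \<sigma> 4 1 (left_mult (b ^ r * c ^ r) (cap_derivation \<delta> (fundamental_cycle q a b c d)))"
    and "HC_line_spanned_by scale \<sigma> 3 0 (left_mult (b ^ r * c ^ r) (fundamental_cycle q a b c d))"
proof -
  let ?x = "left_mult (b ^ r * c ^ r) (fundamental_cycle q a b c d)"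
  let ?y = "left_mult (b ^ r * c ^ r) (cap_derivation \<delta> (fundamental_cycle q a b c d))"
  have x: "?x \<in> chains (int 3)" by (intro left_mult_chains fundamental_chains)
  have y: "?y \<in> chains (int 2)" using cap_chains[of _ 2] fundamental_chains by (intro left_mult_chains) (simp add: numeral_3_eq_3)
  note lx = singular_E2_3[OF N] and ly = singular_E2_2[OF N]
  note E = singular_E2_0[OF N] singular_E2_1[OF N] I.E2zero_neg
  have rx: "\<tau> (hoch_b \<sigma> ?x) = 0" "pr ?x = FC (b ^ r * c ^ r)" using representative[OF x \<tau>_fundamental] lx by simp_all
  have ry: "\<tau> (hoch_b \<sigma> ?y) = 0" "pr ?y = ccap (b ^ r * c ^ r)" using representative[OF y \<tau>_cap[OF \<delta>]] ly by simp_all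
  show "HC_line_spanned_by scale \<sigma> 3 0 ?x"
  proof (rule line_criterion)
    show "I.E2zero (3 - 2 * p)" if "0 \<le> p" "p \<noteq> 0" for p :: int using E(2) E(3)[of "3 - 2 * p"] that by (cases "p = 1") auto
    show "\<exists>z\<in>I.Tot {0..} 3. I.Dt {0..} 3 z = 0 \<and> z 0 = pr ?x \<and> (\<forall>p>0. z p = 0)"
      using I.column0[of 3 "pr ?x"] lx rx by (simp add: I.E2line_def)
  qed (use x rx lx E(1) in simp_all)
  show "HC_line_spanned_by scale \<sigma> 4 1 ?y"
  proof (rule line_criterion)
    show "I.E2zero (4 - 2 * p)" if "0 \<le> p" "p \<noteq> 1" for p :: int
    proof -
      show ?thesis using E2zero_4 E(1) E(3)[of "4 - 2 * p"] that by (cases "p = 0"; cases "p = 2") auto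
    qed
    show "\<exists>z\<in>I.Tot {0..} 4. I.Dt {0..} 4 z = 0 \<and> z 1 = pr ?y \<and> (\<forall>p>1. z p = 0)"
      using I.column1[of 4 "pr ?y"] ly ry by (simp add: I.E2line_def)
  qed (use y ry ly E(3) in simp_all)
qed

theorem regular_lines:
  assumes N: "\<nexists>r::nat. N = 2 * int r + 2"
  shows "HC_line_spanned_by scale \<sigma> 4 2 (tensor [1])" and "HC_line_spanned_by scale \<sigma> 3 1 (tensor [b, c])"
proof goal_cases
  have x: "tensor [1] \<in> chains (int 0)" and y: "tensor [b, c] \<in> chains (int 1)" by (intro chains_tensor; simp)+
  note R = nz_off_regular[OF N]
  note lx = regular_E2_0[OF R] and ly = regular_E2_1[OF R]
  note E = regular_E2_23[OF R] I.E2zero_neg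
  have rx: "\<tau> (hoch_b \<sigma> (tensor [1])) = 0" "pr (tensor [1]) = T 1" using representative[OF x \<tau>_tensor] lx by simp_all
  have ry: "\<tau> (hoch_b \<sigma> (tensor [b, c])) = 0" "pr (tensor [b, c]) = ten [b, c]" using representative[OF y \<tau>_tensor] ly by simp_all
  case 2 show ?case
  proof (rule line_criterion)
    show "I.E2zero (3 - 2 * p)" if "0 \<le> p" "p \<noteq> 1" for p :: int using E(2) E(3)[of "3 - 2 * p"] that by (cases "p = 0") auto
    show "\<exists>z\<in>I.Tot {0..} 3. I.Dt {0..} 3 z = 0 \<and> z 1 = pr (tensor [b, c]) \<and> (\<forall>p>1. z p = 0)"
      using I.column1[of 3 "pr (tensor [b, c])"] ly ry by (simp add: I.E2line_def)
  qed (use y ry ly E(3) in simp_all)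
  case 1 show ?case
  proof (rule line_criterion)
    show "I.E2zero (4 - 2 * p)" if "0 \<le> p" "p \<noteq> 2" for p :: int
      using E2zero_4 E(1) E(3)[of "4 - 2 * p"] that by (cases "p = 0"; cases "p = 1") auto
    show "\<exists>z\<in>I.Tot {0..} 4. I.Dt {0..} 4 z = 0 \<and> z 2 = pr (tensor [1]) \<and> (\<forall>p>2. z p = 0)"
      using I.column2[of 4 "pr (tensor [1])"] lx rx E(2) by (simp add: I.E2line_def)
  qed (use x rx lx E(3) in simp_all)
qed

end

theorem theorem1p1:
  fixes scale :: "complex \<Rightarrow> 'a::ring_1 \<Rightarrow> 'a"
    and q :: complex and a b c d :: 'a
    and N :: int and \<sigma> \<delta> :: "'a \<Rightarrow> 'a"
  assumes q_nonzero: "q \<noteq> 0"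
    and q_not_root_of_unity: "\<forall>n::nat. n > 0 \<longrightarrow> q ^ n \<noteq> 1"
    and A: "quantum_SL2 scale q a b c d"
    and \<sigma>: "algebra_automorphism scale \<sigma>"
      "\<sigma> a = scale (q powi (- N)) a" "\<sigma> b = b" "\<sigma> c = c" "\<sigma> d = scale (q powi N) d"
    and \<delta>: "derivation scale \<delta>"
      "\<delta> a = - a" "\<delta> b = - b" "\<delta> c = c" "\<delta> d = d"
  shows
    "(\<forall>n::int. even n \<longrightarrow> bij_betw (HP_to_HC scale \<sigma> n 4) (HP scale \<sigma> n) (HC scale \<sigma> 4)) \<and>
     (\<forall>n::int. odd n \<longrightarrow> bij_betw (HP_to_HC scale \<sigma> n 3) (HP scale \<sigma> n) (HC scale \<sigma> 3)) \<and>
     (\<forall>r::nat. N = 2 * int r + 2 \<longrightarrow>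
        HC_line_spanned_by scale \<sigma> 4 1
          (left_mult (b ^ r * c ^ r) (cap_derivation \<delta> (fundamental_cycle q a b c d))) \<and>
        HC_line_spanned_by scale \<sigma> 3 0
          (left_mult (b ^ r * c ^ r) (fundamental_cycle q a b c d))) \<and>
     ((\<nexists>r::nat. N = 2 * int r + 2) \<longrightarrow>
        HC_line_spanned_by scale \<sigma> 4 2 (tensor [1]) \<and>
        HC_line_spanned_by scale \<sigma> 3 1 (tensor [b, c]))"
proof -
  interpret quantum_SL2 scale q a b c d by (rule A)
  interpret twisted scale q a b c d \<sigma> N
    by unfold_locales (use q_nonzero q_not_root_of_unity \<sigma> in auto)
  have "\<delta> = Dw (-1) (-1)"
  proof (rule derivation_eq_Dw)
    show "lin scale scale \<delta>"
      using \<delta>(1) by (auto simp: derivation_def lin_def dest: linear.axioms module_hom.add module_hom.scale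
        simp flip: module_hom_iff_linear)
    show "\<delta> (u * z) = \<delta> u * z + u * \<delta> z" for u z using \<delta>(1) by (simp add: derivation_def)
    show "\<delta> (gv g) = scale (gwt (-1) (-1) g) (gv g)" for g
      using \<delta> by (cases g) (simp_all add: scale_minus_left scale_one)
  qed
  note lines = singular_lines[OF _ this] regular_lines
  have "bij_betw (HP_to_HC scale \<sigma> n 4) (HP scale \<sigma> n) (HC scale \<sigma> 4)" if "even n" for n
  proof -
    have "4 + 2 * ((n - 4) div 2) = n" using that by simp
    then show ?thesis using periodic_bij[of 4 "(n - 4) div 2"] by simp
  qed
  moreover have "bij_betw (HP_to_HC scale \<sigma> n 3) (HP scale \<sigma> n) (HC scale \<sigma> 3)" if "odd n" for n
  proof -
    have "3 + 2 * ((n - 3) div 2) = n" using that by simp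
    then show ?thesis using periodic_bij[of 3 "(n - 3) div 2"] by simp
  qed
  ultimately show ?thesis using lines by blast
qed

end
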